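(* Let $\Phi$ be a strictly increasing positive function on $(0,\infty)$ for which there are $0<\underline\alpha\le\overline\alpha<2$ and $0<\underline c\le\overline C<\infty$ with $\underline c(R/r)^{\underline\alpha}\le\Phi(R)/\Phi(r)\le\overline C(R/r)^{\overline\alpha}$ for $0<r\le R$. Suppose that there is $C_0>0$ with $$J(x,y)\ge\frac{C_0}{|x-y|^d\Phi(|x-y|)},\qquad0<|x-y|\le1,$$ and that the open set $D\subset\mathbb R^d$ satisfies $\lim_{x\in D,\,|x|\to\infty}V_D(x)=\infty$, where $V_D(x)=\int_{D^c}J(x,y)\,dy$. Then $(P_t^D)_{t\ge0}$ is compact; let $\phi_1$ be its ground state. There is a constant $c>0$ such that, with $$D_{R,r}=\{x\in D:|x|<R,\ \delta_D(x)>r\},\qquad\alpha(R,r,s;\phi_1)=\frac{c}{\inf_{x\in D_{R+1,r/2}}\phi_1^2(x)}\big(\Phi^{-1}(s)\wedge r\wedge1\big)^{-d}$$ and $$\beta(s)=\inf\Big\{\alpha(R,r,s/2;\phi_1):\ R>0,\ 0<r<1/2\ \text{ and }\inf_{x\in D\setminus D_{R,r}}V_D(x)\ge1/s\Big\}\qquad(\inf\emptyset=\infty),$$ the following hold: for all $f\in C_c^\infty(D)$ and $s>0$, $$\int_Df^2(x)\,dx\le s\,\mathcal E^D(f,f)+\beta(s)\Big(\int_D|f(x)|\phi_1(x)\,dx\Big)^2;$$ consequently, $(P_t^D)_{t\ge0}$ is intrinsically ultracontractive if $$\int_t^\infty\frac{\beta^{-1}(s)}{s}\,ds<\infty\quad\text{for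 all }t>\inf\beta.$$
   Context: Notation: $a\wedge b=\min\{a,b\}$; $\delta_D(x)$ is the distance from $x$ to $D^c$; $\Phi^{-1}(r)=\inf\{s>0:\Phi(s)\ge r\}$; for the decreasing function $\beta$, $\beta^{-1}(r)=\inf\{s>0:\beta(s)\le r\}$, $\inf\emptyset=\infty$. Setting. $J\ge0$ is a symmetric Borel function on $\mathbb R^d\times\mathbb R^d\setminus\{(x,x):x\in\mathbb R^d\}$ with $\sup_x\int_{y\ne x}\min\{1,|x-y|^2\}J(x,y)\,dy<\infty$. Let $\mathcal E(f,f)=\iint_{x\ne y}(f(x)-f(y))^2J(x,y)\,dx\,dy$ and let $\mathcal F$ be the closure of $C_c^\infty(\mathbb R^d)$ under $(\mathcal E(f,f)+\int f^2dx)^{1/2}$; $(\mathcal E,\mathcal F)$ is a regular Dirichlet form on $L^2(\mathbb R^d;dx)$ with associated symmetric Hunt process $X=(X_t)_{t\ge0}$. Standing assumptions: $X$ can be started from every $x\in\mathbb R^d$ (law $\mathbb P^x$, expectation $\mathbb E^x$) and has a transition density $p(t,x,y)\ge0$, i.e. $\mathbb E^xf(X_t)=\int p(t,x,y)f(y)\,dy$. For open $D\subset\mathbb R^d$ let $\tau_D=\inf\{t>0:X_t\notin D\}$. The process $X^D$ killed upon exiting $D$ has transition density (Dirichlet heat kernel) $p^D(t,x,y)=p(t,x,y)-\mathbb E^x[p(t-\tau_D,X_{\tau_D},y)1_{\{t\ge\tau_D\}}]$ for $x,y\in D$, and Dirichlet semigroup $P_t^Df(x)=\int_Dp^D(t,x,y)f(y)\,dy$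 on $L^2(D;dx)$. Standing assumption: for every $t>0$, $p^D(t,\cdot,\cdot)$ is bounded, continuous and strictly positive on $D\times D$. The Dirichlet form of $(P_t^D)$ is, for $f\in C_c^\infty(D)$ (extended by $0$), $\mathcal E^D(f,f)=\mathcal E(f,f)=\iint_{D\times D}(f(x)-f(y))^2J(x,y)\,dx\,dy+2\int_Df^2V_D\,dx$. When $(P_t^D)$ is compact, the ground state $\phi_1$ is its first normalized eigenfunction ($P_t^D\phi_1=e^{-\lambda_1t}\phi_1$, $\lambda_1>0$ the lowest eigenvalue), chosen bounded, continuous and strictly positive on $D$. $(P_t^D)$ is intrinsically ultracontractive if for every $t>0$ there is $C_{t,D}>0$ with $p^D(t,x,y)\le C_{t,D}\phi_1(x)\phi_1(y)$ for all $x,y\in D$.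
   Formalization: The criterion for intrinsic ultracontractivity is proved under the added condition inf β < ∞ (if β is identically ∞ the integral condition is vacuous and the claim can fail, e.g. for a slowly narrowing horn attached to a punctured ball); D is assumed nonempty. *)

theory Defs
  imports "HOL-Probability.Probability"
begin

section \<open>Test functions and the space of square integrable functions\<close>

primrec C_k :: "nat \<Rightarrow> ('a::euclidean_space \<Rightarrow> real) \<Rightarrow> bool" where
  "C_k 0 f \<longleftrightarrow> continuous_on UNIV f"
| "C_k (Suc k) f \<longleftrightarrow> (\<forall>x. f differentiable (at x)) \<and>
     (\<forall>v. C_k k (\<lambda>x. frechet_derivative f (at x) v))"

definition smooth_fun :: "('a::euclidean_space \<Rightarrow> real) \<Rightarrow> bool" where
  "smooth_fun f \<longleftrightarrow> (\<forall>k. C_k k f)"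

text \<open>Functions on an open set \<open>D\<close> are represented by their extension by \<open>0\<close> to the whole space;
  this concerns both \<open>Cc_infty D\<close> and \<open>L2 D\<close>.\<close>

definition Cc_infty :: "'a::euclidean_space set \<Rightarrow> ('a \<Rightarrow> real) set" where
  "Cc_infty D = {f. smooth_fun f \<and> compact (closure {x. f x \<noteq> 0}) \<and> closure {x. f x \<noteq> 0} \<subseteq> D}"

text \<open>Elements of \<open>L2 D\<close> are functions, not classes: two of them are the same vector of the Hilbert
  space if they agree almost everywhere.\<close>

definition L2 :: "'a::euclidean_space set \<Rightarrow> ('a \<Rightarrow> real) set" where
  "L2 D = {f. f \<in> borel_measurable borel \<and> (\<forall>x. x \<notin> D \<longrightarrow> f x = 0) \<and>
              integrable lborel (\<lambda>x. (f x)\<^sup>2)}"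

definition sq_norm :: "('a::euclidean_space \<Rightarrow> real) \<Rightarrow> ennreal" where
  "sq_norm f = (\<integral>\<^sup>+x. ennreal ((f x)\<^sup>2) \<partial>lborel)"


section \<open>The jump form\<close>

definition jump_kernel :: "('a::euclidean_space \<Rightarrow> 'a \<Rightarrow> real) \<Rightarrow> bool" where
  "jump_kernel J \<longleftrightarrow>
     (\<lambda>z. J (fst z) (snd z)) \<in> borel_measurable (restrict_space borel {z. fst z \<noteq> snd z}) \<and>
     (\<forall>x y. x \<noteq> y \<longrightarrow> 0 \<le> J x y \<and> J x y = J y x) \<and>
     (SUP x. (\<integral>\<^sup>+y\<in>-{x}. ennreal (min 1 ((norm (x - y))\<^sup>2) * J x y) \<partial>lborel)) < \<top>"

definition energy :: "('a::euclidean_space \<Rightarrow> 'a \<Rightarrow> real) \<Rightarrow> ('a \<Rightarrow> real) \<Rightarrow> ennreal" where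
  "energy J f = (\<integral>\<^sup>+x. (\<integral>\<^sup>+y\<in>-{x}. ennreal ((f x - f y)\<^sup>2 * J x y) \<partial>lborel) \<partial>lborel)"

definition form_domain :: "('a::euclidean_space \<Rightarrow> 'a \<Rightarrow> real) \<Rightarrow> ('a \<Rightarrow> real) set" where
  "form_domain J = {u \<in> L2 UNIV. \<exists>f. (\<forall>n. f n \<in> Cc_infty UNIV) \<and>
     (\<lambda>n. energy J (\<lambda>x. u x - f n x) + sq_norm (\<lambda>x. u x - f n x)) \<longlonglongrightarrow> 0}"

text \<open>The quadratic form of a symmetric contraction semigroup \<open>T\<close> on the square integrable functions
  is the (monotone) limit of \<open>\<langle>u - T\<^sub>t u, u\<rangle> / t\<close> as \<open>t\<close> decreases to \<open>0\<close>; its domain consists of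
  those \<open>u\<close> for which the limit is finite.\<close>

definition semigroup_form ::
    "(real \<Rightarrow> ('a::euclidean_space \<Rightarrow> real) \<Rightarrow> 'a \<Rightarrow> real) \<Rightarrow> ('a \<Rightarrow> real) set
     \<Rightarrow> (('a \<Rightarrow> real) \<Rightarrow> ennreal) \<Rightarrow> bool" where
  "semigroup_form T Dom E \<longleftrightarrow> (\<forall>u\<in>L2 UNIV.
     ((\<lambda>t. ereal ((\<integral>x. (u x - T t u x) * u x \<partial>lborel) / t))
        \<longlongrightarrow> (if u \<in> Dom then enn2ereal (E u) else \<infinity>)) (at_right 0))"


section \<open>Hunt processes\<close>

text \<open>The state space is the one-point compactification of the Euclidean space, with \<open>None\<close> as the
  cemetery.\<close>

definition state_top :: "'a::euclidean_space option topology" where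
  "state_top = Alexandroff_compactification euclidean"

definition state_space :: "'a::euclidean_space option measure" where
  "state_space = sigma UNIV {A. Some -` A \<in> sets borel}"

text \<open>Time runs through \<open>[0, \<infinity>]\<close>, whence the type \<^typ>\<open>ennreal\<close>; by convention the process sits
  in the cemetery at time \<open>\<infinity>\<close>. The filtration is given by the sigma-algebras of the measures \<open>Fl t\<close>;
  \<open>P (Some x)\<close> is the law of the process started at \<open>x\<close>.\<close>

locale hunt_process = filtration \<Omega> Fl
  for \<Omega> :: "'w set" and Fl :: "ennreal \<Rightarrow> 'w measure" +
  fixes X :: "ennreal \<Rightarrow> 'w \<Rightarrow> 'a::euclidean_space option"
    and P :: "'a option \<Rightarrow> 'w measure"
  assumes prob_space_P: "prob_space (P z)"
    and space_P: "space (P z) = \<Omega>"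
    and sets_P: "sets (P z) = sets (P z')"
    and sets_Fl_P: "sets (Fl t) \<subseteq> sets (P z)"
    and Fl_right_cont: "t < \<top> \<Longrightarrow> sets (Fl t) = (\<Inter>u\<in>{t<..}. sets (Fl u))"
    and adapted: "X t \<in> measurable (Fl t) state_space"
    and kernel_measurable: "B \<in> sets state_space \<Longrightarrow>
          (\<lambda>z. emeasure (P z) {\<omega>\<in>\<Omega>. X t \<omega> \<in> B}) \<in> borel_measurable state_space"
    and normal: "AE \<omega> in P z. X 0 \<omega> = z"
    and at_infinity_None: "\<omega> \<in> \<Omega> \<Longrightarrow> X \<top> \<omega> = None"
    and cemetery: "\<lbrakk>\<omega> \<in> \<Omega>; s \<le> t; X s \<omega> = None\<rbrakk> \<Longrightarrow> X t \<omega> = None"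
    and right_continuous: "\<lbrakk>\<omega> \<in> \<Omega>; t < \<top>\<rbrakk> \<Longrightarrow>
          limitin state_top (\<lambda>s. X s \<omega>) (X t \<omega>) (at_right t)"
    and left_limits: "\<lbrakk>\<omega> \<in> \<Omega>; 0 < t; t < \<top>\<rbrakk> \<Longrightarrow>
          \<exists>l. limitin state_top (\<lambda>s. X s \<omega>) l (at_left t)"
    and strong_Markov: "\<lbrakk>stopping_time Fl T; \<Lambda> \<in> sets (pre_sigma T); B \<in> sets state_space\<rbrakk> \<Longrightarrow>
          emeasure (P z) {\<omega>\<in>\<Lambda>. X (T \<omega> + s) \<omega> \<in> B} =
          (\<integral>\<^sup>+\<omega>\<in>\<Lambda>. emeasure (P (X (T \<omega>) \<omega>)) {\<omega>'\<in>\<Omega>. X s \<omega>' \<in> B} \<partial>P z)"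
    and quasi_left_continuous: "\<lbrakk>\<And>n. stopping_time Fl (S n); \<And>n \<omega>. S n \<omega> \<le> S (Suc n) \<omega>\<rbrakk> \<Longrightarrow>
          AE \<omega> in P z. (SUP n. S n \<omega>) < \<top> \<longrightarrow>
            limitin state_top (\<lambda>n. X (S n \<omega>) \<omega>) (X (SUP n. S n \<omega>) \<omega>) sequentially"

text \<open>As usual, functions on the Euclidean space are extended by \<open>0\<close> to the cemetery.\<close>

definition process_semigroup ::
    "(ennreal \<Rightarrow> 'w \<Rightarrow> 'a::euclidean_space option) \<Rightarrow> ('a option \<Rightarrow> 'w measure)
     \<Rightarrow> real \<Rightarrow> ('a \<Rightarrow> real) \<Rightarrow> 'a \<Rightarrow> real" where
  "process_semigroup X P t f x = (\<integral>\<omega>. case_option 0 f (X (ennreal t) \<omega>) \<partial>P (Some x))"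

definition symmetric_process ::
    "(ennreal \<Rightarrow> 'w \<Rightarrow> 'a::euclidean_space option) \<Rightarrow> ('a option \<Rightarrow> 'w measure) \<Rightarrow> bool" where
  "symmetric_process X P \<longleftrightarrow> (\<forall>t::real. \<forall>f\<in>borel_measurable borel. \<forall>g\<in>borel_measurable borel. 0 < t \<longrightarrow>
     (\<integral>\<^sup>+x. g x * (\<integral>\<^sup>+\<omega>. case_option 0 f (X (ennreal t) \<omega>) \<partial>P (Some x)) \<partial>lborel) =
     (\<integral>\<^sup>+x. f x * (\<integral>\<^sup>+\<omega>. case_option 0 g (X (ennreal t) \<omega>) \<partial>P (Some x)) \<partial>(lborel :: 'a measure)))"

definition transition_density ::
    "(ennreal \<Rightarrow> 'w \<Rightarrow> 'a::euclidean_space option) \<Rightarrow> ('a option \<Rightarrow> 'w measure)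
     \<Rightarrow> (real \<Rightarrow> 'a \<Rightarrow> 'a \<Rightarrow> real) \<Rightarrow> bool" where
  "transition_density X P p \<longleftrightarrow>
     (\<lambda>(t, x, y). p t x y) \<in> borel_measurable (restrict_space borel ({0<..} \<times> UNIV \<times> UNIV)) \<and>
     (\<forall>t x y. 0 < t \<longrightarrow> 0 \<le> p t x y) \<and>
     (\<forall>t x. \<forall>f\<in>borel_measurable borel. 0 < t \<longrightarrow>
        (\<integral>\<^sup>+\<omega>. case_option 0 f (X (ennreal t) \<omega>) \<partial>P (Some x)) =
        (\<integral>\<^sup>+y. ennreal (p t x y) * f y \<partial>lborel))"


section \<open>The killed process\<close>

definition exit_time ::
    "(ennreal \<Rightarrow> 'w \<Rightarrow> 'a::euclidean_space option) \<Rightarrow> 'a set \<Rightarrow> 'w \<Rightarrow> ennreal" where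
  "exit_time X D \<omega> = Inf {t. 0 < t \<and> X t \<omega> \<notin> Some ` D}"

text \<open>The exit time is measurable only with respect to the completed laws.\<close>

definition dirichlet_heat_kernel ::
    "(ennreal \<Rightarrow> 'w \<Rightarrow> 'a::euclidean_space option) \<Rightarrow> ('a option \<Rightarrow> 'w measure)
     \<Rightarrow> (real \<Rightarrow> 'a \<Rightarrow> 'a \<Rightarrow> real) \<Rightarrow> 'a set \<Rightarrow> real \<Rightarrow> 'a \<Rightarrow> 'a \<Rightarrow> real" where
  "dirichlet_heat_kernel X P p D t x y = p t x y -
     (\<integral>\<omega>. (if exit_time X D \<omega> \<le> ennreal t
           then case_option 0 (\<lambda>z. p (t - enn2real (exit_time X D \<omega>)) z y)
                  (X (exit_time X D \<omega>) \<omega>)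
           else 0) \<partial>completion (P (Some x)))"

definition kernel_semigroup ::
    "'a::euclidean_space set \<Rightarrow> (real \<Rightarrow> 'a \<Rightarrow> 'a \<Rightarrow> real) \<Rightarrow> real \<Rightarrow> ('a \<Rightarrow> real) \<Rightarrow> 'a \<Rightarrow> real" where
  "kernel_semigroup D q t f x = (if x \<in> D then (LINT y:D|lborel. q t x y * f y) else 0)"

definition killed_semigroup ::
    "(ennreal \<Rightarrow> 'w \<Rightarrow> 'a::euclidean_space option) \<Rightarrow> ('a option \<Rightarrow> 'w measure)
     \<Rightarrow> (real \<Rightarrow> 'a \<Rightarrow> 'a \<Rightarrow> real) \<Rightarrow> 'a set \<Rightarrow> real \<Rightarrow> ('a \<Rightarrow> real) \<Rightarrow> 'a \<Rightarrow> real" where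
  "killed_semigroup X P p D = kernel_semigroup D (dirichlet_heat_kernel X P p D)"

definition good_kernel ::
    "'a::euclidean_space set \<Rightarrow> (real \<Rightarrow> 'a \<Rightarrow> 'a \<Rightarrow> real) \<Rightarrow> bool" where
  "good_kernel D q \<longleftrightarrow> (\<forall>t>0.
     bounded ((\<lambda>z. q t (fst z) (snd z)) ` (D \<times> D)) \<and>
     continuous_on (D \<times> D) (\<lambda>z. q t (fst z) (snd z)) \<and>
     (\<forall>x\<in>D. \<forall>y\<in>D. 0 < q t x y))"

definition killing_rate ::
    "('a::euclidean_space \<Rightarrow> 'a \<Rightarrow> real) \<Rightarrow> 'a set \<Rightarrow> 'a \<Rightarrow> ennreal" where
  "killing_rate J D x = (\<integral>\<^sup>+y\<in>-D. ennreal (J x y) \<partial>lborel)"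

text \<open>This is the Dirichlet form of the killed semigroup on the test functions on \<open>D\<close>; it coincides
  with \<^const>\<open>energy\<close> there, see the lemma below.\<close>

definition killed_energy ::
    "('a::euclidean_space \<Rightarrow> 'a \<Rightarrow> real) \<Rightarrow> 'a set \<Rightarrow> ('a \<Rightarrow> real) \<Rightarrow> ennreal" where
  "killed_energy J D f =
     (\<integral>\<^sup>+x\<in>D. (\<integral>\<^sup>+y\<in>D - {x}. ennreal ((f x - f y)\<^sup>2 * J x y) \<partial>lborel) \<partial>lborel) +
     2 * (\<integral>\<^sup>+x\<in>D. ennreal ((f x)\<^sup>2) * killing_rate J D x \<partial>lborel)"


lemma killed_energy_eq_energy:
  fixes J :: "'a::euclidean_space \<Rightarrow> 'a \<Rightarrow> real"
  assumes J: "jump_kernel J" and D[measurable]: "D \<in> sets borel"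
    and f[measurable]: "f \<in> borel_measurable borel" and f0: "\<And>x. x \<notin> D \<Longrightarrow> f x = 0"
  shows "killed_energy J D f = energy J f"
proof -
  define K where "K = (\<lambda>z. ennreal (J (fst z) (snd z)) * indicator {z. fst z \<noteq> snd z} z)"
  have off: "{z::'a\<times>'a. fst z \<noteq> snd z} \<in> sets borel"
    by (intro borel_open open_Collect_neq continuous_intros)
  have "(\<lambda>z. J (fst z) (snd z)) \<in> borel_measurable (restrict_space borel {z. fst z \<noteq> snd z})"
    using J by (simp add: jump_kernel_def)
  then have Kb: "K \<in> borel_measurable borel"
    unfolding K_def
    by (subst borel_measurable_restrict_space_iff_ennreal[symmetric]) (use off in auto)
  then have K[measurable]: "K \<in> borel_measurable (borel \<Otimes>\<^sub>M borel)"
    by (simp add: borel_prod)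
  have Ksym: "K (x, y) = K (y, x)" for x y
    using J by (auto simp: K_def jump_kernel_def indicator_def)
  let ?g = "\<lambda>x y. ennreal ((f x - f y)\<^sup>2) * K (x, y)"
  have KJ: "ennreal ((f x - f y)\<^sup>2 * J x y) * indicator (-{x}) y = ?g x y" for x y
    by (auto simp: K_def indicator_def ennreal_mult')
  have E: "energy J f = (\<integral>\<^sup>+x. (\<integral>\<^sup>+y. ?g x y \<partial>lborel) \<partial>lborel)"
    unfolding energy_def by (simp add: KJ)
  have split: "?g x y = ?g x y * indicator D x * indicator D y
        + (ennreal ((f x)\<^sup>2) * indicator D x * (K (x, y) * indicator (-D) y)
        + ennreal ((f y)\<^sup>2) * indicator D y * (K (y, x) * indicator (-D) x))" for x y
    using f0[of x] f0[of y] Ksym[of x y] by (auto simp: indicator_def)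
  have E2: "energy J f =
     (\<integral>\<^sup>+x. (\<integral>\<^sup>+y. ?g x y * indicator D x * indicator D y \<partial>lborel) \<partial>lborel) +
     ((\<integral>\<^sup>+x. (\<integral>\<^sup>+y. ennreal ((f x)\<^sup>2) * indicator D x * (K (x, y) * indicator (-D) y) \<partial>lborel) \<partial>lborel) +
      (\<integral>\<^sup>+x. (\<integral>\<^sup>+y. ennreal ((f y)\<^sup>2) * indicator D y * (K (y, x) * indicator (-D) x) \<partial>lborel) \<partial>lborel))"
    unfolding E by (subst split) (simp add: nn_integral_add)
  have "(\<integral>\<^sup>+x. (\<integral>\<^sup>+y. ennreal ((f y)\<^sup>2) * indicator D y * (K (y, x) * indicator (-D) x) \<partial>lborel) \<partial>lborel)
      = (\<integral>\<^sup>+y. (\<integral>\<^sup>+x. ennreal ((f y)\<^sup>2) * indicator D y * (K (y, x) * indicator (-D) x) \<partial>lborel) \<partial>lborel)"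
    by (rule lborel_pair.Fubini') measurable
  moreover have "(\<integral>\<^sup>+y. ennreal ((f x)\<^sup>2) * indicator D x * (K (x, y) * indicator (-D) y) \<partial>lborel)
      = ennreal ((f x)\<^sup>2) * killing_rate J D x * indicator D x" for x
  proof (cases "x \<in> D")
    case True
    have eq: "K (x, y) * indicator (-D) y = ennreal (J x y) * indicator (-D) y" for y
      using True by (auto simp: K_def indicator_def)
    have "(\<integral>\<^sup>+y. ennreal ((f x)\<^sup>2) * indicator D x * (K (x, y) * indicator (-D) y) \<partial>lborel)
        = ennreal ((f x)\<^sup>2) * indicator D x * (\<integral>\<^sup>+y. K (x, y) * indicator (-D) y \<partial>lborel)"
      by (rule nn_integral_cmult) measurable
    then show ?thesis using True by (simp add: eq killing_rate_def)
  qed simp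
  moreover have "(\<integral>\<^sup>+y. ?g x y * indicator D x * indicator D y \<partial>lborel) =
      (\<integral>\<^sup>+y\<in>D - {x}. ennreal ((f x - f y)\<^sup>2 * J x y) \<partial>lborel) * indicator D x" for x
    by (auto simp: indicator_def K_def ennreal_mult' intro!: nn_integral_cong)
  ultimately show ?thesis
    unfolding E2 killed_energy_def by (simp add: mult_2)
qed


section \<open>Compactness, ground state, intrinsic ultracontractivity\<close>

definition compact_semigroup ::
    "'a::euclidean_space set \<Rightarrow> (real \<Rightarrow> ('a \<Rightarrow> real) \<Rightarrow> 'a \<Rightarrow> real) \<Rightarrow> bool" where
  "compact_semigroup D T \<longleftrightarrow> (\<forall>t>0. (\<forall>f\<in>L2 D. T t f \<in> L2 D) \<and>
     (\<forall>f. (\<forall>n. f n \<in> L2 D \<and> sq_norm (f n) \<le> 1) \<longrightarrow>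
        (\<exists>g\<in>L2 D. \<exists>r::nat \<Rightarrow> nat. strict_mono r \<and>
           (\<lambda>n. sq_norm (\<lambda>x. T t (f (r n)) x - g x)) \<longlonglongrightarrow> 0)))"

definition eigenfunction ::
    "'a::euclidean_space set \<Rightarrow> (real \<Rightarrow> ('a \<Rightarrow> real) \<Rightarrow> 'a \<Rightarrow> real) \<Rightarrow> real \<Rightarrow> ('a \<Rightarrow> real) \<Rightarrow> bool" where
  "eigenfunction D T \<mu> \<psi> \<longleftrightarrow> \<psi> \<in> L2 D \<and> sq_norm \<psi> \<noteq> 0 \<and>
     (\<forall>t>0. AE x in lborel. T t \<psi> x = exp (- \<mu> * t) * \<psi> x)"

definition ground_state ::
    "'a::euclidean_space set \<Rightarrow> (real \<Rightarrow> ('a \<Rightarrow> real) \<Rightarrow> 'a \<Rightarrow> real) \<Rightarrow> ('a \<Rightarrow> real) \<Rightarrow> bool" where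
  "ground_state D T \<phi> \<longleftrightarrow>
     (\<exists>\<mu>\<^sub>1>0. eigenfunction D T \<mu>\<^sub>1 \<phi> \<and> (\<forall>\<mu> \<psi>. eigenfunction D T \<mu> \<psi> \<longrightarrow> \<mu>\<^sub>1 \<le> \<mu>)) \<and>
     sq_norm \<phi> = 1 \<and> bounded (\<phi> ` D) \<and> continuous_on D \<phi> \<and> (\<forall>x\<in>D. 0 < \<phi> x)"

definition intrinsically_ultracontractive ::
    "'a::euclidean_space set \<Rightarrow> (real \<Rightarrow> 'a \<Rightarrow> 'a \<Rightarrow> real) \<Rightarrow> ('a \<Rightarrow> real) \<Rightarrow> bool" where
  "intrinsically_ultracontractive D q \<phi> \<longleftrightarrow>
     (\<forall>t>0. \<exists>C>0. \<forall>x\<in>D. \<forall>y\<in>D. q t x y \<le> C * \<phi> x * \<phi> y)"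


section \<open>The rate functions\<close>

definition scale_function :: "(real \<Rightarrow> real) \<Rightarrow> bool" where
  "scale_function \<Phi> \<longleftrightarrow> strict_mono_on {0<..} \<Phi> \<and> (\<forall>r>0. 0 < \<Phi> r) \<and>
     (\<exists>a1 a2 c1 c2. 0 < a1 \<and> a1 \<le> a2 \<and> a2 < 2 \<and> 0 < c1 \<and> c1 \<le> c2 \<and>
        (\<forall>r R. 0 < r \<and> r \<le> R \<longrightarrow>
           c1 * (R / r) powr a1 \<le> \<Phi> R / \<Phi> r \<and> \<Phi> R / \<Phi> r \<le> c2 * (R / r) powr a2))"

text \<open>Generalised inverses and all quantities below take values in \<open>[0, \<infinity>]\<close>, where the infimum of
  the empty set is \<open>\<infinity>\<close>.\<close>

definition inv_incr :: "(real \<Rightarrow> real) \<Rightarrow> real \<Rightarrow> ennreal" where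
  "inv_incr \<Phi> r = (INF s\<in>{s. 0 < s \<and> r \<le> \<Phi> s}. ennreal s)"

definition inv_decr :: "(real \<Rightarrow> ennreal) \<Rightarrow> real \<Rightarrow> ennreal" where
  "inv_decr b r = (INF s\<in>{s. 0 < s \<and> b s \<le> ennreal r}. ennreal s)"

text \<open>\<^term>\<open>infdist x (- D)\<close> is the distance to the complement; for \<open>D = UNIV\<close> the library sets it
  to \<open>0\<close>, but then \<^const>\<open>killing_rate\<close> vanishes and cannot tend to infinity.\<close>

definition inner_part :: "'a::euclidean_space set \<Rightarrow> real \<Rightarrow> real \<Rightarrow> 'a set" where
  "inner_part D R r = {x\<in>D. norm x < R \<and> r < infdist x (- D)}"

definition rate_alpha ::
    "(real \<Rightarrow> real) \<Rightarrow> 'a::euclidean_space set \<Rightarrow> ('a \<Rightarrow> real) \<Rightarrow> real \<Rightarrow> real \<Rightarrow> real \<Rightarrow> real \<Rightarrow> ennreal" where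
  "rate_alpha \<Phi> D \<phi> c R r s =
     ennreal c / (INF x\<in>inner_part D (R + 1) (r / 2). ennreal ((\<phi> x)\<^sup>2)) *
     inverse (min (inv_incr \<Phi> s) (min (ennreal r) 1) ^ DIM('a))"

definition rate_beta ::
    "('a::euclidean_space \<Rightarrow> 'a \<Rightarrow> real) \<Rightarrow> (real \<Rightarrow> real) \<Rightarrow> 'a set \<Rightarrow> ('a \<Rightarrow> real) \<Rightarrow> real \<Rightarrow> real \<Rightarrow> ennreal" where
  "rate_beta J \<Phi> D \<phi> c s = Inf {rate_alpha \<Phi> D \<phi> c R r (s / 2) | R r.
     0 < R \<and> 0 < r \<and> r < 1 / 2 \<and>
     ennreal (1 / s) \<le> (INF x\<in>D - inner_part D R r. killing_rate J D x)}"

end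

theory Submission imports Defs "HOL-Real_Asymp.Real_Asymp" "HOL-Library.Diagonal_Subsequence" begin

text \<open>
  Let \<open>K n\<close> exhaust \<open>D\<close> by compact sets. The semigroup of \<open>X\<close> killed on leaving \<open>K n\<close> is the decreasing
  limit of the powers of the transition operator compressed to \<open>K n\<close>, hence symmetric; quasi-left-continuity
  identifies the exit time of \<open>D\<close> with the supremum of the exit times of the \<open>K n\<close>, and Hunt's formula
  identifies the kernel of the limiting semigroup \<open>T\<close> with the given Dirichlet heat kernel. Domination by the
  semigroup of \<open>X\<close> then bounds the jump form by the form of \<open>T\<close>.

  Since \<open>V\<^sub>D\<close> tends to infinity, a bound on the form bounds the mass near infinity. With the equicontinuity
  coming from the continuous kernel this makes \<open>T t\<close> compact. A maximiser of \<open>\<langle>T 1 f, f\<rangle>\<close> can be taken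
  nonnegative and is the ground state; \<open>\<lambda>\<^sub>1 > 0\<close> because a function of zero energy vanishes.

  For the super Poincare inequality, \<open>f\<^sup>2\<close> on \<open>D - D\<^bsub>R,r\<^esub>\<close> is controlled by the killing term, while on
  \<open>D\<^bsub>R,r\<^esub>\<close> one compares \<open>f x\<close> with its values on the ball of radius comparable to
  \<open>min (\<Phi>\<^sup>-\<^sup>1 s) (min r 1)\<close>, using the lower bound of \<open>J\<close> there and the lower bound of \<open>\<phi>\<^sub>1\<close> on
  the larger set \<open>D\<^bsub>R+1,r/2\<^esub>\<close>. Applied to \<open>p\<^sup>D(t,x,\<cdot>)\<close>, it shows that the ratio of
  \<open>p\<^sup>D(2t,x,x)\<close> to \<open>\<phi>\<^sub>1(x)\<^sup>2\<close> falls from a level \<open>2 A\<close> to \<open>A\<close> within time \<open>\<beta>\<^sup>-\<^sup>1(A/2)\<close>; summing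
  over dyadic levels, the ratio falls below a fixed level in arbitrarily short time, from any starting value.
\<close>

section \<open>Hunt processes and symmetric killing on compact sets\<close>

text \<open>The exit time of \<open>D\<close> is the hitting time of a closed set, and the
  filtration is not assumed complete, so nothing elementary makes it a stopping time. Leaving a
  compact set is hitting an open set, which right continuity detects at countably many times; this
  is the reason for the exhaustion. Compactness is used twice more: staying in a closed set is a
  condition at dyadic times, and a set of finite measure lets decreasing limits pass under the
  Lebesgue integral.

  The spectral theorem and the domain of the form of \<open>T\<close> are avoided. All that is kept
  of the form is one inequality for nonnegative \<open>u\<close>: \<open>E u \<le> C\<close> as soon
  as \<langle>u - T \<delta> u, u\<rangle> \<le> C \<delta> along times \<delta> tending to 0.
  Convexity of \<langle>T t f, f\<rangle> in t supplies such bounds for |T t f|, and this one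
  direction serves the tail estimate, the positivity of the first eigenvalue and the decay of the
  heat kernel on the diagonal. Eigenfunctions are found for \<open>T 1\<close> alone; the other
  times are reached through roots, dyadic multiples and monotonicity.\<close>

lemma sets_state_space:
  "sets (state_space :: 'a::euclidean_space option measure) = {A. Some -` A \<in> sets borel}"
proof -
  have "sigma_algebra UNIV {A :: 'a option set. Some -` A \<in> sets borel}"
    unfolding sigma_algebra_iff2
  proof (intro conjI ballI allI impI)
    fix A :: "'a option set" assume "A \<in> {A. Some -` A \<in> sets borel}"
    then have "- (Some -` A) \<in> sets borel" by auto
    then show "UNIV - A \<in> {A. Some -` A \<in> sets borel}" by (simp add: vimage_Compl Compl_eq_Diff_UNIV[symmetric])
  qed (auto simp: vimage_Union)
  then show ?thesis
    unfolding state_space_def by (subst sets_measure_of) (auto simp: sigma_algebra.sigma_sets_eq)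
qed

lemma space_state_space [simp]: "space state_space = UNIV"
  by (simp add: state_space_def)

lemma measurable_state_space_iff:
  fixes h :: "'a::euclidean_space option \<Rightarrow> 'b::topological_space"
  shows "h \<in> borel_measurable state_space \<longleftrightarrow> (\<lambda>x. h (Some x)) \<in> borel_measurable borel"
  by (auto simp: measurable_def sets_state_space vimage_def)

lemma measurable_case_option [measurable]:
  fixes f :: "'a::euclidean_space \<Rightarrow> 'b::{topological_space,zero}"
  assumes "f \<in> borel_measurable borel"
  shows "case_option 0 f \<in> borel_measurable state_space"
  using assms by (simp add: measurable_state_space_iff)

section \<open>Convergence in the one-point compactification\<close>

lemma limitin_state_open:
  assumes "limitin state_top \<phi> l F" "l \<in> Some ` U" "open U"
  shows "\<forall>\<^sub>F s in F. \<phi> s \<in> Some ` U"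
  using assms unfolding limitin_def state_top_def by auto

lemma limitin_state_compact:
  assumes "limitin state_top \<phi> l F" "l \<notin> Some ` K" "compact K"
  shows "\<forall>\<^sub>F s in F. \<phi> s \<notin> Some ` K"
proof -
  have "closedin state_top (Some ` K)"
    using assms(3) by (simp add: state_top_def compact_imp_closed)
  then have "openin state_top (topspace state_top - Some ` K)" by auto
  moreover have "l \<in> topspace state_top - Some ` K"
    using assms unfolding limitin_def by auto
  ultimately have "\<forall>\<^sub>F s in F. \<phi> s \<in> topspace state_top - Some ` K"
    using assms(1) unfolding limitin_def by blast
  then show ?thesis by eventually_elim auto
qed

text \<open>Complements of large closed balls are neighbourhoods of the cemetery, so vanishing at
  infinity is what makes the extension by 0 continuous at \<open>None\<close>. This dictates the
  class of test functions used along paths.\<close>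

lemma limitin_state_C0:
  fixes g :: "'a::euclidean_space \<Rightarrow> 'b::{topological_space,zero}"
  assumes lim: "limitin state_top \<phi> l F" and g: "continuous_on UNIV g" "(g \<longlongrightarrow> 0) at_infinity"
  shows "((\<lambda>s. case_option 0 g (\<phi> s)) \<longlongrightarrow> case_option 0 g l) F"
proof (rule topological_tendstoI)
  fix V :: "'b set" assume V: "open V" "case_option 0 g l \<in> V"
  show "\<forall>\<^sub>F s in F. case_option 0 g (\<phi> s) \<in> V"
  proof (cases l)
    case (Some x)
    have "open (g -` V)" using g(1) V(1) by (simp add: continuous_on_open_vimage)
    from limitin_state_open[OF lim _ this] Some V(2)
    have "\<forall>\<^sub>F s in F. \<phi> s \<in> Some ` (g -` V)" by auto
    then show ?thesis by eventually_elim auto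
  next
    case None
    then have V0: "0 \<in> V" using V by simp
    from topological_tendstoD[OF g(2) V(1) V0] obtain b where b: "\<And>x. norm x \<ge> b \<Longrightarrow> g x \<in> V"
      unfolding eventually_at_infinity by auto
    have "\<forall>\<^sub>F s in F. \<phi> s \<notin> Some ` cball 0 b"
      by (rule limitin_state_compact[OF lim]) (auto simp: None)
    then show ?thesis
    proof eventually_elim
      case (elim s)
      then show ?case using b V0 by (cases "\<phi> s") (auto simp: image_iff not_le)
    qed
  qed
qed

text \<open>\<open>disc n u\<close> is the number \<open>j\<close> with \<open>j / (n + 1) \<le> u < (j + 1) / (n + 1)\<close>, so \<open>disc_time n (disc n u)\<close> approximates \<open>u\<close> strictly from above.\<close>

definition disc :: "nat \<Rightarrow> real \<Rightarrow> nat" where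
  "disc n u = nat \<lfloor>real (Suc n) * u\<rfloor>"

definition disc_time :: "nat \<Rightarrow> nat \<Rightarrow> real" where
  "disc_time n j = (real j + 1) / real (Suc n)"

lemma disc_bounds:
  assumes "0 \<le> u"
  shows "u < disc_time n (disc n u)" "disc_time n (disc n u) \<le> u + 1 / real (Suc n)"
proof -
  have n: "0 < real (Suc n)" by simp
  have j: "real (disc n u) = of_int \<lfloor>real (Suc n) * u\<rfloor>"
    using assms by (auto simp: disc_def)
  show "u < disc_time n (disc n u)"
    unfolding disc_time_def j using n by (simp add: pos_less_divide_eq mult.commute del: of_nat_Suc)
  show "disc_time n (disc n u) \<le> u + 1 / real (Suc n)"
    unfolding disc_time_def j using n
    by (simp add: add_divide_distrib pos_divide_le_eq mult.commute del: of_nat_Suc)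
qed

lemma disc_time_tendsto:
  assumes "0 \<le> u" shows "(\<lambda>n. disc_time n (disc n u)) \<longlonglongrightarrow> u"
proof (rule tendsto_sandwich[where f="\<lambda>_. u" and h="\<lambda>n. u + 1 / real (Suc n)"])
  show "(\<lambda>n. u + 1 / real (Suc n)) \<longlonglongrightarrow> u"
    using tendsto_add[OF tendsto_const LIMSEQ_inverse_real_of_nat, of u] by (simp add: inverse_eq_divide)
qed (use disc_bounds[OF assms] in \<open>auto intro!: always_eventually less_imp_le\<close>)

section \<open>The process at random times\<close>

context hunt_process begin

lemma measurable_X [measurable]: "X t \<in> measurable (P z) state_space"
  using adapted[of t] sets_Fl_P[of t z] space_P[of z] space_F[of t]
  by (auto simp: measurable_def)

lemma sets_pre_sigma_P:
  assumes "stopping_time Fl T" "\<Lambda> \<in> sets (pre_sigma T)" shows "\<Lambda> \<in> sets (P z)"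
  using sets_pre_sigmaD[OF assms, of \<top>] sets_Fl_P[of \<top> z] by auto

lemma stopping_time_measurable_P: "stopping_time Fl T \<Longrightarrow> T \<in> borel_measurable (P z)"
  by (rule measurable_stopping_time) (use sets_Fl_P space_P space_F in auto)

lemma filterlim_X_right:
  assumes "\<omega> \<in> \<Omega>" "0 \<le> u" "\<And>n. u < v n" "v \<longlonglongrightarrow> u"
  shows "limitin state_top (\<lambda>n. X (ennreal (v n)) \<omega>) (X (ennreal u) \<omega>) sequentially"
proof -
  have "((\<lambda>n. ennreal (v n)) \<longlongrightarrow> ennreal u) sequentially"
    using assms(4) by (rule tendsto_ennrealI)
  moreover have "ennreal u < ennreal (v n)" for n using assms(2) assms(3)[of n] by (simp add: ennreal_less_iff)
  ultimately have "filterlim (\<lambda>n. ennreal (v n)) (at_right (ennreal u)) sequentially"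
    unfolding filterlim_at by (auto intro!: always_eventually simp: less_imp_neq[symmetric] dest: less_imp_neq)
  moreover have "limitin state_top (\<lambda>s. X s \<omega>) (X (ennreal u) \<omega>) (at_right (ennreal u))"
    using right_continuous[OF assms(1), of "ennreal u"] by simp
  ultimately show ?thesis
    unfolding limitin_def by (auto simp: filterlim_iff)
qed

text \<open>Here \<open>T\<close> is an arbitrary measurable time, not a stopping time: it is
  approximated from above by countably valued times, and right continuity gives pointwise
  convergence in \<open>state_top\<close>. Measurability of the limit is then checked on images of
  open sets.\<close>

lemma measurable_X_at [measurable (raw)]:
  assumes [measurable]: "T \<in> borel_measurable (P z)"
  shows "(\<lambda>\<omega>. X (T \<omega>) \<omega>) \<in> measurable (P z) state_space"
proof -
  \<comment> \<open>\<open>None\<close> encodes the value \<top> of \<open>T\<close>, where the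
    process sits in the cemetery and the approximating sequence is constant.\<close>
  define d where "d n \<omega> = (if T \<omega> = \<top> then None else Some (disc n (enn2real (T \<omega>))))" for n \<omega>
  define t where "t n j = (case j of None \<Rightarrow> \<top> | Some i \<Rightarrow> ennreal (disc_time n i))" for n j
  have [measurable]: "d n \<in> measurable (P z) (count_space UNIV)" for n
    unfolding d_def disc_def by measurable
  have Xd [measurable]: "(\<lambda>\<omega>. X (t n (d n \<omega>)) \<omega>) \<in> measurable (P z) state_space" for n
    by (rule measurable_compose_countable) (measurable)
  have lim: "limitin state_top (\<lambda>n. X (t n (d n \<omega>)) \<omega>) (X (T \<omega>) \<omega>) sequentially" if "\<omega> \<in> \<Omega>" for \<omega>
  proof (cases "T \<omega>")
    case (real r)
    have "limitin state_top (\<lambda>n. X (ennreal (disc_time n (disc n r))) \<omega>) (X (ennreal r) \<omega>) sequentially"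
      by (rule filterlim_X_right) (use that real disc_bounds(1) disc_time_tendsto in auto)
    then show ?thesis using real by (simp add: d_def t_def)
  next
    case top
    then show ?thesis by (simp add: d_def t_def limitin_const state_top_def) (auto simp: image_iff)
  qed
  have op: "{\<omega>\<in>\<Omega>. X (T \<omega>) \<omega> \<in> Some ` U} \<in> sets (P z)" if U: "open U" for U
  proof -
    obtain C where C: "\<And>n. compact (C n)" "\<And>n. C n \<subseteq> U" "\<And>n. C n \<subseteq> interior (C (Suc n))"
      "\<Union>(range C) = U" by (rule open_Union_compact_subsets[OF U]) blast
    \<comment> \<open>Membership of the limit in \<open>U\<close> is recovered through the compact
      exhaustion: a limit in \<open>C m\<close> forces the sequence into the interior of
      \<open>C (Suc m)\<close> eventually, and a sequence that is eventually in the closed set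
      \<open>C m\<close> has its limit there.\<close>
    have "X (T \<omega>) \<omega> \<in> Some ` U \<longleftrightarrow> (\<exists>m. \<exists>N. \<forall>n\<ge>N. X (t n (d n \<omega>)) \<omega> \<in> Some ` C m)" (is "?L \<longleftrightarrow> ?R")
      if w: "\<omega> \<in> \<Omega>" for \<omega>
    proof
      assume ?L
      then obtain x m where x: "X (T \<omega>) \<omega> = Some x" "x \<in> C m" using C(4) by blast
      with C(3)[of m] have "X (T \<omega>) \<omega> \<in> Some ` interior (C (Suc m))" by blast
      from limitin_state_open[OF lim[OF w] this] obtain N where
        "\<forall>n\<ge>N. X (t n (d n \<omega>)) \<omega> \<in> Some ` interior (C (Suc m))" by (auto simp: eventually_sequentially)
      then show ?R using interior_subset by blast
    next
      assume ?R
      then obtain m N where mN: "\<forall>n\<ge>N. X (t n (d n \<omega>)) \<omega> \<in> Some ` C m" by blast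
      have "X (T \<omega>) \<omega> \<in> Some ` C m"
      proof (rule ccontr)
        assume "X (T \<omega>) \<omega> \<notin> Some ` C m"
        from limitin_state_compact[OF lim[OF w] this C(1)] obtain N' where
          "\<forall>n\<ge>N'. X (t n (d n \<omega>)) \<omega> \<notin> Some ` C m" by (auto simp: eventually_sequentially)
        with mN show False by (meson max.cobounded1 max.cobounded2)
      qed
      then show ?L using C(2) by blast
    qed
    note iff = this
    have "{\<omega>\<in>\<Omega>. X (T \<omega>) \<omega> \<in> Some ` U} =
      (\<Union>m. \<Union>N. \<Inter>n\<in>{N..}. {\<omega>\<in>space (P z). X (t n (d n \<omega>)) \<omega> \<in> Some ` C m})" (is "?A = ?B")
    proof (rule set_eqI)
      fix \<omega> show "\<omega> \<in> ?A \<longleftrightarrow> \<omega> \<in> ?B"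
      proof (cases "\<omega> \<in> \<Omega>")
        case True
        then show ?thesis by (simp add: iff space_P) (simp add: Ball_def)
      next
        case False
        then show ?thesis by (auto simp: space_P)
      qed
    qed
    moreover have "{\<omega>\<in>space (P z). X (t n (d n \<omega>)) \<omega> \<in> Some ` C m} \<in> sets (P z)" for n m
      by (rule measurable_sets_Collect[OF Xd])
        (use C(1)[of m] in \<open>auto simp: sets_state_space inj_vimage_image_eq compact_imp_closed\<close>)
    ultimately show ?thesis by (auto intro!: sets.countable_UN sets.countable_INT')
  qed
  have bo: "{\<omega>\<in>\<Omega>. X (T \<omega>) \<omega> \<in> Some ` B} \<in> sets (P z)" if "B \<in> sets borel" for B
  proof -
    have "B \<in> sigma_sets UNIV {S. open S}" using that by (simp add: borel_def)
    then show ?thesis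
  proof (induct rule: sigma_sets.induct)
    case (Compl a)
    have "{\<omega>\<in>\<Omega>. X (T \<omega>) \<omega> \<in> Some ` (UNIV - a)} = {\<omega>\<in>\<Omega>. X (T \<omega>) \<omega> \<in> Some ` UNIV} - {\<omega>\<in>\<Omega>. X (T \<omega>) \<omega> \<in> Some ` a}"
      by auto
    with Compl op[of UNIV] show ?case by auto
  next
    case (Union a)
    have "{\<omega>\<in>\<Omega>. X (T \<omega>) \<omega> \<in> Some ` (\<Union>i. a i)} = (\<Union>i::nat. {\<omega>\<in>\<Omega>. X (T \<omega>) \<omega> \<in> Some ` a i})"
      by auto
    with Union show ?case by auto
  qed (use op in auto)
  qed
  show ?thesis
  proof (rule measurableI)
    fix A :: "'a option set" assume "A \<in> sets state_space"
    then have A: "Some -` A \<in> sets borel" by (simp add: sets_state_space)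
    have "(\<lambda>\<omega>. X (T \<omega>) \<omega>) -` A \<inter> space (P z) =
      {\<omega>\<in>\<Omega>. X (T \<omega>) \<omega> \<in> Some ` (Some -` A)} \<union>
      (if None \<in> A then space (P z) - {\<omega>\<in>\<Omega>. X (T \<omega>) \<omega> \<in> Some ` UNIV} else {})"
      by (auto simp: space_P image_iff split: if_splits) (metis not_None_eq)+
    then show "(\<lambda>\<omega>. X (T \<omega>) \<omega>) -` A \<inter> space (P z) \<in> sets (P z)"
      using bo[OF A] bo[of UNIV] by auto
  qed simp
qed

section \<open>Transition operators and the strong Markov property for functions\<close>

definition trans_op :: "ennreal \<Rightarrow> ('a option \<Rightarrow> ennreal) \<Rightarrow> 'a option \<Rightarrow> ennreal" where
  "trans_op s h z = (\<integral>\<^sup>+\<omega>. h (X s \<omega>) \<partial>P z)"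

lemma trans_op_indicator: "B \<in> sets state_space \<Longrightarrow> trans_op s (indicator B) z = emeasure (P z) {\<omega>\<in>\<Omega>. X s \<omega> \<in> B}"
proof -
  assume B: "B \<in> sets state_space"
  then have "{\<omega>\<in>space (P z). X s \<omega> \<in> B} \<in> sets (P z)" by measurable
  then have [measurable]: "{\<omega>\<in>\<Omega>. X s \<omega> \<in> B} \<in> sets (P z)" by (simp add: space_P)
  have "trans_op s (indicator B) z = (\<integral>\<^sup>+\<omega>. indicator {\<omega>\<in>\<Omega>. X s \<omega> \<in> B} \<omega> \<partial>P z)"
    unfolding trans_op_def by (rule nn_integral_cong) (auto simp: space_P indicator_def)
  then show ?thesis by simp
qed

lemma measurable_trans_op [measurable]:
  assumes "h \<in> borel_measurable state_space"
  shows "trans_op s h \<in> borel_measurable state_space"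
  using assms
proof (induct rule: borel_measurable_induct)
  case (cong f g) then have "f = g" by auto
  with cong show ?case by simp
next
  case (set A) then show ?case
    using kernel_measurable[of A s] by (subst measurable_cong[OF trans_op_indicator]) auto
next
  case (mult u c)
  note [measurable] = mult
  have "trans_op s (\<lambda>x. c * u x) = (\<lambda>z. c * trans_op s u z)"
    unfolding trans_op_def by (rule ext, rule nn_integral_cmult) measurable
  with mult show ?case by simp
next
  case (add u v)
  note [measurable] = add
  have "trans_op s (\<lambda>x. v x + u x) = (\<lambda>z. trans_op s v z + trans_op s u z)"
    unfolding trans_op_def by (rule ext, rule nn_integral_add) measurable
  with add show ?case by simp
next
  case (seq U)
  note [measurable] = seq(1)
  have "trans_op s (SUP i. U i) z = (SUP i. trans_op s (U i) z)" for z
    unfolding trans_op_def SUP_apply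
    by (rule nn_integral_monotone_convergence_SUP) (use \<open>incseq U\<close> in \<open>auto simp: incseq_def le_fun_def\<close>)
  then have eq: "trans_op s (SUP i. U i) = (\<lambda>z. SUP i. trans_op s (U i) z)" by auto
  show ?case unfolding eq using seq(3) by measurable
qed

text \<open>Extension from indicators by the usual induction on nonnegative measurable functions,
  with \<open>\<Lambda>\<close> fixed. The functions live on the state space including the cemetery,
  because the conditional laws may start there.\<close>

lemma strong_Markov_fun:
  assumes h: "h \<in> borel_measurable state_space"
    and T: "stopping_time Fl T" and L: "\<Lambda> \<in> sets (pre_sigma T)"
  shows "(\<integral>\<^sup>+\<omega>\<in>\<Lambda>. h (X (T \<omega> + s) \<omega>) \<partial>P z) = (\<integral>\<^sup>+\<omega>\<in>\<Lambda>. trans_op s h (X (T \<omega>) \<omega>) \<partial>P z)"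
proof -
  have [measurable]: "T \<in> borel_measurable (P z)" using T by (rule stopping_time_measurable_P)
  have [measurable]: "\<Lambda> \<in> sets (P z)" using sets_pre_sigma_P[OF T L] .
  show ?thesis using h
  proof (induct rule: borel_measurable_induct)
    case (cong f g) then have "f = g" by auto
    with cong show ?case by simp
  next
    case (set A)
    have [measurable]: "{\<omega>\<in>\<Lambda>. X (T \<omega> + s) \<omega> \<in> A} \<in> sets (P z)"
    proof -
      have "{\<omega>\<in>space (P z). X (T \<omega> + s) \<omega> \<in> A} \<in> sets (P z)"
        using set by measurable
      then have "{\<omega>\<in>space (P z). X (T \<omega> + s) \<omega> \<in> A} \<inter> \<Lambda> \<in> sets (P z)" by auto
      moreover have "\<Lambda> \<subseteq> space (P z)" using sets.sets_into_space[of \<Lambda> "P z"] by auto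
      ultimately show ?thesis by (auto simp: Int_def conj_commute subset_eq elim!: back_subst[of "\<lambda>x. x \<in> _"])
    qed
    have "(\<integral>\<^sup>+\<omega>\<in>\<Lambda>. indicator A (X (T \<omega> + s) \<omega>) \<partial>P z) = emeasure (P z) {\<omega>\<in>\<Lambda>. X (T \<omega> + s) \<omega> \<in> A}"
    proof -
      have "(\<integral>\<^sup>+\<omega>\<in>\<Lambda>. indicator A (X (T \<omega> + s) \<omega>) \<partial>P z) = (\<integral>\<^sup>+\<omega>. indicator {\<omega>\<in>\<Lambda>. X (T \<omega> + s) \<omega> \<in> A} \<omega> \<partial>P z)"
        by (rule nn_integral_cong) (auto simp: indicator_def)
      then show ?thesis by simp
    qed
    also have "\<dots> = (\<integral>\<^sup>+\<omega>\<in>\<Lambda>. trans_op s (indicator A) (X (T \<omega>) \<omega>) \<partial>P z)"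
      using strong_Markov[OF T L set] by (simp add: trans_op_indicator[OF set])
    finally show ?case .
  next
    case (mult u c)
    note [measurable] = mult(2)
    have "trans_op s (\<lambda>x. c * u x) = (\<lambda>z. c * trans_op s u z)"
      unfolding trans_op_def by (rule ext, rule nn_integral_cmult) measurable
    with mult(4) show ?case by (simp add: mult.assoc nn_integral_cmult)
  next
    case (add u v)
    note [measurable] = add(1,4)
    have "trans_op s (\<lambda>x. v x + u x) = (\<lambda>z. trans_op s v z + trans_op s u z)"
      unfolding trans_op_def by (rule ext, rule nn_integral_add) measurable
    with add show ?case by (simp add: distrib_right nn_integral_add)
  next
    case (seq U)
    note [measurable] = seq(1)
    have eq: "trans_op s (SUP i. U i) z = (SUP i. trans_op s (U i) z)" for z
      unfolding trans_op_def SUP_apply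
      by (rule nn_integral_monotone_convergence_SUP) (use \<open>incseq U\<close> in \<open>auto simp: incseq_def le_fun_def\<close>)
    have inc: "incseq (\<lambda>i \<omega>. U i (X (T \<omega> + s) \<omega>) * indicator \<Lambda> \<omega>)"
      using \<open>incseq U\<close> by (auto simp: incseq_def le_fun_def intro!: mult_right_mono)
    have inc2: "incseq (\<lambda>i \<omega>. trans_op s (U i) (X (T \<omega>) \<omega>) * indicator \<Lambda> \<omega>)"
      using \<open>incseq U\<close> by (auto simp: incseq_def le_fun_def trans_op_def intro!: mult_right_mono nn_integral_mono)
    have "(\<integral>\<^sup>+\<omega>\<in>\<Lambda>. (SUP i. U i) (X (T \<omega> + s) \<omega>) \<partial>P z) = (SUP i. \<integral>\<^sup>+\<omega>\<in>\<Lambda>. U i (X (T \<omega> + s) \<omega>) \<partial>P z)"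
      unfolding SUP_apply SUP_mult_right_ennreal
      by (rule nn_integral_monotone_convergence_SUP[OF inc]) measurable
    also have "\<dots> = (SUP i. \<integral>\<^sup>+\<omega>\<in>\<Lambda>. trans_op s (U i) (X (T \<omega>) \<omega>) \<partial>P z)"
      using seq(3) by simp
    also have "\<dots> = (\<integral>\<^sup>+\<omega>\<in>\<Lambda>. trans_op s (SUP i. U i) (X (T \<omega>) \<omega>) \<partial>P z)"
      unfolding eq SUP_mult_right_ennreal
      by (rule nn_integral_monotone_convergence_SUP[OF inc2, symmetric]) measurable
    finally show ?case .
  qed
qed

end

lemma SUP_mult_indicator_incseq:
  fixes c :: ennreal
  assumes "incseq A"
  shows "(SUP n. c * indicator (A n) x) = c * indicator (\<Union>n. A n) x"
proof (cases "x \<in> (\<Union>n. A n)")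
  case True
  then obtain n where n: "x \<in> A n" by auto
  show ?thesis
  proof (rule antisym)
    show "(SUP n. c * indicator (A n) x) \<le> c * indicator (\<Union>n. A n) x"
      by (rule SUP_least) (use True in \<open>auto simp: indicator_def\<close>)
    have "c * indicator (\<Union>n. A n) x = c * indicator (A n) x" using True n by simp
    also have "\<dots> \<le> (SUP n. c * indicator (A n) x)" by (rule SUP_upper) simp
    finally show "c * indicator (\<Union>n. A n) x \<le> (SUP n. c * indicator (A n) x)" .
  qed
qed auto

lemma ennreal_between_dense:
  obtains C :: "ennreal set" where "countable C" "\<And>a b. a < b \<Longrightarrow> \<exists>r\<in>C. a < r \<and> r < b"
proof -
  obtain C :: "ennreal set" where C: "countable C" "\<And>X. open X \<Longrightarrow> X \<noteq> {} \<Longrightarrow> \<exists>d\<in>C. d \<in> X"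
    using countable_dense_setE by auto
  show ?thesis
  proof (rule that[OF C(1)])
    fix a b :: ennreal assume "a < b"
    then have "{a<..<b} \<noteq> {}" using dense by auto
    from C(2)[OF _ this] show "\<exists>r\<in>C. a < r \<and> r < b" by auto
  qed
qed

section \<open>Exit times of compact sets\<close>

context hunt_process begin

lemma adapted_set:
  assumes "r \<le> t" "B \<in> sets state_space"
  shows "{\<omega>\<in>\<Omega>. X r \<omega> \<in> B} \<in> sets (Fl t)"
proof -
  have "{\<omega>\<in>\<Omega>. X r \<omega> \<in> B} = X r -` B \<inter> space (Fl r)" by (auto simp: space_F)
  also have "\<dots> \<in> sets (Fl r)" using adapted assms(2) by (rule measurable_sets)
  finally show ?thesis using sets_F_mono[OF assms(1)] by auto
qed

lemma Some_image_sets: "B \<in> sets borel \<Longrightarrow> Some ` B \<in> sets state_space"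
  by (simp add: sets_state_space inj_vimage_image_eq)

lemma eventually_right_compact:
  assumes "\<omega> \<in> \<Omega>" "u < \<top>" "compact K" "X u \<omega> \<notin> Some ` K"
  obtains b where "u < b" "\<And>s. u \<le> s \<Longrightarrow> s < b \<Longrightarrow> X s \<omega> \<notin> Some ` K"
proof -
  have "\<forall>\<^sub>F s in at_right u. X s \<omega> \<notin> Some ` K"
    by (rule limitin_state_compact[OF right_continuous]) (use assms in auto)
  then obtain b where "u < b" "\<And>s. u < s \<Longrightarrow> s < b \<Longrightarrow> X s \<omega> \<notin> Some ` K"
    unfolding eventually_at_right[OF assms(2)] by auto
  then show ?thesis using that[of b] assms(4) by (metis order_le_less)
qed

lemma eventually_right_open:
  assumes "\<omega> \<in> \<Omega>" "u < \<top>" "open K" "X u \<omega> \<in> Some ` K"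
  obtains b where "u < b" "\<And>s. u \<le> s \<Longrightarrow> s < b \<Longrightarrow> X s \<omega> \<in> Some ` K"
proof -
  have "\<forall>\<^sub>F s in at_right u. X s \<omega> \<in> Some ` K"
    by (rule limitin_state_open[OF right_continuous]) (use assms in auto)
  then obtain b where "u < b" "\<And>s. u < s \<Longrightarrow> s < b \<Longrightarrow> X s \<omega> \<in> Some ` K"
    unfolding eventually_at_right[OF assms(2)] by auto
  then show ?thesis using that[of b] assms(4) by (metis order_le_less)
qed

text \<open>The infimum runs over all times including 0, unlike in \<open>exit_time\<close>. For
  paths in \<open>\<Omega>\<close> the set contains \<top>, where the process is in the
  cemetery.\<close>

definition leave :: "'a set \<Rightarrow> 'w \<Rightarrow> ennreal" where
  "leave K \<omega> = Inf {u. X u \<omega> \<notin> Some ` K}"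

text \<open>The complement of the image of \<open>K\<close> is open in the compactification, so a
  path outside \<open>K\<close> at time \<open>u\<close> stays outside on an interval to the right
  of \<open>u\<close>, which contains a point of the countable dense set \<open>C\<close>.\<close>

lemma leave_less_pred:
  assumes K: "compact K" shows "{\<omega>\<in>\<Omega>. leave K \<omega> < t} \<in> sets (Fl t)"
proof -
  obtain C :: "ennreal set" where C: "countable C" "\<And>a b. a < b \<Longrightarrow> \<exists>r\<in>C. a < r \<and> r < b"
    by (rule ennreal_between_dense) blast
  have "leave K \<omega> < t \<longleftrightarrow> (\<exists>r\<in>{r\<in>C. r < t}. X r \<omega> \<in> - Some ` K)" if w: "\<omega> \<in> \<Omega>" for \<omega>
  proof
    assume "leave K \<omega> < t"
    then obtain u where u: "u < t" "X u \<omega> \<notin> Some ` K" by (auto simp: leave_def Inf_less_iff)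
    then have "u < \<top>" by (metis less_le_trans top_greatest)
    then obtain b where b: "u < b" "\<And>s. u \<le> s \<Longrightarrow> s < b \<Longrightarrow> X s \<omega> \<notin> Some ` K"
      using eventually_right_compact[OF w _ K u(2)] by blast
    from C(2)[of u "min b t"] u(1) b(1) obtain r where "r \<in> C" "u < r" "r < b" "r < t" by auto
    moreover have "X r \<omega> \<notin> Some ` K" using b(2)[of r] \<open>u < r\<close> \<open>r < b\<close> by (simp add: less_imp_le)
    ultimately show "\<exists>r\<in>{r\<in>C. r < t}. X r \<omega> \<in> - Some ` K" by blast
  next
    assume "\<exists>r\<in>{r\<in>C. r < t}. X r \<omega> \<in> - Some ` K"
    then show "leave K \<omega> < t" by (auto simp: leave_def Inf_less_iff)
  qed
  then have "{\<omega>\<in>\<Omega>. leave K \<omega> < t} = (\<Union>r\<in>{r\<in>C. r < t}. {\<omega>\<in>\<Omega>. X r \<omega> \<in> - Some ` K})"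
    by auto
  moreover have "- Some ` K \<in> sets state_space"
    using Some_image_sets[of K] K sets.compl_sets[of "Some ` K" state_space]
    by (simp add: compact_imp_closed Compl_eq_Diff_UNIV)
  moreover from this have "{\<omega>\<in>\<Omega>. X r \<omega> \<in> - Some ` K} \<in> sets (Fl t)" if "r < t" for r
    by (intro adapted_set) (use that in auto)
  ultimately show ?thesis
    using C(1) by (simp only:) (rule sets.countable_UN'', auto)
qed

text \<open>The strict events of \<open>leave_less_pred\<close> put the event
  \<open>leave K \<omega> \<le> t\<close> into every \<open>Fl u\<close> with \<open>t < u\<close>;
  right continuity of the filtration puts it into \<open>Fl t\<close>.\<close>

lemma leave_stopping_time:
  assumes K: "compact K" shows "stopping_time Fl (leave K)"
proof (rule stopping_timeI)
  fix t
  obtain C :: "ennreal set" where C: "countable C" "\<And>a b. a < b \<Longrightarrow> \<exists>r\<in>C. a < r \<and> r < b"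
    by (rule ennreal_between_dense) blast
  show "Measurable.pred (Fl t) (\<lambda>\<omega>. leave K \<omega> \<le> t)"
  proof (cases "t = \<top>")
    case False
    have "{\<omega>\<in>\<Omega>. leave K \<omega> \<le> t} \<in> sets (Fl u)" if u: "t < u" for u
    proof -
      have ne: "{r\<in>C. t < r \<and> r < u} \<noteq> {}" using C(2)[OF u] by auto
      have "leave K \<omega> \<le> t \<longleftrightarrow> (\<forall>r\<in>{r\<in>C. t < r \<and> r < u}. leave K \<omega> < r)" for \<omega>
      proof
        assume r: "\<forall>r\<in>{r\<in>C. t < r \<and> r < u}. leave K \<omega> < r"
        show "leave K \<omega> \<le> t"
        proof (rule ccontr)
          assume "\<not> leave K \<omega> \<le> t"
          then have "t < min u (leave K \<omega>)" using u by auto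
          from C(2)[OF this] r show False by force
        qed
      qed auto
      then have "{\<omega>\<in>\<Omega>. leave K \<omega> \<le> t} = (\<Inter>r\<in>{r\<in>C. t < r \<and> r < u}. {\<omega>\<in>\<Omega>. leave K \<omega> < r})"
        using ne by auto
      also have "\<dots> \<in> sets (Fl u)"
      proof (rule sets.countable_INT')
        show "countable {r\<in>C. t < r \<and> r < u}" using C(1) by auto
        have "{\<omega>\<in>\<Omega>. leave K \<omega> < r} \<in> sets (Fl u)" if "r \<in> {r\<in>C. t < r \<and> r < u}" for r
          using leave_less_pred[OF K, of r] sets_F_mono[of r u] that by (auto simp: less_imp_le)
        then show "(\<lambda>r. {\<omega>\<in>\<Omega>. leave K \<omega> < r}) ` {r\<in>C. t < r \<and> r < u} \<subseteq> sets (Fl u)" by auto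
      qed (use ne in auto)
      finally show ?thesis .
    qed
    then have "{\<omega>\<in>\<Omega>. leave K \<omega> \<le> t} \<in> sets (Fl t)"
      using Fl_right_cont[of t] False by (auto simp: less_top)
    then show ?thesis by (simp add: pred_def space_F)
  qed (use sets.top[of "Fl t"] in \<open>simp add: pred_def space_F\<close>)
qed

text \<open>Inside the interior, right continuity would postpone the exit. On the boundary of
  \<open>K\<close> the path may still be at that time, so only the interior is excluded.\<close>

lemma X_leave:
  assumes w: "\<omega> \<in> \<Omega>" shows "X (leave K \<omega>) \<omega> \<notin> Some ` interior K"
proof
  assume *: "X (leave K \<omega>) \<omega> \<in> Some ` interior K"
  then have fin: "leave K \<omega> < \<top>" using at_infinity_None[OF w] by (cases "leave K \<omega> = \<top>") (auto simp: less_top)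
  then obtain b where b: "leave K \<omega> < b" "\<And>s. leave K \<omega> \<le> s \<Longrightarrow> s < b \<Longrightarrow> X s \<omega> \<in> Some ` interior K"
    using eventually_right_open[OF w _ open_interior *] by blast
  from b(1) obtain u where u: "u < b" "X u \<omega> \<notin> Some ` K" by (auto simp: leave_def Inf_less_iff)
  then have "leave K \<omega> \<le> u" unfolding leave_def by (auto intro: Inf_lower)
  with b(2)[OF this u(1)] u(2) interior_subset show False by blast
qed

lemma leave_mono: "K \<subseteq> K' \<Longrightarrow> leave K \<omega> \<le> leave K' \<omega>"
  unfolding leave_def by (rule Inf_superset_mono) auto

lemma leave_gt: "ennreal t < leave K \<omega> \<Longrightarrow> u \<le> ennreal t \<Longrightarrow> X u \<omega> \<in> Some ` K"
proof (rule ccontr)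
  assume *: "ennreal t < leave K \<omega>" "u \<le> ennreal t" "X u \<omega> \<notin> Some ` K"
  then have "leave K \<omega> \<le> u" unfolding leave_def by (auto intro: Inf_lower)
  with * show False by auto
qed

lemma trans_op_None: "trans_op s (case_option 0 f) None = 0"
proof -
  have "AE \<omega> in P None. case_option 0 f (X s \<omega>) = 0"
    using normal[of None] AE_space
  proof eventually_elim
    case (elim \<omega>)
    then show ?case using cemetery[of \<omega> 0 s] by (simp add: space_P)
  qed
  then have "trans_op s (case_option 0 f) None = (\<integral>\<^sup>+\<omega>. 0 \<partial>P None)"
    unfolding trans_op_def by (rule nn_integral_cong_AE)
  then show ?thesis by simp
qed

lemma pre_sigma_const: "\<Lambda> \<in> sets (Fl s) \<Longrightarrow> \<Lambda> \<in> sets (pre_sigma (\<lambda>_. s))"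
proof (rule sets_pre_sigmaI)
  fix t assume "\<Lambda> \<in> sets (Fl s)"
  then show "{\<omega> \<in> \<Lambda>. s \<le> t} \<in> sets (Fl t)"
    using sets_F_mono[of s t] by (cases "s \<le> t") auto
qed (rule stopping_time_const)

section \<open>Paths that stay in a compact set\<close>

definition stay :: "'a set \<Rightarrow> real \<Rightarrow> real \<Rightarrow> 'w set" where
  "stay K s t = {\<omega>\<in>\<Omega>. \<forall>u. ennreal s \<le> u \<and> u \<le> ennreal (s + t) \<longrightarrow> X u \<omega> \<in> Some ` K}"

text \<open>Index 0 is left out so that consecutive blocks fit together in
  \<open>Markov_disc\<close>; the state at time \<open>s\<close> is handled by a separate
  condition.\<close>

definition stay_disc :: "'a set \<Rightarrow> real \<Rightarrow> real \<Rightarrow> nat \<Rightarrow> 'w set" where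
  "stay_disc K s h n = {\<omega>\<in>\<Omega>. \<forall>k\<in>{1..n}. X (ennreal (s + real k * h)) \<omega> \<in> Some ` K}"

text \<open>As \<open>K\<close> is closed and paths are right continuous, membership in
  \<open>K\<close> at grid points decreasing to \<open>u\<close> passes to \<open>u\<close>
  itself.\<close>

lemma stay_eq:
  assumes K: "compact K" and s: "0 \<le> s" and t: "0 < t"
  shows "stay K s t = (\<Inter>m. {\<omega>\<in>\<Omega>. X (ennreal s) \<omega> \<in> Some ` K} \<inter> stay_disc K s (t / 2 ^ m) (2 ^ m))"
proof (rule set_eqI, rule iffI)
  fix \<omega> assume w: "\<omega> \<in> stay K s t"
  have "X (ennreal (s + real k * (t / 2 ^ m))) \<omega> \<in> Some ` K" if "k \<le> 2 ^ m" for k m :: nat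
  proof -
    have "real k \<le> real (2 ^ m)" using that by (rule of_nat_mono)
    then have "real k * (t / 2 ^ m) \<le> 2 ^ m * (t / 2 ^ m)"
      using t by (intro mult_right_mono) auto
    then have "s + real k * (t / 2 ^ m) \<le> s + t" by simp
    moreover have "s \<le> s + real k * (t / 2 ^ m)" using t by simp
    ultimately have "ennreal s \<le> ennreal (s + real k * (t / 2 ^ m)) \<and> ennreal (s + real k * (t / 2 ^ m)) \<le> ennreal (s + t)"
      by (intro conjI ennreal_leI)
    then show ?thesis using w unfolding stay_def by blast
  qed
  moreover from this[of 0 0] have "X (ennreal s) \<omega> \<in> Some ` K" by simp
  ultimately show "\<omega> \<in> (\<Inter>m. {\<omega>\<in>\<Omega>. X (ennreal s) \<omega> \<in> Some ` K} \<inter> stay_disc K s (t / 2 ^ m) (2 ^ m))"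
    using w unfolding stay_disc_def stay_def by simp
next
  fix \<omega> assume w: "\<omega> \<in> (\<Inter>m. {\<omega>\<in>\<Omega>. X (ennreal s) \<omega> \<in> Some ` K} \<inter> stay_disc K s (t / 2 ^ m) (2 ^ m))"
  then have w\<Omega>: "\<omega> \<in> \<Omega>" and
    d: "\<And>m k. k \<in> {1..2 ^ m} \<Longrightarrow> X (ennreal (s + real k * (t / 2 ^ m))) \<omega> \<in> Some ` K"
    unfolding stay_disc_def by blast+
  have "X (ennreal u) \<omega> \<in> Some ` K" if u: "s \<le> u" "u \<le> s + t" for u
  proof (cases "u = s + t")
    \<comment> \<open>The right end point has no later grid point; it is itself a grid point of the
      coarsest grid (\<open>k = 1\<close>, \<open>m = 0\<close>).\<close>
    case True then show ?thesis using d[of 1 0] by simp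
  next
    case False
    \<comment> \<open>The floor plus one selects the first grid point strictly after
      \<open>u\<close>; its index is at most \<open>2 ^ m\<close> because
      \<open>u < s + t\<close>.\<close>
    define k where "k m = nat \<lfloor>2 ^ m * ((u - s) / t)\<rfloor> + 1" for m :: nat
    have y: "0 \<le> (u - s) / t" "(u - s) / t < 1" using u False t by (auto simp: field_simps)
    have rk: "real (k m) = of_int \<lfloor>2 ^ m * ((u - s) / t)\<rfloor> + 1" for m
      unfolding k_def using mult_nonneg_nonneg[OF _ y(1), of "2 ^ m"] by (simp del: times_divide_eq_right)
    have k1: "k m \<in> {1..2 ^ m}" for m
    proof -
      have "2 ^ m * ((u - s) / t) < 2 ^ m" using mult_strict_left_mono[OF y(2), of "2 ^ m"] by simp
      then have "\<lfloor>2 ^ m * ((u - s) / t)\<rfloor> < 2 ^ m" by (simp add: floor_less_iff)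
      then have "nat \<lfloor>2 ^ m * ((u - s) / t)\<rfloor> < 2 ^ m" using mult_nonneg_nonneg[OF _ y(1), of "2 ^ m"] by (subst nat_less_iff) (auto simp del: times_divide_eq_right)
      then show ?thesis unfolding k_def by (auto simp: Suc_le_eq)
    qed
    have lo: "u < s + real (k m) * (t / 2 ^ m)" for m
    proof -
      have "2 ^ m * ((u - s) / t) < real (k m)" unfolding rk by linarith
      then have "(2 ^ m * ((u - s) / t)) * (t / 2 ^ m) < real (k m) * (t / 2 ^ m)"
        using t by (intro mult_strict_right_mono) auto
      then show ?thesis using t by simp
    qed
    have hi: "s + real (k m) * (t / 2 ^ m) \<le> u + t * (1/2) ^ m" for m
    proof -
      have "real (k m) \<le> 2 ^ m * ((u - s) / t) + 1" unfolding rk by linarith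
      then have "real (k m) * (t / 2 ^ m) \<le> (2 ^ m * ((u - s) / t) + 1) * (t / 2 ^ m)"
        using t by (intro mult_right_mono) auto
      also have "\<dots> = u - s + t * (1/2) ^ m" using t by (simp add: field_simps power_divide)
      finally show ?thesis by simp
    qed
    have "(\<lambda>m. (1/2::real) ^ m) \<longlonglongrightarrow> 0" by (rule LIMSEQ_power_zero) simp
    from tendsto_add[OF tendsto_const tendsto_mult[OF tendsto_const this], of u t]
    have up: "(\<lambda>m. u + t * (1/2) ^ m) \<longlonglongrightarrow> u" by simp
    have lim: "(\<lambda>m. s + real (k m) * (t / 2 ^ m)) \<longlonglongrightarrow> u"
    proof (rule tendsto_sandwich[OF _ _ tendsto_const up])
      show "\<forall>\<^sub>F m in sequentially. u \<le> s + real (k m) * (t / 2 ^ m)"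
        using lo by (intro always_eventually allI less_imp_le)
      show "\<forall>\<^sub>F m in sequentially. s + real (k m) * (t / 2 ^ m) \<le> u + t * (1/2) ^ m"
        using hi by (intro always_eventually allI)
    qed
    show ?thesis
    proof (rule ccontr)
      assume "X (ennreal u) \<omega> \<notin> Some ` K"
      moreover have "0 \<le> u" using u s by simp
      ultimately have "\<forall>\<^sub>F m in sequentially. X (ennreal (s + real (k m) * (t / 2 ^ m))) \<omega> \<notin> Some ` K"
        using limitin_state_compact[OF filterlim_X_right[OF w\<Omega> _ lo lim] _ K] by blast
      then obtain m where "X (ennreal (s + real (k m) * (t / 2 ^ m))) \<omega> \<notin> Some ` K"
        by (auto simp: eventually_sequentially)
      with d[OF k1] show False by blast
    qed
  qed
  note real = this
  show "\<omega> \<in> stay K s t"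
    unfolding stay_def
  proof (intro CollectI conjI allI impI w\<Omega>)
    fix u assume u: "ennreal s \<le> u \<and> u \<le> ennreal (s + t)"
    then obtain r where r: "u = ennreal r" "0 \<le> r" by (cases u) (auto simp: top_unique)
    have "s \<le> r" "r \<le> s + t" using u s t unfolding r(1) by (simp_all del: ennreal_plus add: r(2))
    then show "X u \<omega> \<in> Some ` K" unfolding r(1) by (rule real)
  qed
qed

lemma stay_disc_sets:
  assumes K: "compact K" and "0 \<le> h"
  shows "stay_disc K s h n \<in> sets (Fl (ennreal (s + real n * h)))"
proof -
  let ?F = "Fl (ennreal (s + real n * h))"
  have "{\<omega>\<in>\<Omega>. X (ennreal (s + real k * h)) \<omega> \<in> Some ` K} \<in> sets ?F" if "k \<in> {1..n}" for k
    by (rule adapted_set) (use that assms in \<open>auto intro!: ennreal_leI Some_image_sets mult_right_mono borel_compact\<close>)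
  then have "{\<omega>\<in>space ?F. \<forall>k\<in>{1..n}. X (ennreal (s + real k * h)) \<omega> \<in> Some ` K} \<in> sets ?F"
    by (intro sets.sets_Collect_finite_All) (auto simp: space_F)
  then show ?thesis by (simp add: stay_disc_def space_F)
qed

lemma stay_sets:
  assumes K: "compact K" and s: "0 \<le> s" and t: "0 < t"
  shows "stay K s t \<in> sets (Fl (ennreal (s + t)))"
  unfolding stay_eq[OF assms]
proof (intro sets.countable_INT' ; safe?)
  fix m
  show "{\<omega>\<in>\<Omega>. X (ennreal s) \<omega> \<in> Some ` K} \<inter> stay_disc K s (t / 2 ^ m) (2 ^ m) \<in> sets (Fl (ennreal (s + t)))"
    using stay_disc_sets[OF K, of "t / 2 ^ m" s "2 ^ m"] t
    by (auto intro!: sets.Int adapted_set Some_image_sets ennreal_leI borel_compact K)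
qed auto

text \<open>Dyadic grids are nested; this monotonicity is what turns \<open>stay\<close> into a
  decreasing limit.\<close>

lemma stay_disc_antimono:
  assumes "m \<le> n"
  shows "stay_disc K s (t / 2 ^ n) (2 ^ n) \<subseteq> stay_disc K s (t / 2 ^ m) (2 ^ m)"
proof
  fix \<omega> assume w: "\<omega> \<in> stay_disc K s (t / 2 ^ n) (2 ^ n)"
  have "X (ennreal (s + real k * (t / 2 ^ m))) \<omega> \<in> Some ` K" if k: "k \<in> {1..2 ^ m}" for k
  proof -
    have n: "(2::nat) ^ n = 2 ^ m * 2 ^ (n - m)" "(2::real) ^ n = 2 ^ m * 2 ^ (n - m)"
      using assms by (simp_all add: power_add[symmetric])
    have "k * 2 ^ (n - m) \<in> {1..2 ^ n}" using k by (auto simp: n(1))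
    with w have "X (ennreal (s + real (k * 2 ^ (n - m)) * (t / 2 ^ n))) \<omega> \<in> Some ` K"
      unfolding stay_disc_def by blast
    moreover have "real (k * 2 ^ (n - m)) * (t / 2 ^ n) = real k * (t / 2 ^ m)"
      by (simp add: n(2))
    ultimately show ?thesis by simp
  qed
  with w show "\<omega> \<in> stay_disc K s (t / 2 ^ m) (2 ^ m)" by (auto simp: stay_disc_def)
qed

end

lemma INF_cmult_decseq:
  fixes g :: "nat \<Rightarrow> ennreal"
  assumes "decseq g" "c < \<top>"
  shows "(INF m. c * g m) = c * (INF m. g m)"
proof -
  have "g \<longlonglongrightarrow> (INF m. g m)" using assms(1) by (rule LIMSEQ_INF)
  then have "(\<lambda>m. c * g m) \<longlonglongrightarrow> c * (INF m. g m)" using assms(2) by (intro ennreal_tendsto_cmult)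
  moreover have "(\<lambda>m. c * g m) \<longlonglongrightarrow> (INF m. c * g m)"
    by (rule LIMSEQ_INF) (use assms(1) in \<open>auto simp: decseq_def intro!: mult_left_mono\<close>)
  ultimately show ?thesis using LIMSEQ_unique by blast
qed

lemma INF_mult_indicator:
  fixes c :: ennreal
  shows "(INF n. c * indicator (A n) x) = c * indicator (\<Inter>n. A n) x"
proof (cases "x \<in> (\<Inter>n. A n)")
  case True then show ?thesis by simp
next
  case False
  then obtain n where n: "x \<notin> A n" by auto
  have "(INF n. c * indicator (A n) x) \<le> c * indicator (A n) x" by (rule INF_lower) simp
  with n False show ?thesis by (auto simp: le_zero_eq)
qed

section \<open>The semigroup of the process killed on leaving a compact set\<close>

context hunt_process begin

text \<open>The cut-off to \<open>K\<close> acts after the step only. The cut-off at the starting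
  point appears as the factor \<open>indicator K x\<close> in \<open>Qstay_eq\<close>, and together
  with it the iterates are symmetric.\<close>

definition step_in :: "'a set \<Rightarrow> real \<Rightarrow> ('a \<Rightarrow> ennreal) \<Rightarrow> 'a \<Rightarrow> ennreal" where
  "step_in K h f = (\<lambda>x. trans_op (ennreal h) (case_option 0 (\<lambda>y. indicator K y * f y)) (Some x))"

definition Qstay :: "'a set \<Rightarrow> real \<Rightarrow> ('a \<Rightarrow> ennreal) \<Rightarrow> 'a \<Rightarrow> ennreal" where
  "Qstay K t f x = (\<integral>\<^sup>+\<omega>\<in>stay K 0 t. case_option 0 f (X (ennreal t) \<omega>) \<partial>P (Some x))"

lemma trans_op_measurable_Some [measurable (raw)]:
  "h \<in> borel_measurable state_space \<Longrightarrow> (\<lambda>x. trans_op s h (Some x)) \<in> borel_measurable borel"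
  using measurable_trans_op[of h s] by (simp add: measurable_state_space_iff)

lemma trans_op_le: "(\<And>y. h y \<le> c) \<Longrightarrow> trans_op s h z \<le> c"
proof -
  assume "\<And>y. h y \<le> c"
  then have "trans_op s h z \<le> (\<integral>\<^sup>+\<omega>. c \<partial>P z)" unfolding trans_op_def by (intro nn_integral_mono) auto
  then show ?thesis using prob_space.emeasure_space_1[OF prob_space_P[of z]] by simp
qed

lemma step_in_measurable [measurable]:
  assumes [measurable]: "K \<in> sets borel" "f \<in> borel_measurable borel"
  shows "step_in K h f \<in> borel_measurable borel"
  unfolding step_in_def by measurable

lemma step_in_iter_measurable [measurable]:
  "K \<in> sets borel \<Longrightarrow> f \<in> borel_measurable borel \<Longrightarrow> (step_in K h ^^ n) f \<in> borel_measurable borel"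
  by (induct n) auto

lemma step_in_le1: "(\<And>x. f x \<le> 1) \<Longrightarrow> step_in K h f x \<le> 1"
  unfolding step_in_def by (rule trans_op_le) (auto simp: indicator_def split: option.split)

lemma step_in_iter_le1: "(\<And>x. f x \<le> 1) \<Longrightarrow> (step_in K h ^^ n) f x \<le> 1"
  by (induct n arbitrary: x) (auto intro: step_in_le1)

lemma sets_Fl_P': "\<Lambda> \<in> sets (Fl s) \<Longrightarrow> \<Lambda> \<in> sets (P z)"
  using sets_Fl_P by auto

text \<open>Induction on the number of steps, peeling off the first one: the condition at time
  \<open>s + h\<close> is absorbed into the event, which is why \<open>s\<close> and
  \<open>\<Lambda>\<close> are generalised.\<close>

lemma Markov_disc:
  assumes K: "compact K" and f [measurable]: "f \<in> borel_measurable borel" and s: "0 \<le> s" and h: "0 \<le> h"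
    and L: "\<Lambda> \<in> sets (Fl (ennreal s))"
  shows "(\<integral>\<^sup>+\<omega>\<in>\<Lambda> \<inter> stay_disc K s h n. case_option 0 f (X (ennreal (s + real n * h)) \<omega>) \<partial>P z) =
    (\<integral>\<^sup>+\<omega>\<in>\<Lambda>. case_option 0 ((step_in K h ^^ n) f) (X (ennreal s) \<omega>) \<partial>P z)"
  using s L
proof (induct n arbitrary: s \<Lambda>)
  case 0
  have "\<Lambda> \<subseteq> \<Omega>" using sets.sets_into_space[OF 0(2)] by (simp add: space_F)
  then have "\<Lambda> \<inter> stay_disc K s h 0 = \<Lambda>" by (auto simp: stay_disc_def)
  then show ?case unfolding funpow_0 by simp
next
  case (Suc n)
  have [measurable]: "K \<in> sets borel" using K by (rule borel_compact)
  let ?g = "(step_in K h ^^ n) f"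
  let ?L = "\<Lambda> \<inter> {\<omega>\<in>\<Omega>. X (ennreal (s + h)) \<omega> \<in> Some ` K}"
  have L\<Omega>: "\<Lambda> \<subseteq> \<Omega>" using sets.sets_into_space[OF Suc(3)] by (simp add: space_F)
  have L': "?L \<in> sets (Fl (ennreal (s + h)))"
    using Suc(3) sets_F_mono[of "ennreal s" "ennreal (s + h)"] h
    by (intro sets.Int adapted_set Some_image_sets) (auto simp: ennreal_leI)
  have st: "\<Lambda> \<inter> stay_disc K s h (Suc n) = ?L \<inter> stay_disc K (s + h) h n"
  proof -
    have "(\<forall>k\<in>{1..Suc n}. X (ennreal (s + real k * h)) \<omega> \<in> Some ` K) \<longleftrightarrow>
      X (ennreal (s + h)) \<omega> \<in> Some ` K \<and> (\<forall>k\<in>{1..n}. X (ennreal (s + h + real k * h)) \<omega> \<in> Some ` K)" for \<omega>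
    proof -
      have e: "{1..Suc n} = insert 1 (Suc ` {1..n})" by (auto simp: image_iff)
      show ?thesis unfolding e by (simp add: algebra_simps del: image_Suc_atLeastAtMost)
    qed
    then show ?thesis by (auto simp: stay_disc_def)
  qed
  have "(\<integral>\<^sup>+\<omega>\<in>\<Lambda> \<inter> stay_disc K s h (Suc n). case_option 0 f (X (ennreal (s + real (Suc n) * h)) \<omega>) \<partial>P z)
     = (\<integral>\<^sup>+\<omega>\<in>?L \<inter> stay_disc K (s + h) h n. case_option 0 f (X (ennreal (s + h + real n * h)) \<omega>) \<partial>P z)"
    unfolding st by (simp add: algebra_simps)
  also have "\<dots> = (\<integral>\<^sup>+\<omega>\<in>?L. case_option 0 ?g (X (ennreal (s + h)) \<omega>) \<partial>P z)"
    using Suc(2) h L' by (intro Suc(1)) auto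
  also have "\<dots> = (\<integral>\<^sup>+\<omega>\<in>\<Lambda>. case_option 0 (\<lambda>y. indicator K y * ?g y) (X (ennreal s + ennreal h) \<omega>) \<partial>P z)"
    using L\<Omega> Suc(2) h
    by (intro nn_integral_cong) (auto simp: indicator_def split: option.split simp flip: ennreal_plus)
  also have "\<dots> = (\<integral>\<^sup>+\<omega>\<in>\<Lambda>. trans_op (ennreal h) (case_option 0 (\<lambda>y. indicator K y * ?g y)) (X (ennreal s) \<omega>) \<partial>P z)"
    by (rule strong_Markov_fun[where T="\<lambda>_. ennreal s"])
       (auto intro!: stopping_time_const pre_sigma_const Suc(3))
  also have "\<dots> = (\<integral>\<^sup>+\<omega>\<in>\<Lambda>. case_option 0 ((step_in K h ^^ Suc n) f) (X (ennreal s) \<omega>) \<partial>P z)"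
  proof -
    have "trans_op (ennreal h) (case_option 0 (\<lambda>y. indicator K y * ?g y)) y = case_option 0 ((step_in K h ^^ Suc n) f) y" for y
      by (cases y) (auto simp: trans_op_None step_in_def)
    then show ?thesis by simp
  qed
  finally show ?case .
qed

lemma case_option_le1: "(\<And>x. f x \<le> 1) \<Longrightarrow> case_option (0::ennreal) f z \<le> 1"
  by (cases z) auto

lemma finite_int_le1:
  assumes "\<And>\<omega>. f \<omega> \<le> 1" shows "(\<integral>\<^sup>+\<omega>\<in>A. f \<omega> \<partial>P z) < \<top>"
proof -
  have "(\<integral>\<^sup>+\<omega>\<in>A. f \<omega> \<partial>P z) \<le> (\<integral>\<^sup>+\<omega>. 1 \<partial>P z)"
    using assms by (intro nn_integral_mono) (auto simp: indicator_def)
  also have "\<dots> < \<top>" using prob_space.emeasure_space_1[OF prob_space_P[of z]] by simp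
  finally show ?thesis .
qed

text \<open>Monotone convergence from above along the nested grids; it requires a finite integral,
  hence the bound \<open>f x \<le> 1\<close>.\<close>

lemma stay_int_INF:
  assumes K: "compact K" and f [measurable]: "f \<in> borel_measurable borel" and f1: "\<And>x. f x \<le> 1"
    and s: "0 \<le> s" and t: "0 < t" and L: "\<Lambda> \<in> sets (Fl (ennreal s))"
  shows "(\<integral>\<^sup>+\<omega>\<in>\<Lambda> \<inter> stay K s t. case_option 0 f (X (ennreal (s + t)) \<omega>) \<partial>P z) =
    (INF m. \<integral>\<^sup>+\<omega>\<in>\<Lambda>. case_option 0 (\<lambda>x. indicator K x * (step_in K (t / 2 ^ m) ^^ 2 ^ m) f x) (X (ennreal s) \<omega>) \<partial>P z)"
    and "decseq (\<lambda>m. \<integral>\<^sup>+\<omega>\<in>\<Lambda>. case_option 0 (\<lambda>x. indicator K x * (step_in K (t / 2 ^ m) ^^ 2 ^ m) f x) (X (ennreal s) \<omega>) \<partial>P z)"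
proof -
  have [measurable]: "K \<in> sets borel" using K by (rule borel_compact)
  let ?L = "\<Lambda> \<inter> {\<omega>\<in>\<Omega>. X (ennreal s) \<omega> \<in> Some ` K}"
  have L\<Omega>: "\<Lambda> \<subseteq> \<Omega>" using sets.sets_into_space[OF L] by (simp add: space_F)
  have L': "?L \<in> sets (Fl (ennreal s))"
    using L by (intro sets.Int adapted_set Some_image_sets) auto
  let ?S = "\<lambda>m. ?L \<inter> stay_disc K s (t / 2 ^ m) (2 ^ m)"
  have S [measurable]: "?S m \<in> sets (P z)" for m
    using L' sets_Fl_P'[of ?L "ennreal s" z] stay_disc_sets[OF K, of "t / 2 ^ m" s "2 ^ m"] t
      sets_Fl_P'[of "stay_disc K s (t / 2 ^ m) (2 ^ m)"] by auto
  have eq: "(\<integral>\<^sup>+\<omega>\<in>?S m. case_option 0 f (X (ennreal (s + t)) \<omega>) \<partial>P z) =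
    (\<integral>\<^sup>+\<omega>\<in>\<Lambda>. case_option 0 (\<lambda>x. indicator K x * (step_in K (t / 2 ^ m) ^^ 2 ^ m) f x) (X (ennreal s) \<omega>) \<partial>P z)" for m
  proof -
    have "(\<integral>\<^sup>+\<omega>\<in>?S m. case_option 0 f (X (ennreal (s + t)) \<omega>) \<partial>P z) =
      (\<integral>\<^sup>+\<omega>\<in>?L. case_option 0 ((step_in K (t / 2 ^ m) ^^ 2 ^ m) f) (X (ennreal s) \<omega>) \<partial>P z)"
      using Markov_disc[OF K f s _ L', where h="t / 2 ^ m" and n="2 ^ m" and z=z] t by simp
    also have "\<dots> = (\<integral>\<^sup>+\<omega>\<in>\<Lambda>. case_option 0 (\<lambda>x. indicator K x * (step_in K (t / 2 ^ m) ^^ 2 ^ m) f x) (X (ennreal s) \<omega>) \<partial>P z)"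
      using L\<Omega> by (intro nn_integral_cong) (auto simp: indicator_def split: option.split)
    finally show ?thesis .
  qed
  have dec: "?S n \<subseteq> ?S m" if "m \<le> n" for m n using stay_disc_antimono[OF that, of K s t] by blast
  have dec': "decseq (\<lambda>m \<omega>. case_option 0 f (X (ennreal (s + t)) \<omega>) * indicator (?S m) \<omega>)"
    by (intro antimonoI le_funI mult_left_mono indicator_leI) (use dec in blast, simp)
  have "\<Lambda> \<inter> stay K s t = (\<Inter>m. ?S m)"
    unfolding stay_eq[OF K s t] using L\<Omega> by (auto simp: stay_disc_def)
  then have "(\<integral>\<^sup>+\<omega>\<in>\<Lambda> \<inter> stay K s t. case_option 0 f (X (ennreal (s + t)) \<omega>) \<partial>P z) =
     (\<integral>\<^sup>+\<omega>. (INF m. case_option 0 f (X (ennreal (s + t)) \<omega>) * indicator (?S m) \<omega>) \<partial>P z)"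
    by (simp only: INF_mult_indicator)
  also have "\<dots> = (INF m. \<integral>\<^sup>+\<omega>\<in>?S m. case_option 0 f (X (ennreal (s + t)) \<omega>) \<partial>P z)"
    by (rule nn_integral_monotone_convergence_INF_decseq[OF dec', where i=0])
       (measurable, auto intro!: finite_int_le1 case_option_le1 f1)
  finally show "(\<integral>\<^sup>+\<omega>\<in>\<Lambda> \<inter> stay K s t. case_option 0 f (X (ennreal (s + t)) \<omega>) \<partial>P z) =
    (INF m. \<integral>\<^sup>+\<omega>\<in>\<Lambda>. case_option 0 (\<lambda>x. indicator K x * (step_in K (t / 2 ^ m) ^^ 2 ^ m) f x) (X (ennreal s) \<omega>) \<partial>P z)"
    unfolding eq .
  show "decseq (\<lambda>m. \<integral>\<^sup>+\<omega>\<in>\<Lambda>. case_option 0 (\<lambda>x. indicator K x * (step_in K (t / 2 ^ m) ^^ 2 ^ m) f x) (X (ennreal s) \<omega>) \<partial>P z)"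
    unfolding eq[symmetric] using dec' unfolding decseq_def by (auto simp: le_fun_def intro!: nn_integral_mono)
qed

lemma int_X0: "h \<in> borel_measurable state_space \<Longrightarrow> (\<integral>\<^sup>+\<omega>\<in>\<Omega>. h (X 0 \<omega>) \<partial>P z) = h z"
proof -
  have "(\<integral>\<^sup>+\<omega>\<in>\<Omega>. h (X 0 \<omega>) \<partial>P z) = (\<integral>\<^sup>+\<omega>. h z \<partial>P z)"
    by (rule nn_integral_cong_AE) (use normal[of z] AE_space[of "P z"] in \<open>eventually_elim, auto simp: space_P\<close>)
  then show ?thesis using prob_space.emeasure_space_1[OF prob_space_P[of z]] by simp
qed

lemma
  assumes K: "compact K" and f [measurable]: "f \<in> borel_measurable borel" and f1: "\<And>x. f x \<le> 1" and t: "0 < t"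
  shows Qstay_eq: "Qstay K t f x = (INF m. indicator K x * (step_in K (t / 2 ^ m) ^^ 2 ^ m) f x)"
    and Qstay_decseq: "decseq (\<lambda>m. indicator K x * (step_in K (t / 2 ^ m) ^^ 2 ^ m) f x)"
proof -
  have [measurable]: "K \<in> sets borel" using K by (rule borel_compact)
  have top: "\<Omega> \<in> sets (Fl (ennreal 0))" using sets.top[of "Fl (ennreal 0)"] by (simp add: space_F)
  have e: "(\<integral>\<^sup>+\<omega>\<in>\<Omega>. case_option 0 (\<lambda>x. indicator K x * (step_in K (t / 2 ^ m) ^^ 2 ^ m) f x) (X (ennreal 0) \<omega>) \<partial>P (Some x))
    = indicator K x * (step_in K (t / 2 ^ m) ^^ 2 ^ m) f x" for m
    using int_X0[of "case_option 0 (\<lambda>x. indicator K x * (step_in K (t / 2 ^ m) ^^ 2 ^ m) f x)" "Some x"] by simp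
  have "\<Omega> \<inter> stay K 0 t = stay K 0 t" by (auto simp: stay_def)
  with stay_int_INF[OF K f f1 order_refl t top, of "Some x", unfolded e]
  show "Qstay K t f x = (INF m. indicator K x * (step_in K (t / 2 ^ m) ^^ 2 ^ m) f x)"
    "decseq (\<lambda>m. indicator K x * (step_in K (t / 2 ^ m) ^^ 2 ^ m) f x)"
    unfolding Qstay_def by simp_all
qed

lemma Qstay_measurable [measurable]:
  assumes K: "compact K" and f [measurable]: "f \<in> borel_measurable borel" and f1: "\<And>x. f x \<le> 1" and t: "0 < t"
  shows "Qstay K t f \<in> borel_measurable borel"
proof -
  have [measurable]: "K \<in> sets borel" using K by (rule borel_compact)
  have "Qstay K t f = (\<lambda>x. INF m. indicator K x * (step_in K (t / 2 ^ m) ^^ 2 ^ m) f x)"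
    using Qstay_eq[OF assms] by auto
  then show ?thesis by simp
qed

lemma Qstay_le1: "(\<And>x. f x \<le> 1) \<Longrightarrow> Qstay K t f x \<le> 1"
proof -
  assume "\<And>x. f x \<le> 1"
  then have "Qstay K t f x \<le> (\<integral>\<^sup>+\<omega>. 1 \<partial>P (Some x))"
    unfolding Qstay_def using case_option_le1[of f]
    by (intro nn_integral_mono) (auto simp: indicator_def)
  then show ?thesis using prob_space.emeasure_space_1[OF prob_space_P[of "Some x"]] by simp
qed

lemma Markov_stay:
  assumes K: "compact K" and f [measurable]: "f \<in> borel_measurable borel" and f1: "\<And>x. f x \<le> 1"
    and s: "0 \<le> s" and t: "0 < t" and L: "\<Lambda> \<in> sets (Fl (ennreal s))"
  shows "(\<integral>\<^sup>+\<omega>\<in>\<Lambda> \<inter> stay K s t. case_option 0 f (X (ennreal (s + t)) \<omega>) \<partial>P z) =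
    (\<integral>\<^sup>+\<omega>\<in>\<Lambda>. case_option 0 (Qstay K t f) (X (ennreal s) \<omega>) \<partial>P z)"
proof -
  have [measurable]: "K \<in> sets borel" using K by (rule borel_compact)
  have [measurable]: "\<Lambda> \<in> sets (P z)" using sets_Fl_P'[OF L] .
  let ?g = "\<lambda>m. case_option 0 (\<lambda>x. indicator K x * (step_in K (t / 2 ^ m) ^^ 2 ^ m) f x)"
  have dec: "decseq (\<lambda>m. ?g m y)" for y
    using Qstay_decseq[OF K f f1 t] by (cases y) (auto simp: decseq_def)
  then have dec': "decseq (\<lambda>m \<omega>. ?g m (X (ennreal s) \<omega>) * indicator \<Lambda> \<omega>)"
    unfolding decseq_def by (auto simp: le_fun_def intro!: mult_right_mono)
  have le1: "?g m y \<le> 1" for m y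
    using step_in_iter_le1[OF f1] by (intro case_option_le1) (auto simp: indicator_def)
  have "case_option 0 (Qstay K t f) y = (INF m. ?g m y)" for y
    by (cases y) (auto simp: Qstay_eq[OF K f f1 t])
  then have "(\<integral>\<^sup>+\<omega>\<in>\<Lambda>. case_option 0 (Qstay K t f) (X (ennreal s) \<omega>) \<partial>P z)
    = (\<integral>\<^sup>+\<omega>. (INF m. ?g m (X (ennreal s) \<omega>) * indicator \<Lambda> \<omega>) \<partial>P z)"
    by (intro nn_integral_cong) (auto simp: indicator_def)
  also have "\<dots> = (INF m. \<integral>\<^sup>+\<omega>\<in>\<Lambda>. ?g m (X (ennreal s) \<omega>) \<partial>P z)"
    by (rule nn_integral_monotone_convergence_INF_decseq[OF dec', where i=0])
       (measurable, auto intro!: finite_int_le1 le1)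
  finally show ?thesis using stay_int_INF(1)[OF assms] by simp
qed

lemma Qstay_semigroup:
  assumes K: "compact K" and f [measurable]: "f \<in> borel_measurable borel" and f1: "\<And>x. f x \<le> 1"
    and s: "0 < s" and t: "0 < t"
  shows "Qstay K (s + t) f x = Qstay K s (Qstay K t f) x"
proof -
  have le: "ennreal s \<le> ennreal (s + t)" using t by (intro ennreal_leI) simp
  have "stay K 0 (s + t) = stay K 0 s \<inter> stay K s t"
  proof (rule set_eqI)
    fix \<omega>
    have "(\<forall>u. u \<le> ennreal (s + t) \<longrightarrow> X u \<omega> \<in> Some ` K) \<longleftrightarrow>
      (\<forall>u. u \<le> ennreal s \<longrightarrow> X u \<omega> \<in> Some ` K) \<and>
      (\<forall>u. ennreal s \<le> u \<and> u \<le> ennreal (s + t) \<longrightarrow> X u \<omega> \<in> Some ` K)"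
      using le by (meson linear order_trans)
    then show "\<omega> \<in> stay K 0 (s + t) \<longleftrightarrow> \<omega> \<in> stay K 0 s \<inter> stay K s t"
      unfolding stay_def by (simp del: ennreal_plus) blast
  qed
  moreover have "stay K 0 s \<in> sets (Fl (ennreal s))" using stay_sets[OF K order_refl s] by simp
  ultimately show ?thesis
    using Markov_stay[OF K f f1 less_imp_le[OF s] t, of "stay K 0 s" "Some x"] by (simp add: Qstay_def)
qed

context
  assumes sym: "symmetric_process X P"
begin

lemma trans_op_sym:
  assumes [measurable]: "f \<in> borel_measurable borel" "g \<in> borel_measurable borel" and t: "0 < t"
  shows "(\<integral>\<^sup>+x. g x * trans_op (ennreal t) (case_option 0 f) (Some x) \<partial>lborel) =
     (\<integral>\<^sup>+x. f x * trans_op (ennreal t) (case_option 0 g) (Some x) \<partial>lborel)"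
  using sym assms unfolding symmetric_process_def trans_op_def by blast

text \<open>Each application of the symmetry of one transition step moves one factor of the operator
  from \<open>f\<close> to \<open>g\<close>; the cut-off travels along as a multiplication
  operator.\<close>

lemma step_in_sym:
  assumes [measurable]: "K \<in> sets borel" and h: "0 < h"
    and "f \<in> borel_measurable borel" "g \<in> borel_measurable borel"
  shows "(\<integral>\<^sup>+x. g x * indicator K x * (step_in K h ^^ n) f x \<partial>lborel) =
    (\<integral>\<^sup>+x. f x * indicator K x * (step_in K h ^^ n) g x \<partial>lborel)"
  using assms(3,4)
proof (induct n arbitrary: f g)
  case 0 then show ?case by (simp add: ac_simps)
next
  case (Suc n)
  note [measurable] = Suc(2,3)
  have "(\<integral>\<^sup>+x. g x * indicator K x * (step_in K h ^^ Suc n) f x \<partial>lborel) =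
    (\<integral>\<^sup>+x. g x * indicator K x * trans_op (ennreal h) (case_option 0 (\<lambda>y. indicator K y * (step_in K h ^^ n) f y)) (Some x) \<partial>lborel)"
    by (simp add: step_in_def)
  also have "\<dots> = (\<integral>\<^sup>+x. (indicator K x * (step_in K h ^^ n) f x) * trans_op (ennreal h) (case_option 0 (\<lambda>y. g y * indicator K y)) (Some x) \<partial>lborel)"
    by (rule trans_op_sym) (use h in auto)
  also have "\<dots> = (\<integral>\<^sup>+x. step_in K h g x * indicator K x * (step_in K h ^^ n) f x \<partial>lborel)"
    by (simp add: step_in_def ac_simps)
  also have "\<dots> = (\<integral>\<^sup>+x. f x * indicator K x * (step_in K h ^^ n) (step_in K h g) x \<partial>lborel)"
    by (rule Suc(1)) measurable
  finally show ?case by (simp add: funpow_swap1)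
qed

text \<open>The discretised operators are symmetric. The decreasing limit may be taken under the
  Lebesgue integral because every integrand is at most \<open>indicator K\<close>, and a compact set
  has finite measure.\<close>

lemma Qstay_sym:
  assumes K: "compact K" and t: "0 < t"
    and [measurable]: "f \<in> borel_measurable borel" "g \<in> borel_measurable borel"
    and f1: "\<And>x. f x \<le> 1" and g1: "\<And>x. g x \<le> 1"
  shows "(\<integral>\<^sup>+x. g x * Qstay K t f x \<partial>lborel) = (\<integral>\<^sup>+x. f x * Qstay K t g x \<partial>lborel)"
proof -
  have [measurable]: "K \<in> sets borel" using K by (rule borel_compact)
  have *: "(\<integral>\<^sup>+x. g x * Qstay K t f x \<partial>lborel) = (INF m. \<integral>\<^sup>+x. g x * indicator K x * (step_in K (t / 2 ^ m) ^^ 2 ^ m) f x \<partial>lborel)"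
    if [measurable]: "f \<in> borel_measurable borel" "g \<in> borel_measurable borel"
      and f1: "\<And>x. f x \<le> 1" and g1: "\<And>x. g x \<le> 1" for f g :: "'a \<Rightarrow> ennreal"
  proof -
    have dec: "decseq (\<lambda>m. indicator K x * (step_in K (t / 2 ^ m) ^^ 2 ^ m) f x)" for x
      by (rule Qstay_decseq[OF K _ f1 t]) simp
    have dec': "decseq (\<lambda>m x. g x * indicator K x * (step_in K (t / 2 ^ m) ^^ 2 ^ m) f x)"
      unfolding mult.assoc by (intro antimonoI le_funI mult_left_mono decseqD[OF dec]) auto
    have le: "g x * indicator K x * (step_in K (t / 2 ^ m) ^^ 2 ^ m) f x \<le> indicator K x" for m x
      using mult_mono[OF g1[of x] step_in_iter_le1[OF f1, where K=K and h="t / 2 ^ m" and n="2 ^ m" and x=x]] by (auto simp: indicator_def)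
    have fin: "(\<integral>\<^sup>+x. g x * indicator K x * (step_in K (t / 2 ^ m) ^^ 2 ^ m) f x \<partial>lborel) < \<top>" for m
    proof -
      have "(\<integral>\<^sup>+x. g x * indicator K x * (step_in K (t / 2 ^ m) ^^ 2 ^ m) f x \<partial>lborel) \<le> (\<integral>\<^sup>+x. indicator K x \<partial>lborel)"
        by (intro nn_integral_mono le)
      also have "\<dots> < \<top>" using emeasure_compact_finite[OF K] by simp
      finally show ?thesis .
    qed
    have "(\<integral>\<^sup>+x. g x * Qstay K t f x \<partial>lborel) = (\<integral>\<^sup>+x. (INF m. g x * indicator K x * (step_in K (t / 2 ^ m) ^^ 2 ^ m) f x) \<partial>lborel)"
      using Qstay_eq[OF K _ f1 t] INF_cmult_decseq[OF dec le_less_trans[OF g1]]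
      by (intro nn_integral_cong) (simp add: mult.assoc)
    also have "\<dots> = (INF m. \<integral>\<^sup>+x. g x * indicator K x * (step_in K (t / 2 ^ m) ^^ 2 ^ m) f x \<partial>lborel)"
      by (rule nn_integral_monotone_convergence_INF_decseq[OF dec', where i=0]) (measurable, use fin[of 0] in \<open>auto simp: infinity_ennreal_def\<close>)
    finally show ?thesis .
  qed
  have "(INF m. \<integral>\<^sup>+x. g x * indicator K x * (step_in K (t / 2 ^ m) ^^ 2 ^ m) f x \<partial>lborel) =
    (INF m. \<integral>\<^sup>+x. f x * indicator K x * (step_in K (t / 2 ^ m) ^^ 2 ^ m) g x \<partial>lborel)"
    by (intro INF_cong refl step_in_sym) (use t in auto)
  then show ?thesis using *[of f g] *[of g f] f1 g1 by (metis assms(3,4))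
qed

end

end

text \<open>A strictly positive integrable function vanishing at infinity, to test laws and symmetric operators against.\<close>

definition decay :: "'a::euclidean_space \<Rightarrow> ennreal" where
  "decay x = ennreal (1 / (1 + norm x) ^ (DIM('a) + 2))"

lemma decay_measurable [measurable]: "decay \<in> borel_measurable borel"
  unfolding decay_def by measurable

lemma decay_pos: "0 < decay (x :: 'a::euclidean_space)"
proof -
  have "0 < (1 + norm x) ^ (DIM('a) + 2)" by (intro zero_less_power add_pos_nonneg) auto
  then have "0 < 1 / (1 + norm x) ^ (DIM('a) + 2)" by (intro divide_pos_pos) auto
  from ennreal_lessI[OF this this] show ?thesis unfolding decay_def by simp
qed

lemma decay_le1: "decay x \<le> 1"
proof -
  have "1 / (1 + norm x) ^ (DIM('a) + 2) \<le> 1 / 1"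
    by (intro divide_left_mono one_le_power mult_pos_pos zero_less_power add_pos_nonneg) auto
  then show ?thesis by (simp add: decay_def)
qed

lemma decay_cont: "continuous_on UNIV (decay :: 'a::euclidean_space \<Rightarrow> ennreal)"
proof -
  have "1 + norm x \<noteq> 0" for x :: 'a by (metis add_nonneg_pos norm_ge_zero add.commute zero_less_one less_irrefl)
  then show ?thesis
    unfolding decay_def by (intro continuous_intros continuous_on_ennreal) auto
qed

lemma decay_at_infinity: "((decay :: 'a::euclidean_space \<Rightarrow> ennreal) \<longlongrightarrow> 0) at_infinity"
proof -
  have "((\<lambda>x::'a. 1 / (1 + norm x)) \<longlongrightarrow> 0) at_infinity"
  proof (rule tendstoI)
    fix e :: real assume e: "0 < e"
    have "dist (1 / (1 + norm x)) 0 < e" if "1 / e \<le> norm x" for x :: 'a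
    proof -
      have "1 / e < 1 + norm x" using that by simp
      then have "1 < e * (1 + norm x)" using e by (simp add: field_simps)
      moreover have "0 < 1 + norm x" by (simp add: add_pos_nonneg)
      ultimately show ?thesis by (simp add: field_simps abs_of_pos)
    qed
    then show "\<forall>\<^sub>F x::'a in at_infinity. dist (1 / (1 + norm x)) 0 < e"
      unfolding eventually_at_infinity by blast
  qed
  then have "((\<lambda>x::'a. ennreal ((1 / (1 + norm x)) ^ (DIM('a) + 2))) \<longlongrightarrow> ennreal (0 ^ (DIM('a) + 2))) at_infinity"
    by (intro tendsto_ennrealI tendsto_power)
  then show ?thesis by (simp add: decay_def[abs_def] power_one_over)
qed

text \<open>On the shell \<open>n \<le> norm x < n + 1\<close> the function is at most 1 over (1 +
  n)^(d + 2), while the ball around the shell has volume proportional to (1 + n)^d. The exponent in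
  \<open>decay\<close> thus leaves the convergent series of 1 / (1 + n)^2.\<close>

lemma decay_integral: "(\<integral>\<^sup>+x. decay x \<partial>(lborel :: 'a::euclidean_space measure)) < \<top>"
proof -
  let ?d = "DIM('a)" let ?w = "unit_ball_vol (real ?d)"
  define c where "c n = ennreal (1 / (1 + real n) ^ (?d + 2))" for n
  have B: "ball (0::'a) r \<in> sets lborel" for r by simp
  have "decay x \<le> (\<Sum>n. c n * indicator (ball 0 (real n + 1)) x)" for x :: 'a
  proof -
    define n where "n = nat \<lfloor>norm x\<rfloor>"
    have n: "real n \<le> norm x" "norm x < real n + 1" by (auto simp: n_def)
    have "1 / (1 + norm x) ^ (?d + 2) \<le> 1 / (1 + real n) ^ (?d + 2)"
      by (intro divide_left_mono power_mono mult_pos_pos zero_less_power add_pos_nonneg) (use n in auto)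
    then have "decay x \<le> c n * indicator (ball 0 (real n + 1)) x"
      using n(2) unfolding decay_def c_def by (simp add: ennreal_leI del: power_Suc add_2_eq_Suc')
    also have "\<dots> = (\<Sum>k\<in>{n}. c k * indicator (ball 0 (real k + 1)) x)"
      by (simp only: sum.insert finite.emptyI empty_iff not_False_eq_True sum.empty add_0_right)
    also have "\<dots> \<le> (\<Sum>n. c n * indicator (ball 0 (real n + 1)) x)"
      by (rule sum_le_suminf) auto
    finally show ?thesis .
  qed
  then have "(\<integral>\<^sup>+x. decay x \<partial>(lborel :: 'a measure)) \<le>
    (\<integral>\<^sup>+x. (\<Sum>n. c n * indicator (ball (0::'a) (real n + 1)) x) \<partial>lborel)"
    by (rule nn_integral_mono)
  also have "\<dots> = (\<Sum>n. c n * emeasure lborel (ball (0::'a) (real n + 1)))"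
    by (subst nn_integral_suminf) (auto simp: nn_integral_cmult_indicator[OF B] intro!: borel_measurable_times_ennreal borel_measurable_indicator)
  also have "\<dots> = (\<Sum>n. ennreal (?w * (1 / (real (Suc n)) ^ 2)))"
  proof -
    have "c n * emeasure lborel (ball (0::'a) (real n + 1)) = ennreal (?w * (1 / (real (Suc n)) ^ 2))" for n
    proof -
      define y where "y = 1 + real n"
      have y: "0 < y" by (simp add: y_def)
      have "1 / y ^ (?d + 2) * (?w * y ^ ?d) = ?w * (1 / y ^ 2)"
        using y by (simp add: power_add divide_simps del: power_Suc add_2_eq_Suc')
      then have "ennreal (1 / y ^ (?d + 2)) * ennreal (?w * y ^ ?d) = ennreal (?w * (1 / y ^ 2))"
        using y by (subst ennreal_mult[symmetric]) (auto simp del: power_Suc add_2_eq_Suc')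
      then show ?thesis unfolding c_def by (subst emeasure_ball) (simp_all add: y_def add.commute)
    qed
    then show ?thesis by simp
  qed
  also have "\<dots> = ennreal (\<Sum>n. ?w * (1 / (real (Suc n)) ^ 2))"
  proof (rule suminf_ennreal2)
    have "summable (\<lambda>n. inverse ((real (Suc n)) ^ 2))"
      using inverse_power_summable[of 2, where 'a=real] by (subst summable_Suc_iff) simp
    then show "summable (\<lambda>n. ?w * (1 / (real (Suc n)) ^ 2))"
      by (intro summable_mult) (simp add: inverse_eq_divide)
  qed auto
  finally show ?thesis by (simp add: le_less_trans)
qed

section \<open>The killed process and its kernel\<close>

locale killed_process = hunt_process \<Omega> Fl X P
  for \<Omega> :: "'w set" and Fl :: "ennreal \<Rightarrow> 'w measure"
    and X :: "ennreal \<Rightarrow> 'w \<Rightarrow> 'a::euclidean_space option" and P :: "'a option \<Rightarrow> 'w measure" +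
  fixes p :: "real \<Rightarrow> 'a \<Rightarrow> 'a \<Rightarrow> real" and D :: "'a set" and K :: "nat \<Rightarrow> 'a set"
  assumes sym: "symmetric_process X P"
    and dens: "transition_density X P p"
    and K: "compact (K n)" "K n \<subseteq> interior (K (Suc n))"
    and UN_K: "(\<Union>n. K n) = D"
begin

lemma K_mono: "n \<le> m \<Longrightarrow> K n \<subseteq> K m"
proof -
  assume "n \<le> m"
  moreover have "K n \<le> K (Suc n)" for n using K(2)[of n] interior_subset[of "K (Suc n)"] by blast
  ultimately show ?thesis using lift_Suc_mono_le[of K n m] by blast
qed

lemma K_sub: "K n \<subseteq> D" using UN_K by auto

lemma D_interior: "x \<in> D \<Longrightarrow> \<exists>n. x \<in> interior (K n)"
  using UN_K K(2) by blast

lemma open_D: "open D"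
proof -
  have "D \<subseteq> (\<Union>n. interior (K n))" using D_interior by blast
  moreover have "interior (K n) \<subseteq> D" for n using interior_subset[of "K n"] K_sub[of n] by blast
  ultimately have "D = (\<Union>n. interior (K n))" by blast
  then show ?thesis by auto
qed

lemma D_borel [measurable]: "D \<in> sets borel" using open_D by simp

text \<open>A stopping time that almost surely equals \<open>exit_time\<close> for starting points
  in \<open>D\<close>; all computations are done with it, since \<open>exit_time\<close> is only
  handled up to null sets.\<close>

definition exit_sup :: "'w \<Rightarrow> ennreal" where "exit_sup \<omega> = (SUP n. leave (K n) \<omega>)"

definition survive :: "real \<Rightarrow> 'w set" where "survive t = (\<Union>n. stay (K n) 0 t)"

definition Qkill :: "real \<Rightarrow> ('a \<Rightarrow> ennreal) \<Rightarrow> 'a \<Rightarrow> ennreal" where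
  "Qkill t f x = (\<integral>\<^sup>+\<omega>\<in>survive t. case_option 0 f (X (ennreal t) \<omega>) \<partial>P (Some x))"

lemma exit_sup_stopping: "stopping_time Fl exit_sup"
  unfolding stopping_time_def exit_sup_def SUP_le_iff
  by (auto intro!: pred_intros_countable leave_stopping_time[OF K(1), THEN stopping_timeD])

lemma exit_sup_measurable [measurable]: "exit_sup \<in> borel_measurable (P z)"
  using exit_sup_stopping by (rule stopping_time_measurable_P)

text \<open>Otherwise \<open>X (exit_sup \<omega>) \<omega>\<close> lies in the interior of some
  \<open>K m\<close>. By quasi-left-continuity the states at the times
  \<open>leave (K n) \<omega>\<close> lie there for large \<open>n\<close>, which contradicts
  \<open>X_leave\<close> once \<open>n\<close> is at least \<open>m\<close>.\<close>

lemma AE_exit_sup_notin: "AE \<omega> in P z. X (exit_sup \<omega>) \<omega> \<notin> Some ` D"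
proof -
  have "AE \<omega> in P z. (SUP n. leave (K n) \<omega>) < \<top> \<longrightarrow>
     limitin state_top (\<lambda>n. X (leave (K n) \<omega>) \<omega>) (X (SUP n. leave (K n) \<omega>) \<omega>) sequentially"
    by (rule quasi_left_continuous) (auto intro: leave_stopping_time K intro!: leave_mono K_mono)
  then show ?thesis
    using AE_space
  proof eventually_elim
    case (elim \<omega>)
    then have w: "\<omega> \<in> \<Omega>" by (simp add: space_P)
    show ?case
    proof
      assume a: "X (exit_sup \<omega>) \<omega> \<in> Some ` D"
      then have "exit_sup \<omega> < \<top>" using at_infinity_None[OF w] by (cases "exit_sup \<omega> = \<top>") (auto simp: less_top)
      then have lim: "limitin state_top (\<lambda>n. X (leave (K n) \<omega>) \<omega>) (X (exit_sup \<omega>) \<omega>) sequentially"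
        using elim(1) by (simp add: exit_sup_def)
      from a D_interior obtain m where "X (exit_sup \<omega>) \<omega> \<in> Some ` interior (K m)" by blast
      from limitin_state_open[OF lim this] obtain N where
        N: "\<And>n. n \<ge> N \<Longrightarrow> X (leave (K n) \<omega>) \<omega> \<in> Some ` interior (K m)"
        by (auto simp: eventually_sequentially)
      from N[of "max N m"] have "X (leave (K (max N m)) \<omega>) \<omega> \<in> Some ` interior (K m)" by simp
      moreover have "interior (K m) \<subseteq> interior (K (max N m))" by (intro interior_mono K_mono) simp
      ultimately show False using X_leave[OF w, of "K (max N m)"] by blast
    qed
  qed
qed

text \<open>\<open>exit_time\<close> looks at positive times only, so \<open>exit_sup\<close> must
  be positive to compete in its infimum. It is, since the path starts in the interior of some
  \<open>K n\<close> and is right continuous.\<close>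

lemma AE_exit: 
  assumes x: "x \<in> D"
  shows "AE \<omega> in P (Some x). exit_time X D \<omega> = exit_sup \<omega>"
  using normal[of "Some x"] AE_exit_sup_notin AE_space
proof eventually_elim
  case (elim \<omega>)
  then have w: "\<omega> \<in> \<Omega>" by (simp add: space_P)
  obtain n where n: "x \<in> interior (K n)" using D_interior[OF x] by auto
  have X0: "X 0 \<omega> \<in> Some ` interior (K n)" using elim(1) n by simp
  have "0 < leave (K n) \<omega>"
  proof -
    obtain b where b: "0 < b" "\<And>s. 0 \<le> s \<Longrightarrow> s < b \<Longrightarrow> X s \<omega> \<in> Some ` interior (K n)"
      using eventually_right_open[OF w _ open_interior X0] by auto
    have "b \<le> leave (K n) \<omega>"
      unfolding leave_def using b(2) interior_subset[of "K n"]
      by (intro Inf_greatest) (metis (no_types, lifting) image_mono mem_Collect_eq not_le subsetD zero_le)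
    with b(1) show ?thesis by simp
  qed
  also have "leave (K n) \<omega> \<le> exit_sup \<omega>" unfolding exit_sup_def by (rule SUP_upper) simp
  finally have "0 < exit_sup \<omega>" .
  with elim(2) have 1: "exit_time X D \<omega> \<le> exit_sup \<omega>"
    unfolding exit_time_def by (intro Inf_lower) auto
  have "exit_sup \<omega> \<le> exit_time X D \<omega>"
    unfolding exit_time_def exit_sup_def leave_def
    using K_sub by (intro SUP_least Inf_superset_mono) blast
  with 1 show ?case by simp
qed

text \<open>The inequality is strict: a path that stays in some \<open>K n\<close> up to and
  including time \<open>t\<close> is in \<open>D\<close> at time \<open>t\<close>, whereas at
  \<open>exit_sup\<close> it is almost surely outside.\<close>

lemma AE_survive:
  assumes t: "0 \<le> t"
  shows "AE \<omega> in P z. \<omega> \<in> survive t \<longleftrightarrow> ennreal t < exit_sup \<omega>"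
  using AE_exit_sup_notin AE_space
proof eventually_elim
  case (elim \<omega>)
  then have w: "\<omega> \<in> \<Omega>" by (simp add: space_P)
  show ?case
  proof
    assume "\<omega> \<in> survive t"
    then obtain n where n: "\<And>u. u \<le> ennreal t \<Longrightarrow> X u \<omega> \<in> Some ` K n" by (auto simp: survive_def stay_def)
    have "ennreal t \<le> leave (K n) \<omega>"
      unfolding leave_def by (rule Inf_greatest) (use n in \<open>auto simp: not_le dest: less_imp_le\<close>, meson le_cases n)
    also have "\<dots> \<le> exit_sup \<omega>" unfolding exit_sup_def by (rule SUP_upper) simp
    finally have "ennreal t \<le> exit_sup \<omega>" .
    moreover have "exit_sup \<omega> \<noteq> ennreal t" using n[of "ennreal t"] K_sub[of n] elim(1) by auto
    ultimately show "ennreal t < exit_sup \<omega>" by simp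
  next
    assume "ennreal t < exit_sup \<omega>"
    then obtain n where "ennreal t < leave (K n) \<omega>" by (auto simp: exit_sup_def less_SUP_iff)
    with w t have "\<omega> \<in> stay (K n) 0 t" unfolding stay_def by (auto intro: leave_gt)
    then show "\<omega> \<in> survive t" by (auto simp: survive_def)
  qed
qed

lemma stay_incseq: "incseq (\<lambda>n. stay (K n) s t)"
  unfolding stay_def using K_mono by (auto simp: incseq_def) blast

lemma stay_K_sets [measurable]: "0 < t \<Longrightarrow> stay (K n) 0 t \<in> sets (P z)"
  using stay_sets[OF K(1) order_refl, of t n] sets_Fl_P' by auto

lemma survive_sets [measurable]: "0 < t \<Longrightarrow> survive t \<in> sets (P z)"
  unfolding survive_def by auto

lemma Qstay_incseq: "incseq (\<lambda>n. Qstay (K n) t f x)"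
  unfolding Qstay_def
  by (intro monoI nn_integral_mono mult_left_mono indicator_leI) (use incseqD[OF stay_incseq] in blast, simp)

lemma Qkill_SUP:
  assumes [measurable]: "f \<in> borel_measurable borel" and t: "0 < t"
  shows "Qkill t f x = (SUP n. Qstay (K n) t f x)"
proof -
  have "Qkill t f x = (\<integral>\<^sup>+\<omega>. (SUP n. case_option 0 f (X (ennreal t) \<omega>) * indicator (stay (K n) 0 t) \<omega>) \<partial>P (Some x))"
    unfolding Qkill_def survive_def SUP_mult_indicator_incseq[OF stay_incseq] ..
  also have "\<dots> = (SUP n. Qstay (K n) t f x)"
    unfolding Qstay_def
  proof (rule nn_integral_monotone_convergence_SUP)
    show "incseq (\<lambda>n \<omega>. case_option 0 f (X (ennreal t) \<omega>) * indicator (stay (K n) 0 t) \<omega>)"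
      by (intro monoI le_funI mult_left_mono indicator_leI) (use incseqD[OF stay_incseq] in blast, simp)
  qed (use t in measurable)
  finally show ?thesis .
qed

lemma Qkill_measurable [measurable]:
  assumes "f \<in> borel_measurable borel" "\<And>x. f x \<le> 1" "0 < t"
  shows "Qkill t f \<in> borel_measurable borel"
proof -
  have "Qkill t f = (\<lambda>x. SUP n. Qstay (K n) t f x)" using Qkill_SUP assms by auto
  then show ?thesis using Qstay_measurable[OF K(1) assms] by simp
qed

lemma Qkill_le1: "(\<And>x. f x \<le> 1) \<Longrightarrow> Qkill t f x \<le> 1"
proof -
  assume "\<And>x. f x \<le> 1"
  then have "Qkill t f x \<le> (\<integral>\<^sup>+\<omega>. 1 \<partial>P (Some x))"
    unfolding Qkill_def using case_option_le1[of f]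
    by (intro nn_integral_mono) (auto simp: indicator_def)
  then show ?thesis using prob_space.emeasure_space_1[OF prob_space_P[of "Some x"]] by simp
qed

text \<open>In the semigroup property of \<open>Qstay\<close> both the event and the inner function
  depend on \<open>n\<close>. As both increase and are bounded by 1, the diagonal supremum is the
  product of the two suprema.\<close>

lemma Qkill_semigroup:
  assumes f [measurable]: "f \<in> borel_measurable borel" and f1: "\<And>x. f x \<le> 1" and s: "0 < s" and t: "0 < t"
  shows "Qkill (s + t) f x = Qkill s (Qkill t f) x"
proof -
  have inc: "incseq (\<lambda>n \<omega>. case_option 0 (Qstay (K n) t f) (X (ennreal s) \<omega>) * indicator (stay (K n) 0 s) \<omega>)"
  proof (intro monoI le_funI mult_mono indicator_leI)
    fix m n :: nat and \<omega> assume "m \<le> n"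
    then show "case_option 0 (Qstay (K m) t f) (X (ennreal s) \<omega>) \<le> case_option 0 (Qstay (K n) t f) (X (ennreal s) \<omega>)"
      using incseqD[OF Qstay_incseq] by (auto split: option.split)
  qed (use incseqD[OF stay_incseq] in blast, auto)
  have "Qkill (s + t) f x = (SUP n. Qstay (K n) s (Qstay (K n) t f) x)"
    using Qkill_SUP[OF f, of "s + t"] Qstay_semigroup[OF K(1) f f1 s t] s t by simp
  also have "\<dots> = (\<integral>\<^sup>+\<omega>. (SUP n. case_option 0 (Qstay (K n) t f) (X (ennreal s) \<omega>) * indicator (stay (K n) 0 s) \<omega>) \<partial>P (Some x))"
    unfolding Qstay_def[of _ s]
    by (rule nn_integral_monotone_convergence_SUP[OF inc, symmetric])
       (use Qstay_measurable[OF K(1) f f1 t] s in measurable)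
  also have "\<dots> = Qkill s (Qkill t f) x"
    unfolding Qkill_def[of s]
  proof (rule nn_integral_cong)
    fix \<omega>
    let ?c = "\<lambda>n. case_option 0 (Qstay (K n) t f) (X (ennreal s) \<omega>)"
    have c: "case_option 0 (Qkill t f) (X (ennreal s) \<omega>) = (SUP n. ?c n)"
      by (cases "X (ennreal s) \<omega>") (auto simp: Qkill_SUP[OF f t])
    have ci: "incseq ?c" using Qstay_incseq by (cases "X (ennreal s) \<omega>") (auto simp: incseq_def)
    have ii: "incseq (\<lambda>n. indicator (stay (K n) 0 s) \<omega> :: ennreal)"
      by (intro monoI indicator_leI) (use incseqD[OF stay_incseq] in blast)
    have "(SUP n. ?c n * indicator (stay (K n) 0 s) \<omega>) = (SUP n. ?c n) * (SUP n. indicator (stay (K n) 0 s) \<omega>)"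
    proof (rule LIMSEQ_unique)
      show "(\<lambda>n. ?c n * indicator (stay (K n) 0 s) \<omega>) \<longlonglongrightarrow> (SUP n. ?c n * indicator (stay (K n) 0 s) \<omega>)"
        by (rule LIMSEQ_SUP) (use incseqD[OF ci] incseqD[OF ii] in \<open>auto intro!: monoI mult_mono\<close>)
      have "(SUP n. ?c n) \<le> 1"
        by (intro SUP_least case_option_le1 Qstay_le1 f1)
      then have f: "(SUP n. ?c n) \<noteq> \<top>" by (metis ennreal_one_neq_top top.extremum_unique)
      have "(SUP n. indicator (stay (K n) 0 s) \<omega> :: ennreal) \<le> 1"
        by (intro SUP_least) (auto simp: indicator_def)
      then have "(SUP n. indicator (stay (K n) 0 s) \<omega> :: ennreal) \<noteq> \<top>" by (metis ennreal_one_neq_top top.extremum_unique)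
      with f show "(\<lambda>n. ?c n * indicator (stay (K n) 0 s) \<omega>) \<longlonglongrightarrow> (SUP n. ?c n) * (SUP n. indicator (stay (K n) 0 s) \<omega>)"
        by (intro tendsto_mult_ennreal LIMSEQ_SUP ci ii) auto
    qed
    also have "(SUP n. indicator (stay (K n) 0 s) \<omega> :: ennreal) = indicator (survive s) \<omega>"
      unfolding survive_def using SUP_mult_indicator_incseq[OF stay_incseq, of 1 0 s \<omega>] by simp
    finally show "(SUP n. ?c n * indicator (stay (K n) 0 s) \<omega>) = case_option 0 (Qkill t f) (X (ennreal s) \<omega>) * indicator (survive s) \<omega>"
      unfolding c .
  qed
  finally show ?thesis .
qed

lemma Qkill_sym:
  assumes t: "0 < t"
    and f [measurable]: "f \<in> borel_measurable borel" and g [measurable]: "g \<in> borel_measurable borel"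
    and f1: "\<And>x. f x \<le> 1" and g1: "\<And>x. g x \<le> 1"
  shows "(\<integral>\<^sup>+x. g x * Qkill t f x \<partial>lborel) = (\<integral>\<^sup>+x. f x * Qkill t g x \<partial>lborel)"
proof -
  have *: "(\<integral>\<^sup>+x. g x * Qkill t f x \<partial>lborel) = (SUP n. \<integral>\<^sup>+x. g x * Qstay (K n) t f x \<partial>lborel)"
    if [measurable]: "f \<in> borel_measurable borel" "g \<in> borel_measurable borel"
      and f1: "\<And>x. f x \<le> 1" for f g :: "'a \<Rightarrow> ennreal"
  proof -
    have "(\<integral>\<^sup>+x. g x * Qkill t f x \<partial>lborel) = (\<integral>\<^sup>+x. (SUP n. g x * Qstay (K n) t f x) \<partial>lborel)"
      by (simp add: Qkill_SUP[OF _ t] SUP_mult_left_ennreal)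
    also have "\<dots> = (SUP n. \<integral>\<^sup>+x. g x * Qstay (K n) t f x \<partial>lborel)"
    proof (rule nn_integral_monotone_convergence_SUP)
      show "incseq (\<lambda>n x. g x * Qstay (K n) t f x)"
        by (intro monoI le_funI mult_left_mono) (use incseqD[OF Qstay_incseq] in auto)
    qed (use Qstay_measurable[OF K(1) _ f1 t] in measurable)
    finally show ?thesis .
  qed
  show ?thesis using *[OF f g f1] *[OF g f g1] Qstay_sym[OF sym K(1) t f g f1 g1] by simp
qed

lemma Qkill_outside: "x \<notin> D \<Longrightarrow> Qkill t f x = 0"
proof -
  assume x: "x \<notin> D"
  have "AE \<omega> in P (Some x). case_option 0 f (X (ennreal t) \<omega>) * indicator (survive t) \<omega> = 0"
    using normal[of "Some x"]
  proof eventually_elim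
    case (elim \<omega>)
    have "X 0 \<omega> \<notin> Some ` K n" for n using elim x K_sub[of n] by auto
    then have "\<omega> \<notin> survive t" unfolding survive_def stay_def by (auto intro!: exI[of _ 0])
    then show ?case by simp
  qed
  then have "Qkill t f x = (\<integral>\<^sup>+\<omega>. 0 \<partial>P (Some x))" unfolding Qkill_def by (rule nn_integral_cong_AE)
  then show ?thesis by simp
qed

lemma Qkill_exit_sup: "0 \<le> t \<Longrightarrow> Qkill t f x = (\<integral>\<^sup>+\<omega>. case_option 0 f (X (ennreal t) \<omega>) * of_bool (ennreal t < exit_sup \<omega>) \<partial>P (Some x))"
proof -
  assume "0 \<le> t"
  from AE_survive[OF this, of "Some x"]
  have "AE \<omega> in P (Some x). case_option 0 f (X (ennreal t) \<omega>) * indicator (survive t) \<omega> =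
     case_option 0 f (X (ennreal t) \<omega>) * of_bool (ennreal t < exit_sup \<omega>)"
    by eventually_elim (auto simp: indicator_def)
  then show ?thesis unfolding Qkill_def by (rule nn_integral_cong_AE)
qed

lemma trans_op_dens: "f \<in> borel_measurable borel \<Longrightarrow> 0 < t \<Longrightarrow>
    trans_op (ennreal t) (case_option 0 f) (Some x) = (\<integral>\<^sup>+y. ennreal (p t x y) * f y \<partial>lborel)"
  using dens unfolding transition_density_def trans_op_def by blast

end

lemma ennreal_AM_GM: "2 * (a * b) \<le> a * a + b * (b :: ennreal)"
proof (cases a; cases b)
  fix r s assume "a = ennreal r" "0 \<le> r" "b = ennreal s" "0 \<le> s"
  moreover have "2 * (r * s) \<le> r * r + s * s" using sum_squares_bound[of r s] by (simp add: power2_eq_square mult.assoc)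
  ultimately show ?thesis
    by (simp add: ennreal_mult[symmetric] ennreal_plus[symmetric] ennreal_leI flip: ennreal_numeral del: ennreal_plus)
qed (auto simp: ennreal_mult_top ennreal_top_mult)

section \<open>Absence of atoms of the killing time\<close>

context killed_process begin

text \<open>Compared with \<open>Qkill\<close> in the shape of \<open>Qkill_exit_sup\<close>, this
  also counts the paths with exit time exactly \<open>t\<close>. On \<open>decay\<close> it is the
  limit of \<open>Qkill\<close> from the left in time.\<close>

definition Qleft :: "real \<Rightarrow> ('a \<Rightarrow> ennreal) \<Rightarrow> 'a \<Rightarrow> ennreal" where
  "Qleft t f x = (\<integral>\<^sup>+\<omega>. case_option 0 f (X (ennreal t) \<omega>) * of_bool (ennreal t \<le> exit_sup \<omega>) \<partial>P (Some x))"

lemma prob_P1: "(\<integral>\<^sup>+\<omega>. 1 \<partial>P z) < \<infinity>"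
  using prob_space.emeasure_space_1[OF prob_space_P[of z]] by simp

text \<open>Quasi-left-continuity along deterministic times: a fixed time is almost surely not a
  jump time.\<close>

lemma left_limit_X:
  assumes v: "incseq v" "\<And>n. 0 \<le> v n" "v \<longlonglongrightarrow> t"
  shows "AE \<omega> in P z. limitin state_top (\<lambda>n. X (ennreal (v n)) \<omega>) (X (ennreal t) \<omega>) sequentially"
proof -
  have inc: "incseq (\<lambda>n. ennreal (v n))" using v(1) by (auto simp: incseq_def intro!: ennreal_leI)
  have "(\<lambda>n. ennreal (v n)) \<longlonglongrightarrow> ennreal t" using v(3) by (rule tendsto_ennrealI)
  then have S: "(SUP n. ennreal (v n)) = ennreal t" using LIMSEQ_SUP[OF inc] LIMSEQ_unique by blast
  have "AE \<omega> in P z. (SUP n. ennreal (v n)) < \<top> \<longrightarrow>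
     limitin state_top (\<lambda>n. X (ennreal (v n)) \<omega>) (X (SUP n. ennreal (v n)) \<omega>) sequentially"
    by (rule quasi_left_continuous[of "\<lambda>n _. ennreal (v n)"]) (use inc in \<open>auto simp: incseq_def stopping_time_const\<close>)
  then show ?thesis unfolding S by simp
qed

lemma decay_X_le1: "case_option 0 decay z * of_bool b \<le> (1::ennreal)"
  using decay_le1 by (cases z) auto

lemma Qkill_left:
  assumes v: "incseq v" "\<And>n. 0 \<le> v n" "\<And>n. v n < t" "v \<longlonglongrightarrow> t"
  shows "(\<lambda>n. Qkill (v n) decay x) \<longlonglongrightarrow> Qleft t decay x"
proof -
  have "AE \<omega> in P (Some x). (\<lambda>n. case_option 0 decay (X (ennreal (v n)) \<omega>) * of_bool (ennreal (v n) < exit_sup \<omega>))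
     \<longlonglongrightarrow> case_option 0 decay (X (ennreal t) \<omega>) * of_bool (ennreal t \<le> exit_sup \<omega>)"
    using left_limit_X[OF v(1,2,4), of "Some x"]
  proof eventually_elim
    case (elim \<omega>)
    have lim: "(\<lambda>n. case_option 0 decay (X (ennreal (v n)) \<omega>)) \<longlonglongrightarrow> case_option 0 decay (X (ennreal t) \<omega>)"
      by (rule limitin_state_C0[OF elim decay_cont decay_at_infinity])
    have vt: "ennreal (v n) < ennreal t" for n using v(2,3)[of n] by (simp add: ennreal_less_iff)
    show ?case
    proof (cases "ennreal t \<le> exit_sup \<omega>")
      case True
      then have "ennreal (v n) < exit_sup \<omega>" for n using vt[of n] by (rule less_le_trans[rotated])
      then show ?thesis using True lim by simp
    next
      case False
      have "(\<lambda>n. ennreal (v n)) \<longlonglongrightarrow> ennreal t" using v(4) by (rule tendsto_ennrealI)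
      then have "\<forall>\<^sub>F n in sequentially. exit_sup \<omega> < ennreal (v n)" using False by (intro order_tendstoD(1)) auto
      then have "\<forall>\<^sub>F n in sequentially. case_option 0 decay (X (ennreal (v n)) \<omega>) * of_bool (ennreal (v n) < exit_sup \<omega>) = (0::ennreal)"
        by eventually_elim auto
      then show ?thesis using False by (simp add: tendsto_eventually)
    qed
  qed
  note lim = this
  show ?thesis
    unfolding Qkill_exit_sup[OF v(2)] Qleft_def
  proof (rule nn_integral_dominated_convergence[where w="\<lambda>_. 1"])
    show "AE \<omega> in P (Some x). case_option 0 decay (X (ennreal (v n)) \<omega>) * of_bool (ennreal (v n) < exit_sup \<omega>) \<le> (1::ennreal)" for n
      by (intro AE_I2 decay_X_le1)
    show "(\<integral>\<^sup>+\<omega>. 1 \<partial>P (Some x)) < \<infinity>" by (rule prob_P1)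
  qed (measurable, rule lim)
qed

lemma Qkill_right:
  assumes v: "\<And>n. t < v n" "v \<longlonglongrightarrow> t" and t: "0 \<le> t"
  shows "(\<lambda>n. Qkill (v n) decay x) \<longlonglongrightarrow> Qkill t decay x"
proof -
  have v0: "0 \<le> v n" for n using v(1)[of n] t by simp
  have "AE \<omega> in P (Some x). (\<lambda>n. case_option 0 decay (X (ennreal (v n)) \<omega>) * of_bool (ennreal (v n) < exit_sup \<omega>))
     \<longlonglongrightarrow> case_option 0 decay (X (ennreal t) \<omega>) * of_bool (ennreal t < exit_sup \<omega>)"
    using AE_space
  proof eventually_elim
    case (elim \<omega>)
    then have w: "\<omega> \<in> \<Omega>" by (simp add: space_P)
    have lim: "(\<lambda>n. case_option 0 decay (X (ennreal (v n)) \<omega>)) \<longlonglongrightarrow> case_option 0 decay (X (ennreal t) \<omega>)"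
      by (rule limitin_state_C0[OF filterlim_X_right[OF w t v] decay_cont decay_at_infinity])
    have vt: "ennreal t < ennreal (v n)" for n using v(1)[of n] t by (simp add: ennreal_less_iff)
    show ?case
    proof (cases "ennreal t < exit_sup \<omega>")
      case False
      then have "\<not> ennreal (v n) < exit_sup \<omega>" for n using vt[of n] by auto
      then show ?thesis using False by simp
    next
      case True
      have "(\<lambda>n. ennreal (v n)) \<longlonglongrightarrow> ennreal t" using v(2) by (rule tendsto_ennrealI)
      then have "\<forall>\<^sub>F n in sequentially. ennreal (v n) < exit_sup \<omega>" using True by (intro order_tendstoD(2)) auto
      then have "\<forall>\<^sub>F n in sequentially. case_option 0 decay (X (ennreal (v n)) \<omega>) =
         case_option 0 decay (X (ennreal (v n)) \<omega>) * (of_bool (ennreal (v n) < exit_sup \<omega>) :: ennreal)"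
        by eventually_elim auto
      then show ?thesis using True lim by (simp add: Lim_transform_eventually)
    qed
  qed
  note lim = this
  show ?thesis
    unfolding Qkill_exit_sup[OF v0] Qkill_exit_sup[OF t]
  proof (rule nn_integral_dominated_convergence[where w="\<lambda>_. 1"])
    show "AE \<omega> in P (Some x). case_option 0 decay (X (ennreal (v n)) \<omega>) * of_bool (ennreal (v n) < exit_sup \<omega>) \<le> (1::ennreal)" for n
      by (intro AE_I2 decay_X_le1)
    show "(\<integral>\<^sup>+\<omega>. 1 \<partial>P (Some x)) < \<infinity>" by (rule prob_P1)
  qed (measurable, rule lim)
qed

text \<open>By symmetry \<open>decay_form\<close> is midpoint convex. Its left and right limits at \<open>t\<close> must then agree, and they differ
  by the part of the law at time \<open>t\<close> that lives on \<open>exit_sup = t\<close>; so the killing time has no atoms and the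
  values of \<open>p\<close> at time \<open>0\<close>, which are arbitrary, do not matter.\<close>

definition decay_form :: "real \<Rightarrow> ennreal" where "decay_form t = (\<integral>\<^sup>+x. decay x * Qkill t decay x \<partial>lborel)"

lemma Qkill_decay_measurable [measurable]: "0 < t \<Longrightarrow> Qkill t decay \<in> borel_measurable borel"
  by (rule Qkill_measurable) (auto simp: decay_le1)

lemma Qkill_decay_le1: "Qkill t decay x \<le> 1"
  by (rule Qkill_le1) (rule decay_le1)

text \<open>By the semigroup property and symmetry, \<open>decay_form (s + t)\<close> is the inner
  product of \<open>Qkill s decay\<close> and \<open>Qkill t decay\<close>, to which 2ab \<le> a^2 +
  b^2 applies.\<close>

lemma decay_form_midpoint:
  assumes s: "0 < s" and t: "0 < t" shows "2 * decay_form (s + t) \<le> decay_form (2 * s) + decay_form (2 * t)"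
proof -
  have *: "decay_form (s + t) = (\<integral>\<^sup>+x. Qkill s decay x * Qkill t decay x \<partial>lborel)" if s: "0 < s" and t: "0 < t" for s t
  proof -
    have "decay_form (s + t) = (\<integral>\<^sup>+x. decay x * Qkill s (Qkill t decay) x \<partial>lborel)"
      unfolding decay_form_def using Qkill_semigroup[OF decay_measurable decay_le1 s t] by simp
    also have "\<dots> = (\<integral>\<^sup>+x. Qkill t decay x * Qkill s decay x \<partial>lborel)"
      by (rule Qkill_sym) (use s t in \<open>auto intro: Qkill_le1 decay_le1\<close>)
    finally show ?thesis by (simp add: mult.commute)
  qed
  have "2 * decay_form (s + t) = (\<integral>\<^sup>+x. 2 * (Qkill s decay x * Qkill t decay x) \<partial>lborel)"
    unfolding *[OF s t] using s t by (subst nn_integral_cmult) auto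
  also have "\<dots> \<le> (\<integral>\<^sup>+x. Qkill s decay x * Qkill s decay x + Qkill t decay x * Qkill t decay x \<partial>lborel)"
    by (intro nn_integral_mono ennreal_AM_GM)
  also have "\<dots> = decay_form (2 * s) + decay_form (2 * t)"
    unfolding mult_2 *[OF s s] *[OF t t] using s t by (intro nn_integral_add) auto
  finally show ?thesis .
qed

lemma Qleft_measurable [measurable]:
  assumes t: "0 < t" shows "Qleft t decay \<in> borel_measurable borel"
proof -
  define v where "v n = t - t / (real n + 2)" for n :: nat
  have v: "incseq v" "\<And>n. 0 < v n" "\<And>n. v n < t" "v \<longlonglongrightarrow> t"
  proof -
    show "incseq v" unfolding v_def using t by (intro monoI diff_left_mono divide_left_mono) auto
    show "0 < v n" for n unfolding v_def using t by (simp add: divide_less_eq)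
    show "v n < t" for n unfolding v_def using t by simp
    show "v \<longlonglongrightarrow> t" unfolding v_def by real_asymp
  qed
  have "Qleft t decay = (\<lambda>x. liminf (\<lambda>n. Qkill (v n) decay x))"
    using lim_imp_Liminf[OF _ Qkill_left[OF v(1) less_imp_le[OF v(2)] v(3,4)]] by auto
  then show ?thesis using v(2) by simp
qed

lemma Qkill_eq_Qleft_AE:
  assumes t: "0 < t" shows "AE x in lborel. Qkill t decay x = Qleft t decay x"
proof -
  define c where "c n = t / (4 * (real n + 2))" for n :: nat
  have c8: "c n \<le> t / 8" for n unfolding c_def using t by (intro divide_left_mono) auto
  have c: "0 < c n" "3 * c n < t" for n
    using t c8[of n] by (auto simp: c_def)
  have cd: "decseq c" unfolding c_def using t by (intro antimonoI divide_left_mono) auto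
  have cl: "c \<longlonglongrightarrow> 0" unfolding c_def by real_asymp
  have L: "(\<lambda>n. decay_form (v n)) \<longlonglongrightarrow> (\<integral>\<^sup>+x. decay x * H x \<partial>lborel)"
    if v: "\<And>n. 0 < v n" and H: "\<And>x. (\<lambda>n. Qkill (v n) decay x) \<longlonglongrightarrow> H x"
      and [measurable]: "H \<in> borel_measurable borel" for v H
    unfolding decay_form_def
  proof (rule nn_integral_dominated_convergence[where w=decay])
    show "AE x in lborel. decay x * Qkill (v n) decay x \<le> decay x" for n
      using mult_left_mono[OF Qkill_decay_le1, of "decay _"] by auto
    have "decay x < \<top>" for x :: 'a by (rule le_less_trans[OF decay_le1]) simp
    then show "AE x in lborel. (\<lambda>n. decay x * Qkill (v n) decay x) \<longlonglongrightarrow> decay x * H x"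
      using H by (intro AE_I2 ennreal_tendsto_cmult) auto
    show "(\<integral>\<^sup>+x. decay x \<partial>(lborel::'a measure)) < \<infinity>" using decay_integral by simp
    show "(\<lambda>x. decay x * Qkill (v n) decay x) \<in> borel_measurable lborel" for n using v[of n] by measurable
  qed measurable
  have [measurable]: "Qleft t decay \<in> borel_measurable borel" "Qkill t decay \<in> borel_measurable borel"
    using Qleft_measurable[OF t] t by auto
  let ?L = "\<integral>\<^sup>+x. decay x * Qleft t decay x \<partial>lborel"
  have 1: "(\<lambda>n. decay_form (t - c n)) \<longlonglongrightarrow> ?L"
  proof (rule L)
    show "0 < t - c n" for n using c[of n] by simp
    show "(\<lambda>n. Qkill (t - c n) decay x) \<longlonglongrightarrow> Qleft t decay x" for x
    proof (rule Qkill_left)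
      show "incseq (\<lambda>n. t - c n)" using cd by (auto simp: incseq_def decseq_def)
      show "0 \<le> t - c n" "t - c n < t" for n using c[of n] by auto
      show "(\<lambda>n. t - c n) \<longlonglongrightarrow> t" using tendsto_diff[OF tendsto_const cl, of t] by simp
    qed
  qed measurable
  have 2: "(\<lambda>n. decay_form (t - 3 * c n)) \<longlonglongrightarrow> ?L"
  proof (rule L)
    show "0 < t - 3 * c n" for n using c[of n] by simp
    show "(\<lambda>n. Qkill (t - 3 * c n) decay x) \<longlonglongrightarrow> Qleft t decay x" for x
    proof (rule Qkill_left)
      show "incseq (\<lambda>n. t - 3 * c n)" using cd by (auto simp: incseq_def decseq_def)
      show "0 \<le> t - 3 * c n" "t - 3 * c n < t" for n using c[of n] by auto
      show "(\<lambda>n. t - 3 * c n) \<longlonglongrightarrow> t"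
        using tendsto_diff[OF tendsto_const tendsto_mult[OF tendsto_const cl], of t 3] by simp
    qed
  qed measurable
  have 3: "(\<lambda>n. decay_form (t + c n)) \<longlonglongrightarrow> decay_form t"
    unfolding decay_form_def[of t]
  proof (rule L)
    show "0 < t + c n" for n using c(1)[of n] t by simp
    show "(\<lambda>n. Qkill (t + c n) decay x) \<longlonglongrightarrow> Qkill t decay x" for x
    proof (rule Qkill_right)
      show "t < t + c n" for n using c[of n] by auto
      show "(\<lambda>n. t + c n) \<longlonglongrightarrow> t" using tendsto_add[OF tendsto_const cl, of t] by simp
    qed (use t in simp)
  qed measurable
  have fin: "?L < \<top>"
  proof -
    have "Qleft t decay x \<le> 1" for x
    proof -
      have "Qleft t decay x \<le> (\<integral>\<^sup>+\<omega>. 1 \<partial>P (Some x))"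
        unfolding Qleft_def by (intro nn_integral_mono decay_X_le1)
      then show ?thesis using prob_space.emeasure_space_1[OF prob_space_P[of "Some x"]] by simp
    qed
    then have "?L \<le> (\<integral>\<^sup>+x. decay x \<partial>(lborel::'a measure))"
      using mult_left_mono[of _ 1 "decay _"] by (intro nn_integral_mono) auto
    then show ?thesis using decay_integral le_less_trans by blast
  qed
  have le: "Qkill t decay x \<le> Qleft t decay x" for x
    using t unfolding Qkill_exit_sup[OF less_imp_le[OF t]] Qleft_def
    by (intro nn_integral_mono mult_left_mono) auto
  have FL: "decay_form t \<le> ?L" unfolding decay_form_def using le by (intro nn_integral_mono mult_left_mono) auto
  \<comment> \<open>\<open>t - c n\<close> is the midpoint of \<open>t - 3 * c n\<close> and
    \<open>t + c n\<close>: two of these three points approach \<open>t\<close> from the left and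
    one from the right, so the limit of midpoint convexity compares the left limit \<open>?L\<close>
    with \<open>decay_form t\<close>.\<close>
  have "2 * ?L \<le> ?L + decay_form t"
  proof (rule LIMSEQ_le)
    show "(\<lambda>n. 2 * decay_form (t - c n)) \<longlonglongrightarrow> 2 * ?L" by (intro ennreal_tendsto_cmult 1) simp
    show "(\<lambda>n. decay_form (t - 3 * c n) + decay_form (t + c n)) \<longlonglongrightarrow> ?L + decay_form t" by (intro tendsto_add 2 3)
    have "2 * decay_form (t - c n) \<le> decay_form (t - 3 * c n) + decay_form (t + c n)" for n
    proof -
      have e: "(t - 3 * c n) / 2 + (t + c n) / 2 = t - c n" "2 * ((t - 3 * c n) / 2) = t - 3 * c n" "2 * ((t + c n) / 2) = t + c n"
        by (auto simp: field_simps)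
      show ?thesis using decay_form_midpoint[of "(t - 3 * c n) / 2" "(t + c n) / 2", unfolded e] c[of n] t by simp
    qed
    then show "\<exists>N. \<forall>n\<ge>N. 2 * decay_form (t - c n) \<le> decay_form (t - 3 * c n) + decay_form (t + c n)" by blast
  qed
  then have LF: "?L \<le> decay_form t" using fin by (auto simp: mult_2 ennreal_add_left_cancel_le)
  have "(\<integral>\<^sup>+x. decay x * Qleft t decay x - decay x * Qkill t decay x \<partial>lborel) = ?L - decay_form t"
    unfolding decay_form_def
  proof (rule nn_integral_diff)
    show "AE x in lborel. decay x * Qkill t decay x \<le> decay x * Qleft t decay x"
      using le by (intro AE_I2 mult_left_mono) auto
    show "(\<integral>\<^sup>+x. decay x * Qkill t decay x \<partial>lborel) \<noteq> \<infinity>"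
      using FL fin unfolding decay_form_def by auto
  qed measurable
  also have "\<dots> = 0" using LF fin by (intro diff_eq_0_ennreal)
  finally have "AE x in lborel. decay x * Qleft t decay x - decay x * Qkill t decay x = 0"
    by (subst (asm) nn_integral_0_iff_AE) auto
  then show ?thesis
  proof eventually_elim
    case (elim x)
    have f: "decay x < \<top>" by (rule le_less_trans[OF decay_le1]) simp
    have q: "Qkill t decay x < \<top>" by (rule le_less_trans[OF Qkill_decay_le1]) simp
    have "decay x * Qleft t decay x \<le> decay x * Qkill t decay x"
      using elim f q by (simp add: ennreal_minus_eq_0 diff_eq_0_iff_ennreal ennreal_mult_less_top)
    then have "Qleft t decay x \<le> Qkill t decay x"
      using decay_pos[of x] f by (simp add: ennreal_mult_le_mult_iff less_imp_neq[symmetric] less_top)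
    with le[of x] show ?case by simp
  qed
qed

lemma AE_X_null:
  assumes t: "0 < t" and N: "AE y in lborel. Q y"
  shows "AE \<omega> in P (Some x). \<forall>y. X (ennreal t) \<omega> = Some y \<longrightarrow> Q y"
proof -
  from N obtain M where M: "{y. \<not> Q y} \<subseteq> M" "M \<in> sets borel" "emeasure lborel M = 0"
    by (auto elim!: AE_E)
  have "(\<integral>\<^sup>+\<omega>. case_option 0 (indicator M) (X (ennreal t) \<omega>) \<partial>P (Some x)) = (\<integral>\<^sup>+y. ennreal (p t x y) * indicator M y \<partial>lborel)"
    using trans_op_dens[of "indicator M" t x] M(2) t by (simp add: trans_op_def)
  also have "\<dots> = (\<integral>\<^sup>+y. 0 \<partial>(lborel::'a measure))"
  proof (rule nn_integral_cong_AE)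
    have "AE y in lborel. y \<notin> M" by (rule AE_not_in) (use M in \<open>auto simp: null_sets_def\<close>)
    then show "AE y in lborel. ennreal (p t x y) * indicator M y = 0" by eventually_elim auto
  qed
  also have "\<dots> = 0" by simp
  finally have "AE \<omega> in P (Some x). case_option 0 (indicator M) (X (ennreal t) \<omega>) = (0::ennreal)"
    using M(2) by (subst (asm) nn_integral_0_iff_AE) auto
  then show ?thesis by eventually_elim (use M(1) in \<open>auto simp: indicator_eq_0_iff\<close>)
qed

text \<open>To pass from almost every to every starting point, the process first runs for time
  \<open>t / 2\<close>. Its law then has a density, so the exceptional null set is not charged by
  \<open>AE_X_null\<close>.\<close>

lemma Qkill_eq_Qleft:
  assumes t: "0 < t" shows "Qkill t decay x = Qleft t decay x"
proof -
  define c where "c n = t / (4 * (real n + 2))" for n :: nat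
  have c8: "c n \<le> t / 8" for n unfolding c_def using t by (intro divide_left_mono) auto
  have c: "0 < c n" "3 * c n < t" for n
    using t c8[of n] by (auto simp: c_def)
  have c2: "c n < t / 2" for n using t c8[of n] by auto
  have cd: "decseq c" unfolding c_def using t by (intro antimonoI divide_left_mono) auto
  have cl: "c \<longlonglongrightarrow> 0" unfolding c_def by real_asymp
  have lim: "(\<lambda>n. Qkill (u - c n) decay y) \<longlonglongrightarrow> Qleft u decay y" if u: "t / 2 \<le> u" for u y
  proof (rule Qkill_left)
    show "incseq (\<lambda>n. u - c n)" using cd by (auto simp: incseq_def decseq_def)
    show "0 \<le> u - c n" "u - c n < u" for n using c[of n] c2[of n] u by auto
    show "(\<lambda>n. u - c n) \<longlonglongrightarrow> u" using tendsto_diff[OF tendsto_const cl, of u] by simp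
  qed
  have "(\<lambda>n. Qkill (t / 2) (Qkill (t / 2 - c n) decay) x) \<longlonglongrightarrow> Qkill (t / 2) (Qkill (t / 2) decay) x"
    unfolding Qkill_def[of "t / 2" _ x]
  proof (rule nn_integral_dominated_convergence[where w="\<lambda>_. 1"])
    have [measurable]: "survive (t / 2) \<in> sets (P (Some x))" "Qkill (t / 2) decay \<in> borel_measurable borel" using t by auto
    have m: "Qkill (t / 2 - c n) decay \<in> borel_measurable borel" for n using c2[of n] by auto
    show "(\<lambda>\<omega>. case_option 0 (Qkill (t / 2 - c n) decay) (X (ennreal (t / 2)) \<omega>) * indicator (survive (t / 2)) \<omega>)
      \<in> borel_measurable (P (Some x))" for n using m[of n] by measurable
    show "(\<lambda>\<omega>. case_option 0 (Qkill (t / 2) decay) (X (ennreal (t / 2)) \<omega>) * indicator (survive (t / 2)) \<omega>)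
      \<in> borel_measurable (P (Some x))" by measurable
    show "AE \<omega> in P (Some x). case_option 0 (Qkill (t / 2 - c n) decay) (X (ennreal (t / 2)) \<omega>) * indicator (survive (t / 2)) \<omega> \<le> (1::ennreal)" for n
      using Qkill_decay_le1 by (intro AE_I2) (auto simp: indicator_def split: option.split)
    show "(\<integral>\<^sup>+\<omega>. 1 \<partial>P (Some x)) < \<infinity>" by (rule prob_P1)
    have "AE y in lborel. Qkill (t / 2) decay y = Qleft (t / 2) decay y" using t by (intro Qkill_eq_Qleft_AE) simp
    then have "AE y in lborel. (\<lambda>n. Qkill (t / 2 - c n) decay y) \<longlonglongrightarrow> Qkill (t / 2) decay y"
      by eventually_elim (use lim[of "t / 2"] in simp)
    from AE_X_null[OF _ this, of "t / 2" x] t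
    have "AE \<omega> in P (Some x). \<forall>y. X (ennreal (t / 2)) \<omega> = Some y \<longrightarrow> (\<lambda>n. Qkill (t / 2 - c n) decay y) \<longlonglongrightarrow> Qkill (t / 2) decay y"
      by simp
    then show "AE \<omega> in P (Some x). (\<lambda>n. case_option 0 (Qkill (t / 2 - c n) decay) (X (ennreal (t / 2)) \<omega>) * indicator (survive (t / 2)) \<omega>)
       \<longlonglongrightarrow> case_option 0 (Qkill (t / 2) decay) (X (ennreal (t / 2)) \<omega>) * indicator (survive (t / 2)) \<omega>"
    proof eventually_elim
      case (elim \<omega>)
      then show ?case by (cases "X (ennreal (t / 2)) \<omega>") (auto simp: indicator_def)
    qed
  qed simp
  moreover have "Qkill (t / 2) (Qkill (t / 2 - c n) decay) x = Qkill (t - c n) decay x" for n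
  proof -
    have "t / 2 + (t / 2 - c n) = t - c n" by linarith
    then show ?thesis
      using Qkill_semigroup[OF decay_measurable decay_le1, of "t / 2" "t / 2 - c n" x] c2[of n] t by simp
  qed
  moreover have "Qkill (t / 2) (Qkill (t / 2) decay) x = Qkill t decay x"
    using Qkill_semigroup[OF decay_measurable decay_le1, of "t / 2" "t / 2" x] t by simp
  ultimately have "(\<lambda>n. Qkill (t - c n) decay x) \<longlonglongrightarrow> Qkill t decay x" by simp
  moreover have "(\<lambda>n. Qkill (t - c n) decay x) \<longlonglongrightarrow> Qleft t decay x" by (rule lim) (use t in simp)
  ultimately show ?thesis by (rule LIMSEQ_unique)
qed

text \<open>\<open>Qleft\<close> and \<open>Qkill\<close> differ by the integral of
  \<open>decay\<close> over the event \<open>exit_sup = t\<close>. As \<open>decay\<close> is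
  strictly positive on the Euclidean space and extended by 0, only paths that are in the cemetery at
  time \<open>t\<close> can remain.\<close>

lemma no_atom:
  assumes t: "0 < t" shows "AE \<omega> in P (Some x). exit_sup \<omega> = ennreal t \<longrightarrow> X (ennreal t) \<omega> = None"
proof -
  let ?f = "\<lambda>\<omega>. case_option 0 decay (X (ennreal t) \<omega>) :: ennreal"
  have fin: "Qkill t decay x \<noteq> \<infinity>" using Qkill_decay_le1[of t x] by (auto simp: top_unique)
  have "(\<integral>\<^sup>+\<omega>. ?f \<omega> * of_bool (ennreal t \<le> exit_sup \<omega>) - ?f \<omega> * of_bool (ennreal t < exit_sup \<omega>) \<partial>P (Some x)) = Qleft t decay x - Qkill t decay x"
    unfolding Qleft_def Qkill_exit_sup[OF less_imp_le[OF t]]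
  proof (rule nn_integral_diff)
    show "(\<integral>\<^sup>+\<omega>. ?f \<omega> * of_bool (ennreal t < exit_sup \<omega>) \<partial>P (Some x)) \<noteq> \<infinity>"
      using fin unfolding Qkill_exit_sup[OF less_imp_le[OF t]] .
    show "AE \<omega> in P (Some x). ?f \<omega> * of_bool (ennreal t < exit_sup \<omega>) \<le> ?f \<omega> * of_bool (ennreal t \<le> exit_sup \<omega>)"
      by (intro AE_I2 mult_left_mono) auto
  qed measurable
  also have "\<dots> = 0" using Qkill_eq_Qleft[OF t, of x] fin by simp
  finally have "AE \<omega> in P (Some x). ?f \<omega> * of_bool (ennreal t \<le> exit_sup \<omega>) - ?f \<omega> * of_bool (ennreal t < exit_sup \<omega>) = 0"
    by (subst (asm) nn_integral_0_iff_AE) auto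
  then show ?thesis
  proof eventually_elim
    case (elim \<omega>)
    show ?case
    proof (intro impI, rule ccontr)
      assume *: "exit_sup \<omega> = ennreal t" "X (ennreal t) \<omega> \<noteq> None"
      then obtain y where "X (ennreal t) \<omega> = Some y" by auto
      with elim * decay_pos[of y] show False by auto
    qed
  qed
qed

end

lemma suminf_of_bool_single: "(\<Sum>j. v j * of_bool (j = m)) = (v m :: ennreal)"
proof -
  have "(\<lambda>j. if j = m then v j else 0) sums v m" by (rule sums_single)
  moreover have "(\<lambda>j. if j = m then v j else 0) = (\<lambda>j. v j * of_bool (j = m))" by auto
  ultimately show ?thesis by (simp add: sums_iff)
qed

section \<open>Hunt's formula for the law after the exit\<close>

context killed_process begin

text \<open>Joint measurability of \<open>p\<close> is given for positive times; the extension by 0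
  makes compositions with random times measurable.\<close>

definition p_pos :: "real \<times> 'a \<times> 'a \<Rightarrow> ennreal" where
  "p_pos = (\<lambda>(s, x, y). if 0 < s then ennreal (p s x y) else 0)"

lemma p_pos_measurable [measurable]: "p_pos \<in> borel_measurable borel"
proof -
  let ?S = "{0<..} \<times> UNIV \<times> UNIV :: (real \<times> 'a \<times> 'a) set"
  have S: "?S \<in> sets borel" by (intro borel_open open_Times) auto
  have "(\<lambda>(t, x, y). p t x y) \<in> borel_measurable (restrict_space borel ?S)"
    using dens by (simp add: transition_density_def)
  then have "(\<lambda>z. ennreal ((\<lambda>(t, x, y). p t x y) z)) \<in> borel_measurable (restrict_space borel ?S)"
    by measurable
  then have "(\<lambda>z. ennreal ((\<lambda>(t, x, y). p t x y) z) * indicator ?S z) \<in> borel_measurable borel"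
    using S by (subst (asm) borel_measurable_restrict_space_iff_ennreal) auto
  moreover have "(\<lambda>z. ennreal ((\<lambda>(t, x, y). p t x y) z) * indicator ?S z) = p_pos"
    by (auto simp: p_pos_def indicator_def)
  ultimately show ?thesis by simp
qed

lemma measurable_state_None [measurable]: "Measurable.pred state_space (\<lambda>z::'a option. z = None)"
  unfolding pred_def by (simp add: sets_state_space vimage_def)

text \<open>The integrand subtracted in \<open>dirichlet_heat_kernel\<close>, with
  \<open>exit_sup\<close> in place of \<open>exit_time\<close> and a strict inequality, so that
  \<open>p\<close> is only evaluated at positive times.\<close>

definition exit_density :: "real \<Rightarrow> 'w \<Rightarrow> 'a \<Rightarrow> ennreal" where
  "exit_density t \<omega> y = (if exit_sup \<omega> < ennreal t
     then case_option 0 (\<lambda>z. ennreal (p (t - enn2real (exit_sup \<omega>)) z y)) (X (exit_sup \<omega>) \<omega>) else 0)"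

lemma exit_sup_real: "exit_sup \<omega> < ennreal t \<Longrightarrow> \<exists>r\<ge>0. exit_sup \<omega> = ennreal r \<and> r < t"
  by (cases "exit_sup \<omega>") (auto simp: ennreal_less_iff)

lemma exit_density_eq: "exit_density t \<omega> y =
    p_pos (t - enn2real (exit_sup \<omega>), case_option 0 id (X (exit_sup \<omega>) \<omega>), y) * of_bool (exit_sup \<omega> < ennreal t) * of_bool (X (exit_sup \<omega>) \<omega> \<noteq> None)"
  using exit_sup_real[of \<omega> t] by (auto simp: exit_density_def p_pos_def split: option.split)

lemma exit_density_measurable [measurable]:
  "(\<lambda>(\<omega>, y). exit_density t \<omega> y) \<in> borel_measurable (P z \<Otimes>\<^sub>M borel)"
proof -
  have XS: "(\<lambda>\<omega>. X (exit_sup \<omega>) \<omega>) \<in> measurable (P z) state_space" by measurable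
  have [measurable]: "(\<lambda>x :: 'w \<times> 'a. X (exit_sup (fst x)) (fst x)) \<in> measurable (P z \<Otimes>\<^sub>M borel) state_space"
    using measurable_compose[OF measurable_fst XS] .
  have [measurable]: "(snd :: 'w \<times> 'a \<Rightarrow> 'a) \<in> borel_measurable (P z \<Otimes>\<^sub>M borel)" by (rule measurable_snd)
  have "(\<lambda>x :: 'w \<times> 'a. (t - enn2real (exit_sup (fst x)), case_option 0 id (X (exit_sup (fst x)) (fst x)), snd x)) \<in> (P z \<Otimes>\<^sub>M borel) \<rightarrow>\<^sub>M borel \<Otimes>\<^sub>M (borel \<Otimes>\<^sub>M borel)"
    by measurable
  then have [measurable]: "(\<lambda>x :: 'w \<times> 'a. (t - enn2real (exit_sup (fst x)), case_option 0 id (X (exit_sup (fst x)) (fst x)), snd x)) \<in> borel_measurable (P z \<Otimes>\<^sub>M borel)"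
    unfolding borel_prod .
  show ?thesis unfolding exit_density_eq split_beta' by measurable
qed

lemma trans_op_exit_density:
  assumes "f \<in> borel_measurable borel" "exit_sup \<omega> < ennreal t"
  shows "trans_op (ennreal t - exit_sup \<omega>) (case_option 0 f) (X (exit_sup \<omega>) \<omega>) = (\<integral>\<^sup>+y. exit_density t \<omega> y * f y \<partial>lborel)"
proof -
  obtain r where r: "0 \<le> r" "exit_sup \<omega> = ennreal r" "r < t" using exit_sup_real[OF assms(2)] by auto
  then show ?thesis using assms trans_op_dens[OF assms(1), of "t - r"]
    by (cases "X (exit_sup \<omega>) \<omega>") (auto simp: trans_op_None exit_density_def ennreal_minus)
qed

text \<open>The remaining time \<open>t - exit_sup\<close> is approximated from above by countably valued times; on each level set the strong
  Markov property with a deterministic time applies, and right continuity of the paths gives the limit.\<close>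

lemma Hunt_formula_C0:
  assumes f: "continuous_on UNIV f" "(f \<longlongrightarrow> 0) at_infinity" "\<And>x. f x \<le> 1" and t: "0 < t"
  shows "(\<integral>\<^sup>+\<omega>. case_option 0 f (X (ennreal t) \<omega>) * of_bool (exit_sup \<omega> < ennreal t) \<partial>P z) =
    (\<integral>\<^sup>+\<omega>. (\<integral>\<^sup>+y. exit_density t \<omega> y * f y \<partial>lborel) \<partial>P z)"
proof -
  have [measurable]: "f \<in> borel_measurable borel" using f(1) by (rule borel_measurable_continuous_onI)
  let ?h = "case_option 0 f :: 'a option \<Rightarrow> ennreal"
  have h1: "?h y * of_bool b \<le> 1" for y b using f(3) by (cases y) auto
  define d where "d n \<omega> = disc n (t - enn2real (exit_sup \<omega>))" for n \<omega>
  have [measurable]: "d n \<in> measurable (P z) (count_space UNIV)" for n unfolding d_def disc_def by measurable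
  let ?A = "\<lambda>n j. {\<omega>\<in>\<Omega>. exit_sup \<omega> < ennreal t \<and> d n \<omega> = j}"
  \<comment> \<open>The level \<open>d n\<close> is a function of \<open>exit_sup\<close> alone, so
    each level set is decided at time \<open>exit_sup\<close> and may serve as the event in the
    strong Markov property.\<close>
  have A: "?A n j \<in> sets (pre_sigma exit_sup)" for n j
  proof -
    note [measurable] = measurable_stopping_time_pre_sigma[OF exit_sup_stopping]
    have [measurable]: "d n \<in> measurable (pre_sigma exit_sup) (count_space UNIV)" unfolding d_def disc_def by measurable
    have "{\<omega>\<in>space (pre_sigma exit_sup). exit_sup \<omega> < ennreal t \<and> d n \<omega> = j} \<in> sets (pre_sigma exit_sup)" by measurable
    then show ?thesis by (simp add: space_pre_sigma)
  qed
  have [measurable]: "?A n j \<in> sets (P z)" for n j using sets_pre_sigma_P[OF exit_sup_stopping A] .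
  have step: "(\<integral>\<^sup>+\<omega>. ?h (X (exit_sup \<omega> + ennreal (disc_time n (d n \<omega>))) \<omega>) * of_bool (exit_sup \<omega> < ennreal t) \<partial>P z) =
    (\<integral>\<^sup>+\<omega>. trans_op (ennreal (disc_time n (d n \<omega>))) ?h (X (exit_sup \<omega>) \<omega>) * of_bool (exit_sup \<omega> < ennreal t) \<partial>P z)" for n
  proof -
    have "(\<integral>\<^sup>+\<omega>. ?h (X (exit_sup \<omega> + ennreal (disc_time n (d n \<omega>))) \<omega>) * of_bool (exit_sup \<omega> < ennreal t) \<partial>P z) =
      (\<integral>\<^sup>+\<omega>. (\<Sum>j. ?h (X (exit_sup \<omega> + ennreal (disc_time n j)) \<omega>) * indicator (?A n j) \<omega>) \<partial>P z)"
    proof (rule nn_integral_cong)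
      fix \<omega> assume "\<omega> \<in> space (P z)"
      then have "indicator (?A n j) \<omega> = (of_bool (exit_sup \<omega> < ennreal t) * of_bool (j = d n \<omega>) :: ennreal)" for j
        by (auto simp: space_P indicator_def)
      then show "?h (X (exit_sup \<omega> + ennreal (disc_time n (d n \<omega>))) \<omega>) * of_bool (exit_sup \<omega> < ennreal t) =
        (\<Sum>j. ?h (X (exit_sup \<omega> + ennreal (disc_time n j)) \<omega>) * indicator (?A n j) \<omega>)"
        unfolding mult.assoc[symmetric]
        using suminf_of_bool_single[of "\<lambda>j. ?h (X (exit_sup \<omega> + ennreal (disc_time n j)) \<omega>) * of_bool (exit_sup \<omega> < ennreal t)" "d n \<omega>"]
        by (simp only: mult.assoc)
    qed
    also have "\<dots> = (\<Sum>j. \<integral>\<^sup>+\<omega>\<in>?A n j. ?h (X (exit_sup \<omega> + ennreal (disc_time n j)) \<omega>) \<partial>P z)"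
      by (rule nn_integral_suminf) measurable
    also have "\<dots> = (\<Sum>j. \<integral>\<^sup>+\<omega>\<in>?A n j. trans_op (ennreal (disc_time n j)) ?h (X (exit_sup \<omega>) \<omega>) \<partial>P z)"
      by (subst strong_Markov_fun[OF _ exit_sup_stopping A]) auto
    also have "\<dots> = (\<integral>\<^sup>+\<omega>. (\<Sum>j. trans_op (ennreal (disc_time n j)) ?h (X (exit_sup \<omega>) \<omega>) * indicator (?A n j) \<omega>) \<partial>P z)"
      by (rule nn_integral_suminf[symmetric]) measurable
    also have "\<dots> = (\<integral>\<^sup>+\<omega>. trans_op (ennreal (disc_time n (d n \<omega>))) ?h (X (exit_sup \<omega>) \<omega>) * of_bool (exit_sup \<omega> < ennreal t) \<partial>P z)"
    proof (rule nn_integral_cong)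
      fix \<omega> assume "\<omega> \<in> space (P z)"
      then have "indicator (?A n j) \<omega> = (of_bool (exit_sup \<omega> < ennreal t) * of_bool (j = d n \<omega>) :: ennreal)" for j
        by (auto simp: space_P indicator_def)
      then show "(\<Sum>j. trans_op (ennreal (disc_time n j)) ?h (X (exit_sup \<omega>) \<omega>) * indicator (?A n j) \<omega>) =
        trans_op (ennreal (disc_time n (d n \<omega>))) ?h (X (exit_sup \<omega>) \<omega>) * of_bool (exit_sup \<omega> < ennreal t)"
        using suminf_of_bool_single[of "\<lambda>j. trans_op (ennreal (disc_time n j)) ?h (X (exit_sup \<omega>) \<omega>) * of_bool (exit_sup \<omega> < ennreal t)" "d n \<omega>"]
        by (simp only: mult.assoc)
    qed
    finally show ?thesis .
  qed
  have L: "(\<lambda>n. \<integral>\<^sup>+\<omega>. ?h (X (exit_sup \<omega> + ennreal (disc_time n (d n \<omega>))) \<omega>) * of_bool (exit_sup \<omega> < ennreal t) \<partial>P z) \<longlonglongrightarrow>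
    (\<integral>\<^sup>+\<omega>. ?h (X (ennreal t) \<omega>) * of_bool (exit_sup \<omega> < ennreal t) \<partial>P z)"
  proof (rule nn_integral_dominated_convergence[where w="\<lambda>_. 1"])
    show "AE \<omega> in P z. ?h (X (exit_sup \<omega> + ennreal (disc_time n (d n \<omega>))) \<omega>) * of_bool (exit_sup \<omega> < ennreal t) \<le> 1" for n
      by (intro AE_I2 h1)
    show "(\<integral>\<^sup>+\<omega>. 1 \<partial>P z) < \<infinity>" by (rule prob_P1)
    show "AE \<omega> in P z. (\<lambda>n. ?h (X (exit_sup \<omega> + ennreal (disc_time n (d n \<omega>))) \<omega>) * of_bool (exit_sup \<omega> < ennreal t)) \<longlonglongrightarrow>
      ?h (X (ennreal t) \<omega>) * of_bool (exit_sup \<omega> < ennreal t)"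
    proof (rule AE_I2)
      fix \<omega> assume "\<omega> \<in> space (P z)"
      then have w: "\<omega> \<in> \<Omega>" by (simp add: space_P)
      show "(\<lambda>n. ?h (X (exit_sup \<omega> + ennreal (disc_time n (d n \<omega>))) \<omega>) * of_bool (exit_sup \<omega> < ennreal t)) \<longlonglongrightarrow>
        ?h (X (ennreal t) \<omega>) * of_bool (exit_sup \<omega> < ennreal t)"
      proof (cases "exit_sup \<omega> < ennreal t")
        case True
        then obtain r where r: "0 \<le> r" "exit_sup \<omega> = ennreal r" "r < t" using exit_sup_real by blast
        have dr: "d n \<omega> = disc n (t - r)" for n using r by (simp add: d_def)
        have tr: "0 \<le> t - r" using r by simp
        have lim: "limitin state_top (\<lambda>n. X (ennreal (r + disc_time n (disc n (t - r)))) \<omega>) (X (ennreal t) \<omega>) sequentially"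
        proof (rule filterlim_X_right[OF w])
          show "t < r + disc_time n (disc n (t - r))" for n using disc_bounds(1)[OF tr, of n] by simp
          show "(\<lambda>n. r + disc_time n (disc n (t - r))) \<longlonglongrightarrow> t"
            using tendsto_add[OF tendsto_const disc_time_tendsto[OF tr], of r] by simp
        qed (use t in simp)
        have e: "exit_sup \<omega> + ennreal (disc_time n (d n \<omega>)) = ennreal (r + disc_time n (disc n (t - r)))" for n
          unfolding dr r(2) using r(1) by (subst ennreal_plus) (auto simp: disc_time_def)
        show ?thesis using limitin_state_C0[OF lim f(1,2)] True unfolding e by simp
      qed simp
    qed
  qed measurable
  have R: "(\<lambda>n. \<integral>\<^sup>+\<omega>. trans_op (ennreal (disc_time n (d n \<omega>))) ?h (X (exit_sup \<omega>) \<omega>) * of_bool (exit_sup \<omega> < ennreal t) \<partial>P z) \<longlonglongrightarrow>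
    (\<integral>\<^sup>+\<omega>. (\<integral>\<^sup>+y. exit_density t \<omega> y * f y \<partial>lborel) \<partial>P z)"
  proof (rule nn_integral_dominated_convergence[where w="\<lambda>_. 1"])
    show "(\<lambda>\<omega>. trans_op (ennreal (disc_time n (d n \<omega>))) ?h (X (exit_sup \<omega>) \<omega>) * of_bool (exit_sup \<omega> < ennreal t)) \<in> borel_measurable (P z)" for n
    proof -
      have "(\<lambda>\<omega>. trans_op (ennreal (disc_time n (d n \<omega>))) ?h (X (exit_sup \<omega>) \<omega>)) \<in> borel_measurable (P z)"
        by (rule measurable_compose_countable[where f="\<lambda>j \<omega>. trans_op (ennreal (disc_time n j)) ?h (X (exit_sup \<omega>) \<omega>)"]) measurable
      then show ?thesis by measurable
    qed
    show "AE \<omega> in P z. trans_op (ennreal (disc_time n (d n \<omega>))) ?h (X (exit_sup \<omega>) \<omega>) * of_bool (exit_sup \<omega> < ennreal t) \<le> 1" for n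
      using trans_op_le[of ?h 1] h1[of _ True] by (intro AE_I2) auto
    show "(\<integral>\<^sup>+\<omega>. 1 \<partial>P z) < \<infinity>" by (rule prob_P1)
    show "AE \<omega> in P z. (\<lambda>n. trans_op (ennreal (disc_time n (d n \<omega>))) ?h (X (exit_sup \<omega>) \<omega>) * of_bool (exit_sup \<omega> < ennreal t)) \<longlonglongrightarrow>
      (\<integral>\<^sup>+y. exit_density t \<omega> y * f y \<partial>lborel)"
    proof (rule AE_I2)
      fix \<omega> assume "\<omega> \<in> space (P z)"
      show "(\<lambda>n. trans_op (ennreal (disc_time n (d n \<omega>))) ?h (X (exit_sup \<omega>) \<omega>) * of_bool (exit_sup \<omega> < ennreal t)) \<longlonglongrightarrow>
        (\<integral>\<^sup>+y. exit_density t \<omega> y * f y \<partial>lborel)"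
      proof (cases "exit_sup \<omega> < ennreal t")
        case True
        then obtain r where r: "0 \<le> r" "exit_sup \<omega> = ennreal r" "r < t" using exit_sup_real by blast
        have dr: "d n \<omega> = disc n (t - r)" for n using r by (simp add: d_def)
        have tr: "0 \<le> t - r" using r by simp
        \<comment> \<open>Here the starting state is fixed: right continuity of the paths under
          \<open>P y\<close> makes the transition operator right continuous in time on such test
          functions.\<close>
        have "(\<lambda>n. trans_op (ennreal (disc_time n (disc n (t - r)))) ?h y) \<longlonglongrightarrow> trans_op (ennreal (t - r)) ?h y" for y
          unfolding trans_op_def
        proof (rule nn_integral_dominated_convergence[where w="\<lambda>_. 1"])
          show "AE \<omega> in P y. ?h (X (ennreal (disc_time n (disc n (t - r)))) \<omega>) \<le> 1" for n
            using h1[of _ True] by auto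
          show "(\<integral>\<^sup>+\<omega>. 1 \<partial>P y) < \<infinity>" by (rule prob_P1)
          show "AE \<omega> in P y. (\<lambda>n. ?h (X (ennreal (disc_time n (disc n (t - r)))) \<omega>)) \<longlonglongrightarrow> ?h (X (ennreal (t - r)) \<omega>)"
            by (intro AE_I2 limitin_state_C0[OF filterlim_X_right f(1,2)])
               (use tr disc_bounds(1)[OF tr] disc_time_tendsto[OF tr] in \<open>auto simp: space_P\<close>)
        qed measurable
        then have "(\<lambda>n. trans_op (ennreal (disc_time n (d n \<omega>))) ?h (X (exit_sup \<omega>) \<omega>)) \<longlonglongrightarrow> trans_op (ennreal t - exit_sup \<omega>) ?h (X (exit_sup \<omega>) \<omega>)"
          unfolding dr r(2) using r(1) by (simp add: ennreal_minus)
        then show ?thesis using trans_op_exit_density[OF \<open>f \<in> borel_measurable borel\<close> True] True by simp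
      qed (simp add: exit_density_def)
    qed
    show "(\<lambda>\<omega>. \<integral>\<^sup>+y. exit_density t \<omega> y * f y \<partial>lborel) \<in> borel_measurable (P z)" by measurable
  qed measurable
  from L R show ?thesis unfolding step by (rule LIMSEQ_unique)
qed

definition exit_part :: "real \<Rightarrow> 'a \<Rightarrow> 'a \<Rightarrow> ennreal" where
  "exit_part t x y = (\<integral>\<^sup>+\<omega>. exit_density t \<omega> y \<partial>P (Some x))"

lemma sigma_finite_P: "sigma_finite_measure (P z)"
  using prob_space_P[of z] prob_space_imp_sigma_finite by blast

lemma exit_part_measurable [measurable]: "exit_part t x \<in> borel_measurable borel"
proof -
  interpret P: sigma_finite_measure "P (Some x)" by (rule sigma_finite_P)
  have "(\<lambda>(y, \<omega>). exit_density t \<omega> y) \<in> borel_measurable (borel \<Otimes>\<^sub>M P (Some x))"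
    by (subst measurable_pair_swap_iff) (simp add: split_beta' exit_density_measurable[unfolded split_beta'])
  then have "(\<lambda>y. \<integral>\<^sup>+\<omega>. (\<lambda>(y, \<omega>). exit_density t \<omega> y) (y, \<omega>) \<partial>P (Some x)) \<in> borel_measurable borel"
    by (rule P.borel_measurable_nn_integral_fst)
  then show ?thesis by (simp add: exit_part_def[abs_def])
qed

lemma exit_density_Fubini:
  assumes [measurable]: "f \<in> borel_measurable borel"
  shows "(\<integral>\<^sup>+\<omega>. (\<integral>\<^sup>+y. exit_density t \<omega> y * f y \<partial>lborel) \<partial>P (Some x)) = (\<integral>\<^sup>+y. exit_part t x y * f y \<partial>lborel)"
proof -
  interpret P: sigma_finite_measure "P (Some x)" by (rule sigma_finite_P)
  interpret PL: pair_sigma_finite "P (Some x)" lborel ..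
  have m: "(\<lambda>\<omega>. exit_density t \<omega> y) \<in> borel_measurable (P (Some x))" for y
    using measurable_compose[OF _ exit_density_measurable[of t "Some x"], of "\<lambda>\<omega>. (\<omega>, y)" "P (Some x)"] by simp
  have "(\<integral>\<^sup>+\<omega>. (\<integral>\<^sup>+y. exit_density t \<omega> y * f y \<partial>lborel) \<partial>P (Some x)) =
    (\<integral>\<^sup>+y. (\<integral>\<^sup>+\<omega>. exit_density t \<omega> y * f y \<partial>P (Some x)) \<partial>lborel)"
    by (rule PL.Fubini'[symmetric]) measurable
  also have "\<dots> = (\<integral>\<^sup>+y. exit_part t x y * f y \<partial>lborel)"
    using m by (simp add: exit_part_def nn_integral_multc)
  finally show ?thesis .
qed

end

lemma completion_measurable_AE:
  assumes AE: "AE x in M. f x = g x" and g: "g \<in> measurable M N" and f: "f \<in> space M \<rightarrow> space N"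
  shows "f \<in> measurable (completion M) N"
proof -
  show ?thesis
  proof (rule measurableI)
    fix A assume A: "A \<in> sets N"
    have "AE x in completion M. x \<in> space (completion M)" by (rule AE_space)
    then have ae: "AE x in completion M. (x \<in> g -` A \<inter> space M) = (x \<in> f -` A \<inter> space (completion M))"
      using AE_completion[OF AE] by eventually_elim auto
    show "f -` A \<inter> space (completion M) \<in> sets (completion M)"
      by (rule completion.in_sets_AE[OF ae]) (use measurable_sets[OF g A] in auto)
  qed (use f in auto)
qed

text \<open>Serves to replace \<open>exit_time\<close> by \<open>exit_sup\<close> in
  \<open>dirichlet_heat_kernel\<close>, whose integral is taken against the completed law: the
  integrand agrees almost everywhere with one that is measurable without completion.\<close>

lemma integral_completion_AE:
  fixes f g :: "'a \<Rightarrow> real"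
  assumes AE: "AE x in M. f x = g x" and g: "g \<in> borel_measurable M"
  shows "integral\<^sup>L (completion M) f = integral\<^sup>L M g"
proof -
  have f: "f \<in> borel_measurable (completion M)"
    using AE g by (rule completion_measurable_AE) auto
  have "integral\<^sup>L (completion M) f = integral\<^sup>L (completion M) g"
    by (rule integral_cong_AE) (use f g AE in \<open>auto intro: measurable_completion AE_completion\<close>)
  also have "\<dots> = integral\<^sup>L M g" using g by (rule integral_completion)
  finally show ?thesis .
qed

text \<open>For bounded open \<open>U\<close> these are continuous, vanish at infinity and increase
  to the indicator of \<open>U\<close>; they carry \<open>Hunt_formula_C0\<close> over to
  boxes.\<close>

definition box_approx :: "'a::euclidean_space set \<Rightarrow> nat \<Rightarrow> 'a \<Rightarrow> ennreal" where
  "box_approx U n x = ennreal (min 1 (real n * infdist x (- U)))"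

lemma box_approx_le1: "box_approx U n x \<le> 1"
  by (simp add: box_approx_def)

lemma box_approx_cont: "continuous_on UNIV (box_approx U n)"
  unfolding box_approx_def by (intro continuous_on_ennreal continuous_intros)

lemma box_approx_inc: "incseq (box_approx U)"
  unfolding box_approx_def
  by (intro monoI le_funI ennreal_leI min.mono mult_right_mono) (auto simp: infdist_nonneg)

lemma box_approx_outside: "x \<notin> U \<Longrightarrow> box_approx U n x = 0"
  by (simp add: box_approx_def)

lemma box_approx_at_infinity:
  assumes "bounded U" shows "(box_approx U n \<longlongrightarrow> 0) at_infinity"
proof (rule tendsto_eventually)
  obtain B where "\<And>x. x \<in> U \<Longrightarrow> norm x \<le> B" using assms by (auto simp: bounded_iff)
  then have "\<And>x. B + 1 \<le> norm x \<Longrightarrow> x \<notin> U" by fastforce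
  then show "\<forall>\<^sub>F x in at_infinity. box_approx U n x = 0"
    unfolding eventually_at_infinity by (meson box_approx_outside)
qed

lemma box_approx_SUP:
  assumes U: "open U" "bounded U"
  shows "(SUP n. box_approx U n x) = indicator U x"
proof (cases "x \<in> U")
  case True
  have "U \<noteq> UNIV" using U(2) not_bounded_UNIV by metis
  then have ne: "- U \<noteq> {}" by blast
  have "infdist x (- U) \<noteq> 0"
    using in_closed_iff_infdist_zero[of "- U" x] U(1) ne True by auto
  then have pos: "0 < infdist x (- U)" using infdist_nonneg[of x "- U"] by simp
  then obtain n where n: "1 < real n * infdist x (- U)" using reals_Archimedean3 by blast
  have "box_approx U n x = 1" using n by (simp add: box_approx_def)
  then have "1 \<le> (SUP n. box_approx U n x)" by (metis SUP_upper UNIV_I)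
  moreover have "(SUP n. box_approx U n x) \<le> 1" by (intro SUP_least box_approx_le1)
  ultimately show ?thesis using True by simp
qed (simp add: box_approx_outside)

context killed_process begin

lemma Hunt_formula_box:
  assumes t: "0 < t" and U: "open U" "bounded U"
  shows "(\<integral>\<^sup>+y. exit_part t x y * indicator U y \<partial>lborel) =
    (\<integral>\<^sup>+\<omega>. case_option 0 (indicator U) (X (ennreal t) \<omega>) * of_bool (exit_sup \<omega> < ennreal t) \<partial>P (Some x))"
proof -
  have [measurable]: "box_approx U n \<in> borel_measurable borel" for n
    by (rule borel_measurable_continuous_onI[OF box_approx_cont])
  have "(\<integral>\<^sup>+y. exit_part t x y * indicator U y \<partial>lborel) = (\<integral>\<^sup>+y. (SUP n. exit_part t x y * box_approx U n y) \<partial>lborel)"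
    by (simp add: SUP_mult_left_ennreal[symmetric] box_approx_SUP[OF U])
  also have "\<dots> = (SUP n. \<integral>\<^sup>+y. exit_part t x y * box_approx U n y \<partial>lborel)"
  proof (rule nn_integral_monotone_convergence_SUP)
    show "incseq (\<lambda>n y. exit_part t x y * box_approx U n y)"
      by (intro monoI le_funI mult_left_mono) (use box_approx_inc in \<open>auto dest: incseqD le_funD\<close>)
  qed measurable
  also have "\<dots> = (SUP n. \<integral>\<^sup>+\<omega>. case_option 0 (box_approx U n) (X (ennreal t) \<omega>) * of_bool (exit_sup \<omega> < ennreal t) \<partial>P (Some x))"
    using Hunt_formula_C0[OF box_approx_cont box_approx_at_infinity[OF U(2)] box_approx_le1 t, where z="Some x"]
    by (simp add: exit_density_Fubini)
  also have "\<dots> = (\<integral>\<^sup>+\<omega>. (SUP n. case_option 0 (box_approx U n) (X (ennreal t) \<omega>) * of_bool (exit_sup \<omega> < ennreal t)) \<partial>P (Some x))"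
  proof (rule nn_integral_monotone_convergence_SUP[symmetric])
    show "incseq (\<lambda>n \<omega>. case_option 0 (box_approx U n) (X (ennreal t) \<omega>) * of_bool (exit_sup \<omega> < ennreal t))"
      by (intro monoI le_funI mult_right_mono)
         (use box_approx_inc in \<open>auto dest: incseqD le_funD split: option.split\<close>)
  qed measurable
  also have "\<dots> = (\<integral>\<^sup>+\<omega>. case_option 0 (indicator U) (X (ennreal t) \<omega>) * of_bool (exit_sup \<omega> < ennreal t) \<partial>P (Some x))"
  proof (rule nn_integral_cong)
    fix \<omega>
    show "(SUP n. case_option 0 (box_approx U n) (X (ennreal t) \<omega>) * of_bool (exit_sup \<omega> < ennreal t)) =
      case_option 0 (indicator U) (X (ennreal t) \<omega>) * of_bool (exit_sup \<omega> < ennreal t)"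
      by (cases "X (ennreal t) \<omega>") (auto simp: SUP_mult_right_ennreal[symmetric] box_approx_SUP[OF U])
  qed
  finally show ?thesis .
qed

text \<open>Both sides integrate \<open>f\<close> against measures on the Euclidean space that agree
  on open boxes, an intersection-stable generator on which they are finite.\<close>

lemma Hunt_formula:
  assumes t: "0 < t" and f [measurable]: "f \<in> borel_measurable borel"
  shows "(\<integral>\<^sup>+y. exit_part t x y * f y \<partial>lborel) =
    (\<integral>\<^sup>+\<omega>. case_option 0 f (X (ennreal t) \<omega>) * of_bool (exit_sup \<omega> < ennreal t) \<partial>P (Some x))"
proof -
  define M1 where "M1 = density lborel (exit_part t x)"
  define M2 where "M2 = distr (density (P (Some x)) (\<lambda>\<omega>. of_bool (exit_sup \<omega> < ennreal t \<and> X (ennreal t) \<omega> \<noteq> None))) borel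
     (\<lambda>\<omega>. case_option 0 id (X (ennreal t) \<omega>))"
  have I1: "(\<integral>\<^sup>+y. g y \<partial>M1) = (\<integral>\<^sup>+y. exit_part t x y * g y \<partial>lborel)" if [measurable]: "g \<in> borel_measurable borel" for g
    unfolding M1_def by (subst nn_integral_density) auto
  have I2: "(\<integral>\<^sup>+y. g y \<partial>M2) = (\<integral>\<^sup>+\<omega>. case_option 0 g (X (ennreal t) \<omega>) * of_bool (exit_sup \<omega> < ennreal t) \<partial>P (Some x))"
    if [measurable]: "g \<in> borel_measurable borel" for g
  proof -
    have m [measurable]: "(\<lambda>\<omega>. case_option 0 id (X (ennreal t) \<omega>)) \<in> borel_measurable (P (Some x))"
      by measurable
    have [measurable]: "(\<lambda>\<omega>. of_bool (exit_sup \<omega> < ennreal t \<and> X (ennreal t) \<omega> \<noteq> None) :: ennreal) \<in> borel_measurable (P (Some x))"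
      by measurable
    have "(\<integral>\<^sup>+y. g y \<partial>M2) = (\<integral>\<^sup>+\<omega>. of_bool (exit_sup \<omega> < ennreal t \<and> X (ennreal t) \<omega> \<noteq> None) * g (case_option 0 id (X (ennreal t) \<omega>)) \<partial>P (Some x))"
      unfolding M2_def by (simp add: nn_integral_distr nn_integral_density del: not_None_eq)
    also have "\<dots> = (\<integral>\<^sup>+\<omega>. case_option 0 g (X (ennreal t) \<omega>) * of_bool (exit_sup \<omega> < ennreal t) \<partial>P (Some x))"
      by (rule nn_integral_cong) (auto split: option.split)
    finally show ?thesis .
  qed
  have em: "emeasure M1 U = emeasure M2 U" if "open U" "bounded U" for U
  proof -
    have [measurable]: "U \<in> sets borel" using that(1) by simp
    have "emeasure M1 U = (\<integral>\<^sup>+y. indicator U y \<partial>M1)" by (simp add: M1_def)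
    also have "\<dots> = (\<integral>\<^sup>+y. indicator U y \<partial>M2)"
      using Hunt_formula_box[OF t that, of x] I1[of "indicator U"] I2[of "indicator U"] by simp
    also have "\<dots> = emeasure M2 U" by (simp add: M2_def)
    finally show ?thesis .
  qed
  have fin: "emeasure M2 A \<le> 1" if [measurable]: "A \<in> sets borel" for A
  proof -
    have "emeasure M2 A = (\<integral>\<^sup>+y. indicator A y \<partial>M2)" by (simp add: M2_def)
    also have "\<dots> \<le> (\<integral>\<^sup>+\<omega>. 1 \<partial>P (Some x))"
      unfolding I2[OF borel_measurable_indicator[OF that]]
      by (intro nn_integral_mono) (auto simp: indicator_def split: option.split)
    finally show ?thesis using prob_space.emeasure_space_1[OF prob_space_P[of "Some x"]] by simp
  qed
  have "M1 = M2"
  proof (rule measure_eqI_generator_eq)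
    let ?E = "range (\<lambda>(a, b). box a b :: 'a set)"
    show "Int_stable ?E" by (auto simp: Int_stable_def box_Int_box)
    show "?E \<subseteq> Pow UNIV" "sets M1 = sigma_sets UNIV ?E" "sets M2 = sigma_sets UNIV ?E"
      by (simp_all add: borel_eq_box M1_def M2_def)
    let ?A = "\<lambda>n::nat. box (- (real n *\<^sub>R One)) (real n *\<^sub>R One) :: 'a set"
    show "range ?A \<subseteq> ?E" "(\<Union>i. ?A i) = UNIV" unfolding UN_box_eq_UNIV by auto
    show "emeasure M1 (?A i) \<noteq> \<infinity>" for i
      using em[of "?A i"] fin[of "?A i"] by (auto simp: open_box bounded_box top_unique)
    show "emeasure M1 Y = emeasure M2 Y" if "Y \<in> ?E" for Y
      using that by (auto intro!: em open_box bounded_box)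
  qed
  then show ?thesis using I1[OF f] I2[OF f] by simp
qed

section \<open>Identification of the Dirichlet heat kernel\<close>

lemma p_split:
  assumes t: "0 < t" and f [measurable]: "f \<in> borel_measurable borel"
  shows "(\<integral>\<^sup>+y. ennreal (p t x y) * f y \<partial>lborel) = (\<integral>\<^sup>+y. exit_part t x y * f y \<partial>lborel) + Qkill t f x"
proof -
  have "(\<integral>\<^sup>+y. ennreal (p t x y) * f y \<partial>lborel) = (\<integral>\<^sup>+\<omega>. case_option 0 f (X (ennreal t) \<omega>) \<partial>P (Some x))"
    using trans_op_dens[OF f t, of x] by (simp add: trans_op_def)
  also have "\<dots> = (\<integral>\<^sup>+\<omega>. case_option 0 f (X (ennreal t) \<omega>) * of_bool (exit_sup \<omega> < ennreal t)
      + case_option 0 f (X (ennreal t) \<omega>) * of_bool (ennreal t < exit_sup \<omega>) \<partial>P (Some x))"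
  proof (rule nn_integral_cong_AE)
    show "AE \<omega> in P (Some x). case_option 0 f (X (ennreal t) \<omega>) = case_option 0 f (X (ennreal t) \<omega>) * of_bool (exit_sup \<omega> < ennreal t)
      + case_option 0 f (X (ennreal t) \<omega>) * of_bool (ennreal t < exit_sup \<omega>)"
      using no_atom[OF t, of x]
    proof eventually_elim
      case (elim \<omega>)
      then show ?case by (cases "exit_sup \<omega>" "ennreal t" rule: linorder_cases) auto
    qed
  qed
  also have "\<dots> = (\<integral>\<^sup>+y. exit_part t x y * f y \<partial>lborel) + Qkill t f x"
    unfolding Hunt_formula[OF t f] Qkill_exit_sup[OF less_imp_le[OF t]] by (rule nn_integral_add) measurable
  finally show ?thesis .
qed

lemma p_measurable: "0 < t \<Longrightarrow> (\<lambda>y. ennreal (p t x y)) \<in> borel_measurable borel"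
proof -
  assume "0 < t"
  then have "(\<lambda>y. ennreal (p t x y)) = (\<lambda>y. p_pos (t, x, y))" by (auto simp: p_pos_def)
  moreover have "(\<lambda>y::'a. (t, x, y)) \<in> borel_measurable borel"
    by (intro borel_measurable_continuous_onI continuous_intros)
  ultimately show ?thesis using measurable_compose[OF _ p_pos_measurable] by auto
qed

lemma p_nonneg: "0 < t \<Longrightarrow> 0 \<le> p t x y"
  using dens by (simp add: transition_density_def)

lemma p_le1: "0 < t \<Longrightarrow> (\<integral>\<^sup>+y. ennreal (p t x y) \<partial>lborel) \<le> 1"
  using trans_op_dens[of "\<lambda>_. 1" t x] trans_op_le[of "case_option 0 (\<lambda>_. 1)" 1 "ennreal t" "Some x"]
  by (simp split: option.split)

text \<open>By \<open>p_split\<close> the integral of the exit part over any Borel set is at most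
  that of \<open>p\<close>, in particular over the set where the exit part is larger; that set is
  therefore null.\<close>

lemma exit_part_le_p:
  assumes t: "0 < t" shows "AE y in lborel. exit_part t x y \<le> ennreal (p t x y)"
proof -
  note [measurable] = p_measurable[OF t]
  let ?B = "{y. ennreal (p t x y) < exit_part t x y}"
  have B [measurable]: "?B \<in> sets borel" by measurable
  have fin: "(\<integral>\<^sup>+y. ennreal (p t x y) * indicator ?B y \<partial>lborel) \<noteq> \<infinity>"
  proof -
    have "(\<integral>\<^sup>+y. ennreal (p t x y) * indicator ?B y \<partial>lborel) \<le> (\<integral>\<^sup>+y. ennreal (p t x y) \<partial>lborel)"
      by (intro nn_integral_mono) (auto simp: indicator_def)
    also have "\<dots> \<le> 1" using p_le1[OF t] .
    finally show ?thesis by (auto simp: top_unique)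
  qed
  have "(\<integral>\<^sup>+y. exit_part t x y * indicator ?B y - ennreal (p t x y) * indicator ?B y \<partial>lborel) =
    (\<integral>\<^sup>+y. exit_part t x y * indicator ?B y \<partial>lborel) - (\<integral>\<^sup>+y. ennreal (p t x y) * indicator ?B y \<partial>lborel)"
    by (rule nn_integral_diff) (use fin in \<open>auto simp: indicator_def\<close>)
  also have "\<dots> = 0"
  proof (rule diff_eq_0_ennreal)
    show "(\<integral>\<^sup>+y. exit_part t x y * indicator ?B y \<partial>lborel) \<le> (\<integral>\<^sup>+y. ennreal (p t x y) * indicator ?B y \<partial>lborel)"
      unfolding p_split[OF t borel_measurable_indicator[OF B]] by simp
    then show "(\<integral>\<^sup>+y. exit_part t x y * indicator ?B y \<partial>lborel) < \<top>" using fin by (auto simp: less_top top_unique)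
  qed
  finally have "AE y in lborel. exit_part t x y * indicator ?B y - ennreal (p t x y) * indicator ?B y = 0"
    by (subst (asm) nn_integral_0_iff_AE) auto
  then show ?thesis
  proof eventually_elim
    case (elim y)
    show ?case
    proof (rule ccontr)
      assume "\<not> exit_part t x y \<le> ennreal (p t x y)"
      with elim show False by (auto simp: diff_eq_0_iff_ennreal)
    qed
  qed
qed

abbreviation q :: "real \<Rightarrow> 'a \<Rightarrow> 'a \<Rightarrow> real" where "q \<equiv> dirichlet_heat_kernel X P p D"

text \<open>The event \<open>exit_time = t\<close> would bring in values of \<open>p\<close> at time
  0. By \<open>no_atom\<close> the path is then almost surely in the cemetery, where the integrand
  is 0.\<close>

lemma q_eq:
  assumes x: "x \<in> D" and t: "0 < t"
  shows "q t x y = p t x y - enn2real (exit_part t x y)"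
proof -
  have m [measurable]: "(\<lambda>\<omega>. exit_density t \<omega> y) \<in> borel_measurable (P (Some x))"
    using measurable_compose[OF _ exit_density_measurable[of t "Some x"], of "\<lambda>\<omega>. (\<omega>, y)" "P (Some x)"] by simp
  have fin: "ennreal (enn2real (exit_density t \<omega> y)) = exit_density t \<omega> y" for \<omega>
    by (auto simp: exit_density_def split: option.split)
  have "(\<integral>\<omega>. (if exit_time X D \<omega> \<le> ennreal t
           then case_option 0 (\<lambda>z. p (t - enn2real (exit_time X D \<omega>)) z y) (X (exit_time X D \<omega>) \<omega>)
           else 0) \<partial>completion (P (Some x))) = (\<integral>\<omega>. enn2real (exit_density t \<omega> y) \<partial>P (Some x))"
  proof (rule integral_completion_AE)
    show "AE \<omega> in P (Some x). (if exit_time X D \<omega> \<le> ennreal t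
           then case_option 0 (\<lambda>z. p (t - enn2real (exit_time X D \<omega>)) z y) (X (exit_time X D \<omega>) \<omega>)
           else 0) = enn2real (exit_density t \<omega> y)"
      using AE_exit[OF x] no_atom[OF t, of x]
    proof eventually_elim
      case (elim \<omega>)
      show ?case
      proof (cases "exit_sup \<omega>" "ennreal t" rule: linorder_cases)
        case less
        then obtain r where "0 \<le> r" "exit_sup \<omega> = ennreal r" "r < t" using exit_sup_real by blast
        with less show ?thesis unfolding elim(1)
          using p_nonneg[of "t - r"] by (auto simp: exit_density_def split: option.split)
      qed (use elim t in \<open>auto simp: exit_density_def\<close>)
    qed
  qed measurable
  also have "\<dots> = enn2real (exit_part t x y)"
    unfolding exit_part_def by (subst integral_eq_nn_integral) (auto simp: fin)
  finally show ?thesis unfolding dirichlet_heat_kernel_def by simp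
qed

lemma q_AE:
  assumes x: "x \<in> D" and t: "0 < t"
  shows "AE y in lborel. 0 \<le> q t x y \<and> ennreal (p t x y) = exit_part t x y + ennreal (q t x y)"
  using exit_part_le_p[OF t, of x]
proof eventually_elim
  case (elim y)
  then have "exit_part t x y < \<top>" by (rule le_less_trans) simp
  then obtain k where k: "exit_part t x y = ennreal k" "0 \<le> k" by (cases "exit_part t x y") auto
  with elim have "k \<le> p t x y" using p_nonneg[OF t] by simp
  with k show ?case unfolding q_eq[OF x t] by (auto simp: ennreal_plus[symmetric] simp del: ennreal_plus)
qed

lemma q_measurable: "x \<in> D \<Longrightarrow> 0 < t \<Longrightarrow> (\<lambda>y. q t x y) \<in> borel_measurable borel"
proof -
  assume x: "x \<in> D" and t: "0 < t"
  have "(\<lambda>y. q t x y) = (\<lambda>y. enn2real (ennreal (p t x y)) - enn2real (exit_part t x y))"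
    using q_eq[OF x t] p_nonneg[OF t] by auto
  then show ?thesis using p_measurable[OF t, of x] by simp
qed

text \<open>The exit part has a finite integral, so it cancels when \<open>q_AE\<close> is compared
  with \<open>p_split\<close>.\<close>

lemma q_int:
  assumes x: "x \<in> D" and t: "0 < t" and f [measurable]: "f \<in> borel_measurable borel" and f1: "\<And>y. f y \<le> 1"
  shows "(\<integral>\<^sup>+y. ennreal (q t x y) * f y \<partial>lborel) = Qkill t f x"
proof -
  note [measurable] = q_measurable[OF x t]
  have "(\<integral>\<^sup>+y. ennreal (p t x y) * f y \<partial>lborel) = (\<integral>\<^sup>+y. exit_part t x y * f y + ennreal (q t x y) * f y \<partial>lborel)"
    by (rule nn_integral_cong_AE) (use q_AE[OF x t] in \<open>eventually_elim, simp add: distrib_right\<close>)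
  also have "\<dots> = (\<integral>\<^sup>+y. exit_part t x y * f y \<partial>lborel) + (\<integral>\<^sup>+y. ennreal (q t x y) * f y \<partial>lborel)"
    by (rule nn_integral_add) measurable
  finally have eq: "(\<integral>\<^sup>+y. exit_part t x y * f y \<partial>lborel) + (\<integral>\<^sup>+y. ennreal (q t x y) * f y \<partial>lborel)
    = (\<integral>\<^sup>+y. exit_part t x y * f y \<partial>lborel) + Qkill t f x"
    unfolding p_split[OF t f] by (rule HOL.sym)
  have "(\<integral>\<^sup>+y. exit_part t x y * f y \<partial>lborel) \<le> (\<integral>\<^sup>+y. ennreal (p t x y) \<partial>lborel)"
  proof (rule nn_integral_mono_AE)
    show "AE y in lborel. exit_part t x y * f y \<le> ennreal (p t x y)"
      using exit_part_le_p[OF t, of x]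
    proof eventually_elim
      case (elim y)
      have "exit_part t x y * f y \<le> exit_part t x y * 1" by (intro mult_left_mono f1) simp
      with elim show ?case by simp
    qed
  qed
  also have "\<dots> \<le> 1" by (rule p_le1[OF t])
  finally have "(\<integral>\<^sup>+y. exit_part t x y * f y \<partial>lborel) \<noteq> \<top>" by (auto simp: top_unique)
  with eq[unfolded ennreal_add_left_cancel] show ?thesis by (auto simp: infinity_ennreal_def)
qed

end

lemma AE_lborel_open_witness:
  fixes U :: "'a::euclidean_space set"
  assumes "AE x in lborel. Q x" "open U" "U \<noteq> {}"
  obtains x where "x \<in> U" "Q x"
proof -
  obtain a r where ar: "0 < r" "ball a r \<subseteq> U"
    using assms(2,3) by (metis ex_in_conv open_contains_ball)
  have "\<exists>x\<in>ball a r. Q x"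
  proof (rule ccontr)
    assume "\<not> (\<exists>x\<in>ball a r. Q x)"
    with assms(1) have "AE x in lborel. x \<notin> ball a r" by (auto elim!: eventually_mono)
    then have "emeasure lborel (ball a r) = 0"
      by (subst (asm) AE_iff_measurable[OF _ refl]) (auto simp: ball_def)
    moreover have "emeasure lborel (ball a r) > 0"
      using ar(1) by (simp add: emeasure_ball)
    ultimately show False by simp
  qed
  then show ?thesis using ar(2) that by blast
qed

lemma continuous_AE_eq_imp_eq:
  fixes f g :: "'a::euclidean_space \<Rightarrow> 'b::t2_space"
  assumes D: "open D" "continuous_on D f" "continuous_on D g"
    and AE: "AE x in lborel. x \<in> D \<longrightarrow> f x = g x" and x: "x \<in> D"
  shows "f x = g x"
proof -
  have "\<exists>y. y \<in> D \<and> dist y x < 1 / real (Suc n) \<and> f y = g y" for n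
  proof -
    have "open (D \<inter> ball x (1 / real (Suc n)))" "D \<inter> ball x (1 / real (Suc n)) \<noteq> {}"
      using D(1) x by (auto intro!: exI[of _ x])
    from AE_lborel_open_witness[OF AE this] show ?thesis by (auto simp: dist_commute)
  qed
  then obtain y where y: "\<And>n. y n \<in> D" "\<And>n. dist (y n) x < 1 / real (Suc n)" "\<And>n. f (y n) = g (y n)"
    by metis
  have "(\<lambda>n. dist (y n) x) \<longlonglongrightarrow> 0"
  proof (rule tendsto_sandwich[OF _ _ tendsto_const LIMSEQ_inverse_real_of_nat])
    show "\<forall>\<^sub>F n in sequentially. dist (y n) x \<le> inverse (real (Suc n))"
      using y(2) by (intro always_eventually allI) (simp add: inverse_eq_divide less_imp_le)
  qed simp
  then have yx: "y \<longlonglongrightarrow> x" by (rule tendsto_dist_iff[THEN iffD2])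
  have "(\<lambda>n. f (y n)) \<longlonglongrightarrow> f x" "(\<lambda>n. g (y n)) \<longlonglongrightarrow> g x"
    using D(2,3) yx x y(1) unfolding continuous_on_sequentially by (auto simp: comp_def)
  then show ?thesis using y(3) LIMSEQ_unique by simp
qed

section \<open>Semigroups of Dirichlet heat kernels\<close>

text \<open>The last assumption says that \<open>E\<close> is at most the form of the semigroup on nonnegative functions, in a shape
  that avoids speaking of the form's domain.\<close>

locale dirichlet_kernel =
  fixes D :: "'a::euclidean_space set" and q :: "real \<Rightarrow> 'a \<Rightarrow> 'a \<Rightarrow> real" and E :: "('a \<Rightarrow> real) \<Rightarrow> ennreal"
  assumes open_D: "open D" and nonempty_D: "D \<noteq> {}"
    and good: "good_kernel D q"
    and mass: "0 < t \<Longrightarrow> x \<in> D \<Longrightarrow> (\<integral>\<^sup>+y\<in>D. ennreal (q t x y) \<partial>lborel) \<le> 1"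
    and q_sym: "0 < t \<Longrightarrow> x \<in> D \<Longrightarrow> y \<in> D \<Longrightarrow> q t x y = q t y x"
    and Chapman_Kolmogorov: "0 < s \<Longrightarrow> 0 < t \<Longrightarrow> x \<in> D \<Longrightarrow> y \<in> D \<Longrightarrow>
      (\<integral>\<^sup>+z\<in>D. ennreal (q s x z * q t z y) \<partial>lborel) = ennreal (q (s + t) x y)"
    and form_lower: "u \<in> L2 D \<Longrightarrow> (\<And>x. 0 \<le> u x) \<Longrightarrow> 0 \<le> C \<Longrightarrow> (\<And>n::nat. 0 < \<delta> n) \<Longrightarrow> \<delta> \<longlonglongrightarrow> 0 \<Longrightarrow>
      (\<And>n. (\<integral>\<^sup>+x. ennreal ((u x)\<^sup>2) \<partial>lborel) \<le> ennreal (C * \<delta> n) +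
         (\<integral>\<^sup>+x\<in>D. ennreal (u x) * (\<integral>\<^sup>+y\<in>D. ennreal (q (\<delta> n) x y * u y) \<partial>lborel) \<partial>lborel)) \<Longrightarrow>
      E u \<le> ennreal C"

lemma kernel_measurable_pair:
  fixes D :: "'a::euclidean_space set"
  assumes "open D" "good_kernel D q" "0 < t"
  shows "(\<lambda>z. indicator (D \<times> D) z * q t (fst z) (snd z)) \<in> borel_measurable (borel \<Otimes>\<^sub>M borel)"
proof -
  have "continuous_on (D \<times> D) (\<lambda>z. q t (fst z) (snd z))"
    using assms by (simp add: good_kernel_def)
  then have "(\<lambda>z. indicator (D \<times> D) z *\<^sub>R q t (fst z) (snd z)) \<in> borel_measurable borel"
    using assms by (intro borel_measurable_continuous_on_indicator borel_open open_Times)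
  then show ?thesis by (simp add: borel_prod)
qed

lemma indicator_le_one: "(indicator S y :: ennreal) \<le> 1"
  by (simp add: indicator_def)

lemma measurable_Some [measurable]: "Some \<in> borel \<rightarrow>\<^sub>M state_space"
  by (simp add: measurable_def sets_state_space)

section \<open>Symmetry and Chapman-Kolmogorov at every point\<close>

context killed_process begin

lemma kernel_measurable_nn:
  assumes "good_kernel D q" "0 < t"
  shows "(\<lambda>(x, y). ennreal (q t x y) * indicator D x * indicator D y) \<in> borel_measurable (borel \<Otimes>\<^sub>M borel)"
proof -
  have "(\<lambda>z. ennreal (indicator (D \<times> D) z * q t (fst z) (snd z))) \<in> borel_measurable (borel \<Otimes>\<^sub>M borel)"
    using kernel_measurable_pair[OF open_D assms] by measurable
  moreover have "(\<lambda>z. ennreal (indicator (D \<times> D) z * q t (fst z) (snd z))) = (\<lambda>(x, y). ennreal (q t x y) * indicator D x * indicator D y)"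
    by (auto simp: indicator_def)
  ultimately show ?thesis by simp
qed

text \<open>\<open>Qkill_sym\<close> gives symmetry of integrals only. If
  \<open>q t a b < c1 < c2 < q t b a\<close>, continuity spreads the gap over a product of small
  balls, and testing with their indicators contradicts \<open>Qkill_sym\<close>.\<close>

lemma q_symmetric:
  assumes good: "good_kernel D q" and t: "0 < t" and a: "a \<in> D" and b: "b \<in> D"
  shows "q t a b = q t b a"
proof -
  have le: "q t b a \<le> q t a b" if a: "a \<in> D" and b: "b \<in> D" for a b
  proof (rule ccontr)
    assume "\<not> q t b a \<le> q t a b"
    then obtain c1 where c1: "q t a b < c1" "c1 < q t b a" using dense not_le by metis
    obtain c2 where c2: "c1 < c2" "c2 < q t b a" using dense c1(2) by metis
    have pos: "0 < q t a b" using good t a b by (simp add: good_kernel_def)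
    have cont: "continuous_on (D \<times> D) (\<lambda>z. q t (fst z) (snd z))"
      using good t by (simp add: good_kernel_def)
    have cont': "continuous_on (D \<times> D) (\<lambda>z. q t (snd z) (fst z))"
    proof -
      have "continuous_on (D \<times> D) ((\<lambda>z. q t (fst z) (snd z)) \<circ> (\<lambda>z. (snd z, fst z)))"
        by (intro continuous_on_compose continuous_intros continuous_on_subset[OF cont]) auto
      then show ?thesis by (simp add: comp_def)
    qed
    have oDD: "open (D \<times> D)" using open_D by (intro open_Times)
    have "open ((D \<times> D) \<inter> (\<lambda>z. q t (fst z) (snd z)) -` {..<c1})"
      by (rule continuous_open_preimage[OF cont oDD]) simp
    moreover have "open ((D \<times> D) \<inter> (\<lambda>z. q t (snd z) (fst z)) -` {c2<..})"
      by (rule continuous_open_preimage[OF cont' oDD]) simp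
    ultimately have "open (((D \<times> D) \<inter> (\<lambda>z. q t (fst z) (snd z)) -` {..<c1}) \<inter> ((D \<times> D) \<inter> (\<lambda>z. q t (snd z) (fst z)) -` {c2<..}))"
      (is "open ?W") by (rule open_Int)
    moreover have "(a, b) \<in> ?W" using a b c1 c2 by auto
    ultimately obtain A B where AB: "open A" "open B" "(a, b) \<in> A \<times> B" "A \<times> B \<subseteq> ?W"
      by (rule open_prod_elim)
    obtain r where r: "0 < r" "ball a r \<subseteq> A" using AB(1,3) open_contains_ball by blast
    obtain r' where r': "0 < r'" "ball b r' \<subseteq> B" using AB(2,3) open_contains_ball by blast
    let ?A = "ball a r" let ?B = "ball b r'"
    have sub: "x \<in> D" "y \<in> D" "q t x y < c1" "c2 < q t y x" if "x \<in> ?A" "y \<in> ?B" for x y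
    proof -
      have "x \<in> A" "y \<in> B" using that r(2) r'(2) by blast+
      then have "(x, y) \<in> ?W" using AB(4) by blast
      then show "x \<in> D" "y \<in> D" "q t x y < c1" "c2 < q t y x" by auto
    qed
    have mA: "?A \<in> sets lborel" and mB: "?B \<in> sets lborel" by auto
    have iA: "(indicator ?A :: 'a \<Rightarrow> ennreal) \<in> borel_measurable borel"
      and iB: "(indicator ?B :: 'a \<Rightarrow> ennreal) \<in> borel_measurable borel"
      by (intro borel_measurable_indicator; simp)+
    have AD: "?A \<subseteq> D" using sub(1)[of _ b] r'(1) by auto
    have BD: "?B \<subseteq> D" using sub(2)[of a] r(1) by auto
    obtain va where va: "emeasure lborel ?A = ennreal va" "0 < va"
      using r(1) that by (metis emeasure_ball less_imp_le mult_pos_pos unit_ball_vol_pos zero_less_power of_nat_0_le_iff)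
    obtain vb where vb: "emeasure lborel ?B = ennreal vb" "0 < vb"
      using r'(1) that by (metis emeasure_ball less_imp_le mult_pos_pos unit_ball_vol_pos zero_less_power of_nat_0_le_iff)
    have 1: "(\<integral>\<^sup>+x. indicator ?A x * Qkill t (indicator ?B) x \<partial>lborel) \<le> ennreal (c1 * va * vb)"
    proof -
      have "indicator ?A x * Qkill t (indicator ?B) x \<le> ennreal (c1 * vb) * indicator ?A x" for x
      proof (cases "x \<in> ?A")
        case True
        then have "Qkill t (indicator ?B) x = (\<integral>\<^sup>+y. ennreal (q t x y) * indicator ?B y \<partial>lborel)"
          using AD t by (intro q_int[symmetric] iB indicator_le_one) auto
        also have "\<dots> \<le> (\<integral>\<^sup>+y. ennreal c1 * indicator ?B y \<partial>lborel)"
          using less_imp_le[OF sub(3)[OF True]] by (intro nn_integral_mono) (auto simp: indicator_def intro!: ennreal_leI)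
        also have "\<dots> = ennreal (c1 * vb)"
          using c1 pos vb by (simp add: nn_integral_cmult_indicator[OF mB] ennreal_mult)
        finally show ?thesis using True by simp
      qed simp
      then have "(\<integral>\<^sup>+x. indicator ?A x * Qkill t (indicator ?B) x \<partial>lborel) \<le> (\<integral>\<^sup>+x. ennreal (c1 * vb) * indicator ?A x \<partial>lborel)"
        by (rule nn_integral_mono)
      also have "\<dots> = ennreal (c1 * va * vb)"
        using c1 pos vb va by (simp add: nn_integral_cmult_indicator[OF mA] ennreal_mult[symmetric] ac_simps)
      finally show ?thesis .
    qed
    have 2: "ennreal (c2 * va * vb) \<le> (\<integral>\<^sup>+x. indicator ?B x * Qkill t (indicator ?A) x \<partial>lborel)"
    proof -
      have "ennreal (c2 * va) * indicator ?B x \<le> indicator ?B x * Qkill t (indicator ?A) x" for x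
      proof (cases "x \<in> ?B")
        case True
        have "ennreal (c2 * va) = (\<integral>\<^sup>+y. ennreal c2 * indicator ?A y \<partial>lborel)"
          using c1 c2 pos va by (simp add: nn_integral_cmult_indicator[OF mA] ennreal_mult)
        also have "\<dots> \<le> (\<integral>\<^sup>+y. ennreal (q t x y) * indicator ?A y \<partial>lborel)"
          using less_imp_le[OF sub(4)[OF _ True]] by (intro nn_integral_mono) (auto simp: indicator_def intro!: ennreal_leI)
        also have "\<dots> = Qkill t (indicator ?A) x"
          using BD True t by (intro q_int iA indicator_le_one) auto
        finally show ?thesis using True by simp
      qed simp
      then have "(\<integral>\<^sup>+x. ennreal (c2 * va) * indicator ?B x \<partial>lborel) \<le> (\<integral>\<^sup>+x. indicator ?B x * Qkill t (indicator ?A) x \<partial>lborel)"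
        by (rule nn_integral_mono)
      moreover have "(\<integral>\<^sup>+x. ennreal (c2 * va) * indicator ?B x \<partial>lborel) = ennreal (c2 * va * vb)"
        using c1 c2 pos vb va by (simp add: nn_integral_cmult_indicator[OF mB] ennreal_mult[symmetric] ac_simps)
      ultimately show ?thesis by simp
    qed
    have "(\<integral>\<^sup>+x. indicator ?A x * Qkill t (indicator ?B) x \<partial>lborel) = (\<integral>\<^sup>+x. indicator ?B x * Qkill t (indicator ?A) x \<partial>lborel)"
      by (intro Qkill_sym[OF t] iA iB indicator_le_one)
    with 1 2 have "ennreal (c2 * va * vb) \<le> ennreal (c1 * va * vb)" by simp
    then have "c2 * va * vb \<le> c1 * va * vb"
      using c1 pos va vb by (subst (asm) ennreal_le_iff) auto
    with c2 va vb show False by simp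
  qed
  from le[OF a b] le[OF b a] show ?thesis by simp
qed

lemma q_mass:
  assumes t: "0 < t" and x: "x \<in> D"
  shows "(\<integral>\<^sup>+y\<in>D. ennreal (q t x y) \<partial>lborel) \<le> 1"
  using q_int[OF x t, of "indicator D"] Qkill_le1[of "indicator D" t x] by (simp add: indicator_le_one)

text \<open>The semigroup property of \<open>Qkill\<close> identifies two densities almost
  everywhere. Both are continuous on \<open>D\<close>, the composed one \<open>h\<close> by
  dominated convergence with the bound on \<open>q t\<close>, so they agree at every point.\<close>

lemma q_Chapman_Kolmogorov:
  assumes good: "good_kernel D q" and s: "0 < s" and t: "0 < t" and x: "x \<in> D" and y: "y \<in> D"
  shows "(\<integral>\<^sup>+z\<in>D. ennreal (q s x z * q t z y) \<partial>lborel) = ennreal (q (s + t) x y)"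
proof -
  let ?q = "\<lambda>t x y. ennreal (q t x y) * indicator D x * indicator D y"
  note mq = kernel_measurable_nn[OF good]
  have [measurable]: "(\<lambda>y. ?q u x y) \<in> borel_measurable borel" if "0 < u" for u x
    using measurable_compose[OF _ mq[OF that], of "\<lambda>y. (x, y)" borel] by simp
  have [measurable]: "(\<lambda>z. ?q u z y) \<in> borel_measurable borel" if "0 < u" for u y
    using measurable_compose[OF _ mq[OF that], of "\<lambda>z. (z, y)" borel] by simp
  note [measurable] = mq[OF t]
  define h where "h y = (\<integral>\<^sup>+z. ?q s x z * ?q t z y \<partial>lborel)" for y
  have [measurable]: "(\<lambda>y. ?q (s + t) x y) \<in> borel_measurable borel" "(\<lambda>z. ?q s x z) \<in> borel_measurable borel"
    using s t by auto
  have m2 [measurable]: "(\<lambda>(z, y). ?q s x z * ?q t z y) \<in> borel_measurable (borel \<Otimes>\<^sub>M borel)"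
    by measurable
  have hm [measurable]: "h \<in> borel_measurable borel"
    unfolding h_def by measurable
  have "density lborel (\<lambda>y. ?q (s + t) x y) = density lborel h"
  proof (rule measure_eqI)
    fix B assume "B \<in> sets (density lborel (\<lambda>y. ?q (s + t) x y))"
    then have B [measurable]: "B \<in> sets borel" by simp
    let ?f = "indicator (B \<inter> D) :: 'a \<Rightarrow> ennreal"
    have f1: "?f y \<le> 1" for y by (simp add: indicator_def)
    have "emeasure (density lborel (\<lambda>y. ?q (s + t) x y)) B = (\<integral>\<^sup>+y. ?q (s + t) x y * indicator B y \<partial>lborel)"
      by (rule emeasure_density) auto
    also have "\<dots> = (\<integral>\<^sup>+y. ennreal (q (s + t) x y) * ?f y \<partial>lborel)"
      using x by (intro nn_integral_cong) (auto simp: indicator_def)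
    also have "\<dots> = Qkill (s + t) ?f x" using s t x f1 by (intro q_int) auto
    also have "\<dots> = Qkill s (Qkill t ?f) x" using s t f1 by (intro Qkill_semigroup) auto
    also have "\<dots> = (\<integral>\<^sup>+z. ennreal (q s x z) * Qkill t ?f z \<partial>lborel)"
      using s t x f1 by (intro q_int[symmetric] Qkill_measurable Qkill_le1) auto
    also have "\<dots> = (\<integral>\<^sup>+z. (\<integral>\<^sup>+y. ?q s x z * ?q t z y * indicator B y \<partial>lborel) \<partial>lborel)"
    proof (rule nn_integral_cong)
      fix z
      show "ennreal (q s x z) * Qkill t ?f z = (\<integral>\<^sup>+y. ?q s x z * ?q t z y * indicator B y \<partial>lborel)"
      proof (cases "z \<in> D")
        case True
        have "Qkill t ?f z = (\<integral>\<^sup>+y. ennreal (q t z y) * ?f y \<partial>lborel)"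
          using True t f1 by (intro q_int[symmetric]) auto
        also have "\<dots> = (\<integral>\<^sup>+y. ?q t z y * indicator B y \<partial>lborel)"
          using True by (intro nn_integral_cong) (auto simp: indicator_def)
        finally have "ennreal (q s x z) * Qkill t ?f z = ?q s x z * (\<integral>\<^sup>+y. ?q t z y * indicator B y \<partial>lborel)"
          using True x by simp
        also have "\<dots> = (\<integral>\<^sup>+y. ?q s x z * (?q t z y * indicator B y) \<partial>lborel)"
          by (rule nn_integral_cmult[symmetric]) (use t in measurable)
        finally show ?thesis by (simp only: mult.assoc)
      qed (simp add: Qkill_outside)
    qed
    also have "\<dots> = (\<integral>\<^sup>+y. (\<integral>\<^sup>+z. ?q s x z * ?q t z y * indicator B y \<partial>lborel) \<partial>lborel)"
      by (rule lborel_pair.Fubini'[symmetric]) (measurable)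
    also have "\<dots> = (\<integral>\<^sup>+y. h y * indicator B y \<partial>lborel)"
      unfolding h_def using s t by (intro nn_integral_cong nn_integral_multc) measurable
    also have "\<dots> = emeasure (density lborel h) B" by (rule emeasure_density[symmetric]) auto
    finally show "emeasure (density lborel (\<lambda>y. ?q (s + t) x y)) B = emeasure (density lborel h) B" .
  qed simp
  then have AE: "AE y in lborel. ?q (s + t) x y = h y"
    by (intro sigma_finite_measure.density_unique[OF lborel.sigma_finite_measure_axioms]) auto
  obtain M where M: "\<And>a b. a \<in> D \<Longrightarrow> b \<in> D \<Longrightarrow> \<bar>q t a b\<bar> \<le> M"
  proof -
    have "bounded ((\<lambda>z. q t (fst z) (snd z)) ` (D \<times> D))" using good t by (simp add: good_kernel_def)
    then obtain M where "\<forall>a\<in>D. \<forall>b\<in>D. \<bar>q t a b\<bar> \<le> M" unfolding bounded_iff by auto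
    then show ?thesis using that by blast
  qed
  have cq: "continuous_on (D \<times> D) (\<lambda>z. q u (fst z) (snd z))" if "0 < u" for u
    using good that by (simp add: good_kernel_def)
  have hc: "continuous_on D h"
    unfolding continuous_on_sequentially
  proof (intro allI ballI impI, elim conjE)
    fix ys b assume b: "b \<in> D" and ys: "\<forall>n. ys n \<in> D" "ys \<longlonglongrightarrow> b"
    show "(h \<circ> ys) \<longlonglongrightarrow> h b"
      unfolding comp_def h_def
    proof (rule nn_integral_dominated_convergence[where w="\<lambda>z. ?q s x z * ennreal M"])
      show "AE z in lborel. ?q s x z * ?q t z (ys n) \<le> ?q s x z * ennreal M" for n
      proof (intro AE_I2 mult_left_mono)
        fix z
        have "q t z (ys n) \<le> M" if "z \<in> D" using M[OF that, of "ys n"] ys(1) by auto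
        then show "?q t z (ys n) \<le> ennreal M" by (auto simp: indicator_def intro!: ennreal_leI)
      qed simp
      have "(\<integral>\<^sup>+z. ?q s x z * ennreal M \<partial>lborel) = (\<integral>\<^sup>+z. ?q s x z \<partial>lborel) * ennreal M"
        by (rule nn_integral_multc) measurable
      also have "(\<integral>\<^sup>+z. ?q s x z \<partial>lborel) \<le> 1" using q_mass[OF s x] x by simp
      then have "(\<integral>\<^sup>+z. ?q s x z \<partial>lborel) < \<top>" by (rule le_less_trans) simp
      then have "(\<integral>\<^sup>+z. ?q s x z \<partial>lborel) * ennreal M < \<infinity>"
        by (simp add: ennreal_mult_less_top)
      finally show "(\<integral>\<^sup>+z. ?q s x z * ennreal M \<partial>lborel) < \<infinity>" .
      show "AE z in lborel. (\<lambda>n. ?q s x z * ?q t z (ys n)) \<longlonglongrightarrow> ?q s x z * ?q t z b"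
      proof (rule AE_I2)
        fix z
        show "(\<lambda>n. ?q s x z * ?q t z (ys n)) \<longlonglongrightarrow> ?q s x z * ?q t z b"
        proof (cases "z \<in> D")
          case True
          have "continuous_on D ((\<lambda>z. q t (fst z) (snd z)) \<circ> (\<lambda>y. (z, y)))"
            using True t by (intro continuous_on_compose continuous_intros continuous_on_subset[OF cq]) auto
          then have "((\<lambda>y. q t z y) \<circ> ys) \<longlonglongrightarrow> q t z b"
            using b ys unfolding continuous_on_sequentially comp_def by simp
          then have "(\<lambda>n. q t z (ys n)) \<longlonglongrightarrow> q t z b" by (simp add: comp_def)
          then have "(\<lambda>n. ennreal (q s x z) * ennreal (q t z (ys n))) \<longlonglongrightarrow> ennreal (q s x z) * ennreal (q t z b)"
            by (intro ennreal_tendsto_cmult tendsto_ennrealI) auto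
          then show ?thesis using True x b ys(1) by simp
        qed simp
      qed
    qed (use t s in measurable)
  qed
  have "ennreal (q (s + t) x y) = h y"
  proof (rule continuous_AE_eq_imp_eq[OF open_D _ hc _ y])
    have "continuous_on D ((\<lambda>z. q (s + t) (fst z) (snd z)) \<circ> (\<lambda>y. (x, y)))"
      using x s t by (intro continuous_on_compose continuous_intros continuous_on_subset[OF cq]) auto
    then show "continuous_on D (\<lambda>y. ennreal (q (s + t) x y))"
      by (intro continuous_on_ennreal) (simp add: comp_def)
    show "AE y in lborel. y \<in> D \<longrightarrow> ennreal (q (s + t) x y) = h y"
      using AE by eventually_elim (use x in auto)
  qed
  also have "h y = (\<integral>\<^sup>+z\<in>D. ennreal (q s x z * q t z y) \<partial>lborel)"
    unfolding h_def using x y good s t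
    by (intro nn_integral_cong) (auto simp: indicator_def good_kernel_def ennreal_mult less_imp_le)
  finally show ?thesis by simp
qed

section \<open>Comparison with the form of the whole process\<close>

lemma q_le_p: "x \<in> D \<Longrightarrow> 0 < t \<Longrightarrow> q t x y \<le> p t x y"
  by (simp add: q_eq)

text \<open>Schur's argument: 2 u(x) u(y) \<le> u(x)^2 + u(y)^2 is integrated against a symmetric
  kernel of mass at most 1. It supplies the finiteness that permits subtraction in
  \<open>form_lower_bound\<close>.\<close>

lemma trans_op_form_le:
  assumes [measurable]: "u \<in> borel_measurable borel" and t: "0 < t"
  shows "(\<integral>\<^sup>+x. u x * trans_op (ennreal t) (case_option 0 u) (Some x) \<partial>lborel) \<le> (\<integral>\<^sup>+x. u x * u x \<partial>lborel)"
proof -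
  let ?P = "\<lambda>f x. trans_op (ennreal t) (case_option 0 f) (Some x)"
  have P1: "?P (\<lambda>_. 1) x \<le> 1" for x by (rule trans_op_le) (auto split: option.split)
  have le: "2 * (u x * ?P u x) \<le> u x * u x + ?P (\<lambda>y. u y * u y) x" for x
  proof -
    note [measurable] = p_measurable[OF t]
    have "2 * (u x * ?P u x) = (\<integral>\<^sup>+y. ennreal (p t x y) * (2 * (u x * u y)) \<partial>lborel)"
      unfolding trans_op_dens[OF assms(1) t]
      by (subst nn_integral_cmult[symmetric], simp, subst nn_integral_cmult[symmetric]) (auto simp: ac_simps)
    also have "\<dots> \<le> (\<integral>\<^sup>+y. ennreal (p t x y) * (u x * u x + u y * u y) \<partial>lborel)"
      by (intro nn_integral_mono mult_left_mono ennreal_AM_GM) auto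
    also have "\<dots> = (\<integral>\<^sup>+y. u x * u x * ennreal (p t x y) \<partial>lborel) + (\<integral>\<^sup>+y. ennreal (p t x y) * (u y * u y) \<partial>lborel)"
      by (subst nn_integral_add[symmetric]) (auto simp: distrib_left ac_simps)
    also have "(\<integral>\<^sup>+y. u x * u x * ennreal (p t x y) \<partial>lborel) = u x * u x * (\<integral>\<^sup>+y. ennreal (p t x y) \<partial>lborel)"
      by (rule nn_integral_cmult) simp
    also have "\<dots> \<le> u x * u x * 1" by (intro mult_left_mono p_le1 t) simp
    also have "(\<integral>\<^sup>+y. ennreal (p t x y) * (u y * u y) \<partial>lborel) = ?P (\<lambda>y. u y * u y) x"
      by (rule trans_op_dens[symmetric]) (use t in auto)
    finally show ?thesis by (simp add: add_right_mono)
  qed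
  have "2 * (\<integral>\<^sup>+x. u x * ?P u x \<partial>lborel) = (\<integral>\<^sup>+x. 2 * (u x * ?P u x) \<partial>lborel)"
    by (rule nn_integral_cmult[symmetric]) measurable
  also have "\<dots> \<le> (\<integral>\<^sup>+x. u x * u x + ?P (\<lambda>y. u y * u y) x \<partial>lborel)"
    by (intro nn_integral_mono le)
  also have "\<dots> = (\<integral>\<^sup>+x. u x * u x \<partial>lborel) + (\<integral>\<^sup>+x. 1 * ?P (\<lambda>y. u y * u y) x \<partial>lborel)"
    by (subst nn_integral_add) auto
  also have "(\<integral>\<^sup>+x. 1 * ?P (\<lambda>y. u y * u y) x \<partial>lborel) = (\<integral>\<^sup>+x. (u x * u x) * ?P (\<lambda>_. 1) x \<partial>lborel)"
    by (rule trans_op_sym[OF sym]) (use t in auto)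
  also have "\<dots> \<le> (\<integral>\<^sup>+x. (u x * u x) * 1 \<partial>lborel)"
    by (intro nn_integral_mono mult_left_mono P1) auto
  finally have "2 * (\<integral>\<^sup>+x. u x * ?P u x \<partial>lborel) \<le> 2 * (\<integral>\<^sup>+x. u x * u x \<partial>lborel)"
    by (simp add: mult_2 add_left_mono)
  then show ?thesis by (subst (asm) ennreal_mult_le_mult_iff) auto
qed

text \<open>As \<open>q\<close> is at most \<open>p\<close> and \<open>u\<close> is nonnegative, the
  approximating form of \<open>X\<close> at the times \<open>\<delta> n\<close> is at most that of
  the killed semigroup, hence at most \<open>C\<close>. Its limit is infinite off
  \<open>form_domain J\<close>, so the finite bound also decides membership.\<close>

lemma form_lower_bound:
  assumes X_form: "semigroup_form (process_semigroup X P) (form_domain J) (energy J)"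
    and u: "u \<in> L2 D" and u0: "\<And>x. 0 \<le> u x" and C: "0 \<le> C"
    and d: "\<And>n::nat. 0 < \<delta> n" "\<delta> \<longlonglongrightarrow> 0"
    and le: "\<And>n. (\<integral>\<^sup>+x. ennreal ((u x)\<^sup>2) \<partial>lborel) \<le> ennreal (C * \<delta> n) +
         (\<integral>\<^sup>+x\<in>D. ennreal (u x) * (\<integral>\<^sup>+y\<in>D. ennreal (q (\<delta> n) x y * u y) \<partial>lborel) \<partial>lborel)"
  shows "energy J u \<le> ennreal C"
proof -
  have um [measurable]: "u \<in> borel_measurable borel" and ui: "integrable lborel (\<lambda>x. (u x)\<^sup>2)"
    and uz: "\<And>x. x \<notin> D \<Longrightarrow> u x = 0" using u by (auto simp: L2_def)
  let ?T = "process_semigroup X P"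
  let ?u = "\<lambda>x. ennreal (u x)"
  let ?w = "\<lambda>t x. trans_op (ennreal t) (case_option 0 ?u) (Some x)"
  have Tw: "?T t u x = enn2real (?w t x)" for t x
  proof -
    have "?T t u x = enn2real (\<integral>\<^sup>+\<omega>. ennreal (case_option 0 u (X (ennreal t) \<omega>)) \<partial>P (Some x))"
      unfolding process_semigroup_def by (rule integral_eq_nn_integral) (auto simp: u0 split: option.split)
    also have "(\<integral>\<^sup>+\<omega>. ennreal (case_option 0 u (X (ennreal t) \<omega>)) \<partial>P (Some x)) = ?w t x"
      unfolding trans_op_def by (intro nn_integral_cong) (auto split: option.split)
    finally show ?thesis .
  qed
  have I2: "(\<integral>\<^sup>+x. ennreal ((u x)\<^sup>2) \<partial>lborel) = ennreal (\<integral>x. (u x)\<^sup>2 \<partial>lborel)"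
    by (rule nn_integral_eq_integral[OF ui]) simp
  have bound: "(\<integral>x. (u x - ?T t u x) * u x \<partial>lborel) \<le> C * t"
    if t: "0 < t" and le: "(\<integral>\<^sup>+x. ennreal ((u x)\<^sup>2) \<partial>lborel) \<le> ennreal (C * t) +
         (\<integral>\<^sup>+x\<in>D. ennreal (u x) * (\<integral>\<^sup>+y\<in>D. ennreal (q t x y * u y) \<partial>lborel) \<partial>lborel)" for t
  proof -
    have sq: "?u x * ?u x = ennreal ((u x)\<^sup>2)" for x
      using u0[of x] by (simp add: ennreal_mult[symmetric] power2_eq_square)
    have W: "(\<integral>\<^sup>+x. ?u x * ?w t x \<partial>lborel) \<le> ennreal (\<integral>x. (u x)\<^sup>2 \<partial>lborel)"
      using trans_op_form_le[of ?u t] t unfolding sq I2 by simp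
    then have Wfin: "(\<integral>\<^sup>+x. ?u x * ?w t x \<partial>lborel) < \<top>" by (rule le_less_trans) simp
    then have "AE x in lborel. ?u x * ?w t x \<noteq> \<infinity>"
      by (intro nn_integral_PInf_AE) auto
    then have ae: "AE x in lborel. ?u x * ?w t x = ennreal (?T t u x * u x)"
    proof eventually_elim
      case (elim x)
      show ?case
      proof (cases "u x = 0")
        case False
        then have "0 < u x" using u0[of x] by simp
        then have "?w t x \<noteq> \<top>" using elim by (auto simp: ennreal_mult_top)
        then show ?thesis unfolding Tw
          by (cases "?w t x") (auto simp: ennreal_mult[symmetric] u0 mult.commute)
      qed simp
    qed
    have T0: "0 \<le> ?T t u x" for x by (simp add: Tw)
    have Tm [measurable]: "?T t u \<in> borel_measurable borel" unfolding Tw[abs_def] by measurable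
    have NW: "(\<integral>\<^sup>+x. ?u x * ?w t x \<partial>lborel) = (\<integral>\<^sup>+x. ennreal (?T t u x * u x) \<partial>lborel)"
      by (rule nn_integral_cong_AE[OF ae])
    have Ti: "integrable lborel (\<lambda>x. ?T t u x * u x)"
      by (rule integrableI_nonneg) (use Wfin NW T0 u0 in \<open>auto simp: less_top\<close>)
    have NI: "(\<integral>\<^sup>+x. ?u x * ?w t x \<partial>lborel) = ennreal (\<integral>x. ?T t u x * u x \<partial>lborel)"
      unfolding NW by (rule nn_integral_eq_integral[OF Ti]) (use T0 u0 in auto)
    have "(\<integral>\<^sup>+x\<in>D. ennreal (u x) * (\<integral>\<^sup>+y\<in>D. ennreal (q t x y * u y) \<partial>lborel) \<partial>lborel)
       \<le> (\<integral>\<^sup>+x. ?u x * ?w t x \<partial>lborel)"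
    proof (rule nn_integral_mono)
      fix x
      show "ennreal (u x) * (\<integral>\<^sup>+y\<in>D. ennreal (q t x y * u y) \<partial>lborel) * indicator D x \<le> ?u x * ?w t x"
      proof (cases "x \<in> D")
        case True
        have "(\<integral>\<^sup>+y\<in>D. ennreal (q t x y * u y) \<partial>lborel) \<le> (\<integral>\<^sup>+y. ennreal (p t x y) * ?u y \<partial>lborel)"
        proof (rule nn_integral_mono)
          fix y
          have "q t x y * u y \<le> p t x y * u y" using q_le_p[OF True t, of y] u0[of y] by (rule mult_right_mono)
          then show "ennreal (q t x y * u y) * indicator D y \<le> ennreal (p t x y) * ?u y"
            using p_nonneg[OF t, of x y] u0[of y] by (auto simp: indicator_def ennreal_mult[symmetric] intro!: ennreal_leI)
        qed
        also have "\<dots> = ?w t x" by (rule trans_op_dens[symmetric]) (use t in auto)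
        finally show ?thesis using True by (simp add: mult_left_mono)
      qed simp
    qed
    with le have "ennreal (\<integral>x. (u x)\<^sup>2 \<partial>lborel) \<le> ennreal (C * t) + ennreal (\<integral>x. ?T t u x * u x \<partial>lborel)"
      unfolding I2 NI using add_left_mono order_trans by blast
    also have "\<dots> = ennreal (C * t + (\<integral>x. ?T t u x * u x \<partial>lborel))"
      using C t T0 u0 by (subst ennreal_plus) (auto intro!: integral_nonneg_AE)
    finally have 1: "(\<integral>x. (u x)\<^sup>2 \<partial>lborel) \<le> C * t + (\<integral>x. ?T t u x * u x \<partial>lborel)"
      using C t T0 u0 by (subst (asm) ennreal_le_iff) (auto intro!: add_nonneg_nonneg integral_nonneg_AE)
    have "(\<integral>x. (u x - ?T t u x) * u x \<partial>lborel) = (\<integral>x. (u x)\<^sup>2 - ?T t u x * u x \<partial>lborel)"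
      by (intro Bochner_Integration.integral_cong) (auto simp: power2_eq_square left_diff_distrib)
    also have "\<dots> = (\<integral>x. (u x)\<^sup>2 \<partial>lborel) - (\<integral>x. ?T t u x * u x \<partial>lborel)"
      using ui Ti by (rule Bochner_Integration.integral_diff)
    finally show ?thesis using 1 by simp
  qed
  have "u \<in> L2 UNIV" using u by (auto simp: L2_def)
  then have "((\<lambda>t. ereal ((\<integral>x. (u x - ?T t u x) * u x \<partial>lborel) / t))
        \<longlongrightarrow> (if u \<in> form_domain J then enn2ereal (energy J u) else \<infinity>)) (at_right 0)"
    using X_form unfolding semigroup_form_def by blast
  moreover have "filterlim \<delta> (at_right 0) sequentially"
    unfolding filterlim_at using d by (auto intro!: always_eventually simp: less_imp_neq[THEN not_sym])
  ultimately have lim: "(\<lambda>n. ereal ((\<integral>x. (u x - ?T (\<delta> n) u x) * u x \<partial>lborel) / \<delta> n))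
     \<longlonglongrightarrow> (if u \<in> form_domain J then enn2ereal (energy J u) else \<infinity>)"
    by (rule filterlim_compose)
  have "(if u \<in> form_domain J then enn2ereal (energy J u) else \<infinity>) \<le> ereal C"
  proof (rule LIMSEQ_le_const2[OF lim], intro exI allI impI)
    fix n
    show "ereal ((\<integral>x. (u x - ?T (\<delta> n) u x) * u x \<partial>lborel) / \<delta> n) \<le> ereal C"
      using bound[OF d(1) le, of n] d(1)[of n] by (simp add: pos_divide_le_eq)
  qed
  then have "enn2ereal (energy J u) \<le> ereal C" by (auto split: if_splits)
  then show ?thesis using C by (simp add: ennreal.rep_eq less_eq_ennreal.rep_eq max_def enn2ereal_ennreal)
qed

lemma dirichlet_kernel:
  assumes "semigroup_form (process_semigroup X P) (form_domain J) (energy J)"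
    and "D \<noteq> {}" "good_kernel D q"
  shows "dirichlet_kernel D q (energy J)"
proof (unfold_locales, goal_cases)
  case (4 t x) then show ?case by (rule q_mass)
next
  case (7 u C \<delta>) then show ?case by (intro form_lower_bound[OF assms(1)])
qed (use assms open_D in \<open>auto intro: q_symmetric q_Chapman_Kolmogorov\<close>)

end

section \<open>The inner product of square integrable functions\<close>

definition ip :: "('a::euclidean_space \<Rightarrow> real) \<Rightarrow> ('a \<Rightarrow> real) \<Rightarrow> real" where
  "ip f g = (\<integral>x. f x * g x \<partial>lborel)"

lemma ip_commute: "ip f g = ip g f"
  by (simp add: ip_def mult.commute)

lemma L2_D:
  assumes "f \<in> L2 D"
  shows L2_measurable: "f \<in> borel_measurable borel" and L2_outside: "x \<notin> D \<Longrightarrow> f x = 0"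
    and L2_integrable: "integrable lborel (\<lambda>x. (f x)\<^sup>2)"
  using assms by (auto simp: L2_def)

lemma L2I:
  assumes "f \<in> borel_measurable borel" "\<And>x. x \<notin> D \<Longrightarrow> f x = 0" "(\<integral>\<^sup>+x. ennreal ((f x)\<^sup>2) \<partial>lborel) < \<top>"
  shows "f \<in> L2 D"
  unfolding L2_def using assms by (auto intro!: integrableI_nonneg)

lemma L2_prod_integrable:
  assumes f: "f \<in> L2 D" and g: "g \<in> L2 D" shows "integrable lborel (\<lambda>x. f x * g x)"
proof (rule Bochner_Integration.integrable_bound)
  show "integrable lborel (\<lambda>x. (f x)\<^sup>2 + (g x)\<^sup>2)"
    using L2_integrable[OF f] L2_integrable[OF g] by simp
  show "(\<lambda>x. f x * g x) \<in> borel_measurable lborel"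
    using L2_measurable[OF f] L2_measurable[OF g] by simp
  show "AE x in lborel. norm (f x * g x) \<le> norm ((f x)\<^sup>2 + (g x)\<^sup>2)"
  proof (rule AE_I2)
    fix x
    have "2 * (\<bar>f x\<bar> * \<bar>g x\<bar>) \<le> (f x)\<^sup>2 + (g x)\<^sup>2"
      using sum_squares_bound[of "\<bar>f x\<bar>" "\<bar>g x\<bar>"] by (simp add: mult.assoc)
    moreover have "0 \<le> \<bar>f x\<bar> * \<bar>g x\<bar>" by simp
    ultimately have "\<bar>f x\<bar> * \<bar>g x\<bar> \<le> (f x)\<^sup>2 + (g x)\<^sup>2" by linarith
    then show "norm (f x * g x) \<le> norm ((f x)\<^sup>2 + (g x)\<^sup>2)"
      by (simp add: abs_mult)
  qed
qed

lemma L2_lincomb: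
  assumes f: "f \<in> L2 D" and g: "g \<in> L2 D" shows "(\<lambda>x. a * f x + b * g x) \<in> L2 D"
  unfolding L2_def
proof (intro CollectI conjI allI impI)
  show "(\<lambda>x. a * f x + b * g x) \<in> borel_measurable borel"
    using L2_measurable[OF f] L2_measurable[OF g] by simp
  show "integrable lborel (\<lambda>x. (a * f x + b * g x)\<^sup>2)"
  proof -
    have "(\<lambda>x. (a * f x + b * g x)\<^sup>2) = (\<lambda>x. a\<^sup>2 * (f x)\<^sup>2 + 2 * a * b * (f x * g x) + b\<^sup>2 * (g x)\<^sup>2)"
      by (auto simp: power2_eq_square algebra_simps)
    then show ?thesis using L2_integrable[OF f] L2_integrable[OF g] L2_prod_integrable[OF f g] by simp
  qed
qed (use L2_outside[OF f] L2_outside[OF g] in auto)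

lemma L2_diff: "f \<in> L2 D \<Longrightarrow> g \<in> L2 D \<Longrightarrow> (\<lambda>x. f x - g x) \<in> L2 D"
  using L2_lincomb[of f D g 1 "-1"] by simp

lemma L2_scale: "f \<in> L2 D \<Longrightarrow> (\<lambda>x. c * f x) \<in> L2 D"
  using L2_lincomb[of f D f c 0] by simp

lemma L2_abs: "f \<in> L2 D \<Longrightarrow> (\<lambda>x. \<bar>f x\<bar>) \<in> L2 D"
  by (auto simp: L2_def)

lemma ip_lincomb:
  assumes f: "f \<in> L2 D" and g: "g \<in> L2 D" and h: "h \<in> L2 D"
  shows "ip (\<lambda>x. a * f x + b * g x) h = a * ip f h + b * ip g h"
proof -
  have "ip (\<lambda>x. a * f x + b * g x) h = (\<integral>x. a * (f x * h x) + b * (g x * h x) \<partial>lborel)"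
    unfolding ip_def by (simp add: algebra_simps)
  then show ?thesis
    unfolding ip_def using L2_prod_integrable[OF f h] L2_prod_integrable[OF g h] by simp
qed

lemma ip_diff:
  assumes "f \<in> L2 D" "g \<in> L2 D" "h \<in> L2 D"
  shows "ip (\<lambda>x. f x - g x) h = ip f h - ip g h" "ip h (\<lambda>x. f x - g x) = ip h f - ip h g"
  using ip_lincomb[OF assms, of 1 "-1"] ip_commute[of h] by simp_all

lemma ip_scale: "ip (\<lambda>x. c * f x) g = c * ip f g" "ip g (\<lambda>x. c * f x) = c * ip g f"
  unfolding ip_def by (simp_all add: mult.assoc mult.left_commute)

lemma ip_self_nonneg: "0 \<le> ip f f"
  unfolding ip_def by (rule integral_nonneg_AE) simp

lemma ip_diff_self:
  assumes "f \<in> L2 D" "g \<in> L2 D"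
  shows "ip (\<lambda>x. f x - g x) (\<lambda>x. f x - g x) = ip f f - 2 * ip f g + ip g g"
  using ip_diff[OF assms L2_diff[OF assms]] ip_diff[OF assms assms(1)] ip_diff[OF assms assms(2)] ip_commute[of f g] by simp

lemma ip_Cauchy_Schwarz:
  assumes f: "f \<in> L2 D" and g: "g \<in> L2 D"
  shows "(ip f g)\<^sup>2 \<le> ip f f * ip g g"
proof -
  have *: "0 \<le> ip f f - 2 * t * ip f g + t\<^sup>2 * ip g g" for t
    using ip_self_nonneg[of "\<lambda>x. f x - t * g x"] ip_diff_self[OF f L2_scale[OF g, of t]]
    by (simp add: ip_scale power2_eq_square mult.assoc)
  show ?thesis
  proof (cases "ip g g = 0")
    case True
    have "ip f g = 0"
    proof (rule ccontr)
      assume "ip f g \<noteq> 0"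
      \<comment> \<open>With \<open>ip g g = 0\<close> the quadratic polynomial is affine in
        \<open>t\<close>; at this argument its value is -1.\<close>
      then show False using *[of "(ip f f + 1) / (2 * ip f g)"] True by (simp add: field_simps)
    qed
    then show ?thesis using True by simp
  next
    case False
    then have pos: "0 < ip g g" using ip_self_nonneg[of g] by simp
    have "0 \<le> ip f f - (ip f g)\<^sup>2 / ip g g"
      using *[of "ip f g / ip g g"] pos by (simp add: power2_eq_square field_simps)
    then show ?thesis using pos by (simp add: field_simps)
  qed
qed

lemma ip_abs_le:
  assumes f: "f \<in> L2 D" and g: "g \<in> L2 D"
  shows "\<bar>ip f g\<bar> \<le> sqrt (ip f f) * sqrt (ip g g)"
  using real_sqrt_le_mono[OF ip_Cauchy_Schwarz[OF assms]] by (simp add: real_sqrt_mult)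

lemma sq_norm_eq_ip: "f \<in> L2 D \<Longrightarrow> sq_norm f = ennreal (ip f f)"
  unfolding sq_norm_def ip_def using nn_integral_eq_integral[OF L2_integrable]
  by (auto simp: power2_eq_square)

lemma ip_self_eq_0:
  assumes f: "f \<in> L2 D" and "ip f f = 0" shows "AE x in lborel. f x = 0"
proof -
  have "sq_norm f = 0" using sq_norm_eq_ip[OF f] assms(2) by simp
  then have "AE x in lborel. ennreal ((f x)\<^sup>2) = 0"
    unfolding sq_norm_def using L2_measurable[OF f] by (subst (asm) nn_integral_0_iff_AE) auto
  then show ?thesis by eventually_elim (simp add: ennreal_eq_0_iff)
qed

lemma ip_cong_AE:
  assumes "AE x in lborel. f x = f' x" "f \<in> L2 D" "f' \<in> L2 D" "g \<in> L2 D"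
  shows "ip f g = ip f' g"
  unfolding ip_def
proof (rule integral_cong_AE)
  show "AE x in lborel. f x * g x = f' x * g x" using assms(1) by eventually_elim simp
qed (use assms(2-4)[THEN L2_measurable] in auto)

lemma ip_mono:
  assumes "f \<in> L2 D" "f' \<in> L2 D" "g \<in> L2 D" "\<And>x. f x \<le> f' x" "\<And>x. 0 \<le> g x"
  shows "ip f g \<le> ip f' g"
  unfolding ip_def
  using assms by (intro integral_mono L2_prod_integrable[of _ D] mult_right_mono) auto

lemma ip_abs_self: "ip (\<lambda>x. \<bar>f x\<bar>) (\<lambda>x. \<bar>f x\<bar>) = ip f f"
  by (simp add: ip_def)

section \<open>The operators of a Dirichlet heat kernel\<close>

context dirichlet_kernel begin

abbreviation T :: "real \<Rightarrow> ('a \<Rightarrow> real) \<Rightarrow> 'a \<Rightarrow> real" where "T \<equiv> kernel_semigroup D q"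

text \<open>For \<open>x\<close> in \<open>D\<close> the row is an element of \<open>L2 D\<close>,
  to be used in inner products; \<open>kernel_ext\<close> below is the same kernel as a jointly
  measurable symmetric function, for Fubini arguments.\<close>

definition kernel_row :: "real \<Rightarrow> 'a \<Rightarrow> 'a \<Rightarrow> real" where "kernel_row t x y = (if y \<in> D then q t x y else 0)"

definition kernel_ext :: "real \<Rightarrow> 'a \<times> 'a \<Rightarrow> real" where "kernel_ext t z = indicator (D \<times> D) z * q t (fst z) (snd z)"

lemma q_pos: "0 < t \<Longrightarrow> x \<in> D \<Longrightarrow> y \<in> D \<Longrightarrow> 0 < q t x y"
  using good by (simp add: good_kernel_def)

lemma q_bound:
  assumes "0 < t" obtains M where "0 \<le> M" "\<And>x y. x \<in> D \<Longrightarrow> y \<in> D \<Longrightarrow> q t x y \<le> M"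
proof -
  have "bounded ((\<lambda>z. q t (fst z) (snd z)) ` (D \<times> D))" using good assms by (simp add: good_kernel_def)
  then obtain M where "\<forall>x\<in>D. \<forall>y\<in>D. \<bar>q t x y\<bar> \<le> M" unfolding bounded_iff by auto
  then show ?thesis using that[of "max 0 M"] by (fastforce simp: le_max_iff_disj abs_le_iff)
qed

lemma kernel_ext_measurable [measurable]: "0 < t \<Longrightarrow> kernel_ext t \<in> borel_measurable (borel \<Otimes>\<^sub>M borel)"
  using kernel_measurable_pair[OF open_D good] by (simp add: kernel_ext_def[abs_def])

lemma kernel_ext_nonneg: "0 < t \<Longrightarrow> 0 \<le> kernel_ext t z"
  using q_pos[of t "fst z" "snd z"] by (auto simp: kernel_ext_def indicator_def less_imp_le)

lemma kernel_row_eq_kernel_ext: "x \<in> D \<Longrightarrow> kernel_row t x y = kernel_ext t (x, y)"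
  by (simp add: kernel_row_def kernel_ext_def indicator_def)

lemma kernel_ext_sym: "0 < t \<Longrightarrow> kernel_ext t (x, y) = kernel_ext t (y, x)"
  using q_sym[of t x y] by (cases "x \<in> D \<and> y \<in> D") (auto simp: kernel_ext_def indicator_def)

lemma kernel_row_nonneg: "0 < t \<Longrightarrow> x \<in> D \<Longrightarrow> 0 \<le> kernel_row t x y"
  using q_pos[of t x y] by (simp add: kernel_row_def less_imp_le)

lemma kernel_row_measurable [measurable]:
  assumes "0 < t" "x \<in> D" shows "kernel_row t x \<in> borel_measurable borel"
proof -
  have "(\<lambda>y. kernel_ext t (x, y)) \<in> borel_measurable borel"
    using measurable_compose[OF _ kernel_ext_measurable[OF assms(1)], of "\<lambda>y. (x, y)" borel] by simp
  moreover have "kernel_row t x = (\<lambda>y. kernel_ext t (x, y))" using kernel_row_eq_kernel_ext[OF assms(2)] by blast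
  ultimately show ?thesis by simp
qed

lemma kernel_row_nn_prod:
  assumes "0 < s" "0 < t" "x \<in> D" "y \<in> D"
  shows "(\<integral>\<^sup>+z. ennreal (kernel_row s x z * kernel_row t y z) \<partial>lborel) = ennreal (q (s + t) x y)"
  unfolding Chapman_Kolmogorov[OF assms, symmetric]
proof (rule nn_integral_cong)
  fix z
  show "ennreal (kernel_row s x z * kernel_row t y z) = ennreal (q s x z * q t z y) * indicator D z"
    using q_sym[OF assms(2,4), of z] by (cases "z \<in> D") (simp_all add: kernel_row_def)
qed

lemma kernel_row_L2: "0 < t \<Longrightarrow> x \<in> D \<Longrightarrow> kernel_row t x \<in> L2 D"
proof (rule L2I)
  assume *: "0 < t" "x \<in> D"
  show "(\<integral>\<^sup>+y. ennreal ((kernel_row t x y)\<^sup>2) \<partial>lborel) < \<top>"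
    using kernel_row_nn_prod[OF *(1,1,2,2)] by (simp add: power2_eq_square)
qed (auto simp: kernel_row_def)

text \<open>Chapman-Kolmogorov combined with symmetry: the rows reproduce the kernel at the sum of
  the times. Pointwise bounds on \<open>T t f\<close> thereby become Cauchy-Schwarz estimates whose
  constants are values of \<open>q\<close>.\<close>

lemma ip_kernel_row:
  assumes "0 < s" "0 < t" "x \<in> D" "y \<in> D"
  shows "ip (kernel_row s x) (kernel_row t y) = q (s + t) x y"
proof -
  have "ennreal (ip (kernel_row s x) (kernel_row t y)) = (\<integral>\<^sup>+z. ennreal (kernel_row s x z * kernel_row t y z) \<partial>lborel)"
    unfolding ip_def
    by (rule nn_integral_eq_integral[symmetric] L2_prod_integrable kernel_row_L2 | use assms kernel_row_nonneg in force)+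
  then have "ennreal (ip (kernel_row s x) (kernel_row t y)) = ennreal (q (s + t) x y)"
    using kernel_row_nn_prod[OF assms] by simp
  moreover have "0 \<le> ip (kernel_row s x) (kernel_row t y)"
    unfolding ip_def using assms kernel_row_nonneg by (intro integral_nonneg_AE) auto
  ultimately show ?thesis using q_pos[of "s + t" x y] assms by simp
qed

lemma T_eq: "T t f x = (if x \<in> D then ip (kernel_row t x) f else 0)"
  unfolding kernel_semigroup_def ip_def set_lebesgue_integral_def
  by (auto intro!: Bochner_Integration.integral_cong simp: kernel_row_def indicator_def)

lemma T_kernel_ext: "T t f x = (\<integral>y. kernel_ext t (x, y) * f y \<partial>lborel)"
  unfolding T_eq ip_def by (auto intro!: Bochner_Integration.integral_cong simp: kernel_row_eq_kernel_ext) (simp add: kernel_ext_def)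

lemma T_measurable:
  assumes "0 < t" and [measurable]: "f \<in> borel_measurable borel"
  shows "T t f \<in> borel_measurable borel"
proof -
  note [measurable] = kernel_ext_measurable[OF assms(1)]
  show ?thesis unfolding T_kernel_ext[abs_def] by measurable
qed

lemma kernel_ext_mass:
  assumes t: "0 < t" shows "(\<integral>\<^sup>+y. ennreal (kernel_ext t (x, y)) \<partial>lborel) \<le> 1"
proof (cases "x \<in> D")
  case True
  then have "(\<integral>\<^sup>+y. ennreal (kernel_ext t (x, y)) \<partial>lborel) = (\<integral>\<^sup>+y\<in>D. ennreal (q t x y) \<partial>lborel)"
    by (intro nn_integral_cong) (auto simp: kernel_ext_def indicator_def)
  then show ?thesis using mass[OF t True] by simp
qed (simp add: kernel_ext_def)

text \<open>Jensen's inequality for a kernel of mass at most 1, obtained by expanding the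
  nonnegative integral of \<open>kernel_ext t (x, y) * (f y - m)\<^sup>2\<close> with
  \<open>m = T t f x\<close>.\<close>

lemma T_square_le:
  assumes t: "0 < t" and f: "f \<in> L2 D"
  shows "ennreal ((T t f x)\<^sup>2) \<le> (\<integral>\<^sup>+y. ennreal (kernel_ext t (x, y)) * ennreal ((f y)\<^sup>2) \<partial>lborel)"
proof (cases "x \<in> D")
  case True
  note [measurable] = L2_measurable[OF f] kernel_ext_measurable[OF t]
  have qm [measurable]: "(\<lambda>y. kernel_ext t (x, y)) \<in> borel_measurable borel" by measurable
  let ?k = "\<lambda>y. kernel_ext t (x, y)"
  obtain M where M: "0 \<le> M" "\<And>x y. x \<in> D \<Longrightarrow> y \<in> D \<Longrightarrow> q t x y \<le> M" using q_bound[OF t] by blast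
  have kM: "?k y \<le> M" for y using M True by (auto simp: kernel_ext_def indicator_def)
  have k0: "0 \<le> ?k y" for y using kernel_ext_nonneg[OF t] .
  have ik: "integrable lborel ?k"
    by (rule integrableI_nonneg) (use k0 kernel_ext_mass[OF t, of x] in \<open>auto intro: le_less_trans\<close>)
  have ik1: "(\<integral>y. ?k y \<partial>lborel) \<le> 1"
    using kernel_ext_mass[OF t, of x] nn_integral_eq_integral[OF ik] k0 by simp
  have ikf: "integrable lborel (\<lambda>y. ?k y * f y)"
    using L2_prod_integrable[OF kernel_row_L2[OF t True] f] by (simp add: kernel_row_eq_kernel_ext[OF True])
  have ikf2: "integrable lborel (\<lambda>y. ?k y * (f y)\<^sup>2)"
  proof (rule Bochner_Integration.integrable_bound)
    show "integrable lborel (\<lambda>y. M * (f y)\<^sup>2)" using L2_integrable[OF f] by simp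
    show "AE y in lborel. norm (?k y * (f y)\<^sup>2) \<le> norm (M * (f y)\<^sup>2)"
      using k0 kM M(1) by (auto intro!: mult_right_mono simp: abs_mult)
  qed measurable
  let ?m = "T t f x"
  have m: "?m = (\<integral>y. ?k y * f y \<partial>lborel)" by (rule T_kernel_ext)
  have "0 \<le> (\<integral>y. ?k y * (f y - ?m)\<^sup>2 \<partial>lborel)" using k0 by (intro integral_nonneg_AE) auto
  also have "(\<integral>y. ?k y * (f y - ?m)\<^sup>2 \<partial>lborel) = (\<integral>y. ?k y * (f y)\<^sup>2 - 2 * ?m * (?k y * f y) + ?m\<^sup>2 * ?k y \<partial>lborel)"
    by (intro Bochner_Integration.integral_cong) (auto simp: power2_eq_square algebra_simps)
  also have "\<dots> = (\<integral>y. ?k y * (f y)\<^sup>2 \<partial>lborel) - 2 * ?m * ?m + ?m\<^sup>2 * (\<integral>y. ?k y \<partial>lborel)"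
    using ik ikf ikf2 m by simp
  also have "\<dots> \<le> (\<integral>y. ?k y * (f y)\<^sup>2 \<partial>lborel) - 2 * ?m * ?m + ?m\<^sup>2 * 1"
    using ik1 by (intro add_left_mono mult_left_mono) auto
  finally have "?m\<^sup>2 \<le> (\<integral>y. ?k y * (f y)\<^sup>2 \<partial>lborel)" by (simp add: power2_eq_square)
  then have "ennreal (?m\<^sup>2) \<le> ennreal (\<integral>y. ?k y * (f y)\<^sup>2 \<partial>lborel)" by (rule ennreal_leI)
  also have "\<dots> = (\<integral>\<^sup>+y. ennreal (?k y * (f y)\<^sup>2) \<partial>lborel)"
    using k0 by (intro nn_integral_eq_integral[symmetric] ikf2) auto
  also have "\<dots> = (\<integral>\<^sup>+y. ennreal (?k y) * ennreal ((f y)\<^sup>2) \<partial>lborel)"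
    using k0 by (simp add: ennreal_mult)
  finally show ?thesis .
qed (simp add: T_eq)

lemma T_contraction_nn:
  assumes t: "0 < t" and f: "f \<in> L2 D"
  shows "(\<integral>\<^sup>+x. ennreal ((T t f x)\<^sup>2) \<partial>lborel) \<le> (\<integral>\<^sup>+x. ennreal ((f x)\<^sup>2) \<partial>lborel)"
proof -
  note [measurable] = L2_measurable[OF f] kernel_ext_measurable[OF t]
  have "(\<integral>\<^sup>+x. ennreal ((T t f x)\<^sup>2) \<partial>lborel) \<le> (\<integral>\<^sup>+x. (\<integral>\<^sup>+y. ennreal (kernel_ext t (x, y)) * ennreal ((f y)\<^sup>2) \<partial>lborel) \<partial>lborel)"
    by (intro nn_integral_mono T_square_le assms)
  also have "\<dots> = (\<integral>\<^sup>+y. (\<integral>\<^sup>+x. ennreal (kernel_ext t (x, y)) * ennreal ((f y)\<^sup>2) \<partial>lborel) \<partial>lborel)"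
    by (rule lborel_pair.Fubini'[symmetric]) measurable
  also have "\<dots> \<le> (\<integral>\<^sup>+y. ennreal ((f y)\<^sup>2) \<partial>lborel)"
  proof (rule nn_integral_mono)
    fix y
    have "(\<integral>\<^sup>+x. ennreal (kernel_ext t (x, y)) * ennreal ((f y)\<^sup>2) \<partial>lborel) = (\<integral>\<^sup>+x. ennreal (kernel_ext t (y, x)) \<partial>lborel) * ennreal ((f y)\<^sup>2)"
      unfolding kernel_ext_sym[OF t, of _ y] by (rule nn_integral_multc) measurable
    also have "\<dots> \<le> 1 * ennreal ((f y)\<^sup>2)" by (intro mult_right_mono kernel_ext_mass t) simp
    finally show "(\<integral>\<^sup>+x. ennreal (kernel_ext t (x, y)) * ennreal ((f y)\<^sup>2) \<partial>lborel) \<le> ennreal ((f y)\<^sup>2)" by simp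
  qed
  finally show ?thesis .
qed

lemma T_L2:
  assumes t: "0 < t" and f: "f \<in> L2 D" shows "T t f \<in> L2 D"
proof (rule L2I)
  show "(\<integral>\<^sup>+x. ennreal ((T t f x)\<^sup>2) \<partial>lborel) < \<top>"
    using T_contraction_nn[OF assms] sq_norm_eq_ip[OF f] unfolding sq_norm_def by (auto intro: le_less_trans)
qed (use T_measurable[OF t L2_measurable[OF f]] in \<open>auto simp: T_eq\<close>)

lemma T_contraction:
  assumes t: "0 < t" and f: "f \<in> L2 D" shows "ip (T t f) (T t f) \<le> ip f f"
  using T_contraction_nn[OF assms] sq_norm_eq_ip[OF f] sq_norm_eq_ip[OF T_L2[OF assms]]
  unfolding sq_norm_def by (simp add: ip_self_nonneg)

lemma T_form_nn:
  assumes t: "0 < t" and f: "f \<in> L2 D" and g: "g \<in> L2 D" and f0: "\<And>x. 0 \<le> f x" and g0: "\<And>x. 0 \<le> g x"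
  shows "(\<integral>\<^sup>+x. (\<integral>\<^sup>+y. ennreal (kernel_ext t (x, y) * f y * g x) \<partial>lborel) \<partial>lborel) = ennreal (ip (T t f) g)"
proof -
  note [measurable] = L2_measurable[OF f] L2_measurable[OF g] kernel_ext_measurable[OF t]
  have "(\<integral>\<^sup>+y. ennreal (kernel_ext t (x, y) * f y * g x) \<partial>lborel) = ennreal (T t f x * g x)" for x
  proof (cases "x \<in> D")
    case True
    have i: "integrable lborel (\<lambda>y. kernel_ext t (x, y) * f y)"
      using L2_prod_integrable[OF kernel_row_L2[OF t True] f] by (simp add: kernel_row_eq_kernel_ext[OF True])
    have "(\<integral>\<^sup>+y. ennreal (kernel_ext t (x, y) * f y * g x) \<partial>lborel) = (\<integral>\<^sup>+y. ennreal (kernel_ext t (x, y) * f y) * ennreal (g x) \<partial>lborel)"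
      using kernel_ext_nonneg[OF t] f0 g0 by (intro nn_integral_cong) (simp add: ennreal_mult)
    also have "\<dots> = (\<integral>\<^sup>+y. ennreal (kernel_ext t (x, y) * f y) \<partial>lborel) * ennreal (g x)"
      by (rule nn_integral_multc) measurable
    also have "(\<integral>\<^sup>+y. ennreal (kernel_ext t (x, y) * f y) \<partial>lborel) = ennreal (T t f x)"
      unfolding T_kernel_ext using kernel_ext_nonneg[OF t] f0 by (intro nn_integral_eq_integral i) auto
    finally show ?thesis using g0 by (simp add: ennreal_mult'')
  qed (simp add: kernel_ext_def T_eq)
  moreover have "(\<integral>\<^sup>+x. ennreal (T t f x * g x) \<partial>lborel) = ennreal (ip (T t f) g)"
    unfolding ip_def
  proof (rule nn_integral_eq_integral)
    show "integrable lborel (\<lambda>x. T t f x * g x)" by (rule L2_prod_integrable[OF T_L2[OF t f] g])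
    have "0 \<le> T t f x" for x
      unfolding T_kernel_ext using kernel_ext_nonneg[OF t] f0 by (intro integral_nonneg_AE) auto
    then show "AE x in lborel. 0 \<le> T t f x * g x" using g0 by auto
  qed
  ultimately show ?thesis by simp
qed

text \<open>Fubini's theorem requires absolute integrability of the double integrand, which
  \<open>T_form_nn\<close> provides for the absolute values of \<open>f\<close> and
  \<open>g\<close>.\<close>

lemma T_sym:
  assumes t: "0 < t" and f: "f \<in> L2 D" and g: "g \<in> L2 D"
  shows "ip (T t f) g = ip f (T t g)"
proof -
  note [measurable] = L2_measurable[OF f] L2_measurable[OF g] kernel_ext_measurable[OF t]
  have "integrable (lborel \<Otimes>\<^sub>M lborel) (\<lambda>(x, y). kernel_ext t (x, y) * f y * g x)"
  proof (rule integrableI_bounded)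
    have "(\<integral>\<^sup>+z. ennreal (norm (case z of (x, y) \<Rightarrow> kernel_ext t (x, y) * f y * g x)) \<partial>(lborel \<Otimes>\<^sub>M lborel))
      = (\<integral>\<^sup>+x. (\<integral>\<^sup>+y. ennreal (norm (kernel_ext t (x, y) * f y * g x)) \<partial>lborel) \<partial>lborel)"
      by (subst lborel.nn_integral_fst[symmetric]) auto
    also have "\<dots> = (\<integral>\<^sup>+x. (\<integral>\<^sup>+y. ennreal (kernel_ext t (x, y) * \<bar>f y\<bar> * \<bar>g x\<bar>) \<partial>lborel) \<partial>lborel)"
      using kernel_ext_nonneg[OF t] by (intro nn_integral_cong) (simp add: abs_mult)
    also have "\<dots> < \<infinity>" by (subst T_form_nn[OF t L2_abs[OF f] L2_abs[OF g]]) auto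
    finally show "(\<integral>\<^sup>+z. ennreal (norm (case z of (x, y) \<Rightarrow> kernel_ext t (x, y) * f y * g x)) \<partial>(lborel \<Otimes>\<^sub>M lborel)) < \<infinity>" .
  qed measurable
  from lborel_pair.Fubini_integral[OF this]
  have "(\<integral>y. (\<integral>x. kernel_ext t (x, y) * f y * g x \<partial>lborel) \<partial>lborel) = (\<integral>x. (\<integral>y. kernel_ext t (x, y) * f y * g x \<partial>lborel) \<partial>lborel)" .
  moreover have "(\<integral>x. (\<integral>y. kernel_ext t (x, y) * f y * g x \<partial>lborel) \<partial>lborel) = ip (T t f) g"
    unfolding ip_def T_kernel_ext by simp
  moreover have "(\<integral>y. (\<integral>x. kernel_ext t (x, y) * f y * g x \<partial>lborel) \<partial>lborel) = ip f (T t g)"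
    unfolding ip_def T_kernel_ext kernel_ext_sym[OF t, of _ "_::'a"]
    by (intro Bochner_Integration.integral_cong refl) (simp add: kernel_ext_sym[OF t] mult.assoc mult.left_commute flip: integral_mult_right_zero)
  ultimately show ?thesis by simp
qed

lemma T_kernel_row: "0 < s \<Longrightarrow> 0 < t \<Longrightarrow> x \<in> D \<Longrightarrow> T t (kernel_row s x) = kernel_row (s + t) x"
proof
  fix y assume *: "0 < s" "0 < t" "x \<in> D"
  show "T t (kernel_row s x) y = kernel_row (s + t) x y"
    using * ip_kernel_row[of t s y x] q_sym[of "s + t" x y] by (auto simp: T_eq kernel_row_def add.commute)
qed

text \<open>Symmetry moves \<open>T t\<close> onto the row, where the identity is
  \<open>T_kernel_row\<close>; hence it holds at every point and not only almost everywhere.\<close>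

lemma T_semigroup:
  assumes s: "0 < s" and t: "0 < t" and f: "f \<in> L2 D"
  shows "T s (T t f) = T (s + t) f"
proof
  fix x
  show "T s (T t f) x = T (s + t) f x"
  proof (cases "x \<in> D")
    case True
    then show ?thesis
      using T_sym[OF t kernel_row_L2[OF s True] f] T_kernel_row[OF s t True] by (simp add: T_eq)
  qed (simp add: T_eq)
qed

lemma T_lincomb:
  assumes t: "0 < t" and f: "f \<in> L2 D" and g: "g \<in> L2 D"
  shows "T t (\<lambda>x. a * f x + b * g x) x = a * T t f x + b * T t g x"
  using ip_lincomb[OF f g kernel_row_L2[OF t], of x a b] ip_commute[of "kernel_row t x"] by (simp add: T_eq)

lemma T_diff:
  assumes "0 < t" "f \<in> L2 D" "g \<in> L2 D"
  shows "T t (\<lambda>x. f x - g x) x = T t f x - T t g x"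
  using T_lincomb[OF assms, of 1 "-1"] by simp

lemma T_scale: "T t (\<lambda>x. c * f x) x = c * T t f x"
  by (simp add: T_eq ip_scale)

lemma T_abs:
  assumes t: "0 < t" and f: "f \<in> L2 D" shows "\<bar>T t f x\<bar> \<le> T t (\<lambda>x. \<bar>f x\<bar>) x"
proof (cases "x \<in> D")
  case True
  have "\<bar>ip (kernel_row t x) f\<bar> \<le> (\<integral>y. \<bar>kernel_row t x y * f y\<bar> \<partial>lborel)" unfolding ip_def by (rule integral_abs_bound)
  also have "\<dots> = ip (kernel_row t x) (\<lambda>x. \<bar>f x\<bar>)"
    unfolding ip_def using kernel_row_nonneg[OF t True] by (simp add: abs_mult)
  finally show ?thesis using True by (simp add: T_eq)
qed (simp add: T_eq)

lemma T_half:
  assumes t: "0 < t" and f: "f \<in> L2 D"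
  shows "ip (T t f) f = ip (T (t / 2) f) (T (t / 2) f)"
  using T_sym[of "t / 2" "T (t / 2) f" f] T_semigroup[of "t / 2" "t / 2" f] T_L2[of "t / 2" f] assms by simp

text \<open>Cauchy-Schwarz against the difference of two rows. The bound depends on \<open>f\<close>
  through its norm only, so it is an equicontinuity estimate on the unit ball.\<close>

lemma T_dist:
  assumes t: "0 < t" and f: "f \<in> L2 D" and x: "x \<in> D" and y: "y \<in> D"
  shows "\<bar>T t f x - T t f y\<bar> \<le> sqrt (q (t + t) x x - 2 * q (t + t) x y + q (t + t) y y) * sqrt (ip f f)"
proof -
  let ?d = "\<lambda>z. kernel_row t x z - kernel_row t y z"
  have "T t f x - T t f y = ip ?d f"
    using ip_diff(1)[OF kernel_row_L2[OF t x] kernel_row_L2[OF t y] f] x y by (simp add: T_eq)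
  moreover have "\<bar>ip ?d f\<bar> \<le> sqrt (ip ?d ?d) * sqrt (ip f f)"
    by (rule ip_abs_le[OF L2_diff[OF kernel_row_L2[OF t x] kernel_row_L2[OF t y]] f])
  moreover have "ip ?d ?d = q (t + t) x x - 2 * q (t + t) x y + q (t + t) y y"
    unfolding ip_diff_self[OF kernel_row_L2[OF t x] kernel_row_L2[OF t y]] ip_kernel_row[OF t t x x] ip_kernel_row[OF t t x y] ip_kernel_row[OF t t y y] ..
  ultimately show ?thesis by simp
qed

lemma T_bound:
  assumes t: "0 < t" and f: "f \<in> L2 D" and x: "x \<in> D"
  shows "\<bar>T t f x\<bar> \<le> sqrt (q (t + t) x x) * sqrt (ip f f)"
  using ip_abs_le[OF kernel_row_L2[OF t x] f] ip_kernel_row[OF t t x x] x by (simp add: T_eq)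

lemma q_modulus:
  assumes t: "0 < t" and x: "x \<in> D"
  shows "((\<lambda>y. sqrt (q t x x - 2 * q t x y + q t y y)) \<longlongrightarrow> 0) (at x within D)"
proof -
  have c: "continuous_on (D \<times> D) (\<lambda>z. q t (fst z) (snd z))" using good t by (simp add: good_kernel_def)
  have "continuous_on D ((\<lambda>z. q t (fst z) (snd z)) \<circ> (\<lambda>y. (x, y)))"
    "continuous_on D ((\<lambda>z. q t (fst z) (snd z)) \<circ> (\<lambda>y. (y, y)))"
    by (intro continuous_on_compose continuous_intros continuous_on_subset[OF c]; use x in auto)+
  then have c2: "continuous_on D (\<lambda>y. q t x y)" "continuous_on D (\<lambda>y. q t y y)" by (simp_all add: comp_def)
  then have "continuous_on D (\<lambda>y. sqrt (q t x x - 2 * q t x y + q t y y))"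
    by (intro continuous_intros)
  then show ?thesis using x by (auto simp: continuous_on_def)
qed

lemma T_continuous:
  assumes t: "0 < t" and f: "f \<in> L2 D" shows "continuous_on D (T t f)"
  unfolding continuous_on_def
proof
  fix x assume x: "x \<in> D"
  have "((\<lambda>y. sqrt (q (t + t) x x - 2 * q (t + t) x y + q (t + t) y y) * sqrt (ip f f)) \<longlongrightarrow> 0 * sqrt (ip f f)) (at x within D)"
    by (intro tendsto_mult q_modulus x tendsto_const) (use t in simp)
  then have lim: "((\<lambda>y. sqrt (q (t + t) x x - 2 * q (t + t) x y + q (t + t) y y) * sqrt (ip f f)) \<longlongrightarrow> 0) (at x within D)"
    by simp
  have "((\<lambda>y. T t f y - T t f x) \<longlongrightarrow> 0) (at x within D)"
  proof (rule Lim_null_comparison[OF _ lim])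
    show "\<forall>\<^sub>F y in at x within D. norm (T t f y - T t f x) \<le> sqrt (q (t + t) x x - 2 * q (t + t) x y + q (t + t) y y) * sqrt (ip f f)"
      using T_dist[OF t f x] by (auto simp: eventually_at_filter abs_minus_commute intro!: always_eventually)
  qed
  then show "(T t f \<longlongrightarrow> T t f x) (at x within D)" by (simp add: LIM_zero_iff)
qed

end

text \<open>Cantor's diagonal argument. Convergence at the \<open>k\<close>-th point is obtained for
  the diagonal sequence shifted by \<open>Suc k\<close>, and \<open>LIMSEQ_offset\<close> removes
  the shift.\<close>

lemma countable_pointwise_subsequence:
  fixes f :: "nat \<Rightarrow> 'a \<Rightarrow> real"
  assumes S: "countable S" and b: "\<And>n x. x \<in> S \<Longrightarrow> \<bar>f n x\<bar> \<le> M"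
  obtains r :: "nat \<Rightarrow> nat" where "strict_mono r" "\<And>x. x \<in> S \<Longrightarrow> convergent (\<lambda>n. f (r n) x)"
proof (cases "S = {}")
  case True
  then show ?thesis using that[of id] by (simp add: strict_mono_id)
next
  case False
  define e where "e = from_nat_into S"
  have eS: "e n \<in> S" for n unfolding e_def by (rule from_nat_into[OF False])
  interpret subseqs "\<lambda>n s. convergent (\<lambda>i. f (s i) (e n))"
  proof
    fix n and s :: "nat \<Rightarrow> nat" assume "strict_mono s"
    have "bounded (range (\<lambda>i. f (s i) (e n)))" unfolding bounded_iff using b[OF eS] by auto
    then obtain l r where "strict_mono r" "((\<lambda>i. f (s i) (e n)) \<circ> r) \<longlonglongrightarrow> l"
      using bounded_imp_convergent_subsequence by blast
    then show "\<exists>r. strict_mono r \<and> convergent (\<lambda>i. f ((s \<circ> r) i) (e n))"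
      by (auto simp: convergent_def comp_def)
  qed
  show ?thesis
  proof (rule that[OF subseq_diagseq])
    fix x assume "x \<in> S"
    then obtain k where k: "x = e k" unfolding e_def using from_nat_into_surj[OF S] by metis
    have "convergent (\<lambda>i. f ((diagseq \<circ> (+) (Suc k)) i) (e k))"
    proof (rule diagseq_holds)
      fix r s :: "nat \<Rightarrow> nat" and n assume r: "strict_mono r" and "convergent (\<lambda>i. f (s i) (e n))"
      then obtain l where "(\<lambda>i. f (s i) (e n)) \<longlonglongrightarrow> l" by (auto simp: convergent_def)
      from LIMSEQ_subseq_LIMSEQ[OF this r] show "convergent (\<lambda>i. f ((s \<circ> r) i) (e n))"
        by (auto simp: convergent_def comp_def)
    qed
    then obtain l where "(\<lambda>i. f (diagseq (i + Suc k)) (e k)) \<longlonglongrightarrow> l"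
      by (auto simp: convergent_def comp_def add.commute)
    then have "(\<lambda>i. f (diagseq i) (e k)) \<longlonglongrightarrow> l" by (rule LIMSEQ_offset)
    then show "convergent (\<lambda>n. f (diagseq n) x)" by (auto simp: convergent_def k)
  qed
qed

section \<open>Bounds on the form along the semigroup\<close>

context dirichlet_kernel begin

lemma T_nonneg: "0 < t \<Longrightarrow> (\<And>x. 0 \<le> f x) \<Longrightarrow> 0 \<le> T t f x"
  unfolding T_kernel_ext using kernel_ext_nonneg by (intro integral_nonneg_AE) auto

lemma T_form_abs:
  assumes t: "0 < t" and u: "u \<in> L2 D"
  shows "ip (T t u) u \<le> ip (T t (\<lambda>x. \<bar>u x\<bar>)) (\<lambda>x. \<bar>u x\<bar>)"
proof -
  have "ip (T t u) u \<le> ip (\<lambda>x. \<bar>T t u x\<bar>) (\<lambda>x. \<bar>u x\<bar>)"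
    unfolding ip_def
    by (intro integral_mono L2_prod_integrable[of _ D] T_L2 L2_abs u t)
       (metis abs_ge_self abs_mult)
  also have "\<dots> \<le> ip (T t (\<lambda>x. \<bar>u x\<bar>)) (\<lambda>x. \<bar>u x\<bar>)"
    by (rule ip_mono[of _ D]) (use t u T_L2 L2_abs T_abs in auto)
  finally show ?thesis .
qed

text \<open>Absolute values keep the norm and do not decrease \<langle>T t u, u\<rangle>, so a bound
  for \<open>u\<close> yields the hypothesis of \<open>form_lower\<close> for \<bar>u\<bar>.\<close>

lemma form_abs:
  assumes u: "u \<in> L2 D" and C: "0 \<le> C" and d: "\<And>n::nat. 0 < \<delta> n" "\<delta> \<longlonglongrightarrow> 0"
    and le: "\<And>n. ip u u - ip (T (\<delta> n) u) u \<le> C * \<delta> n"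
  shows "E (\<lambda>x. \<bar>u x\<bar>) \<le> ennreal C"
proof (rule form_lower[OF L2_abs[OF u] _ C d])
  fix n
  let ?v = "\<lambda>x. \<bar>u x\<bar>"
  have v: "?v \<in> L2 D" by (rule L2_abs[OF u])
  note [measurable] = L2_measurable[OF v] kernel_ext_measurable[OF d(1)[of n]]
  have "(\<integral>\<^sup>+x\<in>D. ennreal (?v x) * (\<integral>\<^sup>+y\<in>D. ennreal (q (\<delta> n) x y * ?v y) \<partial>lborel) \<partial>lborel)
    = (\<integral>\<^sup>+x. (\<integral>\<^sup>+y. ennreal (kernel_ext (\<delta> n) (x, y) * ?v y * ?v x) \<partial>lborel) \<partial>lborel)"
  proof (rule nn_integral_cong)
    fix x
    show "ennreal (?v x) * (\<integral>\<^sup>+y\<in>D. ennreal (q (\<delta> n) x y * ?v y) \<partial>lborel) * indicator D x =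
      (\<integral>\<^sup>+y. ennreal (kernel_ext (\<delta> n) (x, y) * ?v y * ?v x) \<partial>lborel)"
    proof (cases "x \<in> D")
      case True
      have "(\<integral>\<^sup>+y. ennreal (kernel_ext (\<delta> n) (x, y) * ?v y * ?v x) \<partial>lborel) = (\<integral>\<^sup>+y. ennreal (?v x) * ennreal (kernel_ext (\<delta> n) (x, y) * ?v y) \<partial>lborel)"
        using kernel_ext_nonneg[OF d(1)] by (intro nn_integral_cong) (simp add: ennreal_mult[symmetric] ac_simps)
      also have "\<dots> = ennreal (?v x) * (\<integral>\<^sup>+y. ennreal (kernel_ext (\<delta> n) (x, y) * ?v y) \<partial>lborel)"
        by (rule nn_integral_cmult) measurable
      also have "(\<integral>\<^sup>+y. ennreal (kernel_ext (\<delta> n) (x, y) * ?v y) \<partial>lborel) = (\<integral>\<^sup>+y\<in>D. ennreal (q (\<delta> n) x y * ?v y) \<partial>lborel)"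
        using True by (intro nn_integral_cong) (auto simp: kernel_ext_def indicator_def)
      finally show ?thesis using True by simp
    qed (simp add: kernel_ext_def)
  qed
  also have "\<dots> = ennreal (ip (T (\<delta> n) ?v) ?v)" by (rule T_form_nn[OF d(1) v v]) auto
  finally have eq: "(\<integral>\<^sup>+x\<in>D. ennreal (?v x) * (\<integral>\<^sup>+y\<in>D. ennreal (q (\<delta> n) x y * ?v y) \<partial>lborel) \<partial>lborel) = ennreal (ip (T (\<delta> n) ?v) ?v)" .
  have pos: "0 \<le> ip (T (\<delta> n) ?v) ?v"
    unfolding ip_def using T_nonneg[OF d(1)] by (intro integral_nonneg_AE) auto
  have "ip u u \<le> C * \<delta> n + ip (T (\<delta> n) ?v) ?v"
    using le[of n] T_form_abs[OF d(1) u, of n] by simp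
  then have "ennreal (ip u u) \<le> ennreal (C * \<delta> n + ip (T (\<delta> n) ?v) ?v)" by (rule ennreal_leI)
  also have "\<dots> = ennreal (C * \<delta> n) + ennreal (ip (T (\<delta> n) ?v) ?v)"
    using pos C d(1)[of n] by (intro ennreal_plus) auto
  finally have "ennreal (ip u u) \<le> ennreal (C * \<delta> n) + ennreal (ip (T (\<delta> n) ?v) ?v)" .
  moreover have "(\<integral>\<^sup>+x. ennreal ((?v x)\<^sup>2) \<partial>lborel) = ennreal (ip u u)"
    using sq_norm_eq_ip[OF u] by (simp add: sq_norm_def)
  ultimately show "(\<integral>\<^sup>+x. ennreal ((?v x)\<^sup>2) \<partial>lborel) \<le> ennreal (C * \<delta> n) +
     (\<integral>\<^sup>+x\<in>D. ennreal (?v x) * (\<integral>\<^sup>+y\<in>D. ennreal (q (\<delta> n) x y * ?v y) \<partial>lborel) \<partial>lborel)"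
    unfolding eq by simp
qed simp

lemma T_form_nonneg: "0 < t \<Longrightarrow> u \<in> L2 D \<Longrightarrow> 0 \<le> ip (T t u) u"
  using T_half ip_self_nonneg by metis

text \<open>The function \<open>t \<mapsto> \<langle>T t f, f\<rangle>\<close> is convex, so its slope at \<open>2 t\<close> is controlled by its increment over \<open>[0, 2 t]\<close>.\<close>

lemma form_T:
  assumes t: "0 < t" and f: "f \<in> L2 D"
  shows "E (\<lambda>x. \<bar>T t f x\<bar>) \<le> ennreal ((ip f f - ip (T t f) (T t f)) / (2 * t))"
proof (rule form_abs[OF T_L2[OF t f], where \<delta>="\<lambda>n. 2 * t / real (Suc n)"])
  show "0 \<le> (ip f f - ip (T t f) (T t f)) / (2 * t)" using T_contraction[OF t f] t by simp
  show "0 < 2 * t / real (Suc n)" for n using t by simp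
  show "(\<lambda>n. 2 * t / real (Suc n)) \<longlonglongrightarrow> 0" by real_asymp
  fix n
  define d where "d = 2 * t / real (Suc n)"
  have d: "0 < d" using t by (simp add: d_def)
  \<comment> \<open>Samples of \<langle>T r f, f\<rangle> at the multiples r = k d, with
    \<open>Suc n\<close> steps up to \<open>2 * t\<close>. Time 0 is treated apart because the
    kernel is only described for positive times.\<close>
  define a where "a k = (if k = 0 then ip f f else ip (T (real k * d) f) f)" for k :: nat
  have T2: "T r f \<in> L2 D" if "0 < r" for r using T_L2[OF that f] .
  \<comment> \<open>The second difference is \<langle>T r w, w\<rangle> with
    \<open>w = f - T d f\<close> and r = k d, or \<langle>w, w\<rangle> for \<open>k = 0\<close>;
    either is nonnegative.\<close>
  have conv: "0 \<le> a k - 2 * a (Suc k) + a (Suc (Suc k))" for k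
  proof -
    let ?w = "\<lambda>x. f x - T d f x"
    have w: "?w \<in> L2 D" by (rule L2_diff[OF f T2[OF d]])
    have dd: "ip (T d f) (T d f) = ip (T (2 * d) f) f"
      using T_half[of "2 * d" f] d f by simp
    show ?thesis
    proof (cases "k = 0")
      case True
      have "ip ?w ?w = ip f f - 2 * ip (T d f) f + ip (T (2 * d) f) f"
        using ip_diff_self[OF f T2[OF d]] dd ip_commute[of f "T d f"] by simp
      then show ?thesis using True ip_self_nonneg[of ?w] by (simp add: a_def)
    next
      case False
      define r where "r = real k * d"
      have r: "0 < r" using False d by (simp add: r_def)
      have Tw: "T r ?w = (\<lambda>x. T r f x - T (r + d) f x)"
        using T_diff[OF r f T2[OF d]] T_semigroup[OF r d f] by auto
      have s1: "ip (T r f) (T d f) = ip (T (r + d) f) f"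
        using T_sym[OF d T2[OF r] f] T_semigroup[OF d r f] by (simp add: add.commute)
      have s2: "ip (T (r + d) f) (T d f) = ip (T (r + 2 * d) f) f"
        using T_sym[OF d T2[of "r + d"] f] T_semigroup[OF d _ f, of "r + d"] r d by (simp add: algebra_simps)
      have "ip (T r ?w) ?w = ip (T r f) f - 2 * ip (T (r + d) f) f + ip (T (r + 2 * d) f) f"
        unfolding Tw using ip_diff(1)[OF T2[OF r] T2[of "r + d"] w] ip_diff(2)[OF f T2[OF d] T2[OF r]]
          ip_diff(2)[OF f T2[OF d] T2[of "r + d"]] s1 s2 r d by simp
      moreover have "real (Suc k) * d = r + d" "real (Suc (Suc k)) * d = r + 2 * d" by (auto simp: r_def algebra_simps)
      ultimately show ?thesis using T_form_nonneg[OF r w] False by (simp add: a_def r_def[symmetric])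
    qed
  qed
  have dec: "a (Suc j) - a (Suc (Suc j)) \<le> a j - a (Suc j)" for j using conv[of j] by linarith
  have mono: "a m - a (Suc m) \<le> a k - a (Suc k)" if "k \<le> m" for k m
    using that by (induct rule: dec_induct) (use dec order_trans in blast)+
  let ?N = "Suc n"
  \<comment> \<open>The decrements of \<open>a\<close> decrease, so the one at index
    \<open>?N\<close> is at most the mean of the first \<open>?N\<close>.\<close>
  have "real ?N * (a ?N - a (Suc ?N)) = (\<Sum>k<?N. a ?N - a (Suc ?N))" by simp
  also have "\<dots> \<le> (\<Sum>k<?N. a k - a (Suc k))" by (intro sum_mono mono) auto
  also have "\<dots> = a 0 - a ?N" by (rule sum_lessThan_telescope')
  finally have N: "real ?N * (a ?N - a (Suc ?N)) \<le> a 0 - a ?N" .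
  have Nd: "real ?N * d = 2 * t" by (simp add: d_def)
  have aN: "a ?N = ip (T t f) (T t f)" 
  proof -
    have "ip (T (2 * t) f) f = ip (T (2 * t / 2) f) (T (2 * t / 2) f)" by (rule T_half) (use t f in auto)
    then show ?thesis unfolding a_def Nd by simp
  qed
  have aN1: "a (Suc ?N) = ip (T d (T t f)) (T t f)"
  proof -
    have "real (Suc ?N) * d = 2 * t + d" using Nd by (simp add: algebra_simps)
    then have "a (Suc ?N) = ip (T (2 * t + d) f) f" by (simp add: a_def)
    also have "\<dots> = ip (T t (T d (T t f))) f"
      using T_semigroup[OF d t f] T_semigroup[OF t _ f, of "d + t"] d t by (simp add: algebra_simps)
    also have "\<dots> = ip (T d (T t f)) (T t f)"
      by (rule T_sym[OF t T_L2[OF d T2[OF t]] f])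
    finally show ?thesis .
  qed
  have "a ?N - a (Suc ?N) \<le> (a 0 - a ?N) / real ?N"
    using N by (simp add: pos_le_divide_eq mult.commute del: of_nat_Suc)
  also have "\<dots> = (ip f f - ip (T t f) (T t f)) / (2 * t) * d"
  proof -
    have "a 0 = ip f f" by (simp add: a_def)
    then show ?thesis using t unfolding aN d_def by simp
  qed
  finally show "ip (T t f) (T t f) - ip (T (2 * t / real (Suc n)) (T t f)) (T t f)
    \<le> (ip f f - ip (T t f) (T t f)) / (2 * t) * (2 * t / real (Suc n))"
    unfolding aN aN1 d_def[symmetric] .
qed

end

section \<open>Compactness and the ground state\<close>

text \<open>What compactness and the ground state require of \<open>E\<close>: \<open>tight\<close>
  controls the mass near infinity and \<open>irreducible\<close> excludes the eigenvalue 0. For the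
  jump form these are \<open>tightness\<close> and \<open>irreducibility\<close>.\<close>

locale tight_dirichlet_kernel = dirichlet_kernel +
  assumes tight: "0 < \<epsilon> \<Longrightarrow> \<exists>R. \<forall>u\<in>L2 D. (\<forall>x. 0 \<le> u x) \<longrightarrow> (\<integral>\<^sup>+x\<in>-ball 0 R. ennreal ((u x)\<^sup>2) \<partial>lborel) \<le> ennreal \<epsilon> * E u"
    and irreducible: "u \<in> L2 D \<Longrightarrow> (\<And>x. 0 \<le> u x) \<Longrightarrow> E u = 0 \<Longrightarrow> AE x in lborel. u x = 0"
begin

text \<open>On the unit ball \<open>form_T\<close> bounds the form of \<bar>T t f\<bar> by
  \<open>1 / (2 * t)\<close>, whence the choice of \<open>\<epsilon> * (2 * t)\<close> in
  \<open>tight\<close>.\<close>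

lemma T_tail:
  assumes t: "0 < t" and e: "0 < \<epsilon>"
  obtains R where "\<And>f. f \<in> L2 D \<Longrightarrow> ip f f \<le> 1 \<Longrightarrow> (\<integral>\<^sup>+x\<in>-ball 0 R. ennreal ((T t f x)\<^sup>2) \<partial>lborel) \<le> ennreal \<epsilon>"
proof -
  from tight[of "\<epsilon> * (2 * t)"] e t obtain R where
    R: "\<And>u. u \<in> L2 D \<Longrightarrow> (\<And>x. 0 \<le> u x) \<Longrightarrow> (\<integral>\<^sup>+x\<in>-ball 0 R. ennreal ((u x)\<^sup>2) \<partial>lborel) \<le> ennreal (\<epsilon> * (2 * t)) * E u"
    by force
  show ?thesis
  proof (rule that[of R])
    fix f assume f: "f \<in> L2 D" "ip f f \<le> 1"
    have "(\<integral>\<^sup>+x\<in>-ball 0 R. ennreal ((T t f x)\<^sup>2) \<partial>lborel) \<le> ennreal (\<epsilon> * (2 * t)) * E (\<lambda>x. \<bar>T t f x\<bar>)"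
      using R[OF L2_abs[OF T_L2[OF t f(1)]]] by simp
    also have "\<dots> \<le> ennreal (\<epsilon> * (2 * t)) * ennreal ((ip f f - ip (T t f) (T t f)) / (2 * t))"
      by (intro mult_left_mono form_T[OF t f(1)]) simp
    also have "\<dots> \<le> ennreal (\<epsilon> * (2 * t)) * ennreal (1 / (2 * t))"
      using f(2) ip_self_nonneg[of "T t f"] t
      by (intro mult_left_mono ennreal_leI divide_right_mono) auto
    also have "\<dots> = ennreal \<epsilon>" using e t by (simp add: ennreal_mult[symmetric])
    finally show "(\<integral>\<^sup>+x\<in>-ball 0 R. ennreal ((T t f x)\<^sup>2) \<partial>lborel) \<le> ennreal \<epsilon>" .
  qed
qed

text \<open>Arzela-Ascoli: a subsequence that converges on a countable dense subset of
  \<open>D\<close> converges at every point by the equicontinuity in \<open>T_dist\<close>.\<close>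

lemma T_pointwise_subsequence:
  assumes t: "0 < t" and f: "\<And>n. f n \<in> L2 D" "\<And>n. ip (f n) (f n) \<le> 1"
  obtains r :: "nat \<Rightarrow> nat" where "strict_mono r" "\<And>x. convergent (\<lambda>n. T t (f (r n)) x)"
proof -
  obtain S where S: "countable S" "S \<subseteq> D" "D \<subseteq> closure S" using separable[of D] by blast
  obtain M where M: "0 \<le> M" "\<And>x y. x \<in> D \<Longrightarrow> y \<in> D \<Longrightarrow> q (t + t) x y \<le> M" using q_bound[of "t + t"] t by auto
  have s1: "sqrt (ip (f n) (f n)) \<le> 1" for n using f(2)[of n] by simp
  have b: "norm (T t (f n) x) \<le> sqrt M" if "x \<in> S" for n x
  proof -
    have x: "x \<in> D" using S(2) that by auto
    have "\<bar>T t (f n) x\<bar> \<le> sqrt (q (t + t) x x) * sqrt (ip (f n) (f n))" by (rule T_bound[OF t f(1) x])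
    also have "\<dots> \<le> sqrt M * 1" using M x s1 by (intro mult_mono) (auto simp: ip_self_nonneg)
    finally show ?thesis by simp
  qed
  obtain r where r: "strict_mono r" "\<And>x. x \<in> S \<Longrightarrow> convergent (\<lambda>n. T t (f (r n)) x)"
    using countable_pointwise_subsequence[OF S(1), of "\<lambda>n. T t (f n)" "sqrt M"] b by auto
  have "convergent (\<lambda>n. T t (f (r n)) x)" for x
  proof (cases "x \<in> D")
    case True
    have "Cauchy (\<lambda>n. T t (f (r n)) x)"
    proof (rule metric_CauchyI)
      fix e :: real assume e: "0 < e"
      have "\<forall>\<^sub>F y in at x within D. sqrt (q (t + t) x x - 2 * q (t + t) x y + q (t + t) y y) < e / 3"
        using q_modulus[of "t + t" x] t True e by (intro order_tendstoD(2)) auto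
      then obtain d where d: "0 < d" "\<And>y. y \<in> D \<Longrightarrow> y \<noteq> x \<Longrightarrow> dist y x < d \<Longrightarrow>
        sqrt (q (t + t) x x - 2 * q (t + t) x y + q (t + t) y y) < e / 3"
        by (auto simp: eventually_at)
      obtain y where y: "y \<in> S" "dist y x < d"
        using S(3) True d(1) closure_approachable by blast
      have yD: "y \<in> D" using y S by auto
      have mod: "sqrt (q (t + t) x x - 2 * q (t + t) x y + q (t + t) y y) < e / 3"
        using d(2)[OF yD _ y(2)] e by (cases "y = x") auto
      have near: "\<bar>T t (f n) x - T t (f n) y\<bar> < e / 3" for n
      proof -
        have "\<bar>T t (f n) x - T t (f n) y\<bar> \<le> sqrt (q (t + t) x x - 2 * q (t + t) x y + q (t + t) y y) * sqrt (ip (f n) (f n))"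
          by (rule T_dist[OF t f(1) True yD])
        also have "\<dots> \<le> sqrt (q (t + t) x x - 2 * q (t + t) x y + q (t + t) y y) * 1"
        proof (rule mult_left_mono[OF s1])
          have "0 \<le> ip (\<lambda>z. kernel_row t x z - kernel_row t y z) (\<lambda>z. kernel_row t x z - kernel_row t y z)" by (rule ip_self_nonneg)
          then show "0 \<le> sqrt (q (t + t) x x - 2 * q (t + t) x y + q (t + t) y y)"
            unfolding ip_diff_self[OF kernel_row_L2[OF t True] kernel_row_L2[OF t yD]] ip_kernel_row[OF t t True True] ip_kernel_row[OF t t True yD] ip_kernel_row[OF t t yD yD]
            by (rule real_sqrt_ge_zero)
        qed
        finally show ?thesis using mod by simp
      qed
      have "Cauchy (\<lambda>n. T t (f (r n)) y)" using r(2)[OF y(1)] by (simp add: Cauchy_convergent_iff)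
      then obtain N where N: "\<And>m n. m \<ge> N \<Longrightarrow> n \<ge> N \<Longrightarrow> \<bar>T t (f (r m)) y - T t (f (r n)) y\<bar> < e / 3"
        using e unfolding Cauchy_def dist_real_def by (metis zero_less_divide_iff zero_less_numeral)
      have "dist (T t (f (r m)) x) (T t (f (r n)) x) < e" if "m \<ge> N" "n \<ge> N" for m n
        using near[of "r m"] near[of "r n"] N[OF that] unfolding dist_real_def by linarith
      then show "\<exists>M. \<forall>m\<ge>M. \<forall>n\<ge>M. dist (T t (f (r m)) x) (T t (f (r n)) x) < e" by blast
    qed
    then show ?thesis by (simp add: Cauchy_convergent_iff)
  next
    case False
    then show ?thesis by (simp add: T_eq convergent_const)
  qed
  with r(1) show ?thesis using that by blast
qed

text \<open>Inside a ball the pointwise limit is a limit in norm by dominated convergence, as the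
  functions are uniformly bounded. Outside, \<open>T_tail\<close> makes their tails uniformly small,
  and by Fatou also that of the limit.\<close>

lemma T_compact:
  assumes t: "0 < t" and f: "\<And>n. f n \<in> L2 D" "\<And>n. ip (f n) (f n) \<le> 1"
  obtains g r where "g \<in> L2 D" "strict_mono (r :: nat \<Rightarrow> nat)" "(\<lambda>n. sq_norm (\<lambda>x. T t (f (r n)) x - g x)) \<longlonglongrightarrow> 0"
proof -
  obtain r where r: "strict_mono (r :: nat \<Rightarrow> nat)" "\<And>x. convergent (\<lambda>n. T t (f (r n)) x)"
    using T_pointwise_subsequence[of t f] assms by blast
  define u where "u n = T t (f (r n))" for n
  define g where "g x = lim (\<lambda>n. u n x)" for x
  have ug: "(\<lambda>n. u n x) \<longlonglongrightarrow> g x" for x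
    using r(2)[of x] unfolding g_def u_def by (simp add: convergent_LIMSEQ_iff)
  have u: "u n \<in> L2 D" for n unfolding u_def by (rule T_L2[OF t f(1)])
  have um [measurable]: "u n \<in> borel_measurable borel" for n by (rule L2_measurable[OF u])
  have gm [measurable]: "g \<in> borel_measurable borel"
    by (rule borel_measurable_LIMSEQ_real[OF ug]) simp
  have uA: "(\<integral>\<^sup>+x\<in>A. ennreal ((g x)\<^sup>2) \<partial>lborel) \<le> c"
    if [measurable]: "A \<in> sets borel" and le: "\<And>n. (\<integral>\<^sup>+x\<in>A. ennreal ((u n x)\<^sup>2) \<partial>lborel) \<le> c" for A c
  proof -
    have "(\<lambda>n. ennreal ((u n x)\<^sup>2) * indicator A x) \<longlonglongrightarrow> ennreal ((g x)\<^sup>2) * indicator A x" for x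
      using ug[of x] by (cases "x \<in> A") (auto intro!: tendsto_ennrealI tendsto_power)
    then have "(\<integral>\<^sup>+x\<in>A. ennreal ((g x)\<^sup>2) \<partial>lborel) = (\<integral>\<^sup>+x. liminf (\<lambda>n. ennreal ((u n x)\<^sup>2) * indicator A x) \<partial>lborel)"
      by (intro nn_integral_cong lim_imp_Liminf[symmetric]) auto
    also have "\<dots> \<le> liminf (\<lambda>n. \<integral>\<^sup>+x\<in>A. ennreal ((u n x)\<^sup>2) \<partial>lborel)"
      by (rule nn_integral_liminf) measurable
    also have "\<dots> \<le> c" using le by (intro Liminf_le) auto
    finally show ?thesis .
  qed
  have g: "g \<in> L2 D"
  proof (rule L2I[OF gm])
    show "g x = 0" if "x \<notin> D" for x
    proof -
      have "(\<lambda>n. u n x) = (\<lambda>_. 0)" using L2_outside[OF u that] by auto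
      then show ?thesis using ug[of x] LIMSEQ_unique[of "\<lambda>_. 0" "g x" 0] by simp
    qed
    have "(\<integral>\<^sup>+x\<in>UNIV. ennreal ((g x)\<^sup>2) \<partial>lborel) \<le> 1"
    proof (rule uA)
      show "(\<integral>\<^sup>+x\<in>UNIV. ennreal ((u n x)\<^sup>2) \<partial>lborel) \<le> 1" for n
        using sq_norm_eq_ip[OF u, of n] T_contraction[OF t f(1), of "r n"] f(2)[of "r n"]
        unfolding sq_norm_def u_def by (simp add: ennreal_le_1)
    qed simp
    then show "(\<integral>\<^sup>+x. ennreal ((g x)\<^sup>2) \<partial>lborel) < \<top>" by (auto intro: le_less_trans)
  qed
  obtain M where M: "0 \<le> M" "\<And>x y. x \<in> D \<Longrightarrow> y \<in> D \<Longrightarrow> q (t + t) x y \<le> M" using q_bound[of "t + t"] t by auto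
  have ub: "\<bar>u n x\<bar> \<le> sqrt M" for n x
  proof (cases "x \<in> D")
    case True
    have "\<bar>u n x\<bar> \<le> sqrt (q (t + t) x x) * sqrt (ip (f (r n)) (f (r n)))" unfolding u_def by (rule T_bound[OF t f(1) True])
    also have "\<dots> \<le> sqrt M * 1" using M True f(2)[of "r n"] by (intro mult_mono) (auto simp: ip_self_nonneg)
    finally show ?thesis by simp
  qed (use L2_outside[OF u] M in auto)
  have gb: "\<bar>g x\<bar> \<le> sqrt M" for x
    by (rule LIMSEQ_le_const2[OF tendsto_rabs[OF ug]]) (use ub in auto)
  have "(\<lambda>n. sq_norm (\<lambda>x. u n x - g x)) \<longlonglongrightarrow> 0"
  proof (rule order_tendstoI)
    fix a :: ennreal assume "0 < a"
    then obtain e where e: "0 < e" "ennreal e < a"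
    proof -
      obtain b where b: "0 < b" "b < a" using dense[OF \<open>0 < a\<close>] by blast
      then have "b < \<top>" by (metis less_le_trans top_greatest)
      with b that show ?thesis by (cases b) auto
    qed
    \<comment> \<open>The share \<open>e / 8\<close> makes the outer part at most
      \<open>e / 2\<close>, since (u - g)^2 \<le> 2 u^2 + 2 g^2.\<close>
    obtain R where R: "\<And>f. f \<in> L2 D \<Longrightarrow> ip f f \<le> 1 \<Longrightarrow> (\<integral>\<^sup>+x\<in>-ball 0 R. ennreal ((T t f x)\<^sup>2) \<partial>lborel) \<le> ennreal (e / 8)"
      using T_tail[OF t, of "e / 8"] e by auto
    let ?B = "ball 0 R :: 'a set"
    have [measurable]: "?B \<in> sets borel" by simp
    have uR: "(\<integral>\<^sup>+x\<in>-?B. ennreal ((u n x)\<^sup>2) \<partial>lborel) \<le> ennreal (e / 8)" for n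
      unfolding u_def by (rule R[OF f])
    have gR: "(\<integral>\<^sup>+x\<in>-?B. ennreal ((g x)\<^sup>2) \<partial>lborel) \<le> ennreal (e / 8)" by (rule uA[OF _ uR]) simp
    have out: "(\<integral>\<^sup>+x\<in>-?B. ennreal ((u n x - g x)\<^sup>2) \<partial>lborel) \<le> ennreal (e / 2)" for n
    proof -
      have "(\<integral>\<^sup>+x\<in>-?B. ennreal ((u n x - g x)\<^sup>2) \<partial>lborel)
        \<le> (\<integral>\<^sup>+x. 2 * (ennreal ((u n x)\<^sup>2) * indicator (-?B) x) + 2 * (ennreal ((g x)\<^sup>2) * indicator (-?B) x) \<partial>lborel)"
      proof (rule nn_integral_mono)
        fix x
        have "(u n x - g x)\<^sup>2 \<le> 2 * (u n x)\<^sup>2 + 2 * (g x)\<^sup>2"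
          using sum_squares_bound[of "u n x" "- g x"] by (simp add: power2_diff)
        then have "ennreal ((u n x - g x)\<^sup>2) \<le> ennreal (2 * (u n x)\<^sup>2 + 2 * (g x)\<^sup>2)" by (rule ennreal_leI)
        then show "ennreal ((u n x - g x)\<^sup>2) * indicator (-?B) x \<le> 2 * (ennreal ((u n x)\<^sup>2) * indicator (-?B) x) + 2 * (ennreal ((g x)\<^sup>2) * indicator (-?B) x)"
          by (auto simp: indicator_def ennreal_mult)
      qed
      also have "\<dots> = 2 * (\<integral>\<^sup>+x\<in>-?B. ennreal ((u n x)\<^sup>2) \<partial>lborel) + 2 * (\<integral>\<^sup>+x\<in>-?B. ennreal ((g x)\<^sup>2) \<partial>lborel)"
        by (subst nn_integral_add) (auto simp: nn_integral_cmult)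
      also have "\<dots> \<le> 2 * ennreal (e / 8) + 2 * ennreal (e / 8)"
        using uR[of n] gR by (intro add_mono mult_left_mono) auto
      also have "\<dots> = ennreal (2 * (e / 8) + 2 * (e / 8))"
        using e(1) by (simp add: ennreal_mult[symmetric] ennreal_plus[symmetric] flip: ennreal_numeral del: ennreal_plus)
      finally show ?thesis by simp
    qed
    have "(\<lambda>n. \<integral>\<^sup>+x\<in>?B. ennreal ((u n x - g x)\<^sup>2) \<partial>lborel) \<longlonglongrightarrow> (\<integral>\<^sup>+x. 0 \<partial>(lborel :: 'a measure))"
    proof (rule nn_integral_dominated_convergence[where w="\<lambda>x. ennreal ((2 * sqrt M)\<^sup>2) * indicator ?B x"])
      show "AE x in lborel. ennreal ((u n x - g x)\<^sup>2) * indicator ?B x \<le> ennreal ((2 * sqrt M)\<^sup>2) * indicator ?B x" for n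
      proof (intro AE_I2 mult_right_mono ennreal_leI)
        fix x
        have "\<bar>u n x - g x\<bar> \<le> 2 * sqrt M" using ub[of n x] gb[of x] by linarith
        then show "(u n x - g x)\<^sup>2 \<le> (2 * sqrt M)\<^sup>2" using abs_le_square_iff[of "u n x - g x" "2 * sqrt M"] M(1) by simp
      qed simp
      have "(\<integral>\<^sup>+x. ennreal ((2 * sqrt M)\<^sup>2) * indicator ?B x \<partial>lborel) = ennreal ((2 * sqrt M)\<^sup>2) * emeasure lborel ?B"
        by (rule nn_integral_cmult_indicator) simp
      also have "\<dots> < \<infinity>" using emeasure_lborel_ball_finite[of "0::'a" R] by (simp add: ennreal_mult_less_top)
      finally show "(\<integral>\<^sup>+x. ennreal ((2 * sqrt M)\<^sup>2) * indicator ?B x \<partial>lborel) < \<infinity>" .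
      show "AE x in lborel. (\<lambda>n. ennreal ((u n x - g x)\<^sup>2) * indicator ?B x) \<longlonglongrightarrow> 0"
      proof (rule AE_I2)
        fix x
        have "(\<lambda>n. (u n x - g x)\<^sup>2) \<longlonglongrightarrow> (g x - g x)\<^sup>2" by (intro tendsto_intros ug)
        then have "(\<lambda>n. ennreal ((u n x - g x)\<^sup>2)) \<longlonglongrightarrow> ennreal 0" by (intro tendsto_ennrealI) simp
        then show "(\<lambda>n. ennreal ((u n x - g x)\<^sup>2) * indicator ?B x) \<longlonglongrightarrow> 0" by (cases "x \<in> ?B") auto
      qed
    qed measurable
    then have "\<forall>\<^sub>F n in sequentially. (\<integral>\<^sup>+x\<in>?B. ennreal ((u n x - g x)\<^sup>2) \<partial>lborel) < ennreal (e / 2)"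
      using e(1) by (intro order_tendstoD(2)) auto
    then show "\<forall>\<^sub>F n in sequentially. sq_norm (\<lambda>x. u n x - g x) < a"
    proof eventually_elim
      case (elim n)
      have "sq_norm (\<lambda>x. u n x - g x) = (\<integral>\<^sup>+x\<in>?B. ennreal ((u n x - g x)\<^sup>2) \<partial>lborel) + (\<integral>\<^sup>+x\<in>-?B. ennreal ((u n x - g x)\<^sup>2) \<partial>lborel)"
        unfolding sq_norm_def
        by (subst nn_integral_add[symmetric]) (auto intro!: nn_integral_cong simp: indicator_def)
      also have "\<dots> \<le> ennreal (e / 2) + ennreal (e / 2)" using elim out[of n] by (intro add_mono) auto
      also have "\<dots> = ennreal e" using e(1) by (simp add: ennreal_plus[symmetric] del: ennreal_plus)
      finally show ?case using e(2) by (rule le_less_trans)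
    qed
  qed simp
  then show ?thesis using that[OF g r(1)] unfolding u_def by blast
qed

lemma compact: "compact_semigroup D T"
  unfolding compact_semigroup_def
proof (intro allI impI conjI ballI)
  fix t :: real and f :: "nat \<Rightarrow> 'a \<Rightarrow> real" assume t: "0 < t" and f: "\<forall>n. f n \<in> L2 D \<and> sq_norm (f n) \<le> 1"
  have "ip (f n) (f n) \<le> 1" for n
    using f sq_norm_eq_ip[of "f n" D] by (metis ennreal_le_1)
  with f have "f n \<in> L2 D" "ip (f n) (f n) \<le> 1" for n by blast+
  then obtain g r where "g \<in> L2 D" "strict_mono (r :: nat \<Rightarrow> nat)" "(\<lambda>n. sq_norm (\<lambda>x. T t (f (r n)) x - g x)) \<longlonglongrightarrow> 0"
    using T_compact[OF t, of f] by blast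
  then show "\<exists>g\<in>L2 D. \<exists>r::nat \<Rightarrow> nat. strict_mono r \<and> (\<lambda>n. sq_norm (\<lambda>x. T t (f (r n)) x - g x)) \<longlonglongrightarrow> 0" by blast
qed (rule T_L2)

end

section \<open>The ground state\<close>

lemma ip_diff_triangle:
  assumes "f \<in> L2 D" "g \<in> L2 D" "k \<in> L2 D"
  shows "ip (\<lambda>x. f x - g x) (\<lambda>x. f x - g x) \<le> 2 * ip (\<lambda>x. f x - k x) (\<lambda>x. f x - k x) + 2 * ip (\<lambda>x. k x - g x) (\<lambda>x. k x - g x)"
proof -
  note L = L2_prod_integrable[OF L2_diff L2_diff, of _ D]
  have "ip (\<lambda>x. f x - g x) (\<lambda>x. f x - g x) \<le>
    (\<integral>x. 2 * ((f x - k x) * (f x - k x)) + 2 * ((k x - g x) * (k x - g x)) \<partial>lborel)"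
    unfolding ip_def
  proof (rule integral_mono)
    fix x
    show "(f x - g x) * (f x - g x) \<le> 2 * ((f x - k x) * (f x - k x)) + 2 * ((k x - g x) * (k x - g x))"
      using sum_squares_bound[of "f x - k x" "k x - g x"] by (simp add: power2_eq_square algebra_simps)
  qed (use L assms in auto)
  also have "\<dots> = 2 * ip (\<lambda>x. f x - k x) (\<lambda>x. f x - k x) + 2 * ip (\<lambda>x. k x - g x) (\<lambda>x. k x - g x)"
    unfolding ip_def using L assms by simp
  finally show ?thesis .
qed

lemma ip_tendsto_sandwich:
  assumes "\<And>n. f n \<in> L2 D" "g \<in> L2 D" "\<And>n. k n \<in> L2 D"
    and "(\<lambda>n. ip (\<lambda>x. f n x - k n x) (\<lambda>x. f n x - k n x)) \<longlonglongrightarrow> 0"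
    and "(\<lambda>n. ip (\<lambda>x. k n x - g x) (\<lambda>x. k n x - g x)) \<longlonglongrightarrow> 0"
  shows "(\<lambda>n. ip (\<lambda>x. f n x - g x) (\<lambda>x. f n x - g x)) \<longlonglongrightarrow> 0"
proof (rule tendsto_sandwich[OF _ _ tendsto_const])
  show "\<forall>\<^sub>F n in sequentially. ip (\<lambda>x. f n x - g x) (\<lambda>x. f n x - g x) \<le>
    2 * ip (\<lambda>x. f n x - k n x) (\<lambda>x. f n x - k n x) + 2 * ip (\<lambda>x. k n x - g x) (\<lambda>x. k n x - g x)"
    by (intro always_eventually allI ip_diff_triangle[of _ D] assms)
  show "(\<lambda>n. 2 * ip (\<lambda>x. f n x - k n x) (\<lambda>x. f n x - k n x) + 2 * ip (\<lambda>x. k n x - g x) (\<lambda>x. k n x - g x)) \<longlonglongrightarrow> 0"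
    using tendsto_add[OF tendsto_mult[OF tendsto_const assms(4), of 2] tendsto_mult[OF tendsto_const assms(5), of 2]] by simp
qed (auto simp: ip_self_nonneg)

context dirichlet_kernel begin

lemma T_pos:
  assumes t: "0 < t" and f: "f \<in> L2 D" and f0: "\<And>x. 0 \<le> f x" and ne: "ip f f \<noteq> 0" and x: "x \<in> D"
  shows "0 < T t f x"
proof (rule ccontr)
  assume "\<not> 0 < T t f x"
  then have "ip (kernel_row t x) f = 0" using T_nonneg[OF t, of f x] f0 x by (simp add: T_eq)
  then have "AE y in lborel. kernel_row t x y * f y = 0"
    unfolding ip_def
    by (subst (asm) integral_nonneg_eq_0_iff_AE[OF L2_prod_integrable[OF kernel_row_L2[OF t x] f]])
       (use kernel_row_nonneg[OF t x] f0 in auto)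
  then have "AE y in lborel. f y = 0"
  proof eventually_elim
    case (elim y)
    then show ?case using q_pos[OF t x, of y] L2_outside[OF f, of y] by (cases "y \<in> D") (auto simp: kernel_row_def)
  qed
  then have "ip f f = (\<integral>x. 0 \<partial>(lborel::'a measure))"
    unfolding ip_def using L2_measurable[OF f] by (intro integral_cong_AE) auto
  with ne show False by simp
qed

lemma T_cong_AE:
  assumes "0 < t" "f \<in> L2 D" "g \<in> L2 D" "AE x in lborel. f x = g x"
  shows "T t f = T t g"
proof
  fix x
  show "T t f x = T t g x"
    using ip_cong_AE[OF assms(4,2,3) kernel_row_L2[OF assms(1)], of x] ip_commute[of "kernel_row t x" f] ip_commute[of "kernel_row t x" g]
    by (simp add: T_eq)
qed

lemma AE_eq_everywhere:
  assumes "continuous_on D f" "continuous_on D g" "AE x in lborel. f x = g x" "x \<in> D"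
  shows "f x = (g x :: real)"
  by (rule continuous_AE_eq_imp_eq[OF open_D assms(1,2) _ assms(4)]) (use assms(3) in \<open>auto elim: eventually_mono\<close>)

text \<open>The operator \<open>T s + \<kappa>\<close> is injective and annihilates \<open>T s f - \<kappa> f\<close>.\<close>

lemma T_root:
  assumes s: "0 < s" and f: "f \<in> L2 D" "continuous_on D f" and k: "0 < \<kappa>" and e: "T (2 * s) f = (\<lambda>x. \<kappa>\<^sup>2 * f x)"
  shows "T s f = (\<lambda>x. \<kappa> * f x)"
proof -
  let ?w = "\<lambda>x. T s f x - \<kappa> * f x"
  have L: "T s f \<in> L2 D" "(\<lambda>x. \<kappa> * f x) \<in> L2 D" by (rule T_L2[OF s f(1)], rule L2_scale[OF f(1)])
  have w: "?w \<in> L2 D" by (rule L2_diff[OF L])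
  have "T s ?w x = - \<kappa> * ?w x" for x
    using T_diff[OF s L, of x] T_scale[of s \<kappa> f x] T_semigroup[OF s s f(1)] fun_cong[OF e, of x]
    by (simp add: mult_2 power2_eq_square algebra_simps)
  then have "ip (T s ?w) ?w = - \<kappa> * ip ?w ?w"
    using ip_scale(1)[of "- \<kappa>" ?w ?w] by presburger
  then have "\<kappa> * ip ?w ?w \<le> 0" using T_form_nonneg[OF s w] by simp
  then have "ip ?w ?w = 0" using k ip_self_nonneg[of ?w] by (simp add: mult_le_0_iff)
  from ip_self_eq_0[OF w this] have "AE x in lborel. T s f x = \<kappa> * f x" by simp
  from AE_eq_everywhere[OF T_continuous[OF s f(1)] continuous_on_mult_left[OF f(2)] this]
  have "T s f x = \<kappa> * f x" if "x \<in> D" for x using that .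
  then show ?thesis using L2_outside[OF f(1)] by (intro ext) (metis (no_types) T_eq mult_zero_right)
qed

lemma T_dyadic:
  assumes f: "f \<in> L2 D" "continuous_on D f" and e: "T 1 f = (\<lambda>x. exp (- \<mu>) * f x)"
  shows "T (1 / 2 ^ m) f = (\<lambda>x. exp (- \<mu> / 2 ^ m) * f x)"
proof (induct m)
  case (Suc m)
  have a: "(exp (- \<mu> / 2 ^ Suc m))\<^sup>2 = exp (- \<mu> / 2 ^ m)"
    by (simp add: power2_eq_square exp_add[symmetric] field_simps)
  have b: "2 * (1 / 2 ^ Suc m) = (1 / 2 ^ m :: real)" by simp
  show ?case
  proof (rule T_root[OF _ f])
    show "T (2 * (1 / 2 ^ Suc m)) f = (\<lambda>x. (exp (- \<mu> / 2 ^ Suc m))\<^sup>2 * f x)"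
      unfolding a b by (rule Suc)
  qed auto
qed (use e in simp)

lemma T_dyadic_mult:
  assumes f: "f \<in> L2 D" "continuous_on D f" and e: "T 1 f = (\<lambda>x. exp (- \<mu>) * f x)"
  shows "T (real (Suc k) / 2 ^ m) f = (\<lambda>x. exp (- \<mu> * (real (Suc k) / 2 ^ m)) * f x)"
proof (induct k)
  case 0 then show ?case using T_dyadic[OF assms, of m] by simp
next
  case (Suc k)
  have "T (real (Suc (Suc k)) / 2 ^ m) f = T (1 / 2 ^ m) (T (real (Suc k) / 2 ^ m) f)"
  proof -
    have "T (1 / 2 ^ m) (T (real (Suc k) / 2 ^ m) f) = T (1 / 2 ^ m + real (Suc k) / 2 ^ m) f"
      by (rule T_semigroup) (auto intro: f divide_pos_pos)
    moreover have "1 / 2 ^ m + real (Suc k) / 2 ^ m = real (Suc (Suc k)) / 2 ^ m" by (simp add: add_divide_distrib)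
    ultimately show ?thesis by simp
  qed
  also have "\<dots> = (\<lambda>x. exp (- \<mu> * (real (Suc k) / 2 ^ m)) * (exp (- \<mu> / 2 ^ m) * f x))"
    unfolding Suc fun_cong[OF T_dyadic[OF assms, of m], symmetric] by (rule ext, rule T_scale)
  also have "\<dots> = (\<lambda>x. exp (- \<mu> * (real (Suc (Suc k)) / 2 ^ m)) * f x)"
  proof -
    have "- \<mu> * (real (Suc (Suc k)) / 2 ^ m) = - \<mu> * (real (Suc k) / 2 ^ m) + - \<mu> / 2 ^ m"
      by (simp add: field_simps)
    then have "exp (- \<mu> * (real (Suc (Suc k)) / 2 ^ m)) = exp (- \<mu> * (real (Suc k) / 2 ^ m)) * exp (- \<mu> / 2 ^ m)"
      by (simp only: exp_add)
    then show ?thesis by (simp only: mult.assoc)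
  qed
  finally show ?case .
qed

text \<open>With \<open>g = T (s / 2) f\<close> the two sides are \<langle>T (t - s) g, g\<rangle>
  and \<langle>g, g\<rangle>, and \<open>T\<close> is a contraction.\<close>

lemma T_form_antimono:
  assumes s: "0 < s" and t: "s \<le> t" and f: "f \<in> L2 D"
  shows "ip (T t f) f \<le> ip (T s f) f"
proof (cases "s = t")
  case False
  define d where "d = t - s"
  have d: "0 < d" using t False by (simp add: d_def)
  have s2: "0 < s / 2" using s by simp
  let ?g = "T (s / 2) f"
  have g: "?g \<in> L2 D" by (rule T_L2[OF s2 f])
  have "T (s / 2) (T d ?g) = T t f"
  proof -
    have "T d ?g = T (d + s / 2) f" by (rule T_semigroup[OF d s2 f])
    moreover have "T (s / 2) (T (d + s / 2) f) = T (s / 2 + (d + s / 2)) f"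
      by (rule T_semigroup[OF s2 _ f]) (use d s2 in simp)
    moreover have "s / 2 + (d + s / 2) = t" by (simp add: d_def)
    ultimately show ?thesis by simp
  qed
  then have "ip (T t f) f = ip (T d ?g) ?g"
    using T_sym[OF s2 T_L2[OF d g] f] by simp
  also have "\<dots> = ip (T (d / 2) ?g) (T (d / 2) ?g)" by (rule T_half[OF d g])
  also have "\<dots> \<le> ip ?g ?g" by (rule T_contraction) (use d g in auto)
  also have "\<dots> = ip (T s f) f" by (rule T_half[OF s f, symmetric])
  finally show ?thesis .
qed simp

text \<open>From dyadic times to all times by monotonicity of \<open>\<langle>T t f, f\<rangle>\<close> in \<open>t\<close>.\<close>

lemma T_form_exp:
  assumes f: "f \<in> L2 D" "continuous_on D f" and e: "T 1 f = (\<lambda>x. exp (- \<mu>) * f x)" and t: "0 < t"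
  shows "ip (T t f) f = exp (- \<mu> * t) * ip f f"
proof -
  let ?k = "\<lambda>m::nat. nat \<lfloor>t * 2 ^ m\<rfloor>"
  have dy: "ip (T (real k / 2 ^ m) f) f = exp (- \<mu> * (real k / 2 ^ m)) * ip f f" if "0 < k" for k m
    using T_dyadic_mult[OF f e, of "k - 1" m] that by (simp add: ip_scale)
  have lim: "(\<lambda>m. real (?k m) / 2 ^ m) \<longlonglongrightarrow> t" "(\<lambda>m. real (Suc (?k m)) / 2 ^ m) \<longlonglongrightarrow> t"
  proof -
    have b: "t - (1/2) ^ m \<le> real (?k m) / 2 ^ m" "real (?k m) / 2 ^ m \<le> t" for m :: nat
    proof -
      have r: "real (?k m) = of_int \<lfloor>t * 2 ^ m\<rfloor>" using t by simp
      have "t * 2 ^ m - 1 \<le> real (?k m)" "real (?k m) \<le> t * 2 ^ m" unfolding r by linarith+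
      moreover have "t - (1/2) ^ m \<le> K / 2 ^ m \<and> K / 2 ^ m \<le> t" if "t * 2 ^ m - 1 \<le> K" "K \<le> t * 2 ^ m" for K
        using that by (simp add: pos_le_divide_eq pos_divide_le_eq left_diff_distrib power_one_over)
      ultimately show "t - (1/2) ^ m \<le> real (?k m) / 2 ^ m" "real (?k m) / 2 ^ m \<le> t" by blast+
    qed
    have h: "(\<lambda>m. (1/2::real) ^ m) \<longlonglongrightarrow> 0" by (rule LIMSEQ_power_zero) simp
    show l: "(\<lambda>m. real (?k m) / 2 ^ m) \<longlonglongrightarrow> t"
    proof (rule tendsto_sandwich[OF _ _ _ tendsto_const])
      show "(\<lambda>m. t - (1/2) ^ m) \<longlonglongrightarrow> t" using tendsto_diff[OF tendsto_const h, of t] by simp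
    qed (use b in auto)
    have "(\<lambda>m. real (Suc (?k m)) / 2 ^ m) = (\<lambda>m. real (?k m) / 2 ^ m + (1/2) ^ m)"
      by (auto simp: add_divide_distrib power_divide)
    then show "(\<lambda>m. real (Suc (?k m)) / 2 ^ m) \<longlonglongrightarrow> t" using tendsto_add[OF l h] by simp
  qed
  have pos: "\<forall>\<^sub>F m in sequentially. 0 < real (?k m) / 2 ^ m" by (rule order_tendstoD(1)[OF lim(1) t])
  have le: "real (?k m) / 2 ^ m \<le> t" "t \<le> real (Suc (?k m)) / 2 ^ m" for m :: nat
  proof -
    have r: "real (?k m) = of_int \<lfloor>t * 2 ^ m\<rfloor>" using t by simp
    have "real (?k m) \<le> t * 2 ^ m" "t * 2 ^ m \<le> real (Suc (?k m))" unfolding of_nat_Suc r by linarith+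
    then show "real (?k m) / 2 ^ m \<le> t" "t \<le> real (Suc (?k m)) / 2 ^ m" by (auto simp: field_simps)
  qed
  show ?thesis
  proof (rule antisym)
    show "ip (T t f) f \<le> exp (- \<mu> * t) * ip f f"
    proof (rule tendsto_lowerbound)
      show "(\<lambda>m. exp (- \<mu> * (real (?k m) / 2 ^ m)) * ip f f) \<longlonglongrightarrow> exp (- \<mu> * t) * ip f f"
        by (intro tendsto_intros lim)
      show "\<forall>\<^sub>F m in sequentially. ip (T t f) f \<le> exp (- \<mu> * (real (?k m) / 2 ^ m)) * ip f f"
        using pos
      proof eventually_elim
        case (elim m)
        then have "0 < ?k m" by (simp add: zero_less_divide_iff)
        from dy[OF this, of m] T_form_antimono[OF elim le(1)[of m] f(1)] show ?case by simp
      qed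
    qed simp
    show "exp (- \<mu> * t) * ip f f \<le> ip (T t f) f"
    proof (rule tendsto_upperbound)
      show "(\<lambda>m. exp (- \<mu> * (real (Suc (?k m)) / 2 ^ m)) * ip f f) \<longlonglongrightarrow> exp (- \<mu> * t) * ip f f"
        by (intro tendsto_intros lim)
      show "\<forall>\<^sub>F m in sequentially. exp (- \<mu> * (real (Suc (?k m)) / 2 ^ m)) * ip f f \<le> ip (T t f) f"
        using T_form_antimono[OF t le(2) f(1)] dy[OF zero_less_Suc] by (intro always_eventually allI) metis
    qed simp
  qed
qed

text \<open>The squared norm of the difference of the two sides expands into values of \<langle>T r
  f, f\<rangle> at the times \<open>t\<close> and \<open>2 * t\<close>; by \<open>T_form_exp\<close>
  they add up to 0.\<close>

lemma T_exp:
  assumes f: "f \<in> L2 D" "continuous_on D f" and e: "T 1 f = (\<lambda>x. exp (- \<mu>) * f x)" and t: "0 < t"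
  shows "AE x in lborel. T t f x = exp (- \<mu> * t) * f x"
proof -
  let ?c = "exp (- \<mu> * t)"
  have L: "T t f \<in> L2 D" "(\<lambda>x. ?c * f x) \<in> L2 D" by (rule T_L2[OF t f(1)], rule L2_scale[OF f(1)])
  have "ip (T t f) (T t f) = ip (T (2 * t) f) f"
  proof -
    have "ip (T (2 * t) f) f = ip (T (2 * t / 2) f) (T (2 * t / 2) f)" by (rule T_half) (use t f in auto)
    then show ?thesis by simp
  qed
  also have "\<dots> = exp (- \<mu> * (2 * t)) * ip f f" by (rule T_form_exp[OF f e]) (use t in simp)
  also have "exp (- \<mu> * (2 * t)) = ?c * ?c" by (simp add: exp_add[symmetric] field_simps)
  finally have "ip (\<lambda>x. T t f x - ?c * f x) (\<lambda>x. T t f x - ?c * f x) = 0"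
    using ip_diff_self[OF L] T_form_exp[OF f e t] by (simp add: ip_scale)
  from ip_self_eq_0[OF L2_diff[OF L] this] show ?thesis by simp
qed

text \<open>The maximal Rayleigh quotient of \<open>T 1\<close>, that is its largest spectral value.
  The set is nonempty by \<open>exists_unit\<close> and bounded by \<open>top_value_bdd\<close>, as
  a real supremum requires.\<close>

definition top_value :: real where
  "top_value = Sup {ip (T 1 f) f | f. f \<in> L2 D \<and> ip f f = 1}"

lemma form_le_self: "0 < t \<Longrightarrow> f \<in> L2 D \<Longrightarrow> ip (T t f) f \<le> ip f f"
  using T_half[of t f] T_contraction[of "t / 2" f] by simp

lemma top_value_bdd: "bdd_above {ip (T 1 f) f | f. f \<in> L2 D \<and> ip f f = 1}"
proof (rule bdd_aboveI[of _ 1])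
  fix y assume "y \<in> {ip (T 1 f) f | f. f \<in> L2 D \<and> ip f f = 1}"
  then obtain f where "y = ip (T 1 f) f" "f \<in> L2 D" "ip f f = 1" by auto
  then show "y \<le> 1" using form_le_self[of 1 f] by simp
qed

lemma exists_unit: "\<exists>f\<in>L2 D. ip f f = 1 \<and> 0 < ip (T 1 f) f"
proof -
  obtain x where x: "x \<in> D" using nonempty_D by auto
  \<comment> \<open>A row at time 1 has squared norm \<open>q 2 x x\<close> and form value
    \<open>q 3 x x\<close>, both positive; it only remains to normalise it.\<close>
  let ?f = "kernel_row 1 x"
  have f: "?f \<in> L2 D" by (rule kernel_row_L2[OF _ x]) simp
  have n: "ip ?f ?f = q 2 x x" using ip_kernel_row[OF _ _ x x, of 1 1] by simp
  have np: "0 < ip ?f ?f" unfolding n by (rule q_pos[OF _ x x]) simp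
  have "ip (T 1 ?f) ?f = q 3 x x" using T_kernel_row[OF _ _ x, of 1 1] ip_kernel_row[OF _ _ x x, of 2 1] by simp
  then have Tp: "0 < ip (T 1 ?f) ?f" using q_pos[OF _ x x, of 3] by simp
  let ?c = "1 / sqrt (ip ?f ?f)"
  let ?g = "\<lambda>y. ?c * ?f y"
  have "ip ?g ?g = ?c * (?c * ip ?f ?f)" by (simp only: ip_scale)
  then have "ip ?g ?g = 1" using np by simp
  moreover have "ip (T 1 ?g) ?g = ?c * ?c * ip (T 1 ?f) ?f"
  proof -
    have "T 1 ?g = (\<lambda>y. ?c * T 1 ?f y)" using T_scale by blast
    then show ?thesis by (simp only: ip_scale mult.assoc)
  qed
  moreover have "0 < ?c * ?c * ip (T 1 ?f) ?f" using np Tp by simp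
  ultimately show ?thesis using L2_scale[OF f, of ?c] by metis
qed

lemma top_value_pos: "0 < top_value"
proof -
  obtain f where f: "f \<in> L2 D" "ip f f = 1" "0 < ip (T 1 f) f" using exists_unit by auto
  have "ip (T 1 f) f \<le> top_value" unfolding top_value_def
    by (rule cSup_upper[OF _ top_value_bdd]) (use f in auto)
  with f(3) show ?thesis by simp
qed

lemma form_le_top_value:
  assumes f: "f \<in> L2 D" shows "ip (T 1 f) f \<le> top_value * ip f f"
proof (cases "ip f f = 0")
  case True
  then show ?thesis using form_le_self[of 1 f] f by simp
next
  case False
  then have np: "0 < ip f f" using ip_self_nonneg[of f] by simp
  let ?c = "1 / sqrt (ip f f)"
  let ?g = "\<lambda>y. ?c * f y"
  have "ip ?g ?g = ?c * (?c * ip f f)" by (simp only: ip_scale)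
  then have g1: "ip ?g ?g = 1" using np by simp
  have "T 1 ?g = (\<lambda>y. ?c * T 1 f y)" using T_scale by blast
  then have "ip (T 1 ?g) ?g = ?c * (?c * ip (T 1 f) f)" by (simp only: ip_scale)
  then have g2: "ip (T 1 ?g) ?g = ip (T 1 f) f / ip f f" using np by simp
  have "ip (T 1 ?g) ?g \<le> top_value" unfolding top_value_def
    by (rule cSup_upper[OF _ top_value_bdd]) (use g1 L2_scale[OF f, of ?c] in blast)
  then show ?thesis unfolding g2 using np by (simp add: field_simps)
qed

lemma top_value_le1: "top_value \<le> 1"
  unfolding top_value_def
proof (rule cSup_least)
  fix y assume "y \<in> {ip (T 1 f) f | f. f \<in> L2 D \<and> ip f f = 1}"
  then obtain f where "y = ip (T 1 f) f" "f \<in> L2 D" "ip f f = 1" by auto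
  then show "y \<le> 1" using form_le_self[of 1 f] by simp
qed (use exists_unit in auto)

text \<open>The Rayleigh bound applied to \<open>T (1 / 2) f\<close>. Through it, a near-maximal
  form value forces \<open>T 1 f\<close> to be close to \<open>top_value\<close> times
  \<open>f\<close>.\<close>

lemma T1_norm_le:
  assumes f: "f \<in> L2 D" shows "ip (T 1 f) (T 1 f) \<le> top_value * ip (T 1 f) f"
proof -
  let ?g = "T (1 / 2) f"
  have g: "?g \<in> L2 D" by (rule T_L2[OF _ f]) simp
  have "T 1 f = T (1 / 2) ?g" using T_semigroup[of "1/2" "1/2" f] f by simp
  then have "ip (T 1 f) (T 1 f) = ip (T 1 ?g) ?g" using T_half[of 1 ?g] g by simp
  also have "\<dots> \<le> top_value * ip ?g ?g" by (rule form_le_top_value[OF g])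
  also have "ip ?g ?g = ip (T 1 f) f" using T_half[of 1 f] f by simp
  finally show ?thesis .
qed

end

context tight_dirichlet_kernel begin

text \<open>For a maximising sequence \<open>h n\<close> both \<open>T 1 (h n) - g\<close> and
  \<open>top_value * h n - T 1 (h n)\<close> tend to 0 in norm, so \<open>top_value * h n\<close>
  tends to \<open>g\<close>. Applying the contraction \<open>T 1\<close> turns this into the
  eigenvalue equation for \<open>g\<close>.\<close>

lemma exists_maximizer:
  obtains g where "g \<in> L2 D" "\<And>x. 0 \<le> g x" "ip g g \<noteq> 0" "AE x in lborel. T 1 g x = top_value * g x"
proof -
  let ?l = top_value
  have "\<exists>f. f \<in> L2 D \<and> ip f f = 1 \<and> (\<forall>x. 0 \<le> f x) \<and> ?l - 1 / real (Suc n) < ip (T 1 f) f" for n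
  proof -
    have "?l - 1 / real (Suc n) < Sup {ip (T 1 f) f | f. f \<in> L2 D \<and> ip f f = 1}"
      unfolding top_value_def[symmetric] by simp
    moreover have "{ip (T 1 f) f | f. f \<in> L2 D \<and> ip f f = 1} \<noteq> {}" using exists_unit by auto
    ultimately obtain f where f: "f \<in> L2 D" "ip f f = 1" "?l - 1 / real (Suc n) < ip (T 1 f) f"
      using less_cSup_iff[OF _ top_value_bdd] by auto
    let ?v = "\<lambda>x. \<bar>f x\<bar>"
    have "?v \<in> L2 D" "ip ?v ?v = 1" "?l - 1 / real (Suc n) < ip (T 1 ?v) ?v"
      using L2_abs[OF f(1)] ip_abs_self[of f] f T_form_abs[of 1 f] by auto
    then show ?thesis by (intro exI[of _ ?v]) simp
  qed
  then obtain f where f: "\<And>n. f n \<in> L2 D" "\<And>n. ip (f n) (f n) = 1" "\<And>n x. 0 \<le> f n x"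
    "\<And>n. ?l - 1 / real (Suc n) < ip (T 1 (f n)) (f n)" by metis
  obtain g0 r where g0: "g0 \<in> L2 D" and r: "strict_mono (r :: nat \<Rightarrow> nat)"
    and lim: "(\<lambda>n. sq_norm (\<lambda>x. T 1 (f (r n)) x - g0 x)) \<longlonglongrightarrow> 0"
    using T_compact[of 1 f] f by auto
  define h where "h n = f (r n)" for n
  have h: "h n \<in> L2 D" "ip (h n) (h n) = 1" "0 \<le> h n x" for n x unfolding h_def by (rule f)+
  have Th: "T 1 (h n) \<in> L2 D" for n by (rule T_L2[OF _ h(1)]) simp
  \<comment> \<open>The functions \<open>T 1 (h n)\<close> are nonnegative, so the absolute value of
    their limit is at least as close to them as the limit.\<close>
  define g where "g x = \<bar>g0 x\<bar>" for x
  have g: "g \<in> L2 D" unfolding g_def by (rule L2_abs[OF g0])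
  have Tg: "T 1 g \<in> L2 D" by (rule T_L2[OF _ g]) simp
  have lim1: "(\<lambda>n. ip (\<lambda>x. T 1 (h n) x - g x) (\<lambda>x. T 1 (h n) x - g x)) \<longlonglongrightarrow> 0"
  proof (rule tendsto_sandwich[OF _ _ tendsto_const])
    have "(\<lambda>n. ennreal (ip (\<lambda>x. T 1 (h n) x - g0 x) (\<lambda>x. T 1 (h n) x - g0 x))) \<longlonglongrightarrow> ennreal 0"
      using lim sq_norm_eq_ip[OF L2_diff[OF Th g0]] unfolding h_def by simp
    then show "(\<lambda>n. ip (\<lambda>x. T 1 (h n) x - g0 x) (\<lambda>x. T 1 (h n) x - g0 x)) \<longlonglongrightarrow> 0"
      by (subst (asm) tendsto_ennreal_iff) (auto simp: ip_self_nonneg)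
    show "\<forall>\<^sub>F n in sequentially. ip (\<lambda>x. T 1 (h n) x - g x) (\<lambda>x. T 1 (h n) x - g x) \<le> ip (\<lambda>x. T 1 (h n) x - g0 x) (\<lambda>x. T 1 (h n) x - g0 x)"
    proof (intro always_eventually allI)
      fix n
      show "ip (\<lambda>x. T 1 (h n) x - g x) (\<lambda>x. T 1 (h n) x - g x) \<le> ip (\<lambda>x. T 1 (h n) x - g0 x) (\<lambda>x. T 1 (h n) x - g0 x)"
        unfolding ip_def
      proof (rule integral_mono)
        fix x
        have "\<bar>T 1 (h n) x - g x\<bar> \<le> \<bar>T 1 (h n) x - g0 x\<bar>"
          using T_nonneg[of 1 "h n" x] h(3) by (simp add: g_def)
        then show "(T 1 (h n) x - g x) * (T 1 (h n) x - g x) \<le> (T 1 (h n) x - g0 x) * (T 1 (h n) x - g0 x)"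
          by (simp add: abs_le_square_iff power2_eq_square)
      qed (intro L2_prod_integrable[of _ D] L2_diff Th g g0)+
    qed
  qed (auto simp: ip_self_nonneg)
  \<comment> \<open>After expansion of the square, \<open>T1_norm_le\<close> leaves
    \<open>?l\<close> times the defect \<open>?l - ip (T 1 (h n)) (h n)\<close> of the
    maximisation.\<close>
  have lim2: "(\<lambda>n. ip (\<lambda>x. ?l * h n x - T 1 (h n) x) (\<lambda>x. ?l * h n x - T 1 (h n) x)) \<longlonglongrightarrow> 0"
  proof (rule tendsto_sandwich[OF _ _ tendsto_const])
    show "\<forall>\<^sub>F n in sequentially. ip (\<lambda>x. ?l * h n x - T 1 (h n) x) (\<lambda>x. ?l * h n x - T 1 (h n) x) \<le> ?l * (1 / real (Suc n))"
    proof (intro always_eventually allI)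
      fix n
      have "ip (\<lambda>x. ?l * h n x - T 1 (h n) x) (\<lambda>x. ?l * h n x - T 1 (h n) x) = ?l * ?l - 2 * ?l * ip (T 1 (h n)) (h n) + ip (T 1 (h n)) (T 1 (h n))"
        using ip_diff_self[OF L2_scale[OF h(1)] Th, of ?l n n] h(2)[of n] by (simp add: ip_scale ip_commute[of "h n" "T 1 (h n)"])
      also have "\<dots> \<le> ?l * ?l - ?l * ip (T 1 (h n)) (h n)" using T1_norm_le[OF h(1), of n] by simp
      also have "\<dots> = ?l * (?l - ip (T 1 (h n)) (h n))" by (simp add: algebra_simps)
      also have "\<dots> \<le> ?l * (1 / real (Suc n))"
      proof (rule mult_left_mono)
        have "?l - 1 / real (Suc (r n)) < ip (T 1 (h n)) (h n)" unfolding h_def by (rule f(4))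
        moreover have "1 / real (Suc (r n)) \<le> 1 / real (Suc n)"
          using seq_suble[OF r, of n] by (intro divide_left_mono) auto
        ultimately show "?l - ip (T 1 (h n)) (h n) \<le> 1 / real (Suc n)" by simp
      qed (use top_value_pos in simp)
      finally show "ip (\<lambda>x. ?l * h n x - T 1 (h n) x) (\<lambda>x. ?l * h n x - T 1 (h n) x) \<le> ?l * (1 / real (Suc n))" .
    qed
    show "(\<lambda>n. ?l * (1 / real (Suc n))) \<longlonglongrightarrow> 0"
      using tendsto_mult[OF tendsto_const LIMSEQ_inverse_real_of_nat, of ?l] by (simp add: inverse_eq_divide)
  qed (auto simp: ip_self_nonneg)
  have lh: "(\<lambda>x. ?l * h n x) \<in> L2 D" for n by (rule L2_scale[OF h(1)])
  have lim3: "(\<lambda>n. ip (\<lambda>x. ?l * h n x - g x) (\<lambda>x. ?l * h n x - g x)) \<longlonglongrightarrow> 0"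
    by (rule ip_tendsto_sandwich[OF lh g Th lim2 lim1])
  have ne: "ip g g \<noteq> 0"
  proof
    assume g00: "ip g g = 0"
    have "ip (\<lambda>x. ?l * h n x - g x) (\<lambda>x. ?l * h n x - g x) = ?l * ?l" for n
    proof -
      have "ip (\<lambda>x. ?l * h n x) g = 0" using ip_abs_le[OF lh g, of n] g00 by simp
      then show ?thesis using ip_diff_self[OF lh g, of n] g00 h(2)[of n] by (simp add: ip_scale)
    qed
    with lim3 have "(\<lambda>n::nat. ?l * ?l) \<longlonglongrightarrow> 0" by simp
    then have "?l * ?l = 0" by (simp add: LIMSEQ_const_iff)
    with top_value_pos show False by simp
  qed
  have Tl: "T 1 (\<lambda>x. ?l * h n x) \<in> L2 D" for n by (rule T_L2[OF _ lh]) simp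
  have lg: "(\<lambda>x. ?l * g x) \<in> L2 D" by (rule L2_scale[OF g])
  have lim4: "(\<lambda>n. ip (\<lambda>x. T 1 g x - T 1 (\<lambda>x. ?l * h n x) x) (\<lambda>x. T 1 g x - T 1 (\<lambda>x. ?l * h n x) x)) \<longlonglongrightarrow> 0"
  proof (rule tendsto_sandwich[OF _ _ tendsto_const lim3])
    show "\<forall>\<^sub>F n in sequentially. ip (\<lambda>x. T 1 g x - T 1 (\<lambda>x. ?l * h n x) x) (\<lambda>x. T 1 g x - T 1 (\<lambda>x. ?l * h n x) x) \<le>
      ip (\<lambda>x. ?l * h n x - g x) (\<lambda>x. ?l * h n x - g x)"
    proof (intro always_eventually allI)
      fix n
      have "T 1 (\<lambda>x. ?l * h n x - g x) = (\<lambda>x. T 1 (\<lambda>x. ?l * h n x) x - T 1 g x)"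
        using T_diff[OF _ lh g, of 1 n] by auto
      then have "ip (\<lambda>x. T 1 (\<lambda>x. ?l * h n x) x - T 1 g x) (\<lambda>x. T 1 (\<lambda>x. ?l * h n x) x - T 1 g x) \<le>
        ip (\<lambda>x. ?l * h n x - g x) (\<lambda>x. ?l * h n x - g x)"
        using T_contraction[OF _ L2_diff[OF lh g], of 1 n] by simp
      moreover have "ip (\<lambda>x. T 1 (\<lambda>x. ?l * h n x) x - T 1 g x) (\<lambda>x. T 1 (\<lambda>x. ?l * h n x) x - T 1 g x) =
        ip (\<lambda>x. T 1 g x - T 1 (\<lambda>x. ?l * h n x) x) (\<lambda>x. T 1 g x - T 1 (\<lambda>x. ?l * h n x) x)"
        unfolding ip_def by (intro Bochner_Integration.integral_cong) (auto simp: algebra_simps)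
      ultimately show "ip (\<lambda>x. T 1 g x - T 1 (\<lambda>x. ?l * h n x) x) (\<lambda>x. T 1 g x - T 1 (\<lambda>x. ?l * h n x) x) \<le>
        ip (\<lambda>x. ?l * h n x - g x) (\<lambda>x. ?l * h n x - g x)" by simp
    qed
  qed (auto simp: ip_self_nonneg)
  have lim5: "(\<lambda>n. ip (\<lambda>x. T 1 (\<lambda>x. ?l * h n x) x - ?l * g x) (\<lambda>x. T 1 (\<lambda>x. ?l * h n x) x - ?l * g x)) \<longlonglongrightarrow> 0"
  proof -
    have "(\<lambda>x. T 1 (\<lambda>x. ?l * h n x) x - ?l * g x) = (\<lambda>x. ?l * (T 1 (h n) x - g x))" for n
      by (simp add: T_scale algebra_simps)
    then have "ip (\<lambda>x. T 1 (\<lambda>x. ?l * h n x) x - ?l * g x) (\<lambda>x. T 1 (\<lambda>x. ?l * h n x) x - ?l * g x) =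
       ?l * (?l * ip (\<lambda>x. T 1 (h n) x - g x) (\<lambda>x. T 1 (h n) x - g x))" for n
      by (simp only: ip_scale)
    then show ?thesis
      using tendsto_mult[OF tendsto_const tendsto_mult[OF tendsto_const lim1], of ?l ?l] by simp
  qed
  have "(\<lambda>n::nat. ip (\<lambda>x. T 1 g x - ?l * g x) (\<lambda>x. T 1 g x - ?l * g x)) \<longlonglongrightarrow> 0"
    by (rule ip_tendsto_sandwich[OF Tg lg Tl lim4 lim5])
  then have "ip (\<lambda>x. T 1 g x - ?l * g x) (\<lambda>x. T 1 g x - ?l * g x) = 0" by (simp add: LIMSEQ_const_iff)
  from ip_self_eq_0[OF L2_diff[OF Tg lg] this] have "AE x in lborel. T 1 g x = ?l * g x" by simp
  with g ne show ?thesis using that[of g] by (simp add: g_def)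
qed

text \<open>Up to a constant, \<open>T 1 g\<close> is a continuous and strictly positive version of
  the maximiser \<open>g\<close>. That no eigenvalue lies below is the Rayleigh bound for
  \<open>T 1\<close> at another eigenfunction.\<close>

lemma exists_ground_state: "\<exists>\<phi>. ground_state D T \<phi>"
proof -
  let ?l = top_value
  obtain g where g: "g \<in> L2 D" "\<And>x. 0 \<le> g x" "ip g g \<noteq> 0" "AE x in lborel. T 1 g x = ?l * g x"
    using exists_maximizer by blast
  have gp: "0 < ip g g" using g(3) ip_self_nonneg[of g] by simp
  \<comment> \<open>As \<open>T 1 g = ?l * g\<close> almost everywhere, this factor makes
    \<open>c * T 1 g\<close> a unit vector.\<close>
  define c where "c = 1 / (?l * sqrt (ip g g))"
  have c: "0 < c" using top_value_pos gp by (simp add: c_def)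
  define \<phi> where "\<phi> x = c * T 1 g x" for x
  have Tg: "T 1 g \<in> L2 D" by (rule T_L2[OF _ g(1)]) simp
  have L: "\<phi> \<in> L2 D" unfolding \<phi>_def by (rule L2_scale[OF Tg])
  have cont: "continuous_on D \<phi>" unfolding \<phi>_def
    by (intro continuous_on_mult_left T_continuous g) simp
  have ae: "AE x in lborel. \<phi> x = (c * ?l) * g x" using g(4) unfolding \<phi>_def by eventually_elim simp
  have Lc: "(\<lambda>x. (c * ?l) * g x) \<in> L2 D" by (rule L2_scale[OF g(1)])
  have T1: "T 1 \<phi> = (\<lambda>x. ?l * \<phi> x)"
  proof -
    have "T 1 \<phi> = T 1 (\<lambda>x. (c * ?l) * g x)" by (rule T_cong_AE[OF _ L Lc ae]) simp
    also have "\<dots> = (\<lambda>x. ?l * \<phi> x)" using T_scale[of 1 "c * ?l" g] by (intro ext) (simp add: \<phi>_def)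
    finally show ?thesis .
  qed
  have n1: "ip \<phi> \<phi> = 1"
  proof -
    have "ip \<phi> \<phi> = ip (\<lambda>x. (c * ?l) * g x) \<phi>" by (rule ip_cong_AE[OF ae L Lc L])
    also have "\<dots> = ip \<phi> (\<lambda>x. (c * ?l) * g x)" by (rule ip_commute)
    also have "\<dots> = ip (\<lambda>x. (c * ?l) * g x) (\<lambda>x. (c * ?l) * g x)" by (rule ip_cong_AE[OF ae L Lc Lc])
    also have "\<dots> = (c * ?l) * (c * ?l) * ip g g" by (simp add: ip_scale)
    also have "\<dots> = 1" using gp top_value_pos by (simp add: c_def)
    finally show ?thesis .
  qed
  define \<mu> where "\<mu> = - ln ?l"
  have el: "exp (- \<mu>) = ?l" using top_value_pos by (simp add: \<mu>_def)
  have T1e: "T 1 \<phi> = (\<lambda>x. exp (- \<mu>) * \<phi> x)" using T1 by (simp add: el)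
  have mu0: "0 \<le> \<mu>" using top_value_le1 top_value_pos by (simp add: \<mu>_def)
  have pos: "0 < \<phi> x" if "x \<in> D" for x
    unfolding \<phi>_def using c T_pos[OF _ g(1,2,3) that, of 1] by simp
  \<comment> \<open>If \<mu> were 0, \<langle>T t \<phi>, \<phi>\<rangle> would not depend on t.
    Then \<open>form_abs\<close> gives form value 0, and \<open>irreducible\<close> makes \<phi>
    vanish almost everywhere, against its positivity on \<open>D\<close>.\<close>
  have "\<mu> \<noteq> 0"
  proof
    assume m0: "\<mu> = 0"
    have "E (\<lambda>x. \<bar>\<phi> x\<bar>) \<le> ennreal 0"
    proof (rule form_abs[OF L, where \<delta>="\<lambda>n. 1 / real (Suc n)"])
      show "(\<lambda>n. 1 / real (Suc n)) \<longlonglongrightarrow> 0" using LIMSEQ_inverse_real_of_nat by (simp add: inverse_eq_divide)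
      show "ip \<phi> \<phi> - ip (T (1 / real (Suc n)) \<phi>) \<phi> \<le> 0 * (1 / real (Suc n))" for n
        using T_form_exp[OF L cont T1e, of "1 / real (Suc n)"] m0 by simp
    qed auto
    then have "AE x in lborel. \<bar>\<phi> x\<bar> = 0" by (intro irreducible L2_abs L) auto
    then obtain x where "x \<in> D" "\<bar>\<phi> x\<bar> = 0" by (rule AE_lborel_open_witness[OF _ open_D nonempty_D])
    with pos show False by force
  qed
  with mu0 have mu: "0 < \<mu>" by simp
  have eig: "eigenfunction D T \<mu> \<phi>"
    unfolding eigenfunction_def using L n1 sq_norm_eq_ip[OF L] T_exp[OF L cont T1e] by auto
  have least: "\<mu> \<le> \<mu>'" if "eigenfunction D T \<mu>' \<psi>" for \<mu>' \<psi>
  proof -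
    have all: "\<forall>t>0. AE x in lborel. T t \<psi> x = exp (- \<mu>' * t) * \<psi> x"
      and p: "\<psi> \<in> L2 D" "sq_norm \<psi> \<noteq> 0" using that unfolding eigenfunction_def by blast+
    have p3: "AE x in lborel. T 1 \<psi> x = exp (- \<mu>' * 1) * \<psi> x" by (rule all[rule_format]) simp
    have p_pos: "0 < ip \<psi> \<psi>" using p(2) sq_norm_eq_ip[OF p(1)] ip_self_nonneg[of \<psi>] by (cases "ip \<psi> \<psi> = 0") auto
    have "ip (T 1 \<psi>) \<psi> = exp (- \<mu>' * 1) * ip \<psi> \<psi>"
      using ip_cong_AE[OF p3 T_L2[OF _ p(1)] L2_scale[OF p(1)] p(1)] by (simp add: ip_scale)
    with form_le_top_value[OF p(1)] p_pos have "exp (- \<mu>') \<le> exp (- \<mu>)" by (simp add: el)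
    then show ?thesis by simp
  qed
  have bd: "bounded (\<phi> ` D)"
  proof -
    obtain M where M: "0 \<le> M" "\<And>x y. x \<in> D \<Longrightarrow> y \<in> D \<Longrightarrow> q (1 + 1) x y \<le> M" using q_bound[of "1 + 1"] by auto
    have "norm (\<phi> x) \<le> c * (sqrt M * sqrt (ip g g))" if x: "x \<in> D" for x
    proof -
      have "\<bar>T 1 g x\<bar> \<le> sqrt (q (1 + 1) x x) * sqrt (ip g g)" by (rule T_bound[OF _ g(1) x]) simp
      also have "\<dots> \<le> sqrt M * sqrt (ip g g)" using M(2)[OF x x] gp by (intro mult_right_mono) auto
      finally show ?thesis using c by (simp add: \<phi>_def abs_mult)
    qed
    then show ?thesis unfolding bounded_iff by auto
  qed
  have "ground_state D T \<phi>"
    unfolding ground_state_def using mu eig least sq_norm_eq_ip[OF L] n1 bd cont pos by auto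
  then show ?thesis by blast
qed

end

section \<open>The jump form and the super Poincare inequality\<close>

text \<open>The lower scaling bound, read from a scale down to smaller ones. It yields both the
  positivity of the generalised inverse and the constant of \<open>exists_scale\<close>.\<close>

lemma scale_functionE:
  assumes "scale_function \<Phi>"
  obtains a c where "0 < a" "0 < c" "\<And>\<eta> x. 0 < \<eta> \<Longrightarrow> \<eta> \<le> 1 \<Longrightarrow> 0 < x \<Longrightarrow> \<Phi> (\<eta> * x) \<le> \<eta> powr a / c * \<Phi> x"
proof -
  obtain a1 a2 c1 c2 where *: "0 < a1" "0 < c1"
    "\<forall>r R. 0 < r \<and> r \<le> R \<longrightarrow> c1 * (R / r) powr a1 \<le> \<Phi> R / \<Phi> r \<and> \<Phi> R / \<Phi> r \<le> c2 * (R / r) powr a2"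
    and pos: "\<And>r. 0 < r \<Longrightarrow> 0 < \<Phi> r"
    using assms unfolding scale_function_def by auto
  show ?thesis
  proof (rule that[OF *(1,2)])
    fix \<eta> x :: real assume e: "0 < \<eta>" "\<eta> \<le> 1" "0 < x"
    have "c1 * (x / (\<eta> * x)) powr a1 \<le> \<Phi> x / \<Phi> (\<eta> * x)"
      using *(3)[rule_format, of "\<eta> * x" x] e mult_right_mono[OF e(2), of x] by simp
    moreover have "(x / (\<eta> * x)) powr a1 = 1 / \<eta> powr a1"
      using e by (simp add: powr_divide)
    ultimately have "c1 / \<eta> powr a1 \<le> \<Phi> x / \<Phi> (\<eta> * x)" by simp
    moreover have "0 < \<Phi> (\<eta> * x)" "0 < \<eta> powr a1" using e pos[of "\<eta> * x"] by auto
    ultimately show "\<Phi> (\<eta> * x) \<le> \<eta> powr a1 / c1 * \<Phi> x"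
      using *(2) by (simp add: field_simps)
  qed
qed

lemma inv_incr_pos:
  assumes Phi: "scale_function \<Phi>" and s: "0 < s" shows "0 < inv_incr \<Phi> s"
proof -
  obtain a c where ac: "0 < a" "0 < c" "\<And>\<eta> x. 0 < \<eta> \<Longrightarrow> \<eta> \<le> 1 \<Longrightarrow> 0 < x \<Longrightarrow> \<Phi> (\<eta> * x) \<le> \<eta> powr a / c * \<Phi> x"
    using scale_functionE[OF Phi] by blast
  have p1: "0 < \<Phi> 1" using Phi by (simp add: scale_function_def)
  \<comment> \<open>Below this radius the scaling bound from scale 1 makes \<open>\<Phi>\<close>
    smaller than \<open>s\<close>, so no smaller radius takes part in the infimum.\<close>
  define e where "e = min 1 ((s * c / \<Phi> 1) powr (1 / a))"
  have e: "0 < e" using s ac p1 by (simp add: e_def)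
  have "ennreal e \<le> inv_incr \<Phi> s"
    unfolding inv_incr_def
  proof (rule INF_greatest)
    fix u assume "u \<in> {u. 0 < u \<and> s \<le> \<Phi> u}"
    then have u: "0 < u" "s \<le> \<Phi> u" by auto
    show "ennreal e \<le> ennreal u"
    proof (rule ccontr)
      assume "\<not> ennreal e \<le> ennreal u"
      then have ue: "u < e" using ennreal_leI[of e u] by linarith
      then have u1: "u \<le> 1" and ub: "u < (s * c / \<Phi> 1) powr (1 / a)" by (auto simp: e_def)
      have "\<Phi> u \<le> u powr a / c * \<Phi> 1" using ac(3)[of u 1] u u1 by simp
      moreover have "u powr a < s * c / \<Phi> 1"
      proof -
        have "u powr a < ((s * c / \<Phi> 1) powr (1 / a)) powr a"
          using ub u ac by (intro powr_less_mono2) auto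
        also have "\<dots> = s * c / \<Phi> 1" using ac s p1 by (simp add: powr_powr)
        finally show ?thesis .
      qed
      then have "u powr a / c * \<Phi> 1 < s" using ac p1 by (simp add: field_simps)
      ultimately show False using u(2) by simp
    qed
  qed
  with e show ?thesis by (metis ennreal_less_zero_iff order_less_le_trans)
qed

lemma less_inv_incr: "0 < u \<Longrightarrow> ennreal u < inv_incr \<Phi> s \<Longrightarrow> \<Phi> u < s"
  unfolding inv_incr_def by (metis (mono_tags, lifting) INF_lower leD mem_Collect_eq not_le)

lemma killed_energy_abs_le:
  "killed_energy J D (\<lambda>x. \<bar>f x\<bar>) \<le> killed_energy J D f" if J: "\<And>x y. x \<noteq> y \<Longrightarrow> 0 \<le> J x y"
proof -
  have "(\<bar>f x\<bar> - \<bar>f y\<bar>)\<^sup>2 \<le> (f x - f y)\<^sup>2" for x y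
    using abs_le_square_iff[of "\<bar>f x\<bar> - \<bar>f y\<bar>" "f x - f y"] by linarith
  then have "ennreal ((\<bar>f x\<bar> - \<bar>f y\<bar>)\<^sup>2 * J x y) * indicator (D - {x}) y \<le> ennreal ((f x - f y)\<^sup>2 * J x y) * indicator (D - {x}) y" for x y
    using J[of x y] by (cases "x = y") (auto simp: indicator_def intro!: ennreal_leI mult_right_mono)
  then have I: "(\<integral>\<^sup>+y\<in>D - {x}. ennreal ((\<bar>f x\<bar> - \<bar>f y\<bar>)\<^sup>2 * J x y) \<partial>lborel) \<le> (\<integral>\<^sup>+y\<in>D - {x}. ennreal ((f x - f y)\<^sup>2 * J x y) \<partial>lborel)" for x
    by (rule nn_integral_mono)
  show ?thesis
    unfolding killed_energy_def power2_abs
    by (intro add_mono order_refl, rule nn_integral_mono, rule mult_right_mono, rule I) simp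
qed

locale jump_form =
  fixes J :: "'a::euclidean_space \<Rightarrow> 'a \<Rightarrow> real" and \<Phi> :: "real \<Rightarrow> real" and C\<^sub>0 :: real and D :: "'a set"
  assumes J: "jump_kernel J" and Phi: "scale_function \<Phi>" and C0: "0 < C\<^sub>0"
    and J_lower: "\<And>x y. 0 < norm (x - y) \<Longrightarrow> norm (x - y) \<le> 1 \<Longrightarrow>
          C\<^sub>0 / (norm (x - y) ^ DIM('a) * \<Phi> (norm (x - y))) \<le> J x y"
    and open_set: "open D"
begin

text \<open>\<open>J\<close> is arbitrary on the diagonal and measurable only off it; the value 0 on
  the diagonal gives a function measurable on the whole product.\<close>

definition J_off :: "'a \<times> 'a \<Rightarrow> ennreal" where
  "J_off z = ennreal (J (fst z) (snd z)) * indicator {z. fst z \<noteq> snd z} z"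

lemma set_borel [measurable]: "D \<in> sets borel" using open_set by simp

lemma J_off_measurable [measurable]: "J_off \<in> borel_measurable (borel \<Otimes>\<^sub>M borel)"
proof -
  have off: "{z::'a\<times>'a. fst z \<noteq> snd z} \<in> sets borel"
    by (intro borel_open open_Collect_neq continuous_intros)
  have "(\<lambda>z. J (fst z) (snd z)) \<in> borel_measurable (restrict_space borel {z. fst z \<noteq> snd z})"
    using J by (simp add: jump_kernel_def)
  then have "J_off \<in> borel_measurable borel"
    unfolding J_off_def[abs_def]
    by (subst borel_measurable_restrict_space_iff_ennreal[symmetric]) (use off in auto)
  then show ?thesis by (simp add: borel_prod)
qed

lemma J_nonneg: "x \<noteq> y \<Longrightarrow> 0 \<le> J x y"
  using J by (simp add: jump_kernel_def)

lemma J_off_prod: "ennreal (a\<^sup>2 * J x y) * indicator (- {x}) y = ennreal (a\<^sup>2) * J_off (x, y)"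
  by (auto simp: J_off_def indicator_def ennreal_mult')

lemma J_off_prod': "ennreal (a\<^sup>2 * J x y) * indicator (D - {x}) y = ennreal (a\<^sup>2) * J_off (x, y) * indicator D y"
  by (auto simp: J_off_def indicator_def ennreal_mult')

lemma Phi_pos: "0 < r \<Longrightarrow> 0 < \<Phi> r"
  using Phi by (simp add: scale_function_def)

lemma Phi_mono: "0 < r \<Longrightarrow> r \<le> R \<Longrightarrow> \<Phi> r \<le> \<Phi> R"
proof (cases "r = R")
  case False
  assume "0 < r" "r \<le> R"
  with False have "\<Phi> r < \<Phi> R"
    using Phi unfolding scale_function_def strict_mono_on_def by auto
  then show ?thesis by simp
qed simp

text \<open>As r^d \<Phi>(r) increases in r, the lower bound of \<open>J\<close> within the ball is
  at least its value at the radius \<rho>. The inequality is arranged for multiplication by (u(x) -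
  u(y))^2.\<close>

lemma J_ball_lower:
  assumes "y \<in> ball x \<rho>" "x \<noteq> y" "\<rho> \<le> 1"
  shows "1 \<le> \<rho> ^ DIM('a) * \<Phi> \<rho> / C\<^sub>0 * J x y"
proof -
  let ?n = "norm (x - y)"
  have n: "0 < ?n" "?n < \<rho>" using assms by (auto simp: dist_norm)
  then have rho: "0 < \<rho>" by linarith
  have "?n ^ DIM('a) * \<Phi> ?n \<le> \<rho> ^ DIM('a) * \<Phi> \<rho>"
    using n rho Phi_mono[of ?n \<rho>] Phi_pos[of ?n] by (intro mult_mono power_mono) auto
  moreover have np: "0 < ?n ^ DIM('a) * \<Phi> ?n" using n Phi_pos[of ?n] by simp
  ultimately have "C\<^sub>0 / (\<rho> ^ DIM('a) * \<Phi> \<rho>) \<le> C\<^sub>0 / (?n ^ DIM('a) * \<Phi> ?n)"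
    using C0 by (intro divide_left_mono) auto
  also have "\<dots> \<le> J x y" by (rule J_lower) (use n assms in auto)
  finally have "C\<^sub>0 / (\<rho> ^ DIM('a) * \<Phi> \<rho>) \<le> J x y" .
  moreover have "0 < \<rho> ^ DIM('a) * \<Phi> \<rho>" using rho Phi_pos[of \<rho>] by simp
  ultimately show ?thesis using C0 by (simp add: field_simps)
qed

lemma killing_rate_measurable [measurable]: "(\<lambda>x. killing_rate J D x * indicator D x) \<in> borel_measurable borel"
proof -
  have "killing_rate J D x * indicator D x = (\<integral>\<^sup>+y. J_off (x, y) * indicator (- D) y \<partial>lborel) * indicator D x" for x
    unfolding killing_rate_def
    by (cases "x \<in> D") (auto intro!: nn_integral_cong simp: J_off_def indicator_def)
  then show ?thesis by simp
qed

lemma energy_eq: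
  assumes "u \<in> L2 D" shows "energy J u = killed_energy J D u"
  using killed_energy_eq_energy[OF J set_borel L2_measurable[OF assms] L2_outside[OF assms]] by simp

text \<open>Far out in \<open>D\<close> the killing rate exceeds \<open>1 / \<epsilon>\<close>, and
  the integral of u^2 against it is part of the energy.\<close>

lemma tightness:
  assumes V: "(killing_rate J D \<longlongrightarrow> \<top>) (inf at_infinity (principal D))" and e: "0 < \<epsilon>"
  shows "\<exists>R. \<forall>u\<in>L2 D. (\<forall>x. 0 \<le> u x) \<longrightarrow> (\<integral>\<^sup>+x\<in>-ball 0 R. ennreal ((u x)\<^sup>2) \<partial>lborel) \<le> ennreal \<epsilon> * energy J u"
proof -
  have "\<forall>\<^sub>F x in inf at_infinity (principal D). ennreal (1 / \<epsilon>) < killing_rate J D x"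
    by (rule order_tendstoD(1)[OF V]) simp
  then obtain R where R: "\<And>x. R \<le> norm x \<Longrightarrow> x \<in> D \<Longrightarrow> ennreal (1 / \<epsilon>) < killing_rate J D x"
    unfolding eventually_inf_principal eventually_at_infinity by blast
  show ?thesis
  proof (intro exI ballI impI)
    fix u assume u: "u \<in> L2 D"
    note [measurable] = L2_measurable[OF u]
    have "(\<integral>\<^sup>+x\<in>-ball 0 R. ennreal ((u x)\<^sup>2) \<partial>lborel) \<le> (\<integral>\<^sup>+x. ennreal \<epsilon> * (ennreal ((u x)\<^sup>2) * (killing_rate J D x * indicator D x)) \<partial>lborel)"
    proof (rule nn_integral_mono)
      fix x
      show "ennreal ((u x)\<^sup>2) * indicator (-ball 0 R) x \<le> ennreal \<epsilon> * (ennreal ((u x)\<^sup>2) * (killing_rate J D x * indicator D x))"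
      proof (cases "x \<in> D \<and> x \<notin> ball 0 R")
        case True
        then have "ennreal (1 / \<epsilon>) \<le> killing_rate J D x" using R[of x] by (auto simp: less_imp_le)
        then have "ennreal \<epsilon> * ennreal (1 / \<epsilon>) \<le> ennreal \<epsilon> * killing_rate J D x" by (rule mult_left_mono) simp
        moreover have "ennreal \<epsilon> * ennreal (1 / \<epsilon>) = 1" using e by (simp add: ennreal_mult[symmetric])
        ultimately have "1 \<le> ennreal \<epsilon> * killing_rate J D x" by simp
        then have "ennreal ((u x)\<^sup>2) * 1 \<le> ennreal ((u x)\<^sup>2) * (ennreal \<epsilon> * killing_rate J D x)" by (rule mult_left_mono) simp
        then show ?thesis using True by (simp add: ac_simps)
      next
        case False
        then show ?thesis using L2_outside[OF u, of x] by (cases "x \<in> D") auto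
      qed
    qed
    also have "\<dots> = ennreal \<epsilon> * (\<integral>\<^sup>+x. ennreal ((u x)\<^sup>2) * (killing_rate J D x * indicator D x) \<partial>lborel)"
      by (rule nn_integral_cmult) measurable
    also have "\<dots> \<le> ennreal \<epsilon> * energy J u"
    proof (rule mult_left_mono)
      have "(\<integral>\<^sup>+x. ennreal ((u x)\<^sup>2) * (killing_rate J D x * indicator D x) \<partial>lborel) \<le> 2 * (\<integral>\<^sup>+x\<in>D. ennreal ((u x)\<^sup>2) * killing_rate J D x \<partial>lborel)"
        by (simp add: mult_2 mult.assoc)
      also have "\<dots> \<le> energy J u" unfolding energy_eq[OF u] killed_energy_def by simp
      finally show "(\<integral>\<^sup>+x. ennreal ((u x)\<^sup>2) * (killing_rate J D x * indicator D x) \<partial>lborel) \<le> energy J u" .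
    qed simp
    finally show "(\<integral>\<^sup>+x\<in>-ball 0 R. ennreal ((u x)\<^sup>2) \<partial>lborel) \<le> ennreal \<epsilon> * energy J u" .
  qed
qed

text \<open>\<open>J\<close> is positive at distances below 1, so zero energy makes \<open>u\<close>
  constant on the unit ball around almost every point, in the whole space and not only in
  \<open>D\<close>. A superlevel set of \<bar>u\<bar> of positive measure then spreads over
  everything and has infinite measure.\<close>

lemma irreducibility:
  assumes u: "u \<in> L2 D" and E0: "energy J u = 0"
  shows "AE x in lborel. u x = 0"
proof -
  note [measurable] = L2_measurable[OF u]
  have "(\<integral>\<^sup>+x. (\<integral>\<^sup>+y. ennreal ((u x - u y)\<^sup>2) * J_off (x, y) \<partial>lborel) \<partial>lborel) = 0"
    using E0 unfolding energy_def J_off_prod .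
  then have "AE x in lborel. (\<integral>\<^sup>+y. ennreal ((u x - u y)\<^sup>2) * J_off (x, y) \<partial>lborel) = 0"
    by (subst (asm) nn_integral_0_iff_AE) measurable
  then have flat: "AE x in lborel. AE y in lborel. y \<in> ball x 1 \<longrightarrow> u y = u x"
  proof eventually_elim
    case (elim x)
    then have "AE y in lborel. ennreal ((u x - u y)\<^sup>2) * J_off (x, y) = 0"
      by (subst (asm) nn_integral_0_iff_AE) measurable
    then show ?case
    proof eventually_elim
      case (elim y)
      show ?case
      proof
        assume y: "y \<in> ball x 1"
        show "u y = u x"
        proof (rule ccontr)
          assume ne: "u y \<noteq> u x"
          then have xy: "x \<noteq> y" by auto
          have "0 < J x y" using J_ball_lower[OF y xy] J_nonneg[OF xy] by (cases "J x y = 0") auto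
          then have "J_off (x, y) \<noteq> 0" using xy by (simp add: J_off_def)
          with elim ne show False by (simp add: ennreal_eq_0_iff)
        qed
      qed
    qed
  qed
  show ?thesis
  proof (rule ccontr)
    assume nz: "\<not> (AE x in lborel. u x = 0)"
    have "\<not> (AE x in lborel. \<forall>n::nat. \<not> 1 / real (Suc n) \<le> \<bar>u x\<bar>)"
    proof
      assume "AE x in lborel. \<forall>n::nat. \<not> 1 / real (Suc n) \<le> \<bar>u x\<bar>"
      then have "AE x in lborel. u x = 0"
      proof eventually_elim
        case (elim x)
        show ?case
        proof (rule ccontr)
          assume "u x \<noteq> 0"
          then obtain n where "inverse (real (Suc n)) < \<bar>u x\<bar>" using reals_Archimedean[of "\<bar>u x\<bar>"] by auto
          with spec[OF elim, of n] show False by (simp add: inverse_eq_divide)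
        qed
      qed
      with nz show False by simp
    qed
    then obtain n :: nat where n: "\<not> (AE x in lborel. \<not> 1 / real (Suc n) \<le> \<bar>u x\<bar>)"
      unfolding AE_all_countable by blast
    define e where "e = 1 / real (Suc n)"
    have e: "0 < e" by (simp add: e_def)
    \<comment> \<open>Not a null set by the choice of \<open>n\<close>, but of finite measure as
      \<open>u\<close> is square integrable; the rest shows that it fills the space.\<close>
    define S where "S = {x. e \<le> \<bar>u x\<bar>}"
    have S [measurable]: "S \<in> sets borel" unfolding S_def by measurable
    have Sfin: "emeasure lborel S < \<top>"
    proof -
      have "ennreal (e\<^sup>2) * emeasure lborel S = (\<integral>\<^sup>+x. ennreal (e\<^sup>2) * indicator S x \<partial>lborel)"
        by (rule nn_integral_cmult_indicator[symmetric]) simp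
      also have "\<dots> \<le> (\<integral>\<^sup>+x. ennreal ((u x)\<^sup>2) \<partial>lborel)"
        using e by (intro nn_integral_mono) (auto simp: indicator_def S_def abs_le_square_iff[symmetric] intro!: ennreal_leI)
      also have "\<dots> < \<top>" using sq_norm_eq_ip[OF u] unfolding sq_norm_def by simp
      finally show ?thesis using e by (auto simp: ennreal_mult_less_top)
    qed
    have flatS: "AE x in lborel. x \<in> S \<longrightarrow> (AE y in lborel. y \<in> ball x 1 \<longrightarrow> y \<in> S)"
      using flat by eventually_elim (auto simp: S_def elim: eventually_mono)
    \<comment> \<open>Points of a ball of radius 1/2 are within distance 1 of each other, so one
      good point of \<open>S\<close> in it puts almost all of the ball into
      \<open>S\<close>.\<close>
    have spread: "AE y in lborel. y \<in> ball z (1/2) \<longrightarrow> y \<in> S" if ne: "\<not> (AE y in lborel. y \<in> ball z (1/2) \<longrightarrow> y \<notin> S)" for z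
    proof -
      have "\<exists>x. x \<in> ball z (1/2) \<and> x \<in> S \<and> (AE y in lborel. y \<in> ball x 1 \<longrightarrow> y \<in> S)"
      proof (rule ccontr)
        assume no: "\<not> ?thesis"
        have "AE y in lborel. y \<in> ball z (1/2) \<longrightarrow> y \<notin> S"
          using flatS by eventually_elim (use no in blast)
        with ne show False by simp
      qed
      then obtain x where x: "x \<in> ball z (1/2)" "AE y in lborel. y \<in> ball x 1 \<longrightarrow> y \<in> S" by blast
      have "ball z (1/2) \<subseteq> ball x 1"
      proof
        fix y assume "y \<in> ball z (1/2)"
        with x(1) have "dist z x < 1/2" "dist z y < 1/2" by auto
        then show "y \<in> ball x 1" using dist_triangle[of x y z] by (auto simp: dist_commute)
      qed
      with x(2) show ?thesis by (auto elim!: eventually_mono)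
    qed
    have step: "AE y in lborel. y \<in> ball z' (1/2) \<longrightarrow> y \<in> S"
      if full: "AE y in lborel. y \<in> ball z (1/2) \<longrightarrow> y \<in> S" and zz: "dist z z' < 1" for z z'
    proof (rule spread)
      show "\<not> (AE y in lborel. y \<in> ball z' (1/2) \<longrightarrow> y \<notin> S)"
      proof
        assume "AE y in lborel. y \<in> ball z' (1/2) \<longrightarrow> y \<notin> S"
        with full have ae: "AE y in lborel. \<not> (y \<in> ball z (1/2) \<inter> ball z' (1/2))" by eventually_elim auto
        have "midpoint z z' \<in> ball z (1/2) \<inter> ball z' (1/2)"
          using zz dist_midpoint[of z z'] by (simp add: dist_commute)
        then show False using AE_lborel_open_witness[OF ae, of "ball z (1/2) \<inter> ball z' (1/2)"] by blast
      qed
    qed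
    have "\<exists>z. \<not> (AE y in lborel. y \<in> ball z (1/2) \<longrightarrow> y \<notin> S)"
    proof (rule ccontr)
      assume "\<not> ?thesis"
      then have all: "AE y in lborel. y \<in> ball z (1/2) \<longrightarrow> y \<notin> S" for z by blast
      obtain Q :: "'a set" where Q: "countable Q" "\<And>X. open X \<Longrightarrow> X \<noteq> {} \<Longrightarrow> \<exists>d\<in>Q. d \<in> X"
        using countable_dense_setE by auto
      have "AE y in lborel. \<forall>z\<in>Q. y \<in> ball z (1/2) \<longrightarrow> y \<notin> S"
        using all by (subst AE_ball_countable[OF Q(1)]) blast
      then have "AE y in lborel. \<not> 1 / real (Suc n) \<le> \<bar>u y\<bar>"
      proof eventually_elim
        case (elim y)
        obtain z where "z \<in> Q" "z \<in> ball y (1/2)" using Q(2)[of "ball y (1/2)"] by auto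
        with elim show ?case by (auto simp: S_def e_def dist_commute)
      qed
      with n show False by simp
    qed
    then obtain z0 where z0: "AE y in lborel. y \<in> ball z0 (1/2) \<longrightarrow> y \<in> S" using spread by blast
    have full: "AE y in lborel. y \<in> ball z (1/2) \<longrightarrow> y \<in> S" for z
    proof -
      obtain N :: nat where N: "dist z0 z < real N" using reals_Archimedean2 by blast
      then have N0: "0 < real N" by (metis le_less_trans zero_le_dist)
      \<comment> \<open>Equal steps shorter than 1 lead from \<open>z0\<close> to \<open>z\<close>,
        so that consecutive balls of radius 1/2 overlap.\<close>
      define w where "w = (1 / real N) *\<^sub>R (z - z0)"
      have "norm w = dist z0 z / real N" by (simp add: w_def dist_norm norm_minus_commute)
      then have nw: "norm w < 1" using N N0 by simp
      have "AE y in lborel. y \<in> ball (z0 + real k *\<^sub>R w) (1/2) \<longrightarrow> y \<in> S" for k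
      proof (induct k)
        case (Suc k)
        show ?case by (rule step[OF Suc]) (use nw in \<open>simp add: dist_norm algebra_simps\<close>)
      qed (use z0 in simp)
      from this[of N] show ?thesis using N0 by (simp add: w_def)
    qed
    obtain Q :: "'a set" where Q: "countable Q" "\<And>X. open X \<Longrightarrow> X \<noteq> {} \<Longrightarrow> \<exists>d\<in>Q. d \<in> X"
      using countable_dense_setE by auto
    have "AE y in lborel. \<forall>z\<in>Q. y \<in> ball z (1/2) \<longrightarrow> y \<in> S"
      using full by (subst AE_ball_countable[OF Q(1)]) blast
    then have "AE y in lborel. y \<in> S"
    proof eventually_elim
      case (elim y)
      obtain z where "z \<in> Q" "z \<in> ball y (1/2)" using Q(2)[of "ball y (1/2)"] by auto
      with elim show ?case by (auto simp: dist_commute)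
    qed
    then have "emeasure lborel S = emeasure lborel (UNIV :: 'a set)"
      by (intro emeasure_eq_AE) auto
    with Sfin show False by simp
  qed
qed

end

section \<open>The super Poincare inequality\<close>

lemma infdist_inner_measurable: "open D \<Longrightarrow> inner_part D R r \<in> sets borel"
proof -
  assume D: "open D"
  have "open {x. norm x < R}" "open {x. r < infdist x (- D)}"
    by (intro open_Collect_less continuous_intros)+
  then have "open (D \<inter> {x. norm x < R} \<inter> {x. r < infdist x (- D)})" using D by (intro open_Int)
  moreover have "inner_part D R r = D \<inter> {x. norm x < R} \<inter> {x. r < infdist x (- D)}"
    by (auto simp: inner_part_def)
  ultimately show ?thesis by simp
qed

lemma inner_part_ball:
  assumes x: "x \<in> inner_part D R r" and rho: "\<rho> \<le> r / 2" "\<rho> \<le> 1"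
  shows "ball x \<rho> \<subseteq> inner_part D (R + 1) (r / 2)"
proof
  fix y assume y: "y \<in> ball x \<rho>"
  have "infdist x (- D) \<le> infdist y (- D) + dist x y" by (rule infdist_triangle)
  then have i: "r / 2 < infdist y (- D)" using x y rho by (auto simp: inner_part_def)
  moreover have "norm y < R + 1"
    using x y rho norm_triangle_sub[of y x] by (auto simp: inner_part_def dist_norm norm_minus_commute)
  moreover have "y \<in> D"
  proof (rule ccontr)
    assume "y \<notin> D"
    then have "infdist y (- D) = 0" by simp
    moreover have "0 \<le> \<rho>" using y by (auto intro: order_trans[OF zero_le_dist less_imp_le])
    ultimately show False using i rho by simp
  qed
  ultimately show "y \<in> inner_part D (R + 1) (r / 2)" by (simp add: inner_part_def)
qed

text \<open>The inner part lies in a compact subset of \<open>D\<close>, on which the continuous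
  positive function \<phi> is bounded below. The number \<open>m\<close> is the root of the infimum
  that occurs in \<open>rate_alpha\<close>.\<close>

lemma ground_inf_pos:
  assumes phi: "continuous_on D \<phi>" "\<And>x. x \<in> D \<Longrightarrow> 0 < \<phi> x" and r: "0 < r" and ne: "inner_part D R r \<noteq> {}"
  obtains m where "0 < m" "(INF x\<in>inner_part D R r. ennreal ((\<phi> x)\<^sup>2)) = ennreal (m\<^sup>2)"
    "\<And>x. x \<in> inner_part D R r \<Longrightarrow> m \<le> \<phi> x"
proof -
  let ?K = "cball 0 R \<inter> {x. r \<le> infdist x (- D)}"
  have "closed {x. r \<le> infdist x (- D)}" by (intro closed_Collect_le continuous_intros)
  then have K: "compact ?K" by (intro compact_Int_closed) auto
  have KD: "?K \<subseteq> D"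
  proof
    fix x assume "x \<in> ?K"
    then show "x \<in> D" using r by (cases "x \<in> D") auto
  qed
  have IK: "inner_part D R r \<subseteq> ?K" by (auto simp: inner_part_def)
  then have "?K \<noteq> {}" using ne by blast
  then obtain x0 where x0: "x0 \<in> ?K" "\<And>y. y \<in> ?K \<Longrightarrow> \<phi> x0 \<le> \<phi> y"
    using continuous_attains_inf[OF K _ continuous_on_subset[OF phi(1) KD]] by blast
  have p0: "0 < \<phi> x0" using phi(2) x0(1) KD by blast
  let ?I = "INF x\<in>inner_part D R r. ennreal ((\<phi> x)\<^sup>2)"
  have lower: "ennreal ((\<phi> x0)\<^sup>2) \<le> ?I"
  proof (intro INF_greatest ennreal_leI power_mono)
    fix x assume "x \<in> inner_part D R r"
    then show "\<phi> x0 \<le> \<phi> x" using IK x0(2) by blast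
  qed (use p0 in simp)
  obtain x1 where x1: "x1 \<in> inner_part D R r" using ne by blast
  have "?I \<le> ennreal ((\<phi> x1)\<^sup>2)" by (rule INF_lower[OF x1])
  then have "?I < \<top>" by (rule le_less_trans) simp
  then obtain b where b: "?I = ennreal b" "0 \<le> b" by (cases ?I) auto
  have "(\<phi> x0)\<^sup>2 \<le> b" using lower b by simp
  then have bp: "0 < b" using p0 by (metis less_le_trans zero_less_power)
  show ?thesis
  proof (rule that[of "sqrt b"])
    show "0 < sqrt b" using bp by simp
    show "?I = ennreal ((sqrt b)\<^sup>2)" using b by simp
    fix x assume x: "x \<in> inner_part D R r"
    have "ennreal b \<le> ennreal ((\<phi> x)\<^sup>2)" unfolding b(1)[symmetric] by (rule INF_lower[OF x])
    then have "b \<le> (\<phi> x)\<^sup>2" by (simp add: ennreal_le_iff)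
    moreover have "0 < \<phi> x" using phi(2) x by (auto simp: inner_part_def)
    ultimately show "sqrt b \<le> \<phi> x" by (simp add: real_le_lsqrt)
  qed
qed

text \<open>Infinity times 0 is 0: if the infimum is infinite, as for empty \<open>S\<close>, the
  conclusion for \<open>y = 0\<close> reads \<open>L \<le> F\<close> and does not follow from the
  bounds for members of \<open>S\<close>; hence the separate hypothesis.\<close>

lemma Inf_mult_bound:
  fixes S :: "ennreal set"
  assumes "\<And>a. a \<in> S \<Longrightarrow> L \<le> F + a * y" and L: "L < \<top>" and y: "y < \<top>" "y = 0 \<Longrightarrow> L \<le> F"
  shows "L \<le> F + Inf S * y"
proof (rule ccontr)
  assume "\<not> L \<le> F + Inf S * y"
  then have less: "F + Inf S * y < L" by simp
  then have y0: "y \<noteq> 0" using y(2) by auto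
  have F: "F < \<top>" using less L by (metis add_increasing2 leD le_less_trans less_imp_le less_top linorder_not_less top.extremum zero_le order_refl)
  have I: "Inf S < \<top>"
  proof (rule ccontr)
    assume "\<not> Inf S < \<top>"
    then have "Inf S = \<top>" by (metis less_top)
    then have IS: "Inf S * y = \<top>" using y0 by (metis ennreal_top_mult)
    have "F + Inf S * y = \<top>" unfolding IS by simp
    then have "\<top> < L" using less by metis
    then show False by simp
  qed
  obtain l where l: "L = ennreal l" "0 \<le> l" using L by (cases L) auto
  obtain f where f: "F = ennreal f" "0 \<le> f" using F by (cases F) auto
  obtain i where i: "Inf S = ennreal i" "0 \<le> i" using I by (cases "Inf S") auto
  obtain z where z: "y = ennreal z" "0 < z" using y(1) y0 by (cases y) (auto simp: ennreal_eq_0_iff not_le)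
  have "f + i * z < l"
    using less unfolding l(1) f(1) i(1) z(1)
    using f i z l by (simp add: ennreal_mult[symmetric] ennreal_plus[symmetric] ennreal_less_iff del: ennreal_plus)
  then have "i < (l - f) / z" using z by (simp add: pos_less_divide_eq)
  then have "Inf S < ennreal ((l - f) / z)" unfolding i(1) using i(2) by (simp add: ennreal_less_iff)
  then obtain a where a: "a \<in> S" "a < ennreal ((l - f) / z)" by (auto simp: Inf_less_iff)
  then obtain a' where a': "a = ennreal a'" "0 \<le> a'" by (cases a) auto
  have "a' < (l - f) / z" using a(2) unfolding a'(1) using a'(2) by (simp add: ennreal_less_iff)
  then have "f + a' * z < l" using z by (simp add: pos_less_divide_eq)
  then have "F + a * y < L"
    unfolding l(1) f(1) a'(1) z(1)
    using f a' z l by (simp add: ennreal_mult[symmetric] ennreal_plus[symmetric] ennreal_less_iff del: ennreal_plus)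
  with assms(1)[OF a(1)] show False by simp
qed

context jump_form begin

text \<open>For \<open>x\<close> in \<open>A\<close> and \<open>y\<close> in
  \<open>ball x \<rho>\<close>, u(x)^2 \<le> (u(x) - u(y))^2 + 2 u(x) u(y). The first term is
  compared with the energy by \<open>J_ball_lower\<close>; the second contributes at most twice the
  squared integral over \<open>B\<close>.\<close>

lemma local_average:
  assumes A [measurable]: "A \<in> sets borel" and B [measurable]: "B \<in> sets borel" and BD: "B \<subseteq> D" and AB: "A \<subseteq> B"
    and rho: "0 < \<rho>" "\<rho> \<le> 1" and balls: "\<And>x. x \<in> A \<Longrightarrow> ball x \<rho> \<subseteq> B"
    and u [measurable]: "u \<in> borel_measurable borel" and u0: "\<And>x. 0 \<le> u x"
  shows "emeasure lborel (ball (0::'a) \<rho>) * (\<integral>\<^sup>+x\<in>A. ennreal ((u x)\<^sup>2) \<partial>lborel) \<le>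
    ennreal (\<rho> ^ DIM('a) * \<Phi> \<rho> / C\<^sub>0) * (\<integral>\<^sup>+x\<in>D. (\<integral>\<^sup>+y\<in>D - {x}. ennreal ((u x - u y)\<^sup>2 * J x y) \<partial>lborel) \<partial>lborel)
    + 2 * (\<integral>\<^sup>+x\<in>B. ennreal (u x) \<partial>lborel)\<^sup>2"
proof -
  let ?c = "ennreal (\<rho> ^ DIM('a) * \<Phi> \<rho> / C\<^sub>0)"
  let ?G = "\<lambda>x. \<integral>\<^sup>+y. ennreal ((u x - u y)\<^sup>2) * J_off (x, y) * indicator D y \<partial>lborel"
  let ?I = "\<integral>\<^sup>+x\<in>B. ennreal (u x) \<partial>lborel"
  have c0: "0 \<le> \<rho> ^ DIM('a) * \<Phi> \<rho> / C\<^sub>0" using rho Phi_pos[of \<rho>] C0 by simp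
  have pt: "emeasure lborel (ball (0::'a) \<rho>) * (ennreal ((u x)\<^sup>2) * indicator A x) \<le>
     ?c * (?G x * indicator D x) + 2 * ?I * (ennreal (u x) * indicator B x)" for x
  proof (cases "x \<in> A")
    case True
    then have xB: "x \<in> B" and xD: "x \<in> D" using AB BD by auto
    have "emeasure lborel (ball (0::'a) \<rho>) = emeasure lborel (ball x \<rho>)" using rho by (simp add: emeasure_ball)
    then have "emeasure lborel (ball (0::'a) \<rho>) * ennreal ((u x)\<^sup>2) = (\<integral>\<^sup>+y. ennreal ((u x)\<^sup>2) * indicator (ball x \<rho>) y \<partial>lborel)"
      by (subst nn_integral_cmult_indicator) (auto simp: mult.commute)
    also have "\<dots> \<le> (\<integral>\<^sup>+y. ?c * (ennreal ((u x - u y)\<^sup>2) * J_off (x, y) * indicator D y) + 2 * ennreal (u x) * (ennreal (u y) * indicator B y) \<partial>lborel)"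
    proof (rule nn_integral_mono)
      fix y
      show "ennreal ((u x)\<^sup>2) * indicator (ball x \<rho>) y \<le> ?c * (ennreal ((u x - u y)\<^sup>2) * J_off (x, y) * indicator D y) + 2 * ennreal (u x) * (ennreal (u y) * indicator B y)"
      proof (cases "y \<in> ball x \<rho>")
        case yb: True
        then have yB: "y \<in> B" and yD: "y \<in> D" using balls[OF True] BD by auto
        have "(u x - u y)\<^sup>2 \<le> \<rho> ^ DIM('a) * \<Phi> \<rho> / C\<^sub>0 * ((u x - u y)\<^sup>2 * J x y)" if "x \<noteq> y"
          using mult_left_mono[OF J_ball_lower[OF yb that rho(2)], of "(u x - u y)\<^sup>2"] by (simp add: ac_simps)
        then have 1: "ennreal ((u x - u y)\<^sup>2) \<le> ?c * (ennreal ((u x - u y)\<^sup>2) * J_off (x, y) * indicator D y)"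
          using yD c0 J_nonneg[of x y]
          by (cases "x = y") (auto simp: J_off_def ennreal_mult[symmetric] intro!: ennreal_leI)
        have "(u x)\<^sup>2 \<le> (u x - u y)\<^sup>2 + 2 * u x * u y" by (simp add: power2_diff)
        then have "ennreal ((u x)\<^sup>2) \<le> ennreal ((u x - u y)\<^sup>2 + 2 * u x * u y)" by (rule ennreal_leI)
        also have "\<dots> = ennreal ((u x - u y)\<^sup>2) + 2 * ennreal (u x) * ennreal (u y)"
          using u0 by (simp add: ennreal_mult)
        finally show ?thesis using 1 yb yB by (simp add: add_mono order_trans)
      qed simp
    qed
    also have "\<dots> = ?c * ?G x + 2 * ennreal (u x) * ?I"
      by (subst nn_integral_add) (auto simp: nn_integral_cmult)
    finally show ?thesis using True xB xD by (simp add: ac_simps)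
  qed simp
  have "emeasure lborel (ball (0::'a) \<rho>) * (\<integral>\<^sup>+x\<in>A. ennreal ((u x)\<^sup>2) \<partial>lborel)
    = (\<integral>\<^sup>+x. emeasure lborel (ball (0::'a) \<rho>) * (ennreal ((u x)\<^sup>2) * indicator A x) \<partial>lborel)"
    by (rule nn_integral_cmult[symmetric]) measurable
  also have "\<dots> \<le> (\<integral>\<^sup>+x. ?c * (?G x * indicator D x) + 2 * ?I * (ennreal (u x) * indicator B x) \<partial>lborel)"
    by (rule nn_integral_mono) (rule pt)
  also have "\<dots> = ?c * (\<integral>\<^sup>+x. ?G x * indicator D x \<partial>lborel) + 2 * ?I * ?I"
    by (subst nn_integral_add) (auto simp: nn_integral_cmult)
  finally show ?thesis unfolding J_off_prod' by (simp add: power2_eq_square mult.assoc)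
qed

text \<open>With \<rho> = \<kappa> \<mu> the energy coefficient in \<open>local_average\<close>
  becomes at most \<open>s\<close> times the volume of the ball of radius \<rho>. That \<kappa> is
  obtained before \<open>s\<close> and \<mu> makes the final constant uniform.\<close>

lemma exists_scale:
  obtains \<kappa> where "0 < \<kappa>" "\<kappa> \<le> 1 / 2"
    "\<And>s \<mu>. 0 < s \<Longrightarrow> 0 < \<mu> \<Longrightarrow> ennreal \<mu> \<le> inv_incr \<Phi> (s / 2) \<Longrightarrow>
       \<Phi> (\<kappa> * \<mu>) \<le> s * C\<^sub>0 * unit_ball_vol (real DIM('a))"
proof -
  obtain a c where ac: "0 < a" "0 < c" "\<And>\<eta> x. 0 < \<eta> \<Longrightarrow> \<eta> \<le> 1 \<Longrightarrow> 0 < x \<Longrightarrow> \<Phi> (\<eta> * x) \<le> \<eta> powr a / c * \<Phi> x"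
    using scale_functionE[OF Phi] by blast
  let ?w = "unit_ball_vol (real DIM('a))"
  have w: "0 < ?w" by simp
  \<comment> \<open>Apart from the cap at 1 this solves
    \<open>k powr a = 2 * C\<^sub>0 * ?w * c\<close>, so that the factor \<open>s / 2\<close> below
    is turned into \<open>s * C\<^sub>0 * ?w\<close>.\<close>
  define k where "k = min 1 ((2 * C\<^sub>0 * ?w * c) powr (1 / a))"
  have pos: "0 < 2 * C\<^sub>0 * ?w * c" using C0 ac w by simp
  then have "0 < (2 * C\<^sub>0 * ?w * c) powr (1 / a)" by (metis powr_gt_zero less_irrefl)
  then have k: "0 < k" "k \<le> 1" by (auto simp: k_def)
  have kp: "k powr a \<le> 2 * C\<^sub>0 * ?w * c"
  proof -
    have "k powr a \<le> ((2 * C\<^sub>0 * ?w * c) powr (1 / a)) powr a"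
      using k ac by (intro powr_mono2) (auto simp: k_def)
    also have "\<dots> = 2 * C\<^sub>0 * ?w * c" using ac(1) pos by (simp only: powr_powr) (simp add: less_imp_le)
    finally show ?thesis .
  qed
  show ?thesis
  proof (rule that[of "k / 2"])
    fix s \<mu> :: real assume s: "0 < s" and mu: "0 < \<mu>" and le: "ennreal \<mu> \<le> inv_incr \<Phi> (s / 2)"
    \<comment> \<open>At the generalised inverse itself \<open>\<Phi>\<close> need not be below
      \<open>s / 2\<close>; halving moves strictly to the left of it.\<close>
    have "ennreal (\<mu> / 2) < inv_incr \<Phi> (s / 2)"
      by (rule less_le_trans[OF _ le]) (use mu in \<open>simp add: ennreal_less_iff\<close>)
    then have small: "\<Phi> (\<mu> / 2) < s / 2" using mu by (intro less_inv_incr[of "\<mu> / 2" "\<Phi>" "s / 2"]) simp_all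
    have "\<Phi> (k / 2 * \<mu>) = \<Phi> (k * (\<mu> / 2))" by (simp add: mult.commute)
    also have "\<dots> \<le> k powr a / c * \<Phi> (\<mu> / 2)" using ac(3)[OF k, of "\<mu> / 2"] mu by simp
    also have "\<dots> \<le> (2 * C\<^sub>0 * ?w * c) / c * (s / 2)"
    proof (rule mult_mono)
      show "k powr a / c \<le> 2 * C\<^sub>0 * ?w * c / c" using kp ac(2) by (intro divide_right_mono) simp_all
      show "0 \<le> 2 * C\<^sub>0 * ?w * c / c" using pos ac(2) by (intro divide_nonneg_nonneg) simp_all
    qed (use small Phi_pos[of "\<mu> / 2"] mu in simp_all)
    also have "\<dots> = s * C\<^sub>0 * ?w" using ac(2) by simp
    finally show "\<Phi> (k / 2 * \<mu>) \<le> s * C\<^sub>0 * ?w" .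
  qed (use k in auto)
qed

text \<open>Stated for all nonnegative functions in \<open>L2 D\<close> and not for test functions,
  because it is applied to rows of the heat kernel.\<close>

lemma super_Poincare:
  assumes phi: "\<phi> \<in> L2 D" "continuous_on D \<phi>" "\<And>x. x \<in> D \<Longrightarrow> 0 < \<phi> x"
  obtains c where "0 < c" "\<And>u s. u \<in> L2 D \<Longrightarrow> (\<And>x. 0 \<le> u x) \<Longrightarrow> 0 < s \<Longrightarrow>
    (\<integral>\<^sup>+x\<in>D. ennreal ((u x)\<^sup>2) \<partial>lborel) \<le> ennreal s * killed_energy J D u +
      rate_beta J \<Phi> D \<phi> c s * (\<integral>\<^sup>+x\<in>D. ennreal (u x * \<phi> x) \<partial>lborel)\<^sup>2"
proof -
  let ?w = "unit_ball_vol (real DIM('a))"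
  have w: "0 < ?w" by simp
  obtain \<kappa> where k: "0 < \<kappa>" "\<kappa> \<le> 1 / 2" and kP: "\<And>s \<mu>. 0 < s \<Longrightarrow> 0 < \<mu> \<Longrightarrow> ennreal \<mu> \<le> inv_incr \<Phi> (s / 2) \<Longrightarrow>
       \<Phi> (\<kappa> * \<mu>) \<le> s * C\<^sub>0 * ?w" using exists_scale by blast
  \<comment> \<open>Chosen so that \<open>c / \<mu> ^ DIM('a)\<close> equals \<open>2 / W\<close>,
    where \<open>W\<close> is the volume of a ball of radius \<open>\<kappa> * \<mu>\<close> and 2
    is the factor from \<open>local_average\<close>.\<close>
  define c where "c = 2 / (?w * \<kappa> ^ DIM('a))"
  have c: "0 < c" using w k by (simp add: c_def)
  show ?thesis
  proof (rule that[OF c])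
    fix u s assume u: "u \<in> L2 D" and u0: "\<And>x. 0 \<le> u x" and s: "0 < (s :: real)"
    note [measurable] = L2_measurable[OF u] L2_measurable[OF phi(1)]
    let ?L = "\<integral>\<^sup>+x\<in>D. ennreal ((u x)\<^sup>2) \<partial>lborel"
    let ?X = "\<integral>\<^sup>+x\<in>D. ennreal (u x * \<phi> x) \<partial>lborel"
    let ?EDD = "\<integral>\<^sup>+x\<in>D. (\<integral>\<^sup>+y\<in>D - {x}. ennreal ((u x - u y)\<^sup>2 * J x y) \<partial>lborel) \<partial>lborel"
    let ?EV = "\<integral>\<^sup>+x\<in>D. ennreal ((u x)\<^sup>2) * killing_rate J D x \<partial>lborel"
    have phi0: "0 \<le> \<phi> x" for x using phi(3)[of x] L2_outside[OF phi(1), of x] by (cases "x \<in> D") auto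
    have X: "?X = ennreal (ip u \<phi>)"
    proof -
      have "?X = (\<integral>\<^sup>+x. ennreal (u x * \<phi> x) \<partial>lborel)"
        using L2_outside[OF u] by (intro nn_integral_cong) (auto simp: indicator_def)
      also have "\<dots> = ennreal (ip u \<phi>)" unfolding ip_def
        using u0 phi0 by (intro nn_integral_eq_integral L2_prod_integrable[OF u phi(1)]) auto
      finally show ?thesis .
    qed
    have Lfin: "?L < \<top>"
    proof -
      have "?L \<le> sq_norm u" unfolding sq_norm_def by (intro nn_integral_mono) (auto simp: indicator_def)
      then show ?thesis unfolding sq_norm_eq_ip[OF u] by (rule le_less_trans) simp
    qed
    show "?L \<le> ennreal s * killed_energy J D u + rate_beta J \<Phi> D \<phi> c s * ?X\<^sup>2"
      unfolding rate_beta_def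
    proof (rule Inf_mult_bound[OF _ Lfin])
      show "?X\<^sup>2 < \<top>" unfolding X by (simp add: power2_eq_square ennreal_mult_less_top)
      \<comment> \<open>A vanishing pairing with the positive function \<phi> forces
        \<open>u\<close> to vanish almost everywhere on \<open>D\<close>.\<close>
      show "?L \<le> ennreal s * killed_energy J D u" if "?X\<^sup>2 = 0"
      proof -
        have "?X = 0" using that by (simp add: power2_eq_square)
        then have "AE x in lborel. ennreal (u x * \<phi> x) * indicator D x = 0"
          by (subst (asm) nn_integral_0_iff_AE) measurable
        then have "AE x in lborel. ennreal ((u x)\<^sup>2) * indicator D x = 0"
        proof eventually_elim
          case (elim x)
          show ?case
          proof (cases "x \<in> D")
            case True
            then have "u x * \<phi> x \<le> 0" using elim by (simp add: ennreal_eq_0_iff)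
            then have "u x = 0" using u0[of x] phi(3)[OF True] by (simp add: mult_le_0_iff)
            then show ?thesis by simp
          qed simp
        qed
        then have "?L = (\<integral>\<^sup>+x. 0 \<partial>(lborel :: 'a measure))" by (rule nn_integral_cong_AE)
        then show ?thesis by simp
      qed
      fix al assume "al \<in> {rate_alpha \<Phi> D \<phi> c R r (s / 2) | R r. 0 < R \<and> 0 < r \<and> r < 1 / 2 \<and>
        ennreal (1 / s) \<le> (INF x\<in>D - inner_part D R r. killing_rate J D x)}"
      then obtain R r where al: "al = rate_alpha \<Phi> D \<phi> c R r (s / 2)" and Rr: "0 < R" "0 < r" "r < 1 / 2"
        and V: "ennreal (1 / s) \<le> (INF x\<in>D - inner_part D R r. killing_rate J D x)" by blast
      let ?A = "inner_part D R r" let ?B = "inner_part D (R + 1) (r / 2)"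
      have Am [measurable]: "?A \<in> sets borel" and Bm [measurable]: "?B \<in> sets borel"
        by (rule infdist_inner_measurable[OF open_set])+
      have AD: "?A \<subseteq> D" and BD: "?B \<subseteq> D" and AB: "?A \<subseteq> ?B" using Rr by (auto simp: inner_part_def)
      have split: "?L = (\<integral>\<^sup>+x\<in>D - ?A. ennreal ((u x)\<^sup>2) \<partial>lborel) + (\<integral>\<^sup>+x\<in>?A. ennreal ((u x)\<^sup>2) \<partial>lborel)"
        using AD by (subst nn_integral_add[symmetric]) (auto intro!: nn_integral_cong simp: indicator_def)
      have 1: "(\<integral>\<^sup>+x\<in>D - ?A. ennreal ((u x)\<^sup>2) \<partial>lborel) \<le> ennreal s * ?EV"
      proof -
        have "(\<integral>\<^sup>+x\<in>D - ?A. ennreal ((u x)\<^sup>2) \<partial>lborel) \<le> (\<integral>\<^sup>+x. ennreal s * (ennreal ((u x)\<^sup>2) * (killing_rate J D x * indicator D x)) \<partial>lborel)"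
        proof (rule nn_integral_mono)
          fix x
          show "ennreal ((u x)\<^sup>2) * indicator (D - ?A) x \<le> ennreal s * (ennreal ((u x)\<^sup>2) * (killing_rate J D x * indicator D x))"
          proof (cases "x \<in> D - ?A")
            case True
            have "ennreal (1 / s) \<le> killing_rate J D x" using V INF_lower[OF True, of "killing_rate J D"] by (rule order_trans)
            then have "ennreal s * ennreal (1 / s) \<le> ennreal s * killing_rate J D x" by (rule mult_left_mono) simp
            moreover have "ennreal s * ennreal (1 / s) = 1" using s by (simp add: ennreal_mult[symmetric])
            ultimately have "1 \<le> ennreal s * killing_rate J D x" by simp
            then have "ennreal ((u x)\<^sup>2) * 1 \<le> ennreal ((u x)\<^sup>2) * (ennreal s * killing_rate J D x)" by (rule mult_left_mono) simp
            then show ?thesis using True by (simp add: ac_simps)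
          qed simp
        qed
        also have "\<dots> = ennreal s * (\<integral>\<^sup>+x. ennreal ((u x)\<^sup>2) * (killing_rate J D x * indicator D x) \<partial>lborel)"
          by (rule nn_integral_cmult) measurable
        finally show ?thesis by (simp add: mult.assoc)
      qed
      have 2: "(\<integral>\<^sup>+x\<in>?A. ennreal ((u x)\<^sup>2) \<partial>lborel) \<le> ennreal s * ?EDD + al * ?X\<^sup>2"
      proof (cases "?A = {}")
        case False
        then have "?B \<noteq> {}" using AB by blast
        then obtain m where m: "0 < m" "(INF x\<in>?B. ennreal ((\<phi> x)\<^sup>2)) = ennreal (m\<^sup>2)" "\<And>x. x \<in> ?B \<Longrightarrow> m \<le> \<phi> x"
          using ground_inf_pos[OF phi(2,3), of "r / 2" "R + 1"] Rr by auto
        let ?M = "min (inv_incr \<Phi> (s / 2)) (min (ennreal r) 1)"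
        have "?M \<le> 1" by (simp add: min.coboundedI2)
        then have "?M < \<top>" by (rule le_less_trans) simp
        moreover have "0 < ?M" using inv_incr_pos[OF Phi, of "s / 2"] s Rr by (simp add: ennreal_zero_less_one)
        ultimately obtain \<mu> where mu: "?M = ennreal \<mu>" "0 < \<mu>" by (cases ?M) auto
        have "ennreal \<mu> \<le> ennreal r" unfolding mu(1)[symmetric] by (simp add: min.coboundedI2)
        then have mur: "\<mu> \<le> r" using Rr by simp
        have mui: "ennreal \<mu> \<le> inv_incr \<Phi> (s / 2)" unfolding mu(1)[symmetric] by simp
        \<comment> \<open>From \<open>\<kappa> \<le> 1 / 2\<close> and \<open>\<mu> \<le> r\<close>
          it follows that \<open>\<rho> \<le> r / 2\<close>, which keeps the balls around points of
          \<open>?A\<close> inside \<open>?B\<close>.\<close>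
        define \<rho> where "\<rho> = \<kappa> * \<mu>"
        have rho: "0 < \<rho>" using k mu by (simp add: \<rho>_def)
        have rr: "\<rho> \<le> r / 2" using mult_mono[OF k(2) mur] k mu by (simp add: \<rho>_def)
        then have r1: "\<rho> \<le> 1" using Rr by simp
        have Pr: "\<Phi> \<rho> \<le> s * C\<^sub>0 * ?w" unfolding \<rho>_def by (rule kP[OF s mu(2) mui])
        let ?I = "\<integral>\<^sup>+x\<in>?B. ennreal (u x) \<partial>lborel"
        have mI: "ennreal m * ?I \<le> ?X"
        proof -
          have "ennreal m * ?I = (\<integral>\<^sup>+x. ennreal m * (ennreal (u x) * indicator ?B x) \<partial>lborel)"
            by (rule nn_integral_cmult[symmetric]) measurable
          also have "\<dots> \<le> ?X"
          proof (rule nn_integral_mono)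
            fix x
            show "ennreal m * (ennreal (u x) * indicator ?B x) \<le> ennreal (u x * \<phi> x) * indicator D x"
            proof (cases "x \<in> ?B")
              case True
              then have "m * u x \<le> u x * \<phi> x" using mult_right_mono[OF m(3)[OF True] u0[of x]] by (simp add: mult.commute)
              then show ?thesis using True BD m(1) u0 by (auto simp: ennreal_mult[symmetric] intro!: ennreal_leI)
            qed simp
          qed
          finally show ?thesis .
        qed
        obtain x where xX: "?X = ennreal x" "0 \<le> x" using X ip_def u0 phi0 by (metis ennreal_cases ennreal_neq_top)
        have "?I < \<top>"
        proof (rule ccontr)
          assume "\<not> ?I < \<top>"
          then have "?I = \<top>" by (metis less_top)
          then show False using mI m(1) xX by (simp add: ennreal_mult_top top_unique)
        qed
        then obtain i where i: "?I = ennreal i" "0 \<le> i" by (cases ?I) auto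
        have ix: "m * i \<le> x" using mI m(1) i xX by (simp add: ennreal_mult[symmetric])
        let ?a = "\<integral>\<^sup>+x\<in>?A. ennreal ((u x)\<^sup>2) \<partial>lborel"
        define W where "W = ?w * \<rho> ^ DIM('a)"
        have W: "0 < W" using w rho by (simp add: W_def)
        have eW: "emeasure lborel (ball (0::'a) \<rho>) = ennreal W" using rho by (simp add: emeasure_ball W_def)
        have "ennreal W * ?a \<le> ennreal (\<rho> ^ DIM('a) * \<Phi> \<rho> / C\<^sub>0) * ?EDD + 2 * ?I\<^sup>2"
          unfolding eW[symmetric]
          by (rule local_average[OF Am Bm BD AB rho r1 inner_part_ball[OF _ rr r1] L2_measurable[OF u] u0])
        also have "\<dots> \<le> ennreal (W * s) * ?EDD + ennreal (2 * i\<^sup>2)"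
        proof (intro add_mono mult_right_mono ennreal_leI)
          have "\<rho> ^ DIM('a) * \<Phi> \<rho> \<le> \<rho> ^ DIM('a) * (s * C\<^sub>0 * ?w)" using Pr rho by (intro mult_left_mono) auto
          then show "\<rho> ^ DIM('a) * \<Phi> \<rho> / C\<^sub>0 \<le> W * s" using C0 by (simp add: W_def field_simps)
          show "2 * ?I\<^sup>2 \<le> ennreal (2 * i\<^sup>2)" using i by (simp add: ennreal_mult ennreal_power)
        qed simp
        finally have main: "ennreal W * ?a \<le> ennreal (W * s) * ?EDD + ennreal (2 * i\<^sup>2)" .
        have "?a = ennreal (1 / W) * (ennreal W * ?a)"
          using W by (simp add: mult.assoc[symmetric] ennreal_mult[symmetric])
        also have "\<dots> \<le> ennreal (1 / W) * (ennreal (W * s) * ?EDD + ennreal (2 * i\<^sup>2))"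
          using main by (rule mult_left_mono) simp
        also have "\<dots> = ennreal s * ?EDD + ennreal (2 * i\<^sup>2 / W)"
          using W s by (simp add: distrib_left mult.assoc[symmetric] ennreal_mult[symmetric])
        also have "\<dots> \<le> ennreal s * ?EDD + al * ?X\<^sup>2"
        proof (rule add_left_mono)
          have "al = ennreal c / ennreal (m\<^sup>2) * inverse (ennreal \<mu> ^ DIM('a))"
            unfolding al rate_alpha_def m(2) mu(1) ..
          also have "\<dots> = ennreal (c / m\<^sup>2 * inverse (\<mu> ^ DIM('a)))"
            using c m(1) mu(2) by (simp add: divide_ennreal ennreal_power inverse_ennreal ennreal_mult[symmetric])
          also have "c / m\<^sup>2 * inverse (\<mu> ^ DIM('a)) = 2 / (W * m\<^sup>2)"
            using w k mu(2) m(1) by (simp add: c_def W_def \<rho>_def power_mult_distrib field_simps)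
          finally have ale: "al = ennreal (2 / (W * m\<^sup>2))" .
          have "(m * i)\<^sup>2 \<le> x\<^sup>2" using ix m(1) i(2) by (intro power_mono) auto
          then have "2 * i\<^sup>2 / W \<le> 2 / (W * m\<^sup>2) * x\<^sup>2"
            using W m(1) by (simp add: power_mult_distrib field_simps)
          then show "ennreal (2 * i\<^sup>2 / W) \<le> al * ?X\<^sup>2"
            unfolding ale xX(1) using W m(1) xX(2) by (simp add: ennreal_power ennreal_mult[symmetric] ennreal_leI)
        qed
        finally show ?thesis .
      qed simp
      have "?L \<le> ennreal s * ?EV + (ennreal s * ?EDD + al * ?X\<^sup>2)"
        unfolding split by (intro add_mono 1 2)
      also have "\<dots> \<le> ennreal s * (?EDD + 2 * ?EV) + al * ?X\<^sup>2"
      proof -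
        have "ennreal s * ?EV \<le> ennreal s * (2 * ?EV)" by (intro mult_left_mono) (auto simp: mult_2)
        then have "ennreal s * ?EV + ennreal s * ?EDD \<le> ennreal s * (?EDD + 2 * ?EV)"
          by (simp add: distrib_left add.commute add_left_mono)
        then show ?thesis by (simp add: add.assoc[symmetric] add_right_mono)
      qed
      finally show "?L \<le> ennreal s * killed_energy J D u + al * ?X\<^sup>2"
        unfolding killed_energy_def .
    qed
  qed
qed

end

section \<open>Intrinsic ultracontractivity\<close>

lemma inv_decr_antimono: "r \<le> r' \<Longrightarrow> inv_decr b r' \<le> inv_decr b r"
  unfolding inv_decr_def by (rule INF_superset_mono) (auto intro: order_trans ennreal_leI)

lemma inv_decr_less:
  assumes "inv_decr b r < ennreal s" obtains s' where "0 < s'" "s' < s" "b s' \<le> ennreal r"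
proof -
  obtain s' where "0 < s'" "b s' \<le> ennreal r" "ennreal s' < ennreal s"
    using assms unfolding inv_decr_def by (auto simp: INF_less_iff)
  then show ?thesis using that[of s'] by (auto simp: ennreal_less_iff)
qed

text \<open>On the interval from \<open>2 ^ k * a\<close> to \<open>2 ^ Suc k * a\<close> the
  integrand is at least \<open>inv_decr b (2 ^ Suc k * a) / (2 ^ Suc k * a)\<close>, and the length
  is half of that denominator. Finiteness of the integral thus makes the values at dyadic points
  summable.\<close>

lemma dyadic_tail_small:
  assumes a: "0 < a" and fin: "(\<integral>\<^sup>+s\<in>{a<..}. inv_decr b s / ennreal s \<partial>lborel) < \<top>" and e: "0 < \<epsilon>"
  obtains \<gamma> N where "\<And>k. 0 \<le> \<gamma> k" "\<And>k. inv_decr b (2 ^ Suc k * a) = ennreal (\<gamma> k)"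
    "\<And>n. (\<Sum>k=N..<n. \<gamma> k) < \<epsilon>"
proof -
  let ?g = "\<lambda>k. inv_decr b (2 ^ Suc k * a)"
  let ?I = "\<lambda>k::nat. {2 ^ k * a<..2 ^ Suc k * a}"
  have "(\<Sum>k. ?g k / 2) \<le> (\<integral>\<^sup>+s\<in>{a<..}. inv_decr b s / ennreal s \<partial>lborel)"
  proof -
    have "(\<Sum>k. ?g k / 2) = (\<Sum>k. \<integral>\<^sup>+s. ?g k / ennreal (2 ^ Suc k * a) * indicator (?I k) s \<partial>lborel)"
    proof (rule arg_cong[where f=suminf], rule ext)
      fix k
      have "(\<integral>\<^sup>+s. ?g k / ennreal (2 ^ Suc k * a) * indicator (?I k) s \<partial>lborel) = ?g k / ennreal (2 ^ Suc k * a) * ennreal (2 ^ k * a)"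
        using a by (subst nn_integral_cmult_indicator) (auto simp: algebra_simps)
      also have "\<dots> = ?g k * (ennreal (2 ^ k * a) / ennreal (2 ^ Suc k * a))"
        by (simp add: ennreal_times_divide mult.commute)
      also have "ennreal (2 ^ k * a) / ennreal (2 ^ Suc k * a) = ennreal (1 / 2)"
        using a by (subst divide_ennreal) auto
      also have "?g k * ennreal (1 / 2) = ?g k / 2"
        by (simp add: divide_ennreal_def inverse_ennreal[symmetric] flip: ennreal_numeral)
      finally show "?g k / 2 = (\<integral>\<^sup>+s. ?g k / ennreal (2 ^ Suc k * a) * indicator (?I k) s \<partial>lborel)" by simp
    qed
    also have "\<dots> = (\<integral>\<^sup>+s. (\<Sum>k. ?g k / ennreal (2 ^ Suc k * a) * indicator (?I k) s) \<partial>lborel)"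
      by (rule nn_integral_suminf[symmetric]) measurable
    also have "\<dots> \<le> (\<integral>\<^sup>+s\<in>{a<..}. inv_decr b s / ennreal s \<partial>lborel)"
    proof (rule nn_integral_mono)
      fix s :: real
      show "(\<Sum>k. ?g k / ennreal (2 ^ Suc k * a) * indicator (?I k) s) \<le> inv_decr b s / ennreal s * indicator {a<..} s"
      proof (cases "\<exists>k. s \<in> ?I k")
        case False
        then have "indicator (?I k) s = (0 :: ennreal)" for k by (auto simp: indicator_def)
        then show ?thesis by (simp only: mult_zero_right suminf_zero zero_le)
      next
        case True
        then obtain k where k: "s \<in> ?I k" by blast
        have uniq: "j = k" if "s \<in> ?I j" for j
        proof (rule ccontr)
          assume "j \<noteq> k"
          then consider "Suc j \<le> k" | "Suc k \<le> j" by linarith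
          then show False
          proof cases
            case 1
            then have "(2::real) ^ Suc j * a \<le> 2 ^ k * a" using a by (intro mult_right_mono power_increasing) auto
            with that k show False by auto
          next
            case 2
            then have "(2::real) ^ Suc k * a \<le> 2 ^ j * a" using a by (intro mult_right_mono power_increasing) auto
            with that k show False by auto
          qed
        qed
        have "(\<Sum>j. ?g j / ennreal (2 ^ Suc j * a) * indicator (?I j) s) = (\<Sum>j. ?g j / ennreal (2 ^ Suc j * a) * of_bool (j = k))"
        proof -
          have "indicator (?I j) s = (of_bool (j = k) :: ennreal)" for j
            unfolding indicator_def using uniq[of j] k by (cases "j = k") auto
          then show ?thesis by (simp only:)
        qed
        also have "\<dots> = ?g k / ennreal (2 ^ Suc k * a)" by (rule suminf_of_bool_single)
        also have "\<dots> \<le> inv_decr b s / ennreal s"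
          unfolding divide_ennreal_def
        proof (intro mult_mono inv_decr_antimono)
          show "inverse (ennreal (2 ^ Suc k * a)) \<le> inverse (ennreal s)"
          proof -
            have "0 < 2 ^ k * a" using a by simp
            then have "0 < s" "s \<le> 2 ^ Suc k * a" using k by auto
            then show ?thesis
              by (metis ennreal_leI inverse_ennreal le_imp_inverse_le less_le_trans)
          qed
        qed (use k in auto)
        also have "\<dots> = inv_decr b s / ennreal s * indicator {a<..} s"
        proof -
          have "1 * a \<le> 2 ^ k * a" using a by (intro mult_right_mono one_le_power) auto
          then show ?thesis using k by simp
        qed
        finally show ?thesis .
      qed
    qed
    finally show ?thesis .
  qed
  then have sfin: "(\<Sum>k. ?g k / 2) < \<top>" using fin by (rule le_less_trans)
  have gfin: "?g k < \<top>" for k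
  proof -
    have "?g k / 2 \<le> (\<Sum>k. ?g k / 2)"
      using sum_le_suminf[of "\<lambda>k. ?g k / 2" "{k}"] by simp
    then have "?g k / 2 < \<top>" using sfin by (rule le_less_trans)
    then show ?thesis by (cases "?g k = \<top>") (auto simp: ennreal_top_divide less_top)
  qed
  define \<gamma> where "\<gamma> k = enn2real (?g k)" for k
  have g: "?g k = ennreal (\<gamma> k)" for k using gfin[of k] unfolding \<gamma>_def by simp
  have g0: "0 \<le> \<gamma> k" for k by (simp add: \<gamma>_def)
  have "(\<Sum>k. ennreal (\<gamma> k / 2)) \<noteq> \<top>"
  proof -
    have "ennreal (\<gamma> k / 2) = ?g k / 2" for k
      unfolding g using g0[of k] by (subst divide_ennreal[symmetric]) auto
    then show ?thesis using sfin by simp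
  qed
  then have "summable (\<lambda>k. \<gamma> k / 2)"
    using g0 by (intro summable_suminf_not_top) auto
  then have "summable \<gamma>" using summable_mult[of "\<lambda>k. \<gamma> k / 2" 2] by simp
  then obtain N where N: "\<forall>m\<ge>N. \<forall>n. norm (\<Sum>k=m..<n. \<gamma> k) < \<epsilon>"
    using e unfolding summable_Cauchy by blast
  have "(\<Sum>k=N..<n. \<gamma> k) < \<epsilon>" for n using N[rule_format, of N n] by simp
  then show ?thesis using that[OF g0 g] by blast
qed

context dirichlet_kernel begin

lemma diag_eq: "0 < t \<Longrightarrow> x \<in> D \<Longrightarrow> ip (kernel_row t x) (kernel_row t x) = q (2 * t) x x"
  using ip_kernel_row[of t t x x] unfolding mult_2 by blast

lemma diag_antimono:
  assumes "0 < s" "s \<le> t" "x \<in> D" shows "q (2 * t) x x \<le> q (2 * s) x x"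
proof (cases "s = t")
  case False
  then have d: "0 < t - s" using assms by simp
  have "kernel_row t x = T (t - s) (kernel_row s x)" using T_kernel_row[OF assms(1) d assms(3)] by simp
  then have "ip (kernel_row t x) (kernel_row t x) \<le> ip (kernel_row s x) (kernel_row s x)"
    using T_contraction[OF d kernel_row_L2[OF assms(1,3)]] by simp
  then show ?thesis using diag_eq assms by simp
qed simp

text \<open>\<open>form_T\<close> applied to the row at time \<open>s\<close>: the loss of squared
  norm during the time \<sigma> bounds the form at the end.\<close>

lemma form_kernel_row:
  assumes s: "0 < s" and d: "0 < \<sigma>" and x: "x \<in> D"
  shows "E (kernel_row (s + \<sigma>) x) \<le> ennreal ((q (2 * s) x x - q (2 * (s + \<sigma>)) x x) / (2 * \<sigma>))"
proof -
  have T: "T \<sigma> (kernel_row s x) = kernel_row (s + \<sigma>) x" by (rule T_kernel_row[OF s d x])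
  have "(\<lambda>y. \<bar>kernel_row (s + \<sigma>) x y\<bar>) = kernel_row (s + \<sigma>) x" using kernel_row_nonneg[OF _ x, of "s + \<sigma>"] s d by (auto simp: abs_of_nonneg)
  then show ?thesis
    using form_T[OF d kernel_row_L2[OF s x]] diag_eq[OF s x] diag_eq[OF _ x, of "s + \<sigma>"] s d unfolding T by simp
qed

lemma ultracontractive_of_super_Poincare:
  assumes ground: "ground_state D T \<phi>"
    and SPI: "\<And>u s. u \<in> L2 D \<Longrightarrow> (\<And>x. 0 \<le> u x) \<Longrightarrow> 0 < s \<Longrightarrow>
      (\<integral>\<^sup>+x\<in>D. ennreal ((u x)\<^sup>2) \<partial>lborel) \<le> ennreal s * E u + \<beta> s * (\<integral>\<^sup>+x\<in>D. ennreal (u x * \<phi> x) \<partial>lborel)\<^sup>2"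
    and inf: "(INF s\<in>{0<..}. \<beta> s) < \<top>"
    and int: "\<And>t::real. (INF s\<in>{0<..}. \<beta> s) < ennreal t \<Longrightarrow> (\<integral>\<^sup>+s\<in>{t<..}. inv_decr \<beta> s / ennreal s \<partial>lborel) < \<top>"
  shows "intrinsically_ultracontractive D q \<phi>"
proof -
  obtain \<mu> where mu: "0 < \<mu>" "eigenfunction D T \<mu> \<phi>" and cont: "continuous_on D \<phi>" and pos: "\<And>x. x \<in> D \<Longrightarrow> 0 < \<phi> x"
    using ground unfolding ground_state_def by blast
  have L: "\<phi> \<in> L2 D" and eig: "\<forall>t>0. AE x in lborel. T t \<phi> x = exp (- \<mu> * t) * \<phi> x"
    using mu(2) unfolding eigenfunction_def by blast+
  have phi0: "0 \<le> \<phi> x" for x using pos[of x] L2_outside[OF L, of x] by (cases "x \<in> D") auto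
  have Tphi: "T t \<phi> x \<le> \<phi> x" if t: "0 < t" and x: "x \<in> D" for t x
  proof -
    have "T t \<phi> x = exp (- \<mu> * t) * \<phi> x"
      by (rule AE_eq_everywhere[OF T_continuous[OF t L] continuous_on_mult_left[OF cont] eig[rule_format, OF t] x])
    also have "\<dots> \<le> 1 * \<phi> x" using mu(1) t pos[OF x] by (intro mult_right_mono) auto
    finally show ?thesis by simp
  qed
  \<comment> \<open>With \<open>?ha\<close> and \<open>?hb\<close> for the diagonal values before
    and after, the inequality gives
    \<open>?hb \<le> (?ha - ?hb) / 2 + A / 2 * (\<phi> x)\<^sup>2\<close>; inserting
    \<open>?ha \<le> 2 * A * (\<phi> x)\<^sup>2\<close> yields
    \<open>?hb \<le> A * (\<phi> x)\<^sup>2\<close>.\<close>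
  have step: "q (2 * (s + \<sigma>)) x x \<le> A * (\<phi> x)\<^sup>2"
    if x: "x \<in> D" and s: "0 < s" and \<sigma>: "inv_decr \<beta> (A / 2) < ennreal \<sigma>" and A: "0 < A" and H: "q (2 * s) x x \<le> 2 * A * (\<phi> x)\<^sup>2"
    for x s \<sigma> A
  proof -
    obtain r where r: "0 < r" "r < \<sigma>" "\<beta> r \<le> ennreal (A / 2)" using inv_decr_less[OF \<sigma>] by blast
    have d: "0 < \<sigma>" using r by simp
    let ?t = "s + \<sigma>" let ?u = "kernel_row ?t x"
    have t: "0 < ?t" using s d by simp
    have u: "?u \<in> L2 D" by (rule kernel_row_L2[OF t x])
    have u0: "0 \<le> ?u y" for y by (rule kernel_row_nonneg[OF t x])
    let ?ha = "q (2 * s) x x" let ?hb = "q (2 * ?t) x x"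
    have hh: "?hb \<le> ?ha" by (rule diag_antimono) (use s d x in auto)
    have "ennreal ?hb = (\<integral>\<^sup>+y\<in>D. ennreal ((?u y)\<^sup>2) \<partial>lborel)"
    proof -
      have "(\<integral>\<^sup>+y\<in>D. ennreal ((?u y)\<^sup>2) \<partial>lborel) = sq_norm ?u"
        unfolding sq_norm_def by (intro nn_integral_cong) (auto simp: indicator_def kernel_row_def)
      then show ?thesis using sq_norm_eq_ip[OF u] diag_eq[OF t x] by simp
    qed
    also have "\<dots> \<le> ennreal r * E ?u + \<beta> r * (\<integral>\<^sup>+y\<in>D. ennreal (?u y * \<phi> y) \<partial>lborel)\<^sup>2"
      by (rule SPI[OF u u0 r(1)])
    also have "\<dots> \<le> ennreal r * ennreal ((?ha - ?hb) / (2 * \<sigma>)) + ennreal (A / 2) * (ennreal (\<phi> x))\<^sup>2"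
    proof (intro add_mono mult_left_mono mult_mono power_mono)
      show "E ?u \<le> ennreal ((?ha - ?hb) / (2 * \<sigma>))" by (rule form_kernel_row[OF s d x])
      have "(\<integral>\<^sup>+y\<in>D. ennreal (?u y * \<phi> y) \<partial>lborel) = (\<integral>\<^sup>+y. ennreal (?u y * \<phi> y) \<partial>lborel)"
        by (intro nn_integral_cong) (auto simp: indicator_def kernel_row_def)
      also have "\<dots> = ennreal (ip ?u \<phi>)" unfolding ip_def
        using u0 phi0 by (intro nn_integral_eq_integral L2_prod_integrable[OF u L]) auto
      also have "\<dots> \<le> ennreal (\<phi> x)" using Tphi[OF t x] x by (intro ennreal_leI) (simp add: T_eq)
      finally show "(\<integral>\<^sup>+y\<in>D. ennreal (?u y * \<phi> y) \<partial>lborel) \<le> ennreal (\<phi> x)" .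
    qed (use r in auto)
    also have "\<dots> = ennreal (r * ((?ha - ?hb) / (2 * \<sigma>)) + A / 2 * (\<phi> x)\<^sup>2)"
    proof -
      have "0 \<le> (?ha - ?hb) / (2 * \<sigma>)" using d hh by simp
      moreover have "0 \<le> r" "0 \<le> A / 2" "0 \<le> (\<phi> x)\<^sup>2" using r A by auto
      ultimately show ?thesis
        using phi0[of x] by (simp only: ennreal_power ennreal_mult[symmetric] ennreal_plus[symmetric] mult_nonneg_nonneg)
    qed
    finally have "?hb \<le> r * ((?ha - ?hb) / (2 * \<sigma>)) + A / 2 * (\<phi> x)\<^sup>2"
      using r d hh A phi0[of x] by (subst (asm) ennreal_le_iff) (auto intro!: add_nonneg_nonneg)
    also have "r * ((?ha - ?hb) / (2 * \<sigma>)) \<le> \<sigma> * ((?ha - ?hb) / (2 * \<sigma>))"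
      using r d hh by (intro mult_right_mono) auto
    also have "\<sigma> * ((?ha - ?hb) / (2 * \<sigma>)) = (?ha - ?hb) / 2" using d by simp
    finally have "?hb \<le> (?ha - ?hb) / 2 + A / 2 * (\<phi> x)\<^sup>2" by simp
    then show ?thesis using H by (simp add: field_simps)
  qed
  show ?thesis
    unfolding intrinsically_ultracontractive_def
  proof (intro allI impI)
    fix t :: real assume t: "0 < t"
    \<comment> \<open>Three shares of size \<open>t / 6\<close>: the starting time, the sum of the
      \<open>\<gamma> k\<close> and the sum of the slacks \<open>\<eta> k\<close>. Together they are
      at most \<open>t / 2\<close>, and the diagonal value at \<open>s\<close> is taken at time
      \<open>2 * s\<close>.\<close>
    define \<tau> where "\<tau> = t / 6"
    have tau: "0 < \<tau>" using t by (simp add: \<tau>_def)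
    obtain b where b: "(INF s\<in>{0<..}. \<beta> s) < b" "b < \<top>" using dense[OF inf] by blast
    then obtain a where a: "b = ennreal a" "0 \<le> a" by (cases b) auto
    have a0: "0 < a" using b(1) a by (cases "a = 0") auto
    obtain \<gamma> N where g: "\<And>k. 0 \<le> \<gamma> k" "\<And>k. inv_decr \<beta> (2 ^ Suc k * a) = ennreal (\<gamma> k)" "\<And>n. (\<Sum>k=N..<n. \<gamma> k) < \<tau>"
      using dyadic_tail_small[OF a0 int tau] b(1) a by metis
    \<comment> \<open>Slack of finite total: crossing a level takes a time strictly larger than the
      value of \<open>inv_decr\<close>.\<close>
    define \<eta> where "\<eta> k = \<tau> * (1 / 2) ^ Suc k" for k
    have eta: "0 < \<eta> k" for k using tau by (simp add: \<eta>_def)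
    have eta_sum: "(\<Sum>k=N..<n. \<eta> k) \<le> \<tau>" for n
    proof -
      have "(\<Sum>k=N..<n. \<eta> k) \<le> (\<Sum>k<n. \<eta> k)" by (rule sum_mono2) (use eta in \<open>auto intro: less_imp_le\<close>)
      also have "\<dots> = \<tau> * (1 - (1 / 2) ^ n)"
        unfolding \<eta>_def by (induct n) (auto simp: algebra_simps)
      also have "\<dots> \<le> \<tau> * 1" using tau by (intro mult_left_mono) auto
      finally show ?thesis by simp
    qed
    \<comment> \<open>The indices fit: \<open>A k / 2 = 2 ^ Suc k * a\<close> is the argument
      belonging to \<open>\<gamma> k\<close>, and \<open>2 * A k = A (Suc k)\<close>.\<close>
    define A where "A k = 2 ^ (k + 2) * a" for k :: nat
    have A0: "0 < A k" for k using a0 by (simp add: A_def)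
    have descend: "q (2 * (s + (\<Sum>k=N..<n. \<gamma> k + \<eta> k))) x x \<le> A N * (\<phi> x)\<^sup>2"
      if "N \<le> n" "x \<in> D" "0 < s" "q (2 * s) x x \<le> A n * (\<phi> x)\<^sup>2" for n s x
      using that
    proof (induct n arbitrary: s rule: dec_induct)
      case (step n)
      have s': "q (2 * (s + (\<gamma> n + \<eta> n))) x x \<le> A n * (\<phi> x)\<^sup>2"
      proof (rule \<open>\<And>x s \<sigma> A. x \<in> D \<Longrightarrow> 0 < s \<Longrightarrow> inv_decr \<beta> (A / 2) < ennreal \<sigma> \<Longrightarrow> 0 < A \<Longrightarrow> q (2 * s) x x \<le> 2 * A * (\<phi> x)\<^sup>2 \<Longrightarrow> q (2 * (s + \<sigma>)) x x \<le> A * (\<phi> x)\<^sup>2\<close>)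
        have "A n / 2 = 2 ^ Suc n * a" by (simp add: A_def)
        then show "inv_decr \<beta> (A n / 2) < ennreal (\<gamma> n + \<eta> n)"
          using g(1,2)[of n] eta[of n] by (simp only: ennreal_less_iff)
        have "2 * A n = A (Suc n)" by (simp add: A_def)
        then show "q (2 * s) x x \<le> 2 * A n * (\<phi> x)\<^sup>2" using step by simp
      qed (use step A0 in auto)
      have "0 < s + (\<gamma> n + \<eta> n)" using step g(1)[of n] eta[of n] by simp
      from step(3)[OF step(4) this s'] step(1) show ?case by (simp add: algebra_simps)
    qed simp
    have diag: "q t x x \<le> A N * (\<phi> x)\<^sup>2" if x: "x \<in> D" for x
    proof -
      have p2: "0 < (\<phi> x)\<^sup>2 * a" using pos[OF x] a0 by simp
      obtain n0 :: nat where n0: "q (2 * \<tau>) x x / ((\<phi> x)\<^sup>2 * a) < 2 ^ n0" using real_arch_pow[of 2] by auto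
      \<comment> \<open>The starting level depends on \<open>x\<close> through the size of
        \<open>q (2 * \<tau>) x x\<close>, whereas \<open>N\<close>, and with it the final level
        \<open>A N\<close>, does not.\<close>
      define n where "n = max N n0"
      have "(2::real) ^ n0 \<le> 2 ^ (n + 2)" by (rule power_increasing) (auto simp: n_def)
      with n0 have "q (2 * \<tau>) x x / ((\<phi> x)\<^sup>2 * a) \<le> 2 ^ (n + 2)" by linarith
      then have "q (2 * \<tau>) x x \<le> 2 ^ (n + 2) * ((\<phi> x)\<^sup>2 * a)" using p2 by (simp add: pos_divide_le_eq)
      then have "q (2 * \<tau>) x x \<le> A n * (\<phi> x)\<^sup>2" by (simp add: A_def ac_simps)
      from descend[OF _ x tau this] have 1: "q (2 * (\<tau> + (\<Sum>k=N..<n. \<gamma> k + \<eta> k))) x x \<le> A N * (\<phi> x)\<^sup>2"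
        by (simp add: n_def)
      have 2: "(\<Sum>k=N..<n. \<gamma> k + \<eta> k) \<le> 2 * \<tau>"
        using g(3)[of n] eta_sum[of n] by (simp add: sum.distrib)
      have 3: "0 \<le> (\<Sum>k=N..<n. \<gamma> k + \<eta> k)" using g(1) eta by (intro sum_nonneg) (auto intro: add_nonneg_nonneg less_imp_le)
      have "q (2 * (t / 2)) x x \<le> q (2 * (\<tau> + (\<Sum>k=N..<n. \<gamma> k + \<eta> k))) x x"
        by (rule diag_antimono) (use 2 3 tau x in \<open>auto simp: \<tau>_def\<close>)
      then show ?thesis using 1 by simp
    qed
    show "\<exists>C>0. \<forall>x\<in>D. \<forall>y\<in>D. q t x y \<le> C * \<phi> x * \<phi> y"
    proof (intro exI[of _ "A N"] conjI A0 ballI)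
      fix x y assume x: "x \<in> D" and y: "y \<in> D"
      have t2: "0 < t / 2" using t by simp
      have "q t x y = ip (kernel_row (t / 2) x) (kernel_row (t / 2) y)" using ip_kernel_row[OF t2 t2 x y] by simp
      also have "\<dots> \<le> sqrt (ip (kernel_row (t / 2) x) (kernel_row (t / 2) x)) * sqrt (ip (kernel_row (t / 2) y) (kernel_row (t / 2) y))"
        using ip_abs_le[OF kernel_row_L2[OF t2 x] kernel_row_L2[OF t2 y]] by simp
      also have "\<dots> = sqrt (q t x x) * sqrt (q t y y)" using diag_eq[OF t2 x] diag_eq[OF t2 y] by simp
      also have "\<dots> \<le> sqrt (A N * (\<phi> x)\<^sup>2) * sqrt (A N * (\<phi> y)\<^sup>2)"
        using diag[OF x] diag[OF y] A0[of N] q_pos[OF t y y] by (intro mult_mono) auto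
      also have "\<dots> = A N * \<phi> x * \<phi> y"
        using A0[of N] phi0[of x] phi0[of y] by (simp add: real_sqrt_mult)
      finally show "q t x y \<le> A N * \<phi> x * \<phi> y" .
    qed
  qed
qed

end

section \<open>From the abstract results to the killed process\<close>

lemma Cc_infty_L2:
  assumes D: "open D" and f: "f \<in> Cc_infty D" shows "f \<in> L2 D"
proof -
  let ?S = "closure {x. f x \<noteq> 0}"
  have "C_k 0 f" using f unfolding Cc_infty_def smooth_fun_def by blast
  then have cont: "continuous_on UNIV f" by simp
  have S: "compact ?S" "?S \<subseteq> D" using f unfolding Cc_infty_def by auto
  have out: "f x = 0" if "x \<notin> ?S" for x using that closure_subset[of "{x. f x \<noteq> 0}"] by auto
  have "set_integrable lborel ?S (\<lambda>x. (f x)\<^sup>2)"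
    unfolding set_integrable_def
    by (rule borel_integrable_compact[OF S(1)])
       (intro continuous_intros continuous_on_subset[OF cont], simp)
  moreover have "(\<lambda>x. indicator ?S x *\<^sub>R (f x)\<^sup>2) = (\<lambda>x. (f x)\<^sup>2)"
  proof
    fix x show "indicator ?S x *\<^sub>R (f x)\<^sup>2 = (f x)\<^sup>2" using out[of x] by (cases "x \<in> ?S") simp_all
  qed
  ultimately have "integrable lborel (\<lambda>x. (f x)\<^sup>2)"
    unfolding set_integrable_def by simp
  moreover have "f \<in> borel_measurable borel" by (rule borel_measurable_continuous_onI[OF cont])
  ultimately show ?thesis using S out unfolding L2_def by blast
qed

text \<open>In the condition for intrinsic ultracontractivity the infimum of the rate function is
  required to be finite: were it infinite, no \<open>t\<close> would be admissible and the integral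
  condition would hold vacuously.\<close>

theorem theorem4p2:
  fixes J :: "'a::euclidean_space \<Rightarrow> 'a \<Rightarrow> real"
    and \<Omega> :: "'w set" and Fl :: "ennreal \<Rightarrow> 'w measure"
    and X :: "ennreal \<Rightarrow> 'w \<Rightarrow> 'a option" and P :: "'a option \<Rightarrow> 'w measure"
    and p :: "real \<Rightarrow> 'a \<Rightarrow> 'a \<Rightarrow> real"
    and D :: "'a set"
    and \<Phi> :: "real \<Rightarrow> real" and C\<^sub>0 :: real
  assumes J: "jump_kernel J"
    and X: "hunt_process \<Omega> Fl X P" "symmetric_process X P"
    and X_form: "semigroup_form (process_semigroup X P) (form_domain J) (energy J)"
    and p: "transition_density X P p"
    and D: "open D" "D \<noteq> {}"
    and pD: "good_kernel D (dirichlet_heat_kernel X P p D)"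
    and Phi: "scale_function \<Phi>"
    and C0: "0 < C\<^sub>0"
    and J_lower: "\<And>x y. 0 < norm (x - y) \<Longrightarrow> norm (x - y) \<le> 1 \<Longrightarrow>
          C\<^sub>0 / (norm (x - y) ^ DIM('a) * \<Phi> (norm (x - y))) \<le> J x y"
    and V_lim: "(killing_rate J D \<longlongrightarrow> \<top>) (inf at_infinity (principal D))"
  shows "compact_semigroup D (killed_semigroup X P p D) \<and>
    (\<exists>\<phi>\<^sub>1. ground_state D (killed_semigroup X P p D) \<phi>\<^sub>1) \<and>
    (\<forall>\<phi>\<^sub>1. ground_state D (killed_semigroup X P p D) \<phi>\<^sub>1 \<longrightarrow>
      (\<exists>c>0.
        (\<forall>f\<in>Cc_infty D. \<forall>s>0.
           (\<integral>\<^sup>+x\<in>D. ennreal ((f x)\<^sup>2) \<partial>lborel) \<le>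
             ennreal s * killed_energy J D f +
             rate_beta J \<Phi> D \<phi>\<^sub>1 c s * (\<integral>\<^sup>+x\<in>D. ennreal (\<bar>f x\<bar> * \<phi>\<^sub>1 x) \<partial>lborel)\<^sup>2) \<and>
        ((INF s\<in>{0<..}. rate_beta J \<Phi> D \<phi>\<^sub>1 c s) < \<top> \<and>
         (\<forall>t::real. (INF s\<in>{0<..}. rate_beta J \<Phi> D \<phi>\<^sub>1 c s) < ennreal t \<longrightarrow>
            (\<integral>\<^sup>+s\<in>{t<..}. inv_decr (rate_beta J \<Phi> D \<phi>\<^sub>1 c) s / ennreal s \<partial>lborel) < \<top>)
         \<longrightarrow> intrinsically_ultracontractive D (dirichlet_heat_kernel X P p D) \<phi>\<^sub>1)))"
proof -
  let ?q = "dirichlet_heat_kernel X P p D"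
  obtain K where K: "\<And>n. compact (K n)" "\<And>n. K n \<subseteq> interior (K (Suc n))" "(\<Union>n. K n) = D"
    using open_Union_compact_subsets[OF D(1)] by metis
  interpret killed_process \<Omega> Fl X P p D K
    by (intro killed_process.intro X(1) killed_process_axioms.intro X(2) p K)
  interpret jump_form J \<Phi> C\<^sub>0 D
    by (intro jump_form.intro J Phi C0 J_lower D(1))
  have "dirichlet_kernel D ?q (energy J)" by (rule dirichlet_kernel[OF X_form D(2) pD])
  then interpret tight_dirichlet_kernel D ?q "energy J"
    by (intro tight_dirichlet_kernel.intro tight_dirichlet_kernel_axioms.intro tightness[OF V_lim] irreducibility)
  have main: "\<exists>c>0.
        (\<forall>f\<in>Cc_infty D. \<forall>s>0.
           (\<integral>\<^sup>+x\<in>D. ennreal ((f x)\<^sup>2) \<partial>lborel) \<le>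
             ennreal s * killed_energy J D f +
             rate_beta J \<Phi> D \<phi> c s * (\<integral>\<^sup>+x\<in>D. ennreal (\<bar>f x\<bar> * \<phi> x) \<partial>lborel)\<^sup>2) \<and>
        ((INF s\<in>{0<..}. rate_beta J \<Phi> D \<phi> c s) < \<top> \<and>
         (\<forall>t::real. (INF s\<in>{0<..}. rate_beta J \<Phi> D \<phi> c s) < ennreal t \<longrightarrow>
            (\<integral>\<^sup>+s\<in>{t<..}. inv_decr (rate_beta J \<Phi> D \<phi> c) s / ennreal s \<partial>lborel) < \<top>)
         \<longrightarrow> intrinsically_ultracontractive D ?q \<phi>)"
    if ground: "ground_state D T \<phi>" for \<phi>
  proof -
    have phi: "\<phi> \<in> L2 D" "continuous_on D \<phi>" "\<And>x. x \<in> D \<Longrightarrow> 0 < \<phi> x"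
      using ground unfolding ground_state_def eigenfunction_def by blast+
    obtain c where c: "0 < c" and SPI: "\<And>u s. u \<in> L2 D \<Longrightarrow> (\<And>x. 0 \<le> u x) \<Longrightarrow> 0 < s \<Longrightarrow>
      (\<integral>\<^sup>+x\<in>D. ennreal ((u x)\<^sup>2) \<partial>lborel) \<le> ennreal s * killed_energy J D u +
        rate_beta J \<Phi> D \<phi> c s * (\<integral>\<^sup>+x\<in>D. ennreal (u x * \<phi> x) \<partial>lborel)\<^sup>2"
      using super_Poincare[OF phi] by blast
    show ?thesis
    proof (intro exI[of _ c] conjI c ballI allI impI)
      fix f and s :: real assume f: "f \<in> Cc_infty D" and s: "0 < s"
      \<comment> \<open>The inequality is available for nonnegative functions; passing from
        \<open>f\<close> to its absolute value can only lower the killed energy.\<close>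
      have "(\<integral>\<^sup>+x\<in>D. ennreal ((f x)\<^sup>2) \<partial>lborel) \<le> ennreal s * killed_energy J D (\<lambda>x. \<bar>f x\<bar>) +
          rate_beta J \<Phi> D \<phi> c s * (\<integral>\<^sup>+x\<in>D. ennreal (\<bar>f x\<bar> * \<phi> x) \<partial>lborel)\<^sup>2"
        using SPI[OF L2_abs[OF Cc_infty_L2[OF D(1) f]] _ s] by simp
      also have "\<dots> \<le> ennreal s * killed_energy J D f +
          rate_beta J \<Phi> D \<phi> c s * (\<integral>\<^sup>+x\<in>D. ennreal (\<bar>f x\<bar> * \<phi> x) \<partial>lborel)\<^sup>2"
        by (intro add_right_mono mult_left_mono killed_energy_abs_le J_nonneg zero_le)
      finally show "(\<integral>\<^sup>+x\<in>D. ennreal ((f x)\<^sup>2) \<partial>lborel) \<le> ennreal s * killed_energy J D f +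
          rate_beta J \<Phi> D \<phi> c s * (\<integral>\<^sup>+x\<in>D. ennreal (\<bar>f x\<bar> * \<phi> x) \<partial>lborel)\<^sup>2" .
    next
      assume A: "(INF s\<in>{0<..}. rate_beta J \<Phi> D \<phi> c s) < \<top> \<and>
         (\<forall>t::real. (INF s\<in>{0<..}. rate_beta J \<Phi> D \<phi> c s) < ennreal t \<longrightarrow>
            (\<integral>\<^sup>+s\<in>{t<..}. inv_decr (rate_beta J \<Phi> D \<phi> c) s / ennreal s \<partial>lborel) < \<top>)"
      show "intrinsically_ultracontractive D ?q \<phi>"
      proof (rule ultracontractive_of_super_Poincare[OF ground])
        fix u and s :: real assume u: "u \<in> L2 D" "\<And>x. 0 \<le> u x" "0 < s"
        show "(\<integral>\<^sup>+x\<in>D. ennreal ((u x)\<^sup>2) \<partial>lborel) \<le> ennreal s * energy J u +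
            rate_beta J \<Phi> D \<phi> c s * (\<integral>\<^sup>+x\<in>D. ennreal (u x * \<phi> x) \<partial>lborel)\<^sup>2"
          unfolding energy_eq[OF u(1)] by (rule SPI[OF u])
      qed (use A in auto)
    qed
  qed
  show ?thesis
    unfolding killed_semigroup_def
    by (intro conjI compact exists_ground_state allI impI main)
qed

end
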